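(* Let $d\in\mathbb{N}$, $\frac{2d}{d+1}<p<\infty$, $0<q\le\infty$, and $-\infty<b<\infty$. Let $f\in\widehat{GM}^d$, with $\widehat f(\xi)=F_0(|\xi|)$. If $s>0$, then $$\|f\|_{\mathbf{B}^{s,b}_{p,q}(\mathbb{R}^d)}\asymp\left(\int_0^1t^{dp-d-1}F_0^p(t)\,dt\right)^{1/p}+\left(\int_1^\infty t^{sq+dq-dq/p-1}(1+\log t)^{bq}F_0^q(t)\,dt\right)^{1/q}$$ whenever $q<\infty$, and $$\|f\|_{\mathbf{B}^{s,b}_{p,\infty}(\mathbb{R}^d)}\asymp\left(\int_0^1t^{dp-d-1}F_0^p(t)\,dt\right)^{1/p}+\sup_{t>1}t^{s+d-d/p}(1+\log t)^bF_0(t).$$ If $s=0$, then $$\|f\|_{\mathbf{B}^{0,b}_{p,q}(\mathbb{R}^d)}\asymp\left(\int_0^1t^{dp-d-1}F_0^p(t)\,dt\right)^{1/p}+\left(\int_1^\infty\left[(1+\log t)^b\left(\int_t^\infty u^{dp-d-1}F_0^p(u)\,du\right)^{1/p}\right]^q\frac{dt}{t}\right)^{1/q}$$ whenever $q<\infty$, and $$\|f\|_{\mathbf{B}^{0,b}_{p,\infty}(\mathbb{R}^d)}\asymp\left(\int_0^1t^{dp-d-1}F_0^p(t)\,dt\right)^{1/p}+\sup_{t>1}(1+\log t)^b\left(\int_t^\infty u^{dp-d-1}F_0^p(u)\,du\right)^{1/p}.$$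
   Context: General monotone functions: $\varphi:(0,\infty)\to\mathbb{C}$ belongs to $GM$ if it is locally of bounded variation and there is $C>1$ with $\int_z^{2z}|d\varphi(u)|\le C|\varphi(z)|$ for all $z>0$. $\widehat{GM}^d$ is the collection of radial functions $f(x)=f_0(|x|)$ on $\mathbb{R}^d$ whose Fourier transform is $\widehat f(\xi)=F_0(|\xi|)$ with $F_0\in GM$ positive and $\int_0^1u^{d-1}F_0(u)\,du+\int_1^\infty u^{(d-1)/2}|dF_0(u)|<\infty$; that is, $f_0(z)=\frac{2}{\Gamma(d/2)(2\sqrt\pi)^d}\int_0^\infty F_0(s)j_{d/2-1}(zs)s^{d-1}\,ds$ for $z>0$ (improper integral), where $j_\alpha(t)=\Gamma(\alpha+1)(t/2)^{-\alpha}J_\alpha(t)$ is the normalized Bessel function. (The normalization of the Fourier transform is immaterial.) For $1\le p\le\infty$, $0<q\le\infty$, $b\in\mathbb{R}$, $s\ge0$, $\mathbf{B}^{s,b}_{p,q}(\mathbb{R}^d)$ is the set of $f\in L_p(\mathbb{R}^d)$ with finite quasi-norm $\|f\|_{\mathbf{B}^{s,b}_{p,q}}=\|f\|_{L_p(\mathbb{R}^d)}+\left(\int_0^1(t^{-s}(1-\log t)^b\omega_k(f,t)_p)^q\frac{dt}{t}\right)^{1/q}$ (supremum over $0<t<1$ if $q=\infty$), where $k\in\mathbb{N}$, $k>s$, is fixed (different $k$ give equivalent quasi-norms), $\omega_k(f,t)_p=\sup_{|h|\le t}\|\Delta_h^kf\|_{L_p(\mathbb{R}^d)}$, $\Delta^1_hf(x)=f(x+h)-f(x)$,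 $\Delta_h^{k+1}=\Delta_h^1\Delta_h^k$. $A\asymp B$ means $c^{-1}B\le A\le cB$ (both sides may be infinite) with $c$ depending only on the parameters and on the constant $C$ in the $GM$ condition for $F_0$. *)

theory Defs
  imports "HOL-Analysis.Analysis"
begin

section \<open>General monotone functions\<close>

definition partitions :: "real \<Rightarrow> real \<Rightarrow> (nat \<times> (nat \<Rightarrow> real)) set" where
  "partitions a b = {(n, x). x 0 = a \<and> x n = b \<and> (\<forall>i<n. x i \<le> x (Suc i))}"

definition total_variation :: "(real \<Rightarrow> complex) \<Rightarrow> real \<Rightarrow> real \<Rightarrow> ennreal" where
  "total_variation \<phi> a b =
     (SUP (n, x)\<in>partitions a b. \<Sum>i<n. ennreal (norm (\<phi> (x (Suc i)) - \<phi> (x i))))"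

text \<open>The integral of \<open>g\<close> against \<open>|d\<phi>|\<close> over \<open>[a,b]\<close>, for continuous \<open>g \<ge> 0\<close>: the
  Riemann-Stieltjes integral of \<open>g\<close> with respect to the total variation function of \<open>\<phi>\<close>,
  given here as the supremum of its lower Darboux sums.\<close>

definition variation_integral ::
    "(real \<Rightarrow> real) \<Rightarrow> (real \<Rightarrow> complex) \<Rightarrow> real \<Rightarrow> real \<Rightarrow> ennreal" where
  "variation_integral g \<phi> a b =
     (SUP (n, x)\<in>partitions a b.
        \<Sum>i<n. (INF u\<in>{x i..x (Suc i)}. ennreal (g u)) * total_variation \<phi> (x i) (x (Suc i)))"

definition GM_with :: "real \<Rightarrow> (real \<Rightarrow> complex) \<Rightarrow> bool" where
  "GM_with C \<phi> \<longleftrightarrow> C > 1 \<and>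
     (\<forall>a b. 0 < a \<longrightarrow> a \<le> b \<longrightarrow> total_variation \<phi> a b < \<infinity>) \<and>
     (\<forall>z>0. total_variation \<phi> z (2 * z) \<le> ennreal (C * norm (\<phi> z)))"

section \<open>Radial functions with general monotone Fourier transform\<close>

definition Bessel_J :: "real \<Rightarrow> real \<Rightarrow> real" where
  "Bessel_J \<alpha> t = (\<Sum>m. (-1) ^ m / fact m * rGamma (real m + \<alpha> + 1) * (t / 2) powr (2 * real m + \<alpha>))"

definition normalized_Bessel :: "real \<Rightarrow> real \<Rightarrow> real" where
  "normalized_Bessel \<alpha> t = Gamma (\<alpha> + 1) * (t / 2) powr (- \<alpha>) * Bessel_J \<alpha> t"

text \<open>\<open>GM_hat C F\<^sub>0 f\<close>: \<open>f\<close> is a radial function whose Fourier transform is \<open>F\<^sub>0(|\<xi>|)\<close>, where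
  \<open>F\<^sub>0\<close> is positive, satisfies the \<open>GM\<close> condition with constant \<open>C\<close>, and has the required
  integrability. The dimension is \<open>CARD('n)\<close>. The inversion integral converges absolutely
  at \<open>0\<close> and is improper only at infinity; its convergence is part of the definition.
  The value \<open>f\<^sub>0 0\<close>, i.e. the value of \<open>f\<close> at the origin, is unconstrained.\<close>

definition GM_hat :: "real \<Rightarrow> (real \<Rightarrow> real) \<Rightarrow> (real ^ 'n \<Rightarrow> complex) \<Rightarrow> bool" where
  "GM_hat C F\<^sub>0 f \<longleftrightarrow>
     (\<forall>u>0. F\<^sub>0 u > 0) \<and>
     GM_with C (\<lambda>u. complex_of_real (F\<^sub>0 u)) \<and>
     (\<integral>\<^sup>+ u\<in>{0<..<1}. ennreal (u ^ (CARD('n) - 1) * F\<^sub>0 u) \<partial>lborel)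
       + (SUP N\<in>{1..}. variation_integral (\<lambda>u. u powr ((real CARD('n) - 1) / 2))
                         (\<lambda>u. complex_of_real (F\<^sub>0 u)) 1 N) < \<infinity> \<and>
     (\<exists>f\<^sub>0. (\<forall>x. f x = f\<^sub>0 (norm x)) \<and>
       (\<forall>z>0. ((\<lambda>N. complex_of_real
                  (2 / (Gamma (real CARD('n) / 2) * (2 * sqrt pi) ^ CARD('n)) *
                   (LBINT s:{0<..N}. F\<^sub>0 s * normalized_Bessel (real CARD('n) / 2 - 1) (z * s)
                                       * s ^ (CARD('n) - 1))))
               \<longlongrightarrow> f\<^sub>0 z) at_top))"

section \<open>Besov quasi-norms\<close>

text \<open>Powers of extended nonnegative reals, used only with exponent \<open>a > 0\<close>.\<close>

definition epowr :: "ennreal \<Rightarrow> real \<Rightarrow> ennreal" (infixr \<open>epowr\<close> 80) where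
  "x epowr a = (if x = \<infinity> then \<infinity> else ennreal (enn2real x powr a))"

text \<open>Only \<open>1 \<le> p < \<infinity>\<close> is needed. The value is finite exactly if \<open>f\<close> belongs to \<open>L\<^sub>p\<close>.\<close>

definition Lp_norm :: "real \<Rightarrow> (real ^ 'n \<Rightarrow> complex) \<Rightarrow> ennreal" where
  "Lp_norm p f =
     (if f \<in> borel_measurable lebesgue
      then (\<integral>\<^sup>+ x. ennreal (norm (f x) powr p) \<partial>lebesgue) epowr (1 / p) else \<infinity>)"

primrec iterated_diff :: "nat \<Rightarrow> real ^ 'n \<Rightarrow> (real ^ 'n \<Rightarrow> complex) \<Rightarrow> real ^ 'n \<Rightarrow> complex" where
  "iterated_diff 0 h f = f"
| "iterated_diff (Suc k) h f = (\<lambda>x. iterated_diff k h f (x + h) - iterated_diff k h f x)"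

definition modulus :: "nat \<Rightarrow> real \<Rightarrow> (real ^ 'n \<Rightarrow> complex) \<Rightarrow> real \<Rightarrow> ennreal" where
  "modulus k p f t = (SUP h\<in>{h. norm h \<le> t}. Lp_norm p (iterated_diff k h f))"

text \<open>The quasi-norm, as an extended real: it is finite exactly on the Besov space.\<close>

definition besov_norm ::
    "nat \<Rightarrow> real \<Rightarrow> real \<Rightarrow> real \<Rightarrow> ennreal \<Rightarrow> (real ^ 'n \<Rightarrow> complex) \<Rightarrow> ennreal" where
  "besov_norm k s b p q f = Lp_norm p f +
     (if q = \<infinity>
      then (SUP t\<in>{0<..<1}. ennreal (t powr (- s) * (1 - ln t) powr b) * modulus k p f t)
      else (\<integral>\<^sup>+ t\<in>{0<..<1}. (ennreal (t powr (- s) * (1 - ln t) powr b) * modulus k p f t)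
                              epowr enn2real q * ennreal (1 / t) \<partial>lborel) epowr (1 / enn2real q))"

definition comparable :: "real \<Rightarrow> ennreal \<Rightarrow> ennreal \<Rightarrow> bool" where
  "comparable c A B \<longleftrightarrow> ennreal (1 / c) * B \<le> A \<and> A \<le> ennreal c * B"

end

theory Submission
  imports Defs
begin

text \<open>Everything is reduced to the numbers \<open>c n = 2 powr (n * d * (1 - 1 / p)) * F\<^sub>0 (2 powr n)\<close>, \<open>n\<close> an
  integer. Summation by parts on the dyadic shells, together with the decay of order
  \<open>(d + 1) / 2\<close> of the Fourier transform of a ball, bounds the \<open>p\<close>-th power of the \<open>L\<^sub>p\<close> norm of the
  \<open>k\<close>-th difference with step \<open>h\<close> by the sum of \<open>(min 1 (2 powr n * |h|) ^ k * c n) powr p\<close>;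
  this is where \<open>p > 2 * d / (d + 1)\<close> is needed. Conversely, the symmetric difference with
  symbol \<open>(2 - 2 * cos (h \<bullet> \<xi>)) ^ k \<ge> 0\<close> is averaged over \<open>|h| \<le> t\<close> and tested against
  Gaussians of width \<open>2 powr - n\<close>. As \<open>F\<^sub>0\<close> is positive nothing cancels, and the shell at
  \<open>2 powr n\<close> contributes \<open>c n\<close> as soon as \<open>2 powr n * t\<close> is large. What remains are inequalities
  for weighted sequences.\<close>

text \<open>The lower bound is delicate because \<open>f\<close> is known only as a pointwise limit,
  off the origin, of truncated integrals \<open>fN N\<close> that need not converge absolutely. A
  test of \<open>f\<close> against a Gaussian must be justified as a limit of tests of
  \<open>fN N\<close>. Summation by parts leaves the boundary term
  \<open>F N * ball_kernel N x\<close>, so \<open>F\<close> has to tend to 0. The finite variation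
  yields only some limit of \<open>F\<close>; that it is 0 comes from the assumed convergence of the
  inversion integral, since the transform of a growing ball keeps oscillating. This is the reason
  for an energy estimate on the Bessel equation.

  The Gaussian tests must also be summed over all shells. A Gaussian alone as the weight in
  Hoelder's inequality is not summable in \<open>n\<close> for small \<open>n\<close>; an extra
  factor \<open>norm x powr - (d / 2)\<close> repairs this.

  The constants may depend on \<open>C\<close> but not on \<open>f\<close>. Hence the many
  statements that first obtain a constant and then quantify over \<open>F\<close>, \<open>V\<close>
  and the function. The general monotone condition compares \<open>F\<close> only with later values,
  so each discretization loses an index; these losses are repaired at the end.\<close>

abbreviation nn_int_lborel (binder "NI " 10) where "nn_int_lborel f == nn_integral lborel f"

abbreviation int_lborel (binder "RI " 10) where "int_lborel f == integral\<^sup>L lborel f"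

section \<open>Bessel functions\<close>

text \<open>The Bessel-Clifford function at \<open>- u\<close>: for \<open>t > 0\<close> and the
  indices used here, \<open>Bessel_J al t = (t / 2) powr al * bess al (t ^ 2 / 4)\<close>. It is
  entire in \<open>u\<close>, so no powers of \<open>t\<close> interfere at the origin, and
  differentiation merely raises the index.\<close>

definition bess :: "real => real => real" where
 "bess al u = (\<Sum>m. ((-1) ^ m * rGamma (real m + al + 1) / fact m) * u ^ m)"

lemma bess_coeff_bound:
 assumes "al >= - 1 / 2"
 shows "norm ((-1) ^ m * rGamma (real m + al + 1) / fact m * u ^ m)
  <= rGamma (al + 1) * (inverse (fact m) * \<bar>2 * u\<bar> ^ m)"
proof -
 have "0 <= rGamma (real m + al + 1) \<and> rGamma (real m + al + 1) <= 2 ^ m * rGamma (al + 1)"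
 proof (induction m)
  case 0
  show ?case using assms by (simp add: rGamma_inverse_Gamma)
 next
  case (Suc m)
  have p: "real m + al + 1 >= 1 / 2" using assms by simp
  have "(real m + al + 1) * rGamma (real m + al + 1 + 1) = rGamma (real m + al + 1)"
   by (rule rGamma_plus1)
  then have e: "rGamma (real (Suc m) + al + 1) = rGamma (real m + al + 1) / (real m + al + 1)"
   using p by (auto simp: field_simps add_ac)
  have "rGamma (real m + al + 1) / (real m + al + 1) <= rGamma (real m + al + 1) / (1 / 2)"
   using p Suc by (intro divide_left_mono) auto
  then show ?case using Suc p unfolding e by auto
 qed
 then show ?thesis
  using mult_left_mono[of "rGamma (real m + al + 1)" "2 ^ m * rGamma (al + 1)" "\<bar>u\<bar> ^ m"]
  by (simp add: abs_mult power_abs power_mult_distrib) (simp add: field_simps)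
qed

lemma bess_summable:
 assumes "al >= - 1 / 2"
 shows "summable (%m. ((-1) ^ m * rGamma (real m + al + 1) / fact m) * u ^ m)"
proof (rule summable_comparison_test'[OF _ bess_coeff_bound[OF assms]])
 show "summable (%m. rGamma (al + 1) * (inverse (fact m) * \<bar>2 * u\<bar> ^ m))"
  by (intro summable_mult summable_exp)
qed

lemma bess_deriv:
 assumes "al >= - 1 / 2"
 shows "(bess al has_real_derivative - bess (al + 1) u) (at u)"
proof -
 let ?c = "%m. (-1) ^ m * rGamma (real m + al + 1) / fact m"
 have "((%x. \<Sum>n. ?c n * x ^ n) has_field_derivative (\<Sum>n. diffs ?c n * u ^ n)) (at u)"
  by (rule termdiffs_strong_converges_everywhere) (rule bess_summable[OF assms])
 moreover have "diffs ?c n = - ((-1) ^ n * rGamma (real n + (al + 1) + 1) / fact n)" for n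
  by (simp add: diffs_def add_ac del: of_nat_Suc) (simp add: add_ac)
 then have "(\<Sum>n. diffs ?c n * u ^ n) = - bess (al + 1) u"
  unfolding bess_def using bess_summable[of "al + 1" u] assms
  by (simp add: suminf_minus)
 ultimately show ?thesis unfolding bess_def[abs_def] by simp
qed

text \<open>The three-term recurrence of the Bessel functions in these variables; the coefficients
  are compared through the functional equation of the reciprocal Gamma function.\<close>

lemma bess_rec:
 assumes "al >= - 1 / 2"
 shows "(al + 1) * bess (al + 1) u - u * bess (al + 2) u = bess al u"
proof -
 let ?c = "%al m. (-1) ^ m * rGamma (real m + al + 1) / fact m"
 have s: "!!j u. j >= 0 ==> summable (%m. ?c (al + j) m * u ^ m)"
  by (rule bess_summable) (use assms in auto)
 let ?g = "%m. u * (?c (al + 2) m * u ^ m)"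
 \<comment> \<open>Multiplication by \<open>u\<close> moves every coefficient up by one
   place.\<close>
 let ?G = "%m. case m of 0 => 0 | Suc n => ?g n"
 have g: "?g sums (u * bess (al + 2) u)" unfolding bess_def
  by (intro sums_mult summable_sums s) simp
 have "?G sums (u * bess (al + 2) u)"
  using g by (subst sums_Suc_iff[symmetric, of ?G, simplified]) (simp)
 moreover have "(%m. (al + 1) * (?c (al + 1) m * u ^ m)) sums ((al + 1) * bess (al + 1) u)"
  unfolding bess_def by (intro sums_mult summable_sums s) simp
 ultimately have "(%m. (al + 1) * (?c (al + 1) m * u ^ m) - ?G m) sums
   ((al + 1) * bess (al + 1) u - u * bess (al + 2) u)"
  by (rule sums_diff[rotated])
 moreover have "(al + 1) * (?c (al + 1) m * u ^ m) - ?G m = ?c al m * u ^ m" for m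
 proof (cases m)
  case 0
  have "(al + 1) * rGamma (al + 1 + 1) = rGamma (al + 1)" by (rule rGamma_plus1)
  then show ?thesis using 0 by (simp add: add_ac)
 next
  case (Suc n)
  let ?R = "rGamma (real n + al + 3)"
  have r: "rGamma (real n + al + 2) = (real n + al + 2) * ?R"
   using rGamma_plus1[of "real n + al + 2"] by (simp add: add_ac)
  have "(al + 1) * (?c (al + 1) m * u ^ m) - ?G m =
    (-1) ^ Suc n * u ^ Suc n * ?R * ((al + 1) / fact (Suc n) + 1 / fact n)"
   by (simp add: Suc field_simps add_ac)
  also have "1 / fact n = (real n + 1) / (fact (Suc n) :: real)"
   by (simp add: divide_simps)
  also have "(al + 1) / fact (Suc n) + (real n + 1) / fact (Suc n) = (real n + al + 2) / fact (Suc n)"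
   by (simp add: add_divide_distrib[symmetric] add_ac del: fact_Suc)
  finally show ?thesis using r unfolding Suc
   by (simp add: add_ac mult_ac del: fact_Suc power_Suc)
 qed
 ultimately have "(%m. ?c al m * u ^ m) sums ((al + 1) * bess (al + 1) u - u * bess (al + 2) u)"
  by simp
 then show ?thesis unfolding bess_def[of al] by (simp add: sums_iff)
qed

lemma bess_0: "bess al 0 = rGamma (al + 1)"
proof -
 have "(%m. ((-1) ^ m * rGamma (real m + al + 1) / fact m) * 0 ^ m) sums
   ((-1) ^ 0 * rGamma (real 0 + al + 1) / fact 0)"
  by (rule powser_sums_zero)
 then show ?thesis by (simp add: bess_def sums_iff)
qed

lemma bess_continuous: "al >= - 1 / 2 ==> continuous_on S (bess al)"
 by (meson DERIV_isCont bess_deriv continuous_at_imp_continuous_on)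

lemma normalized_Bessel_bess:
 assumes "al >= - 1 / 2" "t > 0"
 shows "normalized_Bessel al t = Gamma (al + 1) * bess al (t\<^sup>2 / 4)"
proof -
 have "Bessel_J al t = (\<Sum>m. (t / 2) powr al * (((-1) ^ m * rGamma (real m + al + 1) / fact m) * (t\<^sup>2 / 4) ^ m))"
  unfolding Bessel_J_def
 proof (rule suminf_cong)
  fix m
  have "(t / 2) powr (2 * real m) = (t\<^sup>2 / 4) ^ m"
   using assms(2) by (simp add: powr_realpow[symmetric] powr_powr[symmetric] power2_eq_square powr_numeral)
  then show "(- 1) ^ m / fact m * rGamma (real m + al + 1) * (t / 2) powr (2 * real m + al) =
     (t / 2) powr al * ((- 1) ^ m * rGamma (real m + al + 1) / fact m * (t\<^sup>2 / 4) ^ m)"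
   by (simp add: powr_add)
 qed
 also have "... = (t / 2) powr al * bess al (t\<^sup>2 / 4)"
  unfolding bess_def by (rule suminf_mult) (rule bess_summable[OF assms(1)])
 finally show ?thesis using assms(2) by (simp add: normalized_Bessel_def powr_minus field_simps)
qed

text \<open>The Liouville normal form \<open>w'' = -(1 - (al\<^sup>2 - 1/4)/t\<^sup>2) w\<close> of the Bessel equation.\<close>

definition bw :: "real => real => real" where
 "bw al t = t powr (al + 1 / 2) * bess al (t\<^sup>2 / 4)"

definition bw' :: "real => real => real" where
 "bw' al t = (al + 1 / 2) * t powr (al - 1 / 2) * bess al (t\<^sup>2 / 4)
   - t powr (al + 3 / 2) / 2 * bess (al + 1) (t\<^sup>2 / 4)"

lemma bess_sq_deriv:
 assumes "al >= - 1 / 2"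
 shows "((%t. bess al (t\<^sup>2 / 4)) has_real_derivative - bess (al + 1) (t\<^sup>2 / 4) * (t / 2)) (at t)"
 by (rule DERIV_chain2[OF bess_deriv[OF assms]]) (auto intro!: derivative_eq_intros)

lemma bw_deriv:
 assumes "al >= 1 / 2" "t > 0"
 shows "(bw al has_real_derivative bw' al t) (at t)"
proof -
 have "al >= - 1 / 2" using assms(1) by simp
 note b = bess_sq_deriv[OF this, of t]
 have "((%t. t powr (al + 1 / 2) * bess al (t\<^sup>2 / 4)) has_real_derivative
   (al + 1 / 2) * t powr (al + 1 / 2 - 1) * bess al (t\<^sup>2 / 4)
    + (- bess (al + 1) (t\<^sup>2 / 4) * (t / 2)) * t powr (al + 1 / 2)) (at t)"
  using assms(2) by (intro DERIV_mult has_real_derivative_powr b)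
 moreover have "t powr (al + 3 / 2) = t * t powr (al + 1 / 2)"
  using assms(2) powr_add[of t 1 "al + 1 / 2"] by (simp add: add_ac)
 ultimately show ?thesis unfolding bw_def[abs_def] bw'_def by (simp add: field_simps)
qed

lemma bw'_deriv:
 assumes "al >= 1 / 2" "t > 0"
 shows "(bw' al has_real_derivative - (1 - (al\<^sup>2 - 1 / 4) / t\<^sup>2) * bw al t) (at t)"
proof -
 have a: "al >= - 1 / 2" "al + 1 >= - 1 / 2" using assms(1) by simp_all
 let ?A = "bess al (t\<^sup>2 / 4)" and ?B = "bess (al + 1) (t\<^sup>2 / 4)" and ?C = "bess (al + 2) (t\<^sup>2 / 4)"
 let ?q = "t powr (al - 3 / 2)"
 have e: "t powr (al - 1 / 2) = ?q * t" "t powr (al + 1 / 2) = ?q * t\<^sup>2" "t powr (al + 3 / 2) = ?q * t ^ 3"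
  using assms(2) powr_add[of t "al - 3 / 2" 1] powr_add[of t "al - 3 / 2" 2] powr_add[of t "al - 3 / 2" 3]
  by (auto simp: powr_numeral algebra_simps)
 have "(bw' al has_real_derivative
   ((al + 1 / 2) * ((al - 1 / 2) * t powr (al - 1 / 2 - 1)) * ?A + (- ?B * (t / 2)) * ((al + 1 / 2) * t powr (al - 1 / 2)))
   - (((al + 3 / 2) * t powr (al + 3 / 2 - 1) / 2) * ?B + (- bess (al + 1 + 1) (t\<^sup>2 / 4) * (t / 2)) * (t powr (al + 3 / 2) / 2))) (at t)"
  unfolding bw'_def[abs_def] using assms(2)
  by (intro DERIV_diff DERIV_mult has_real_derivative_powr bess_sq_deriv a DERIV_cmult DERIV_cdivide)
 moreover have "bess (al + 1 + 1) (t\<^sup>2 / 4) = ?C" by (simp add: add_ac)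
 moreover have "?A = (al + 1) * ?B - t\<^sup>2 / 4 * ?C" using bess_rec[OF a(1), of "t\<^sup>2 / 4"] by simp
 then have C: "t\<^sup>2 * ?C = 4 * ((al + 1) * ?B - ?A)" by (simp add: field_simps)
 moreover have "((al + 1 / 2) * ((al - 1 / 2) * t powr (al - 1 / 2 - 1)) * ?A + (- ?B * (t / 2)) * ((al + 1 / 2) * t powr (al - 1 / 2)))
   - (((al + 3 / 2) * t powr (al + 3 / 2 - 1) / 2) * ?B + (- ?C * (t / 2)) * (t powr (al + 3 / 2) / 2))
   = ?q * ((al\<^sup>2 - 1 / 4) * ?A - (al + 1) * t\<^sup>2 * ?B + t\<^sup>2 / 4 * (t\<^sup>2 * ?C))"
  using e by (simp add: field_simps power2_eq_square power3_eq_cube)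
 moreover have "?q * ((al\<^sup>2 - 1 / 4) * ?A - (al + 1) * t\<^sup>2 * ?B + t\<^sup>2 / 4 * (t\<^sup>2 * ?C))
   = - (1 - (al\<^sup>2 - 1 / 4) / t\<^sup>2) * bw al t"
  unfolding C bw_def e using assms(2) by (simp add: field_simps power2_eq_square)
 ultimately show ?thesis by simp
qed

section \<open>Energy estimates for the Bessel equation\<close>

definition bE :: "real => real => real" where "bE al t = (bw al t)\<^sup>2 + (bw' al t)\<^sup>2"

text \<open>The normal form gives the energy the derivative
  \<open>2 * (\<mu> / s ^ 2) * bw al s * bw' al s\<close>, bounded by \<open>\<mu> / s ^ 2\<close>
  times the energy. This rate is integrable at infinity, so with the integrating factors
  \<open>exp (\<mu> / s)\<close> and \<open>exp (- \<mu> / s)\<close> the energy can neither grow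
  without bound nor die out.\<close>

lemma bE_compare:
 assumes "al >= 1 / 2" "0 < t" "t <= T"
 defines "\<mu> \<equiv> al\<^sup>2 - 1 / 4"
 shows "bE al T * exp (\<mu> / T) <= bE al t * exp (\<mu> / t)"
  and "bE al t * exp (- \<mu> / t) <= bE al T * exp (- \<mu> / T)"
proof -
 have mu: "\<mu> >= 0" using power_mono[of "1/2" al 2] assms(1) by (simp add: \<mu>_def power2_eq_square)
 define D where "D s = 2 * (\<mu> / s\<^sup>2) * bw al s * bw' al s" for s
 have bD: "\<bar>D s\<bar> <= \<mu> / s\<^sup>2 * bE al s" for s
 proof -
  have "2 * \<bar>bw al s * bw' al s\<bar> <= bE al s"
   using sum_squares_bound[of "\<bar>bw al s\<bar>" "\<bar>bw' al s\<bar>"] by (simp add: bE_def abs_mult)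
  then have "(\<mu> / s\<^sup>2) * (2 * \<bar>bw al s * bw' al s\<bar>) <= \<mu> / s\<^sup>2 * bE al s"
   using mu by (intro mult_left_mono) auto
  then show ?thesis using mu by (simp add: D_def abs_mult mult_ac)
 qed
 have dE: "(bE al has_real_derivative D s) (at s)" if "s > 0" for s
 proof -
  have "(bE al has_real_derivative 2 * bw al s * bw' al s + 2 * bw' al s * (- (1 - \<mu> / s\<^sup>2) * bw al s)) (at s)"
   unfolding bE_def[abs_def]
   by (rule derivative_eq_intros refl bw_deriv[OF assms(1) that] bw'_deriv[OF assms(1) that, folded \<mu>_def])+
    simp
  then show ?thesis by (simp add: D_def algebra_simps)
 qed
 have d: "((%s. bE al s * exp (c / s)) has_real_derivative (D s - c / s\<^sup>2 * bE al s) * exp (c / s)) (at s)"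
  if "s > 0" for s c
  using that by (auto intro!: derivative_eq_intros dE[OF that] simp: field_simps power2_eq_square)
 show "bE al T * exp (\<mu> / T) <= bE al t * exp (\<mu> / t)"
 proof (rule DERIV_nonpos_imp_nonincreasing[OF assms(3)])
  fix s assume "t <= s" "s <= T"
  then have "s > 0" using assms(2) by simp
  from d[OF this, of \<mu>] bD[of s] show "\<exists>y. ((%s. bE al s * exp (\<mu> / s)) has_real_derivative y) (at s) \<and> y <= 0"
   by (intro exI conjI) (auto simp: mult_le_0_iff)
 qed
 show "bE al t * exp (- \<mu> / t) <= bE al T * exp (- \<mu> / T)"
 proof (rule DERIV_nonneg_imp_nondecreasing[OF assms(3)])
  fix s assume "t <= s" "s <= T"
  then have "s > 0" using assms(2) by simp
  from d[OF this, of "- \<mu>"] bD[of s] show "\<exists>y. ((%s. bE al s * exp (- \<mu> / s)) has_real_derivative y) (at s) \<and> y >= 0"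
   by (intro exI conjI) auto
 qed
qed

text \<open>Beyond \<open>t = 1\<close> the energy bounds \<open>bw\<close>, which is exactly decay
  of order \<open>al + 1 / 2\<close>; on the unit interval continuity suffices. For
  \<open>al = d / 2\<close> this is the order (d + 1)/2 of the transform of a ball.\<close>

lemma bess_decay:
 assumes "al >= 1 / 2"
 obtains C where "C > 0" "!!t. t >= 0 ==> \<bar>bess al (t\<^sup>2 / 4)\<bar> <= C * (1 + t) powr - (al + 1 / 2)"
proof -
 define \<mu> where "\<mu> = al\<^sup>2 - 1 / 4"
 have mu: "\<mu> >= 0" using power_mono[of "1/2" al 2] assms(1) by (simp add: \<mu>_def power2_eq_square)
 have "compact (bess al ` {0..1})"
  by (intro compact_continuous_image bess_continuous) (use assms in auto)
 then have "bounded (bess al ` {0..1})" by (rule compact_imp_bounded)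
 then obtain M where M: "!!u. u \<in> {0..1} ==> \<bar>bess al u\<bar> <= M" and "M > 0"
  unfolding bounded_pos by (metis imageI real_norm_def)
 define K where "K = sqrt (bE al 1 * exp \<mu>)"
 have K: "K >= 0" by (simp add: K_def bE_def)
 define C where "C = (M + K) * 2 powr (al + 1 / 2)"
 have C: "C > 0" using K \<open>M > 0\<close> by (simp add: C_def add_pos_nonneg)
 have "\<bar>bess al (t\<^sup>2 / 4)\<bar> <= C * (1 + t) powr - (al + 1 / 2)" if "t >= 0" for t
 proof (cases "t <= 1")
  case True
  have "1 <= (2 / (1 + t)) powr (al + 1 / 2)"
   using True that assms by (intro ge_one_powr_ge_zero) auto
  also have "... = 2 powr (al + 1 / 2) * (1 + t) powr - (al + 1 / 2)"
   using that powr_minus_divide[of "1 + t" "al + 1 / 2"] by (simp add: powr_divide)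
  finally have "(M + K) * 1 <= (M + K) * (2 powr (al + 1 / 2) * (1 + t) powr - (al + 1 / 2))"
   using K \<open>M > 0\<close> by (intro mult_left_mono) auto
  moreover have "\<bar>bess al (t\<^sup>2 / 4)\<bar> <= M"
   using True that by (intro M) (auto simp: power_le_one_iff intro: order_trans[of _ 1])
  ultimately show ?thesis using K by (simp add: C_def mult.assoc)
 next
  case False
  then have t: "t > 1" by simp
  have "bE al t <= bE al t * exp (\<mu> / t)" 
   using mult_left_mono[of 1 "exp (\<mu> / t)" "bE al t"] mu t by (simp add: bE_def)
  also have "... <= bE al 1 * exp \<mu>"
   using bE_compare(1)[OF assms, of 1 t] t by (simp add: \<mu>_def)
  finally have "\<bar>bw al t\<bar> <= K" unfolding K_def
   by (intro real_le_rsqrt) (simp add: bE_def, smt (verit) zero_le_power2)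
  then have "\<bar>bess al (t\<^sup>2 / 4)\<bar> <= K * t powr - (al + 1 / 2)"
   using t by (simp add: bw_def abs_mult powr_minus field_simps)
  also have "t powr - (al + 1 / 2) <= 2 powr (al + 1 / 2) * (1 + t) powr - (al + 1 / 2)"
  proof -
   have "1 <= (2 * t / (1 + t)) powr (al + 1 / 2)"
    using t assms by (intro ge_one_powr_ge_zero) (auto simp: field_simps)
   also have "... = 2 powr (al + 1 / 2) * t powr (al + 1 / 2) * (1 + t) powr - (al + 1 / 2)"
    using t powr_minus_divide[of "1 + t" "al + 1 / 2"] by (simp add: powr_divide powr_mult)
   finally show ?thesis using t by (simp add: powr_minus_divide field_simps)
  qed
  then have "K * t powr - (al + 1 / 2) <= (M + K) * (2 powr (al + 1 / 2) * (1 + t) powr - (al + 1 / 2))"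
   using K \<open>M > 0\<close> by (intro mult_mono) auto
  finally show ?thesis by (simp add: C_def mult.assoc)
 qed
 with C show thesis by (rule that)
qed

text \<open>If \<open>bw\<close> tended to \<open>L\<close>, its second derivative would tend to
  \<open>- L\<close>, while its first derivative is small at points supplied by the mean value
  theorem; this forces \<open>L = 0\<close>. Then the function and its derivative are both small at
  arbitrarily large points, against the lower bound for the energy.\<close>

lemma bw_not_convergent:
 assumes "al >= 1 / 2"
 shows "\<not> (bw al \<longlongrightarrow> L) at_top"
proof
 assume L: "(bw al \<longlongrightarrow> L) at_top"
 define \<mu> where "\<mu> = al\<^sup>2 - 1 / 4"
 have mu: "\<mu> >= 0" using power_mono[of "1/2" al 2] assms(1) by (simp add: \<mu>_def power2_eq_square)
 define g where "g t = - (1 - \<mu> / t\<^sup>2) * bw al t" for t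
 have gL: "(g \<longlongrightarrow> - (1 - 0) * L) at_top"
  unfolding g_def
  by (intro tendsto_intros L tendsto_divide_0[OF tendsto_const] filterlim_at_top_imp_at_infinity
    filterlim_pow_at_top filterlim_ident) auto
 have dw': "(bw' al has_real_derivative g t) (at t)" if "t > 0" for t
  using bw'_deriv[OF assms that] by (simp add: g_def \<mu>_def)
 have mv: "\<exists>z>t. z < t + 1 \<and> bw al (t + 1) - bw al t = bw' al z" if "t > 0" for t
  using MVT2[of t "t + 1" "bw al" "bw' al"] bw_deriv[OF assms] that by auto
 have mv': "\<exists>z>a. z < b \<and> bw' al b - bw' al a = (b - a) * g z" if "a > 0" "a < b" for a b
  using MVT2[of a b "bw' al" g] dw' that by auto
 have small: "\<exists>T>0. \<forall>t\<ge>T. \<bar>bw al t - L\<bar> < e \<and> \<bar>g t + L\<bar> < e" if "e > 0" for e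
 proof -
  have "eventually (%t. dist (bw al t) L < e \<and> dist (g t) (- (1 - 0) * L) < e) at_top"
   using that by (intro eventually_conj tendstoD[OF L] tendstoD[OF gL])
  then obtain T where "\<forall>t\<ge>T. dist (bw al t) L < e \<and> dist (g t) (- (1 - 0) * L) < e"
   by (auto simp: eventually_at_top_linorder)
  then show ?thesis by (intro exI[of _ "max 1 T"]) (auto simp: dist_real_def)
 qed
 have L0: "L = 0"
 proof (rule ccontr)
  assume "L \<noteq> 0"
  then obtain T where T: "T > 0" "!!t. t >= T ==> \<bar>bw al t - L\<bar> < \<bar>L\<bar> / 4 \<and> \<bar>g t + L\<bar> < \<bar>L\<bar> / 4"
   using small[of "\<bar>L\<bar> / 4"] by auto
  obtain a where a: "a > T" "a < T + 1" "bw al (T + 1) - bw al T = bw' al a"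
   using mv[of T] T by auto
  \<comment> \<open>The points \<open>a\<close> and \<open>b\<close> are more than 2 apart, so the
    second derivative changes the first by at least 3/2 of \<open>|L|\<close>, whereas four values
    of \<open>bw\<close> near \<open>L\<close> allow a change of at most \<open>|L|\<close>.\<close>
  obtain b where b: "b > T + 3" "b < T + 4" "bw al (T + 4) - bw al (T + 3) = bw' al b"
   using mv[of "T + 3"] T by (auto simp: add_ac)
  obtain z where z: "z > a" "z < b" "bw' al b - bw' al a = (b - a) * g z"
   using mv'[of a b] a b T by auto
  have "\<bar>bw' al b - bw' al a\<bar> <= \<bar>L\<bar>"
  proof -
   have *: "bw al t - L < \<bar>L\<bar> / 4" "- (bw al t - L) < \<bar>L\<bar> / 4" if "t >= T" for t
    using T(2)[OF that] abs_less_iff by blast+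
   show ?thesis unfolding a(3)[symmetric] b(3)[symmetric]
    using *[of T] *[of "T + 1"] *[of "T + 3"] *[of "T + 4"] by (intro abs_leI) auto
  qed
  moreover have "\<bar>(b - a) * g z\<bar> >= 2 * (3 / 4 * \<bar>L\<bar>)"
   unfolding abs_mult using T(2)[of z] a b z abs_triangle_ineq4[of "g z + L" "g z"] by (intro mult_mono) auto
  ultimately show False using z(3) \<open>L \<noteq> 0\<close> by simp
 qed
 define c where "c t = bE al t * exp (- \<mu> / t)" for t
 \<comment> \<open>Zero energy everywhere would make \<open>bess al\<close> vanish on the positive
   axis and hence, by continuity, at 0, where its value is a reciprocal Gamma value.\<close>
 have "\<exists>t>0. c t > 0"
 proof (rule ccontr)
  assume neg: "\<not> (\<exists>t>0. c t > 0)"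
  have b0: "bess al (t\<^sup>2 / 4) = 0" if "t > 0" for t
  proof -
   have "c t <= 0" using neg that by (meson not_less)
   then have "bE al t <= 0" by (simp add: c_def mult_le_0_iff)
   then have "bw al t = 0" by (simp add: bE_def sum_power2_le_zero_iff)
   then show ?thesis using that by (simp add: bw_def)
  qed
  have z: "bess al u = 0" if "u > 0" for u
   using b0[of "2 * sqrt u"] that by (simp add: power_mult_distrib)
  have "(bess al \<longlongrightarrow> bess al 0) (at_right 0)"
   using assms DERIV_isCont[OF bess_deriv[of al 0]] by (intro tendsto_within_subset[OF isContD]) auto
  moreover have "(bess al \<longlongrightarrow> 0) (at_right 0)"
   by (intro tendsto_eventually) (auto simp: eventually_at_right_less z intro: eventually_mono[OF eventually_at_right_less])
  ultimately have "bess al 0 = 0" using tendsto_unique trivial_limit_at_right_real by blast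
  then show False using assms Gamma_real_pos[of "al + 1"] by (simp add: bess_0 rGamma_inverse_Gamma)
 qed
 then obtain t0 where t0: "t0 > 0" "c t0 > 0" by auto
 have low: "bE al t >= c t0" if "t >= t0" for t
 proof -
  have "c t0 <= bE al t * exp (- \<mu> / t)" using bE_compare(2)[OF assms t0(1) that] by (simp add: c_def \<mu>_def)
  also have "... <= bE al t" using mu that t0 by (simp add: bE_def mult_left_le)
  finally show ?thesis .
 qed
 \<comment> \<open>The energy at a suitable point will be at most \<open>5 * e ^ 2\<close>, that is
   5/16 of its lower bound \<open>c t0\<close>.\<close>
 define e where "e = sqrt (c t0) / 4"
 have e: "e > 0" "e\<^sup>2 = c t0 / 16" using t0 by (auto simp: e_def power_divide)
 obtain T where T: "T > 0" "!!t. t >= T ==> \<bar>bw al t\<bar> < e \<and> \<bar>g t\<bar> < e"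
  using small[OF e(1)] L0 by auto
 define t where "t = max T t0"
 have t: "t > 0" "t >= T" "t >= t0" using T by (auto simp: t_def)
 obtain a where a: "a > t" "a < t + 1" "bw al (t + 1) - bw al t = bw' al a"
  using mv[of t] t by auto
 have "\<bar>bw' al a\<bar> <= 2 * e" unfolding a(3)[symmetric]
  using T(2)[of t] T(2)[of "t + 1"] t abs_triangle_ineq4[of "bw al (t + 1)" "bw al t"] by auto
 then have "(bw' al a)\<^sup>2 <= (2 * e)\<^sup>2" using e by (intro power2_le_iff_abs_le[THEN iffD2]) auto
 moreover have "(bw al a)\<^sup>2 <= e\<^sup>2" using T(2)[of a] a t e by (intro power2_le_iff_abs_le[THEN iffD2]) auto
 ultimately have "bE al a <= 5 * e\<^sup>2" by (simp add: bE_def power_mult_distrib)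
 then show False using low[of a] a t e t0 by auto
qed

section \<open>Fourier transforms of Gaussians and balls\<close>

lemma nn_integral_lborel_scale:
 fixes f :: "'a::euclidean_space => ennreal"
 assumes [measurable]: "f \<in> borel_measurable borel" and "c > 0"
 shows "(NI x. f x) = ennreal (c ^ DIM('a)) * (NI x. f (c *\<^sub>R x))"
 using assms(2)
 by (subst lborel_affine[of c 0])
   (auto simp: nn_integral_density nn_integral_distr nn_integral_cmult ennreal_power)

lemma nn_integral_lborel_translate:
 fixes f :: "'a::euclidean_space => ennreal"
 assumes [measurable]: "f \<in> borel_measurable borel"
 shows "(NI x. f (x + t)) = (NI x. f x)"
proof -
 have "(NI x. f x) = (\<integral>\<^sup>+x. f x \<partial>distr lborel borel (%x. t + x))"
  by (subst lborel_distr_plus) simp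
 then show ?thesis by (simp add: nn_integral_distr add.commute)
qed

lemma nn_integral_exp_tail:
 "(NI u. ennreal (exp (- u)) * indicator {r..} u) = ennreal (exp (- r))"
proof -
 have "((%u::real. - exp (- u)) \<longlongrightarrow> - 0) at_top"
  by (intro tendsto_minus filterlim_compose[OF exp_at_bot] filterlim_uminus_at_bot_at_top)
 then have "(NI u. ennreal (exp (- u)) * indicator {r..} u) = - 0 - (- exp (- r))"
  by (intro nn_integral_FTC_atLeast) (auto intro!: derivative_eq_intros)
 then show ?thesis by simp
qed

text \<open>Polar coordinates are avoided by writing \<open>exp (- |x| ^ 2)\<close> as a superposition of
  indicator functions of balls.\<close>

lemma nn_integral_gauss_homogeneous:
 fixes g :: "'a::euclidean_space => real"
 assumes [measurable]: "g \<in> borel_measurable borel"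
  and nn: "!!x. g x >= 0" and hom: "!!c x. c > 0 ==> g (c *\<^sub>R x) = c ^ (2 * m) * g x"
 shows "(NI x. ennreal (g x * exp (- (norm x)\<^sup>2))) =
   ennreal (Gamma (real m + real DIM('a) / 2 + 1)) * (\<integral>\<^sup>+x\<in>cball 0 1. ennreal (g x) \<partial>lborel)"
proof -
 let ?d = "DIM('a)" and ?I = "\<integral>\<^sup>+x\<in>cball 0 1. ennreal (g x) \<partial>lborel"
 have [measurable]: "cball 0 1 \<in> sets (borel :: 'a measure)" by (intro borel_closed closed_cball)
 have "(NI x. ennreal (g x * exp (- (norm x)\<^sup>2))) =
   (\<integral>\<^sup>+x. (NI u. ennreal (g x) * (ennreal (exp (- u)) * indicator {(norm x)\<^sup>2..} u)) \<partial>(lborel :: 'a measure))"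
  by (subst nn_integral_cmult) (auto simp: nn_integral_exp_tail ennreal_mult nn)
 also have "... = (NI u. \<integral>\<^sup>+x. ennreal (g x) * (ennreal (exp (- u)) * indicator {(norm x)\<^sup>2..} u) \<partial>(lborel :: 'a measure))"
  by (rule lborel_pair.Fubini'[symmetric]) (simp add: indicator_def)
 also have "... = (NI u. ennreal (indicator {0..} u * u powr (real m + real ?d / 2) / exp u) * ?I)"
 proof (intro nn_integral_cong_AE eventually_mono[OF AE_lborel_singleton[of 0]])
  fix u :: real assume "u \<noteq> 0"
  show "(\<integral>\<^sup>+x. ennreal (g x) * (ennreal (exp (- u)) * indicator {(norm x)\<^sup>2..} u) \<partial>(lborel :: 'a measure)) =
    ennreal (indicator {0..} u * u powr (real m + real ?d / 2) / exp u) * ?I"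
  proof (cases "u < 0")
   case True
   then have "u < (norm x)\<^sup>2" for x :: 'a by (meson less_le_trans zero_le_power2)
   then show ?thesis using True by (simp add: not_le[symmetric])
  next
   case False
   then have u: "u > 0" using \<open>u \<noteq> 0\<close> by simp
   \<comment> \<open>The indicator restricts \<open>x\<close> to the ball of radius
     \<open>sqrt u\<close>. Dilating to the unit ball brings out \<open>u powr (m + d / 2)\<close>,
     and the integral over \<open>u\<close> becomes a Gamma integral.\<close>
   define c where "c = sqrt u"
   have c: "c > 0" "c\<^sup>2 = u" using u by (auto simp: c_def)
   have "(\<integral>\<^sup>+x. ennreal (g x) * (ennreal (exp (- u)) * indicator {(norm x)\<^sup>2..} u) \<partial>(lborel :: 'a measure)) =
    ennreal (c ^ ?d) * (\<integral>\<^sup>+x. ennreal (g (c *\<^sub>R x)) * (ennreal (exp (- u)) * indicator {(norm (c *\<^sub>R x))\<^sup>2..} u) \<partial>(lborel :: 'a measure))"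
    by (rule nn_integral_lborel_scale[OF _ c(1)]) (simp add: indicator_def)
   also have "(\<integral>\<^sup>+x. ennreal (g (c *\<^sub>R x)) * (ennreal (exp (- u)) * indicator {(norm (c *\<^sub>R x))\<^sup>2..} u) \<partial>(lborel :: 'a measure))
    = (\<integral>\<^sup>+x. ennreal (c ^ (2 * m) * exp (- u)) * (ennreal (g x) * indicator (cball 0 1) x) \<partial>(lborel :: 'a measure))"
   proof (intro nn_integral_cong)
    fix x :: 'a
    have "(norm (c *\<^sub>R x))\<^sup>2 <= u \<longleftrightarrow> norm x <= 1"
    proof -
     have "(norm (c *\<^sub>R x))\<^sup>2 = u * (norm x)\<^sup>2" using c by (simp add: power_mult_distrib)
     then show ?thesis using u by (simp add: power_le_one_iff)
    qed
    then show "ennreal (g (c *\<^sub>R x)) * (ennreal (exp (- u)) * indicator {(norm (c *\<^sub>R x))\<^sup>2..} u) =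
      ennreal (c ^ (2 * m) * exp (- u)) * (ennreal (g x) * indicator (cball 0 1) x)"
     using nn c hom[OF c(1)] by (auto simp: indicator_def ennreal_mult[symmetric] mult_ac)
   qed
   also have "... = ennreal (c ^ (2 * m) * exp (- u)) * ?I"
    by (rule nn_integral_cmult) measurable
   also have "ennreal (c ^ ?d) * ... = ennreal (c ^ ?d * (c ^ (2 * m) * exp (- u))) * ?I"
    using c by (simp add: ennreal_mult mult.assoc)
   also have "c ^ ?d * (c ^ (2 * m) * exp (- u)) = indicator {0..} u * u powr (real m + real ?d / 2) / exp u"
   proof -
    have "c ^ ?d = u powr (real ?d / 2)"
     using c u by (simp add: c_def powr_half_sqrt[symmetric] powr_powr powr_realpow[symmetric])
    moreover have "c ^ (2 * m) = u powr real m" using c u by (simp add: power_mult powr_realpow)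
    moreover have "B * (A * exp (- u)) = indicator {0..} u * (A * B) / exp u" for A B
     using u by (simp add: exp_minus field_simps)
    moreover have "u powr (real m + real ?d / 2) = u powr real m * u powr (real ?d / 2)"
     by (rule powr_add)
    ultimately show ?thesis by (simp only:)
   qed
   finally show ?thesis .
  qed
 qed
 also have "... = (NI u. ennreal (indicator {0..} u * u powr (real m + real ?d / 2) / exp u)) * ?I"
  by (rule nn_integral_multc) simp
 also have "(NI u. ennreal (indicator {0..} u * u powr (real m + real ?d / 2) / exp u))
   = ennreal (Gamma (real m + real ?d / 2 + 1))"
  by (subst Gamma_conv_nn_integral_real) (auto simp: add_pos_nonneg)
 finally show ?thesis .
qed

lemma nn_integral_gauss:
 "(\<integral>\<^sup>+x. ennreal (exp (- (norm x)\<^sup>2)) \<partial>(lborel :: 'a::euclidean_space measure)) = ennreal (pi powr (real DIM('a) / 2))"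
proof -
 have "(\<integral>\<^sup>+x. ennreal (1 * exp (- (norm x)\<^sup>2)) \<partial>(lborel :: 'a measure)) =
   ennreal (Gamma (real 0 + real DIM('a) / 2 + 1)) * (\<integral>\<^sup>+x\<in>cball 0 1. ennreal 1 \<partial>(lborel :: 'a measure))"
  by (rule nn_integral_gauss_homogeneous) auto
 moreover have "(\<integral>\<^sup>+x\<in>cball 0 1. ennreal 1 \<partial>(lborel :: 'a measure)) = ennreal (unit_ball_vol (real DIM('a)))"
  using emeasure_cball[of 1 "0::'a"] by simp
 moreover have "Gamma (real DIM('a) / 2 + 1) \<noteq> 0"
  by (rule less_imp_neq[symmetric]) (intro Gamma_real_pos add_nonneg_pos, auto)
 moreover have "Gamma (real DIM('a) / 2 + 1) >= 0"
  by (rule less_imp_le) (intro Gamma_real_pos add_nonneg_pos, auto)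
 ultimately show ?thesis
  by (simp add: unit_ball_vol_def ennreal_mult[symmetric])
qed

text \<open>Completing the square. This is the generating function from which all moments of the
  Gaussian are read off.\<close>

lemma nn_integral_gauss_exp:
 fixes x :: "'a::euclidean_space"
 shows "(NI y. ennreal (exp (x \<bullet> y) * exp (- (norm y)\<^sup>2))) =
  ennreal (pi powr (real DIM('a) / 2) * exp ((norm x)\<^sup>2 / 4))"
proof -
 have e: "exp (x \<bullet> y) * exp (- (norm y)\<^sup>2) = exp ((norm x)\<^sup>2 / 4) * exp (- (norm (y + - (x /\<^sub>R 2)))\<^sup>2)" for y :: 'a
  unfolding exp_add[symmetric] power2_norm_eq_inner
  by (simp add: inner_simps inner_commute field_simps)
 have "(NI y. ennreal (exp (x \<bullet> y) * exp (- (norm y)\<^sup>2))) =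
  ennreal (exp ((norm x)\<^sup>2 / 4)) * (NI y. ennreal (exp (- (norm (y + - (x /\<^sub>R 2)))\<^sup>2)))"
  unfolding e by (simp add: ennreal_mult nn_integral_cmult)
 also have "(NI y. ennreal (exp (- (norm (y + - (x /\<^sub>R 2)))\<^sup>2))) = ennreal (pi powr (real DIM('a) / 2))"
  by (subst nn_integral_lborel_translate) (auto simp: nn_integral_gauss)
 finally show ?thesis by (simp add: ennreal_mult[symmetric] mult.commute)
qed

lemma cosh_sums: "(%n. x ^ (2 * n) / fact (2 * n)) sums cosh (x::real)"
proof -
 have "(%n. if even n then x ^ n / fact n else 0) = (%n. if even n then x ^ n /\<^sub>R fact n else 0)"
  by (intro ext) (simp add: divide_inverse mult.commute[of "inverse (fact _)"])
 then have "(%n. (if even n then x ^ n / fact n else 0)) sums cosh x"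
  by (simp only: cosh_converges)
 then have "(%n. (%n. if even n then x ^ n / fact n else 0) (2 * n)) sums cosh x"
  by (subst sums_mono_reindex) (auto simp: strict_mono_def)
 then show ?thesis by simp
qed

text \<open>Only nonnegative arguments are available because the series will be used with
  \<open>v = t ^ 2\<close>. Dividing by the lowest power with different coefficients and letting
  \<open>v\<close> tend to 0 from the right gives the contradiction.\<close>

lemma powser_coeff_unique:
 fixes a b :: "nat => real"
 assumes "!!v. v >= 0 ==> (%n. a n * v ^ n) sums f v" "!!v. v >= 0 ==> (%n. b n * v ^ n) sums f v"
 shows "a = b"
proof (rule ccontr)
 assume "a \<noteq> b"
 define c where "c n = a n - b n" for n
 from \<open>a \<noteq> b\<close> have "\<exists>n. c n \<noteq> 0" by (auto simp: c_def)
 define N where "N = (LEAST n. c n \<noteq> 0)"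
 have N: "c N \<noteq> 0" "!!n. n < N ==> c n = 0"
  using \<open>\<exists>n. c n \<noteq> 0\<close> LeastI_ex[of "%n. c n \<noteq> 0"] not_less_Least unfolding N_def by auto
 have s: "(%n. c n * v ^ n) sums 0" if "v >= 0" for v
  using sums_diff[OF assms(1)[OF that] assms(2)[OF that]] by (simp add: c_def algebra_simps)
 have s': "(%n. c (n + N) * v ^ n) sums 0" if "v > 0" for v
 proof -
  have "(%n. c (n + N) * v ^ (n + N)) sums (0 - (\<Sum>i<N. c i * v ^ i))"
   using s[of v] that by (intro sums_split_initial_segment) auto
  then have "(%n. (c (n + N) * v ^ n) * v ^ N) sums (0 * v ^ N)"
   using N(2) by (simp add: power_add mult_ac)
  then show ?thesis using that by (subst (asm) sums_mult2_iff) auto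
 qed
 define g where "g v = (\<Sum>n. c (n + N) * v ^ n)" for v
 have "isCont g 0" unfolding g_def[abs_def]
  using isCont_powser[of "%n. c (n + N)" 1 0] s'[of 1] by (auto simp: sums_iff)
 then have "(g \<longlongrightarrow> g 0) (at_right 0)" by (simp add: isCont_def filterlim_at_split)
 moreover have "(g \<longlongrightarrow> 0) (at_right 0)"
  by (intro tendsto_eventually eventually_at_rightI[of 0 1]) (use s' in \<open>auto simp: g_def sums_iff\<close>)
 ultimately have "g 0 = 0" using tendsto_unique trivial_limit_at_right_real by blast
 then show False using N(1) by (simp add: g_def)
qed

text \<open>Averaging \<open>cosh (t * (x \<bullet> y))\<close> against the Gaussian gives an
  exponential in \<open>t ^ 2\<close>. All terms are nonnegative, so the series may be integrated
  termwise, and comparing coefficients yields the Gaussian moments. Homogeneity turns these into the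
  moments of the ball at the price of one Gamma factor.\<close>

lemma nn_integral_inner_power_cball:
 fixes x :: "'a::euclidean_space"
 shows "(NI y. ennreal ((x \<bullet> y) ^ (2 * m) * exp (- (norm y)\<^sup>2))) =
   ennreal (pi powr (real DIM('a) / 2) * fact (2 * m) / fact m * ((norm x)\<^sup>2 / 4) ^ m)"
  and "(\<integral>\<^sup>+y\<in>cball 0 1. ennreal ((x \<bullet> y) ^ (2 * m)) \<partial>lborel) =
   ennreal (pi powr (real DIM('a) / 2) * fact (2 * m) / fact m * ((norm x)\<^sup>2 / 4) ^ m
    * rGamma (real m + real DIM('a) / 2 + 1))"
proof -
 let ?P = "pi powr (real DIM('a) / 2)"
 define G where "G m = (NI y. ennreal ((x \<bullet> y) ^ (2 * m) * exp (- (norm y)\<^sup>2)))" for m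
 define I where "I m = (\<integral>\<^sup>+y\<in>cball 0 1. ennreal ((x \<bullet> y) ^ (2 * m)) \<partial>lborel)" for m
 have gp: "Gamma (real m + real DIM('a) / 2 + 1) > 0" for m by (intro Gamma_real_pos) (simp add: add_nonneg_pos)
 have GI: "G m = ennreal (Gamma (real m + real DIM('a) / 2 + 1)) * I m" for m
  unfolding G_def I_def
  by (rule nn_integral_gauss_homogeneous) (auto simp: power_mult_distrib)
 have cosh: "(NI y. ennreal (cosh (t * (x \<bullet> y)) * exp (- (norm y)\<^sup>2))) = ennreal (?P * exp (t\<^sup>2 * (norm x)\<^sup>2 / 4))" for t
 proof -
  have "(NI y. ennreal (cosh (t * (x \<bullet> y)) * exp (- (norm y)\<^sup>2))) =
   (NI y. ennreal (1 / 2) * (ennreal (exp ((t *\<^sub>R x) \<bullet> y) * exp (- (norm y)\<^sup>2)) + ennreal (exp ((- t *\<^sub>R x) \<bullet> y) * exp (- (norm y)\<^sup>2))))"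
  proof (intro nn_integral_cong)
   fix y :: 'a
   let ?A = "exp ((t *\<^sub>R x) \<bullet> y) * exp (- (norm y)\<^sup>2)" and ?B = "exp ((- t *\<^sub>R x) \<bullet> y) * exp (- (norm y)\<^sup>2)"
   have "cosh (t * (x \<bullet> y)) * exp (- (norm y)\<^sup>2) = 1 / 2 * (?A + ?B)"
    by (simp add: cosh_def field_simps)
   then show "ennreal (cosh (t * (x \<bullet> y)) * exp (- (norm y)\<^sup>2)) = ennreal (1 / 2) * (ennreal ?A + ennreal ?B)"
    by (simp only: ennreal_plus[symmetric] ennreal_mult[symmetric] mult_nonneg_nonneg exp_ge_zero add_nonneg_nonneg zero_le_divide_1_iff zero_le_numeral)
  qed
  also have "... = ennreal (1 / 2) * (ennreal (?P * exp ((norm (t *\<^sub>R x))\<^sup>2 / 4)) + ennreal (?P * exp ((norm (- t *\<^sub>R x))\<^sup>2 / 4)))"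
   by (subst nn_integral_cmult, simp, subst nn_integral_add, simp, simp) (simp only: nn_integral_gauss_exp)
  also have "... = ennreal (?P * exp (t\<^sup>2 * (norm x)\<^sup>2 / 4))"
  proof -
   have n: "(norm (t *\<^sub>R x))\<^sup>2 / 4 = t\<^sup>2 * (norm x)\<^sup>2 / 4" "(norm (- t *\<^sub>R x))\<^sup>2 / 4 = t\<^sup>2 * (norm x)\<^sup>2 / 4"
    by (simp_all add: power_mult_distrib)
   have h: "ennreal (1 / 2) * (ennreal X + ennreal X) = ennreal X" if "X >= 0" for X
   proof -
    have "ennreal (1 / 2) * (ennreal X + ennreal X) = ennreal (1 / 2) * ennreal (X + X)"
     by (simp only: ennreal_plus that)
    also have "... = ennreal (1 / 2 * (X + X))"
     by (rule ennreal_mult[symmetric]) (use that in auto)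
    finally show ?thesis by simp
   qed
   show ?thesis unfolding n by (rule h) simp
  qed
  finally show ?thesis .
 qed
 have series: "(\<Sum>m. ennreal (t ^ (2 * m) / fact (2 * m)) * G m) = ennreal (?P * exp (t\<^sup>2 * (norm x)\<^sup>2 / 4))" for t
 proof -
  have "(\<Sum>m. ennreal (t ^ (2 * m) / fact (2 * m)) * G m) =
    (NI y. (\<Sum>m. ennreal (t ^ (2 * m) / fact (2 * m)) * ennreal ((x \<bullet> y) ^ (2 * m) * exp (- (norm y)\<^sup>2))))"
   unfolding G_def by (subst nn_integral_suminf) (auto simp: nn_integral_cmult)
  also have "... = (NI y. ennreal (cosh (t * (x \<bullet> y)) * exp (- (norm y)\<^sup>2)))"
  proof (intro nn_integral_cong)
   fix y :: 'a
   have "(%m. (t * (x \<bullet> y)) ^ (2 * m) / fact (2 * m) * exp (- (norm y)\<^sup>2)) sums (cosh (t * (x \<bullet> y)) * exp (- (norm y)\<^sup>2))"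
    by (intro sums_mult2 cosh_sums)
   then have "(\<Sum>m. ennreal ((t * (x \<bullet> y)) ^ (2 * m) / fact (2 * m) * exp (- (norm y)\<^sup>2))) = ennreal (cosh (t * (x \<bullet> y)) * exp (- (norm y)\<^sup>2))"
    by (intro suminf_ennreal_eq) auto
   moreover have "ennreal (t ^ (2 * m) / fact (2 * m)) * ennreal ((x \<bullet> y) ^ (2 * m) * exp (- (norm y)\<^sup>2)) =
     ennreal ((t * (x \<bullet> y)) ^ (2 * m) / fact (2 * m) * exp (- (norm y)\<^sup>2))" for m
    by (subst ennreal_mult[symmetric]) (auto simp: power_mult_distrib)
   ultimately show "(\<Sum>m. ennreal (t ^ (2 * m) / fact (2 * m)) * ennreal ((x \<bullet> y) ^ (2 * m) * exp (- (norm y)\<^sup>2))) = ennreal (cosh (t * (x \<bullet> y)) * exp (- (norm y)\<^sup>2))"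
    by (simp only:)
  qed
  finally show ?thesis unfolding cosh .
 qed
 \<comment> \<open>A single term of the nonnegative series at \<open>t = 1\<close> is at most its
   finite sum.\<close>
 have Gfin: "G m < \<infinity>" for m
 proof -
  have "ennreal (1 ^ (2 * m) / fact (2 * m)) * G m <= (\<Sum>m. ennreal (1 ^ (2 * m) / fact (2 * m)) * G m)"
   using sum_le_suminf[of "%m. ennreal (1 ^ (2 * m) / fact (2 * m)) * G m" "{m}"] by simp
  also have "... < \<infinity>" unfolding series by simp
  finally show ?thesis by (auto simp: ennreal_mult_less_top)
 qed
 define g where "g m = enn2real (G m)" for m
 have Gg: "G m = ennreal (g m)" for m using Gfin by (simp add: g_def)
 have gnn: "g m >= 0" for m by (simp add: g_def)
 have "(%m. g m / fact (2 * m)) = (%m. ?P * ((norm x)\<^sup>2 / 4) ^ m / fact m)"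
 proof (rule powser_coeff_unique)
  fix v :: real assume v: "v >= 0"
  have "(\<Sum>m. ennreal (g m / fact (2 * m) * v ^ m)) = ennreal (?P * exp (v * (norm x)\<^sup>2 / 4))"
  proof -
   have "ennreal (sqrt v ^ (2 * m) / fact (2 * m)) * G m = ennreal (g m / fact (2 * m) * v ^ m)" for m
    using v gnn by (subst Gg, subst ennreal_mult[symmetric]) (auto simp: power_mult)
   then show ?thesis using series[of "sqrt v"] v by simp
  qed
  then have "(%m. ennreal (g m / fact (2 * m) * v ^ m)) sums ennreal (?P * exp (v * (norm x)\<^sup>2 / 4))"
   by (simp only: sums_iff summableI simp_thms)
  then show "(%m. g m / fact (2 * m) * v ^ m) sums (?P * exp (v * (norm x)\<^sup>2 / 4))"
   using v gnn by (subst (asm) sums_ennreal) auto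
  have "(%m. ?P * ((v * (norm x)\<^sup>2 / 4) ^ m /\<^sub>R fact m)) sums (?P * exp (v * (norm x)\<^sup>2 / 4))"
   by (intro sums_mult exp_converges)
  moreover have "?P * ((v * (norm x)\<^sup>2 / 4) ^ m /\<^sub>R fact m) = ?P * ((norm x)\<^sup>2 / 4) ^ m / fact m * v ^ m" for m
   by (simp add: power_mult_distrib power_divide field_simps)
  ultimately show "(%m. ?P * ((norm x)\<^sup>2 / 4) ^ m / fact m * v ^ m) sums (?P * exp (v * (norm x)\<^sup>2 / 4))"
   by (simp only:)
 qed
 then have "g m / fact (2 * m) = ?P * ((norm x)\<^sup>2 / 4) ^ m / fact m" for m by meson
 then have g: "g m = ?P * fact (2 * m) / fact m * ((norm x)\<^sup>2 / 4) ^ m" for m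
  by (simp add: field_simps)
 show "(NI y. ennreal ((x \<bullet> y) ^ (2 * m) * exp (- (norm y)\<^sup>2))) =
   ennreal (?P * fact (2 * m) / fact m * ((norm x)\<^sup>2 / 4) ^ m)"
  using Gg[of m] g[of m] by (simp add: G_def)
 let ?z = "real m + real DIM('a) / 2 + 1"
 have rG: "rGamma ?z * Gamma ?z = 1" unfolding rGamma_inverse_Gamma
  by (rule left_inverse[OF less_imp_neq[OF gp, symmetric]])
 have rp: "rGamma ?z >= 0" unfolding rGamma_inverse_Gamma
  by (simp only: inverse_nonnegative_iff_nonnegative less_imp_le[OF gp])
 have "I m = ennreal (rGamma ?z * Gamma ?z) * I m" by (simp only: rG ennreal_1 mult_1)
 also have "... = ennreal (rGamma ?z) * (ennreal (Gamma ?z) * I m)"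
  using gp[of m] rp by (simp only: ennreal_mult less_imp_le mult.assoc)
 also have "... = ennreal (rGamma ?z) * ennreal (g m)" by (simp only: GI[symmetric] Gg)
 also have "... = ennreal (g m * rGamma ?z)" using rp gnn by (simp only: ennreal_mult mult.commute)
 finally show "(\<integral>\<^sup>+y\<in>cball 0 1. ennreal ((x \<bullet> y) ^ (2 * m)) \<partial>lborel) =
   ennreal (?P * fact (2 * m) / fact m * ((norm x)\<^sup>2 / 4) ^ m * rGamma (real m + real DIM('a) / 2 + 1))"
  by (simp add: I_def g)
qed

text \<open>Termwise integration of the Taylor series of the cosine. By the moment hypothesis the
  integral of the absolute value of the \<open>m\<close>-th term is \<open>c m\<close>, and these
  are summable.\<close>

lemma integral_cos_series:
 fixes x :: "'a::euclidean_space"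
 assumes [measurable]: "w \<in> borel_measurable borel" and w: "!!y. w y >= (0::real)"
  and mom: "!!m. (NI y. ennreal ((x \<bullet> y) ^ (2 * m) * w y)) = ennreal (fact (2 * m) * c m)"
  and c: "!!m. c m >= 0" "summable c"
 shows "integrable lborel (%y. w y * cos (x \<bullet> y))"
  and "(RI y. w y * cos (x \<bullet> y)) = (\<Sum>m. (-1) ^ m * c m)"
proof -
 define f where "f m y = (-1) ^ m * ((x \<bullet> y) ^ (2 * m) * w y) / fact (2 * m)" for m y
 have hb: "has_bochner_integral lborel (%y. (x \<bullet> y) ^ (2 * m) * w y) (fact (2 * m) * c m)" for m
  by (rule has_bochner_integral_nn_integral) (use w c mom in auto)
 have f: "has_bochner_integral lborel (f m) ((-1) ^ m * c m)" for m
  using has_bochner_integral_mult_right[OF hb[of m], where c="(-1) ^ m / fact (2 * m)"]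
  unfolding f_def[abs_def] by (simp add: field_simps)
 have nf: "norm (f m y) = (x \<bullet> y) ^ (2 * m) * w y * (1 / fact (2 * m))" for m y
  using w by (simp add: f_def abs_mult power_mult)
 have nf': "has_bochner_integral lborel (%y. norm (f m y)) (c m)" for m
  using has_bochner_integral_mult_left[OF hb[of m], where c="1 / fact (2 * m)"]
  unfolding nf by simp
 have S: "(%m. f m y) sums (w y * cos (x \<bullet> y))" for y
 proof -
  have "(%n. (if even n then (-1) ^ (n div 2) / fact n else 0) * (x \<bullet> y) ^ n) sums cos (x \<bullet> y)"
   using cos_converges[of "x \<bullet> y"] unfolding real_scaleR_def cos_coeff_def .
  then have "(%n. (%n. (if even n then (-1) ^ (n div 2) / fact n else 0) * (x \<bullet> y) ^ n) (2 * n)) sums cos (x \<bullet> y)"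
   by (subst sums_mono_reindex) (auto simp: strict_mono_def)
  then have "(%n. w y * ((-1) ^ n / fact (2 * n) * (x \<bullet> y) ^ (2 * n))) sums (w y * cos (x \<bullet> y))"
   by (intro sums_mult) simp
  moreover have "w y * ((-1) ^ n / fact (2 * n) * (x \<bullet> y) ^ (2 * n)) = f n y" for n
   by (simp add: f_def)
  ultimately show ?thesis by simp
 qed
 have Sn: "summable (%m. norm (f m y))" for y
 proof -
  have "(%m. w y * ((x \<bullet> y) ^ (2 * m) / fact (2 * m))) sums (w y * cosh (x \<bullet> y))"
   by (intro sums_mult cosh_sums)
  then show ?thesis unfolding nf by (simp add: sums_iff mult.commute)
 qed
 have cs: "summable (%m. RI y. norm (f m y))"
  unfolding has_bochner_integral_integral_eq[OF nf'] by (rule c(2))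
 have fi: "integrable lborel (f m)" for m using f[of m] unfolding has_bochner_integral_iff by (rule conjunct1)
 have eq: "(\<Sum>m. f m y) = w y * cos (x \<bullet> y)" for y using S by (simp add: sums_iff)
 show "integrable lborel (%y. w y * cos (x \<bullet> y))"
  using integrable_suminf[OF fi AE_I2[OF Sn] cs] by (simp add: eq)
 show "(RI y. w y * cos (x \<bullet> y)) = (\<Sum>m. (-1) ^ m * c m)"
  using integral_suminf[OF fi AE_I2[OF Sn] cs] unfolding eq has_bochner_integral_integral_eq[OF f] .
qed

text \<open>The even moments of the ball carry the factor \<open>rGamma (m + d / 2 + 1)\<close>, so
  the cosine series is literally the series of \<open>bess\<close> with index \<open>d / 2\<close>.
  No polar coordinates and no integral over a sphere enter.\<close>

lemma cball_transform:
 fixes x :: "'a::euclidean_space"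
 assumes s: "s > 0"
 shows "(RI y. indicator (cball 0 s) y * cos (x \<bullet> y)) =
  pi powr (real DIM('a) / 2) * s ^ DIM('a) * bess (real DIM('a) / 2) ((s * norm x)\<^sup>2 / 4)"
proof -
 let ?d = "DIM('a)" and ?P = "pi powr (real DIM('a) / 2)" and ?u = "(s * norm x)\<^sup>2 / 4"
 have [measurable]: "cball 0 r \<in> sets (borel :: 'a measure)" for r by (intro borel_closed closed_cball)
 define c where "c m = ?P * s ^ ?d * (rGamma (real m + real ?d / 2 + 1) / fact m * ?u ^ m)" for m
 have rp: "rGamma (real m + real ?d / 2 + 1) >= 0" for m
 proof -
  have "real m + real ?d / 2 + 1 > 0" by (rule add_nonneg_pos) simp_all
  then show ?thesis unfolding rGamma_inverse_Gamma inverse_nonnegative_iff_nonnegative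
   by (intro less_imp_le Gamma_real_pos)
 qed
 have mom: "(NI y. ennreal ((x \<bullet> y) ^ (2 * m) * indicator (cball 0 s) y)) = ennreal (fact (2 * m) * c m)" for m
 proof -
  have "(NI y. ennreal ((x \<bullet> y) ^ (2 * m) * indicator (cball 0 s) y)) =
   ennreal (s ^ ?d) * (NI y. ennreal ((x \<bullet> (s *\<^sub>R y)) ^ (2 * m) * indicator (cball 0 s) (s *\<^sub>R y)))"
   by (rule nn_integral_lborel_scale[OF _ s]) measurable
  also have "(NI y. ennreal ((x \<bullet> (s *\<^sub>R y)) ^ (2 * m) * indicator (cball 0 s) (s *\<^sub>R y))) =
    (NI y. ennreal (s ^ (2 * m)) * (ennreal ((x \<bullet> y) ^ (2 * m)) * indicator (cball 0 1) y))"
  proof (intro nn_integral_cong)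
   fix y :: 'a
   have "s *\<^sub>R y \<in> cball 0 s \<longleftrightarrow> y \<in> cball 0 1" using s by simp
   then show "ennreal ((x \<bullet> (s *\<^sub>R y)) ^ (2 * m) * indicator (cball 0 s) (s *\<^sub>R y)) =
     ennreal (s ^ (2 * m)) * (ennreal ((x \<bullet> y) ^ (2 * m)) * indicator (cball 0 1) y)"
    using s by (auto simp: indicator_def ennreal_mult power_mult_distrib)
  qed
  also have "... = ennreal (s ^ (2 * m)) * (\<integral>\<^sup>+y\<in>cball 0 1. ennreal ((x \<bullet> y) ^ (2 * m)) \<partial>lborel)"
   by (rule nn_integral_cmult) measurable
  also have "ennreal (s ^ ?d) * ... = ennreal (s ^ ?d * (s ^ (2 * m) *
    (?P * fact (2 * m) / fact m * ((norm x)\<^sup>2 / 4) ^ m * rGamma (real m + real ?d / 2 + 1))))"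
   unfolding nn_integral_inner_power_cball(2) using s rp[of m]
   by (subst ennreal_mult, simp, simp, subst ennreal_mult) auto
  also have "s ^ ?d * (s ^ (2 * m) * (?P * fact (2 * m) / fact m * ((norm x)\<^sup>2 / 4) ^ m * rGamma (real m + real ?d / 2 + 1)))
    = fact (2 * m) * c m"
   by (simp add: c_def power_mult power_mult_distrib power_divide)
  finally show ?thesis .
 qed
 have cc: "c m >= 0" for m using rp[of m] s by (simp add: c_def)
 have half: "real ?d / 2 >= - 1 / 2" by (rule order_trans[of _ 0]) auto
 \<comment> \<open>Evaluating at \<open>- ?u\<close> cancels the alternating signs, so convergence
   of the Bessel series there is absolute convergence at \<open>?u\<close>.\<close>
 have "summable (%m. ((-1) ^ m * rGamma (real m + real ?d / 2 + 1) / fact m) * (- ?u) ^ m)"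
  by (rule bess_summable[OF half])
 moreover have "((-1) ^ m * rGamma (real m + real ?d / 2 + 1) / fact m) * (- ?u) ^ m = rGamma (real m + real ?d / 2 + 1) / fact m * ?u ^ m" for m
  by (simp only: power_minus[of ?u m] times_divide_eq_left times_divide_eq_right) (simp add: mult_ac power_add[symmetric] mult_2[symmetric])
 ultimately have "summable (%m. rGamma (real m + real ?d / 2 + 1) / fact m * ?u ^ m)" by (simp only:)
 then have "summable c" unfolding c_def by (rule summable_mult)
 from integral_cos_series(2)[OF _ _ mom cc this]
 have "(RI y. indicator (cball 0 s) y * cos (x \<bullet> y)) = (\<Sum>m. (-1) ^ m * c m)" by simp
 also have "... = (\<Sum>m. ?P * s ^ ?d * (((-1) ^ m * rGamma (real m + real ?d / 2 + 1) / fact m) * ?u ^ m))"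
  by (simp add: c_def mult_ac)
 also have "... = ?P * s ^ ?d * bess (real ?d / 2) ?u"
  unfolding bess_def by (rule suminf_mult[OF bess_summable[OF half]])
 finally show ?thesis .
qed

text \<open>The same termwise argument as for the ball; here the moments sum to an
  exponential.\<close>

lemma gauss_transform:
 fixes x :: "'a::euclidean_space"
 assumes c: "c > 0"
 shows "integrable lborel (%y. exp (- (norm y / c)\<^sup>2) * cos (x \<bullet> y))"
  and "(RI y. exp (- (norm y / c)\<^sup>2) * cos (x \<bullet> y)) =
   pi powr (real DIM('a) / 2) * c ^ DIM('a) * exp (- (c * norm x / 2)\<^sup>2)"
proof -
 let ?d = "DIM('a)" and ?P = "pi powr (real DIM('a) / 2)" and ?u = "(c * norm x / 2)\<^sup>2"
 define a where "a m = ?P * c ^ ?d * (?u ^ m / fact m)" for m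
 have mom: "(NI y. ennreal ((x \<bullet> y) ^ (2 * m) * exp (- (norm y / c)\<^sup>2))) = ennreal (fact (2 * m) * a m)" for m
 proof -
  have "(NI y. ennreal ((x \<bullet> y) ^ (2 * m) * exp (- (norm y / c)\<^sup>2))) =
   ennreal (c ^ ?d) * (NI y. ennreal ((x \<bullet> (c *\<^sub>R y)) ^ (2 * m) * exp (- (norm (c *\<^sub>R y) / c)\<^sup>2)))"
   by (rule nn_integral_lborel_scale[OF _ c]) measurable
  also have "(NI y. ennreal ((x \<bullet> (c *\<^sub>R y)) ^ (2 * m) * exp (- (norm (c *\<^sub>R y) / c)\<^sup>2))) =
    (NI y. ennreal (c ^ (2 * m)) * ennreal ((x \<bullet> y) ^ (2 * m) * exp (- (norm y)\<^sup>2)))"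
   using c by (intro nn_integral_cong) (simp add: ennreal_mult'[symmetric] power_mult_distrib mult_ac)
  also have "... = ennreal (c ^ (2 * m)) * (NI y. ennreal ((x \<bullet> y) ^ (2 * m) * exp (- (norm y)\<^sup>2)))"
   by (rule nn_integral_cmult) measurable
  also have "ennreal (c ^ ?d) * ... = ennreal (c ^ ?d * (c ^ (2 * m) *
    (?P * fact (2 * m) / fact m * ((norm x)\<^sup>2 / 4) ^ m)))"
   unfolding nn_integral_inner_power_cball(1) using c
   by (subst ennreal_mult, simp, simp, subst ennreal_mult) auto
  also have "c ^ ?d * (c ^ (2 * m) * (?P * fact (2 * m) / fact m * ((norm x)\<^sup>2 / 4) ^ m)) = fact (2 * m) * a m"
   by (simp add: a_def power_mult power_mult_distrib power_divide) (simp add: mult_ac)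
  finally show ?thesis .
 qed
 have E: "(%m. v ^ m / fact m) sums exp v" for v :: real
  using exp_converges[of v] by (simp add: divide_inverse mult.commute[of "inverse (fact _)"])
 have aa: "a m >= 0" for m using c by (simp add: a_def)
 have sa: "summable a" unfolding a_def using E[of ?u] by (intro summable_mult) (simp add: sums_iff)
 note I = integral_cos_series[OF _ _ mom aa sa]
 show "integrable lborel (%y. exp (- (norm y / c)\<^sup>2) * cos (x \<bullet> y))" by (rule I) auto
 have "(RI y. exp (- (norm y / c)\<^sup>2) * cos (x \<bullet> y)) = (\<Sum>m. (-1) ^ m * a m)" by (rule I) auto
 also have "(%m. (-1) ^ m * a m) = (%m. ?P * c ^ ?d * ((- ?u) ^ m / fact m))"
  by (intro ext) (simp only: a_def power_minus[of ?u] times_divide_eq_right mult_ac)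
 also have "(\<Sum>m. ?P * c ^ ?d * ((- ?u) ^ m / fact m)) = ?P * c ^ ?d * exp (- ?u)"
  by (rule sums_unique[symmetric]) (intro sums_mult E)
 finally show "(RI y. exp (- (norm y / c)\<^sup>2) * cos (x \<bullet> y)) = ?P * c ^ ?d * exp (- ?u)" .
qed

section \<open>Functions of bounded variation\<close>

lemma total_variation_ge:
 assumes "a <= b"
 shows "ennreal (norm (\<phi> b - \<phi> a)) <= total_variation \<phi> a b"
proof -
 have "(1, %i::nat. if i = 0 then a else b) \<in> partitions a b" using assms by (simp add: partitions_def)
 from SUP_upper[OF this, of "%(n, x). \<Sum>i<n. ennreal (norm (\<phi> (x (Suc i)) - \<phi> (x i)))"]
 show ?thesis by (simp add: total_variation_def)
qed

text \<open>Two partitions are concatenated at \<open>b\<close>. Superadditivity is the direction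
  that lets variations over consecutive shells be summed.\<close>

lemma total_variation_add:
 assumes "a <= b" "b <= c"
 shows "total_variation \<phi> a b + total_variation \<phi> b c <= total_variation \<phi> a c"
proof -
 let ?S = "%(n, x). \<Sum>i<n. ennreal (norm (\<phi> (x (Suc i)) - \<phi> (x i)))"
 have one: "?S X + ?S Y <= total_variation \<phi> a c" if X: "X \<in> partitions a b" and Y: "Y \<in> partitions b c" for X Y
 proof -
  obtain n x m y where [simp]: "X = (n, x)" "Y = (m, y)" by (cases X, cases Y)
  \<comment> \<open>At the junction both formulas agree, because
    \<open>x n = b = y 0\<close>.\<close>
  define z where "z i = (if i <= n then x i else y (i - n))" for i
  have x: "x 0 = a" "x n = b" "!!i. i < n ==> x i <= x (Suc i)" and y: "y 0 = b" "y m = c" "!!i. i < m ==> y i <= y (Suc i)"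
   using X Y by (auto simp: partitions_def)
  have z1: "z i = x i" if "i <= n" for i using that by (simp add: z_def)
  have z2: "z (n + i) = y i" for i using x y by (cases i) (auto simp: z_def)
  have "z i <= z (Suc i)" if "i < n + m" for i
  proof (cases "i < n")
   case True then show ?thesis using x(3)[of i] by (simp add: z1)
  next
   case False
   then obtain j where "i = n + j" using le_Suc_ex not_less by blast
   then show ?thesis using that y(3)[of j] z2[of j] z2[of "Suc j"] by simp
  qed
  then have "(n + m, z) \<in> partitions a c"
   using x y z1[of 0] z2[of m] by (simp add: partitions_def)
  from SUP_upper[OF this, of ?S] have "?S (n + m, z) <= total_variation \<phi> a c"
   by (simp add: total_variation_def)
  moreover have "?S (n + m, z) = ?S (n, x) + ?S (m, y)"
  proof -
   have "(\<Sum>i<n + m. ennreal (norm (\<phi> (z (Suc i)) - \<phi> (z i)))) =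
    (\<Sum>i<n. ennreal (norm (\<phi> (z (Suc i)) - \<phi> (z i)))) + (\<Sum>i<m. ennreal (norm (\<phi> (z (Suc (n + i))) - \<phi> (z (n + i)))))"
    by (induction m) (auto simp: add.assoc)
   also have "(\<Sum>i<n. ennreal (norm (\<phi> (z (Suc i)) - \<phi> (z i)))) = ?S (n, x)"
    by (auto simp: z1 intro!: sum.cong)
   also have "(\<Sum>i<m. ennreal (norm (\<phi> (z (Suc (n + i))) - \<phi> (z (n + i))))) = ?S (m, y)"
    using z2[of "Suc _"] by (simp add: z2)
   finally show ?thesis by simp
  qed
  ultimately show ?thesis by simp
 qed
 have ne: "partitions u v \<noteq> {}" if "u <= v" for u v
 proof -
  have "(1, %i::nat. if i = 0 then u else v) \<in> partitions u v" using that by (simp add: partitions_def)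
  then show ?thesis by blast
 qed
 have "?S X + total_variation \<phi> b c <= total_variation \<phi> a c" if X: "X \<in> partitions a b" for X
 proof -
  have "?S X + total_variation \<phi> b c = (SUP Y\<in>partitions b c. ?S X + ?S Y)"
   using ennreal_SUP_add_right[OF ne[OF assms(2)], where c = "?S X" and f = ?S]
   by (simp only: total_variation_def)
  also have "... <= total_variation \<phi> a c" by (rule SUP_least) (rule one[OF X])
  finally show ?thesis .
 qed
 moreover have "total_variation \<phi> a b + total_variation \<phi> b c = (SUP X\<in>partitions a b. ?S X + total_variation \<phi> b c)"
  using ennreal_SUP_add_left[OF ne[OF assms(1)], where c = "total_variation \<phi> b c" and f = ?S]
  by (simp only: total_variation_def[of \<phi> a b])
 ultimately show ?thesis by (simp only: SUP_least)
qed

text \<open>\<open>V a b\<close> stands for the variation of \<open>F\<close> on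
  \<open>[a, b]\<close>, kept abstract as a superadditive majorant of increments. Setting
  \<open>F\<close> to 0 at nonpositive arguments, where the data impose nothing, makes
  \<open>F\<close> measurable on the whole line.\<close>

locale bounded_var =
 fixes F :: "real => real" and V :: "real => real => real"
 assumes V_ge: "!!a b. 0 < a ==> a <= b ==> \<bar>F b - F a\<bar> <= V a b"
  and V_add: "!!a b c. 0 < a ==> a <= b ==> b <= c ==> V a b + V b c <= V a c"
  and F_nonpos: "!!s. s <= 0 ==> F s = 0"
begin

lemma V_nonneg: "0 < a ==> a <= b ==> 0 <= V a b"
 using V_ge[of a b] by linarith

lemma V_mono: "0 < a ==> a <= b ==> b <= c ==> V a b <= V a c"
 using V_add[of a b c] V_nonneg[of b c] by linarith

lemma F_bounded: "0 < a ==> a <= s ==> s <= b ==> \<bar>F s\<bar> <= \<bar>F a\<bar> + V a b"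
 using V_ge[of a s] V_mono[of a s b] by linarith

text \<open>Jordan decomposition: on \<open>[1 / (n + 1), n + 1]\<close> the function is a
  difference of two increasing ones. Clamping the argument to this interval extends this to the
  line, and \<open>F\<close> is the pointwise limit over \<open>n\<close>.\<close>

lemma F_measurable [measurable]: "F \<in> borel_measurable borel"
proof -
 define cl where "cl n s = max (1 / real (Suc n)) (min (real (Suc n)) s)" for n s
 define v where "v n s = V (1 / real (Suc n)) s" for n s
 have pos: "1 / real (Suc n) > 0" "1 / real (Suc n) <= cl n s" for n s by (auto simp: cl_def)
 have clm: "cl n s <= cl n t" if "s <= t" for n s t using that by (auto simp: cl_def)
 have m1: "mono (%s. v n (cl n s))" for n
  unfolding v_def by (intro monoI V_mono pos clm)
 have m2: "mono (%s. v n (cl n s) - F (cl n s))" for n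
 proof (rule monoI)
  fix s t :: real assume st: "s <= t"
  have "F (cl n t) - F (cl n s) <= V (cl n s) (cl n t)"
   using V_ge[of "cl n s" "cl n t"] pos(1)[of n] pos(2)[of n s] clm[OF st, of n] by linarith
  also have "... <= v n (cl n t) - v n (cl n s)"
   using V_add[of "1 / real (Suc n)" "cl n s" "cl n t"] pos(1)[of n] pos(2)[of n s] clm[OF st, of n] by (simp add: v_def)
  finally show "v n (cl n s) - F (cl n s) <= v n (cl n t) - F (cl n t)" by simp
 qed
 have "(%s. v n (cl n s) - (v n (cl n s) - F (cl n s))) \<in> borel_measurable borel" for n
  by (intro borel_measurable_diff borel_measurable_mono m1 m2)
 then have meas: "(%s. if s > 0 then F (cl n s) else 0) \<in> borel_measurable borel" for n by simp
 show ?thesis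
 proof (rule borel_measurable_LIMSEQ_real[OF _ meas])
  fix s :: real
  show "(%n. if s > 0 then F (cl n s) else 0) \<longlonglongrightarrow> F s"
  proof (cases "s > 0")
   case True
   obtain N where N: "real N > max s (1 / s)" using reals_Archimedean2 by blast
   have "cl n s = s" if "n >= N" for n
   proof -
    have r: "real (Suc n) > s" "real (Suc n) > 1 / s" using N that by auto
    then have "1 / real (Suc n) <= s" using True by (simp add: field_simps)
    then show ?thesis using r by (simp add: cl_def)
   qed
   then show ?thesis using True
    by (intro tendsto_eventually) (auto simp: eventually_sequentially intro!: exI[of _ N])
  qed (simp add: F_nonpos)
 qed
qed

text \<open>Summation by parts over the shells of a fine radial partition; the error of the
  Riemann sums is at most the mesh times the variation.\<close>

lemma radial_integral_by_parts:
 fixes \<psi> :: "'a::euclidean_space => real"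
 assumes [measurable]: "\<psi> \<in> borel_measurable borel" and M: "!!y. \<bar>\<psi> y\<bar> <= M"
  and ab: "0 < a" "a <= b"
 defines "\<Psi> \<equiv> %s. RI y. indicator (cball 0 s) y * \<psi> y"
 assumes B: "!!s. a <= s ==> s <= b ==> \<bar>\<Psi> s\<bar> <= B"
 shows "\<bar>(RI y. indicator (cball 0 b - cball 0 a) y * (F (norm y) * \<psi> y)) - (F b * \<Psi> b - F a * \<Psi> a)\<bar> <= B * V a b"
  and "integrable lborel (%y. indicator (cball 0 b - cball 0 a) y * (F (norm y) * \<psi> y))"
proof -
 have [measurable]: "cball 0 s \<in> sets (borel :: 'a measure)" for s by (intro borel_closed closed_cball)
 have M0: "M >= 0" using M[of 0] by linarith
 have B0: "B >= 0" using B[of a] ab by linarith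
 have bfin: "emeasure lborel (cball (0::'a) s) < \<infinity>" for s
  using emeasure_bounded_finite[of "cball (0::'a) s"] bounded_cball by auto
 have icball: "integrable lborel (%y::'a. indicator (cball 0 s) y * c)" for s and c :: real
  using bfin[of s] by (intro integrable_mult_left integrable_real_indicator) auto
 have ipsi: "integrable lborel (%y. indicator (cball 0 s) y * \<psi> y)" for s
  by (rule Bochner_Integration.integrable_bound[OF icball[of s M]]) (use M M0 in \<open>auto simp: indicator_def\<close>)
 define K where "K = \<bar>F a\<bar> + V a b"
 have K: "\<bar>F s\<bar> <= K" if "a <= s" "s <= b" for s using F_bounded[OF ab(1) that] by (simp add: K_def)
 have K0: "K >= 0" using K[of a] ab by linarith
 have iF: "integrable lborel (%y. indicator (cball 0 t - cball 0 s) y * (F (norm y) * \<psi> y))"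
  if "a <= s" "t <= b" for s t
 proof (rule Bochner_Integration.integrable_bound[OF icball[of b "K * M"]])
  show "AE y in lborel. norm (indicator (cball 0 t - cball 0 s) y * (F (norm y) * \<psi> y)) <= norm (indicator (cball (0::'a) b) y * (K * M))"
  proof (intro AE_I2)
   fix y :: 'a
   show "norm (indicator (cball 0 t - cball 0 s) y * (F (norm y) * \<psi> y)) <= norm (indicator (cball (0::'a) b) y * (K * M))"
   proof (cases "s < norm y \<and> norm y <= t")
    case True
    then have "\<bar>F (norm y)\<bar> * \<bar>\<psi> y\<bar> <= K * M" using that K0 by (intro mult_mono K M) auto
    then show ?thesis using True that K0 M0 by (auto simp: abs_mult indicator_def)
   qed (use K0 M0 in \<open>auto simp: indicator_def\<close>)
  qed
 qed measurable
 show "integrable lborel (%y. indicator (cball 0 b - cball 0 a) y * (F (norm y) * \<psi> y))" by (rule iF) auto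
 let ?I = "%s t. RI y. indicator (cball 0 t - cball 0 s) y * (F (norm y) * \<psi> y)"
 define kp where "kp = unit_ball_vol (real DIM('a))"
 have kap: "kp >= 0" by (simp add: kp_def)
 have vol: "(RI y. indicator (cball 0 s) (y::'a) * c) = kp * s ^ DIM('a) * c" if "s >= 0" for s c :: real
  using that content_cball[OF that, of "0::'a"] by (simp add: kp_def)
 define L where "L = real DIM('a) * b ^ (DIM('a) - 1)"
 have L0: "L >= 0" using ab by (simp add: L_def)
 have vold: "t ^ DIM('a) - s ^ DIM('a) <= L * (t - s)" if "a <= s" "s <= t" "t <= b" for s t
 proof (cases "s = t")
  case False
  then have "s < t" using that by simp
  moreover have "((%x. x ^ DIM('a)) has_real_derivative real DIM('a) * z ^ (DIM('a) - 1)) (at z)" for z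
   by (auto intro!: derivative_eq_intros)
  ultimately obtain z where z: "s < z" "z < t" "t ^ DIM('a) - s ^ DIM('a) = (t - s) * (real DIM('a) * z ^ (DIM('a) - 1))"
   using MVT2[of s t "%x. x ^ DIM('a)" "%z. real DIM('a) * z ^ (DIM('a) - 1)"] by blast
  have "real DIM('a) * z ^ (DIM('a) - 1) <= L"
   unfolding L_def using z that ab by (intro mult_left_mono power_mono) auto
  then show ?thesis using z that by (simp add: mult.commute mult_left_mono)
 qed simp
 \<comment> \<open>On a thin shell, replacing \<open>F (norm y)\<close> by its value at the outer
   radius costs the variation across the shell times the volume, which is at most a constant times
   the thickness.\<close>
 have shell: "\<bar>?I s t - F t * (\<Psi> t - \<Psi> s)\<bar> <= V s t * (M * kp * L * (t - s))"
  if st: "a <= s" "s <= t" "t <= b" for s t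
 proof -
  have s0: "s > 0" using st ab by simp
  have d: "indicator (cball 0 t - cball 0 s) y = indicator (cball 0 t) y - (indicator (cball 0 s) y :: real)" for y :: 'a
   using st by (auto simp: indicator_def)
  have i1: "integrable lborel (%y. indicator (cball 0 t - cball 0 s) y * (F t * \<psi> y))"
   using integrable_mult_left[OF Bochner_Integration.integrable_diff[OF ipsi[of t] ipsi[of s]], of "F t"]
   by (simp add: d algebra_simps)
  have "F t * (\<Psi> t - \<Psi> s) = (RI y. indicator (cball 0 t - cball 0 s) y * (F t * \<psi> y))"
   unfolding \<Psi>_def Bochner_Integration.integral_diff[OF ipsi ipsi, symmetric] integral_mult_right_zero[symmetric]
   by (intro Bochner_Integration.integral_cong) (auto simp: d algebra_simps)
  then have "?I s t - F t * (\<Psi> t - \<Psi> s) =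
    (RI y. indicator (cball 0 t - cball 0 s) y * (F (norm y) * \<psi> y) - indicator (cball 0 t - cball 0 s) y * (F t * \<psi> y))"
   using iF[of s t] st i1 by (simp add: Bochner_Integration.integral_diff)
  also have "\<bar>...\<bar> <= (RI y. indicator (cball 0 t) (y::'a) * (V s t * M) - indicator (cball 0 s) y * (V s t * M))"
  proof (rule integral_abs_bound_integral)
   show "integrable lborel (%y. indicator (cball 0 t - cball 0 s) y * (F (norm y) * \<psi> y) - indicator (cball 0 t - cball 0 s) y * (F t * \<psi> y))"
    using iF[of s t] st i1 by (intro Bochner_Integration.integrable_diff) auto
   show "integrable lborel (%y::'a. indicator (cball 0 t) y * (V s t * M) - indicator (cball 0 s) y * (V s t * M))"
    by (intro Bochner_Integration.integrable_diff icball)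
   fix y :: 'a
   show "\<bar>indicator (cball 0 t - cball 0 s) y * (F (norm y) * \<psi> y) - indicator (cball 0 t - cball 0 s) y * (F t * \<psi> y)\<bar>
     <= indicator (cball 0 t) y * (V s t * M) - indicator (cball 0 s) y * (V s t * M)"
   proof (cases "s < norm y \<and> norm y <= t")
    case True
    then have "\<bar>F t - F (norm y)\<bar> <= V (norm y) t"
     using s0 by (intro V_ge) auto
    moreover have "V s (norm y) + V (norm y) t <= V s t" "V s (norm y) >= 0"
     using True s0 by (auto intro!: V_add V_nonneg)
    ultimately have "\<bar>F (norm y) - F t\<bar> <= V s t"
     by linarith
    then have "\<bar>F (norm y) - F t\<bar> * \<bar>\<psi> y\<bar> <= V s t * M"
     using M[of y] V_nonneg[OF s0 st(2)] by (intro mult_mono) auto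
    then show ?thesis using True by (auto simp: indicator_def abs_mult[symmetric] algebra_simps)
   qed (use st in \<open>auto simp: indicator_def\<close>)
  qed
  also have "... = kp * t ^ DIM('a) * (V s t * M) - kp * s ^ DIM('a) * (V s t * M)"
   unfolding Bochner_Integration.integral_diff[OF icball icball]
   using st s0 by (subst (1 2) vol) auto
  also have "... = V s t * M * kp * (t ^ DIM('a) - s ^ DIM('a))"
   by (simp add: algebra_simps)
  also have "... <= V s t * M * kp * (L * (t - s))"
   using V_nonneg[OF s0 st(2)] M0 kap by (intro mult_left_mono vold st) auto
  finally show ?thesis by (simp add: mult_ac)
 qed
 have Isplit: "?I s u = ?I s t + ?I t u" if "a <= s" "s <= t" "t <= u" "u <= b" for s t u
 proof -
  have "?I s t + ?I t u = (RI y. indicator (cball 0 t - cball 0 s) y * (F (norm y) * \<psi> y) + indicator (cball 0 u - cball 0 t) y * (F (norm y) * \<psi> y))"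
   using that by (intro Bochner_Integration.integral_add[symmetric] iF) auto
  also have "... = ?I s u"
   using that by (intro Bochner_Integration.integral_cong) (auto simp: indicator_def)
  finally show ?thesis by simp
 qed
 \<comment> \<open>For \<open>n + 1\<close> shells of equal thickness. The term
   \<open>B * V a b\<close> comes from Abel summation; the other one is the accumulated shell error
   and vanishes as the mesh tends to 0.\<close>
 have est: "\<bar>?I a b - (F b * \<Psi> b - F a * \<Psi> a)\<bar> <= B * V a b + V a b * (M * kp * L * ((b - a) / real (Suc n)))" for n
 proof -
  define dl where "dl = (b - a) / real (Suc n)"
  define x where "x i = a + real i * dl" for i
  have d0: "dl >= 0" using ab by (simp add: dl_def)
  have xm: "x i <= x j" if "i <= j" for i j using that d0 by (simp add: x_def mult_right_mono)
  have xN: "x (Suc n) = b" by (simp add: x_def dl_def)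
  have x0: "x 0 = a" by (simp add: x_def)
  have xa: "a <= x i" for i using xm[of 0 i] x0 by simp
  have step: "\<bar>?I a (x i) - (F (x i) * \<Psi> (x i) - F a * \<Psi> a)\<bar> <= B * V a (x i) + V a (x i) * (M * kp * L * dl)"
   if "i <= Suc n" for i
   using that
  proof (induction i)
   case 0
   have "?I a a = 0" by simp
   then show ?case using V_nonneg[OF ab(1), of a] B0 M0 kap L0 d0 by (simp add: x0)
  next
   case (Suc i)
   have st: "a <= x i" "x i <= x (Suc i)" "x (Suc i) <= b"
    using xa xm[of i "Suc i"] xm[OF Suc.prems] xN by auto
   have p: "x i > 0" using st ab by simp
   have dx: "x (Suc i) - x i = dl" by (simp add: x_def algebra_simps)
   have 1: "\<bar>?I (x i) (x (Suc i)) - F (x (Suc i)) * (\<Psi> (x (Suc i)) - \<Psi> (x i))\<bar> <= V (x i) (x (Suc i)) * (M * kp * L * dl)"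
    using shell[OF st] dx by simp
   have 2: "\<bar>\<Psi> (x i) * (F (x (Suc i)) - F (x i))\<bar> <= B * V (x i) (x (Suc i))"
    unfolding abs_mult using st p B0 by (intro mult_mono B V_ge) auto
   have 3: "V a (x i) + V (x i) (x (Suc i)) <= V a (x (Suc i))" using V_add[OF ab(1) st(1,2)] .
   have 4: "B * (V a (x i) + V (x i) (x (Suc i))) + (V a (x i) + V (x i) (x (Suc i))) * (M * kp * L * dl)
     <= B * V a (x (Suc i)) + V a (x (Suc i)) * (M * kp * L * dl)"
    using 3 B0 M0 kap L0 d0 by (intro add_mono mult_left_mono mult_right_mono) auto
   have 5: "?I a (x (Suc i)) = ?I a (x i) + ?I (x i) (x (Suc i))" using st by (intro Isplit) auto
   have 6: "\<bar>?I a (x i) - (F (x i) * \<Psi> (x i) - F a * \<Psi> a)\<bar> <= B * V a (x i) + V a (x i) * (M * kp * L * dl)"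
    using Suc by simp
   \<comment> \<open>One step of Abel summation: a new shell changes the defect by its own error and
     by the increment of \<open>F\<close> times the primitive at the inner radius.\<close>
   have "?I a (x (Suc i)) - (F (x (Suc i)) * \<Psi> (x (Suc i)) - F a * \<Psi> a) =
     (?I a (x i) - (F (x i) * \<Psi> (x i) - F a * \<Psi> a))
     + (?I (x i) (x (Suc i)) - F (x (Suc i)) * (\<Psi> (x (Suc i)) - \<Psi> (x i)))
     - \<Psi> (x i) * (F (x (Suc i)) - F (x i))"
    unfolding 5 by (simp add: algebra_simps)
   then have "\<bar>?I a (x (Suc i)) - (F (x (Suc i)) * \<Psi> (x (Suc i)) - F a * \<Psi> a)\<bar>
    <= (B * V a (x i) + V a (x i) * (M * kp * L * dl)) + V (x i) (x (Suc i)) * (M * kp * L * dl) + B * V (x i) (x (Suc i))"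
    using 1 2 6 by linarith
   also have "... = B * (V a (x i) + V (x i) (x (Suc i))) + (V a (x i) + V (x i) (x (Suc i))) * (M * kp * L * dl)"
    by (simp add: algebra_simps)
   finally show ?case using 4 by linarith
  qed
  from step[of "Suc n"] show ?thesis by (simp add: xN dl_def)
 qed
 have "(%n. B * V a b + V a b * (M * kp * L * ((b - a) / real (Suc n)))) \<longlonglongrightarrow> B * V a b + V a b * (M * kp * L * 0)"
  by (intro tendsto_intros LIMSEQ_Suc lim_const_over_n)
 then show "\<bar>?I a b - (F b * \<Psi> b - F a * \<Psi> a)\<bar> <= B * V a b"
  using est by (intro LIMSEQ_le_const[where X = "%n. B * V a b + V a b * (M * kp * L * ((b - a) / real (Suc n)))"]) auto
qed

end

section \<open>Integrals of radial functions against plane waves\<close>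

lemma bess_scaled_deriv:
 fixes r :: real
 assumes "al >= - 1 / 2"
 shows "((%s. bess al ((s * r)\<^sup>2 / 4)) has_real_derivative - bess (al + 1) ((s * r)\<^sup>2 / 4) * (s * r\<^sup>2 / 2)) (at s)"
proof -
 have "((%s. (s * r)\<^sup>2 / 4) has_real_derivative (s * r\<^sup>2 / 2)) (at s)"
  by (auto intro!: derivative_eq_intros simp: power2_eq_square)
 from DERIV_chain2[OF bess_deriv[OF assms] this] show ?thesis .
qed

text \<open>The density, in the radius \<open>s\<close>, of the image of the measure
  \<open>(1 + cos (x \<bullet> y)) dy\<close> under the norm, where \<open>r = norm x\<close>. The
  added 1 makes this measure nonnegative and accounts for the value of \<open>bess\<close> at
  0.\<close>

definition radial_density :: "'a::euclidean_space itself => real => real => real" where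
 "radial_density _ r s = 2 * pi powr (real DIM('a) / 2) * s ^ (DIM('a) - 1)
   * (bess (real DIM('a) / 2 - 1) 0 + bess (real DIM('a) / 2 - 1) ((s * r)\<^sup>2 / 4))"

text \<open>The two measures agree on half-lines: the mass of a ball is a sum of two ball
  transforms, and differentiating it in the radius gives the density. Since the mass increases with
  the ball, the density is nonnegative.\<close>

lemma radial_measure:
 fixes x :: "'a::euclidean_space"
 assumes N: "N > 0"
 shows "distr (density lborel (%y. ennreal (indicator (cball 0 N) y * (1 + cos (x \<bullet> y))))) borel (norm :: 'a => real)
   = density lborel (%s. ennreal (indicator {0<..N} s * radial_density TYPE('a) (norm x) s))"
  and "s >= 0 ==> radial_density TYPE('a) (norm x) s >= 0"
  and "radial_density TYPE('a) r \<in> borel_measurable borel"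
proof -
 let ?d = "DIM('a)" and ?P = "pi powr (real DIM('a) / 2)"
 have [measurable]: "cball 0 s \<in> sets (borel :: 'a measure)" for s by (intro borel_closed closed_cball)
 define al where "al = real ?d / 2 - 1"
 have d1: "real ?d >= 1" by simp
 have al2: "al >= - 1 / 2" "al + 1 >= - 1 / 2" "al + 1 = real ?d / 2" using d1 unfolding al_def by linarith+
 define kp where "kp = radial_density TYPE('a)"
 have kdef: "kp r s = 2 * ?P * s ^ (?d - 1) * (bess al 0 + bess al ((s * r)\<^sup>2 / 4))" for r s
  by (simp add: kp_def radial_density_def al_def)
 define G where "G r s = ?P * s ^ ?d * (bess (real ?d / 2) 0 + bess (real ?d / 2) ((s * r)\<^sup>2 / 4))" for r s
 \<comment> \<open>With \<open>al + 1 = d / 2\<close> the product rule gives the left side of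
   \<open>bess_rec\<close>, which lowers the index from \<open>d / 2\<close> to
   \<open>d / 2 - 1\<close>.\<close>
 have half: "((%s. ?P * s ^ ?d * bess (al + 1) ((s * r)\<^sup>2 / 4)) has_real_derivative 2 * ?P * s ^ (?d - 1) * bess al ((s * r)\<^sup>2 / 4)) (at s)" for r s
 proof -
  let ?u = "(s * r)\<^sup>2 / 4"
  have p: "s ^ ?d = s * s ^ (?d - 1)" using DIM_positive[where 'a = 'a] by (metis power_eq_if not_gr_zero)
  have "((%s. ?P * s ^ ?d * bess (al + 1) ((s * r)\<^sup>2 / 4)) has_real_derivative
    ?P * (real ?d * s ^ (?d - 1)) * bess (al + 1) ?u + (- bess (al + 1 + 1) ?u * (s * r\<^sup>2 / 2)) * (?P * s ^ ?d)) (at s)"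
   by (intro DERIV_mult bess_scaled_deriv al2 DERIV_cmult) (auto intro!: derivative_eq_intros)
  moreover have "?P * (real ?d * s ^ (?d - 1)) * bess (al + 1) ?u + (- bess (al + 1 + 1) ?u * (s * r\<^sup>2 / 2)) * (?P * s ^ ?d)
    = 2 * ?P * s ^ (?d - 1) * ((al + 1) * bess (al + 1) ?u - ?u * bess (al + 2) ?u)"
   unfolding p al2(3) by (simp add: algebra_simps power2_eq_square al_def)
  ultimately show ?thesis using bess_rec[OF al2(1), of ?u] by simp
 qed
 have Gd: "(G r has_real_derivative kp r s) (at s)" for r s
  using DERIV_add[OF half[of 0 s] half[of r s]]
  unfolding G_def[abs_def] kdef al2(3)[symmetric] by (simp add: algebra_simps)
 have G0: "G r 0 = 0" for r by (simp add: G_def)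
 have icos: "integrable lborel (%y. indicator (cball 0 s) y * cos (x \<bullet> y))" for s and x :: 'a
 proof (rule Bochner_Integration.integrable_bound)
  show "integrable lborel (%y::'a. indicator (cball 0 s) y :: real)"
   using emeasure_bounded_finite[of "cball (0::'a) s"] bounded_cball
   by (intro integrable_real_indicator) auto
 qed (auto simp: indicator_def)
 have Gint: "(NI y. ennreal (indicator (cball 0 s) y * (1 + cos (x \<bullet> y)))) = ennreal (G (norm x) s)"
  if s: "s >= 0" for s and x :: 'a
 proof (cases "s = 0")
  case True
  have "(NI y. ennreal (indicator (cball 0 0) y * (1 + cos (x \<bullet> y)))) = (\<integral>\<^sup>+y. 0 \<partial>(lborel :: 'a measure))"
   by (intro nn_integral_cong_AE eventually_mono[OF AE_lborel_singleton[of 0]]) auto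
  then show ?thesis using True G0 by simp
 next
  case False
  have eq: "indicator (cball 0 s) y * (1 + cos (x \<bullet> y)) = indicator (cball 0 s) y * cos (0 \<bullet> y) + indicator (cball 0 s) y * cos (x \<bullet> y)" for y
   by (simp add: algebra_simps)
  have i: "integrable lborel (%y. indicator (cball 0 s) y * (1 + cos (x \<bullet> y)))"
   unfolding eq by (intro Bochner_Integration.integrable_add icos)
  have "(NI y. ennreal (indicator (cball 0 s) y * (1 + cos (x \<bullet> y)))) =
    ennreal (RI y. indicator (cball 0 s) y * (1 + cos (x \<bullet> y)))"
   using i
  proof (rule nn_integral_eq_integral)
   have "0 <= 1 + cos (x \<bullet> y)" for y using cos_ge_minus_one[of "x \<bullet> y"] by linarith
   then show "AE y in lborel. 0 <= indicator (cball 0 s) y * (1 + cos (x \<bullet> y))" by simp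
  qed
  also have "(RI y. indicator (cball 0 s) y * (1 + cos (x \<bullet> y))) = G (norm x) s"
   unfolding eq using False s
   by (subst Bochner_Integration.integral_add[OF icos icos], subst (1 2) cball_transform)
     (auto simp: G_def algebra_simps)
  finally show ?thesis .
 qed
 have Gmono: "G (norm x) s <= G (norm x) t" if "0 <= s" "s <= t" for s t and x :: 'a
 proof -
  have "0 <= 1 + cos (x \<bullet> y)" for y using cos_ge_minus_one[of "x \<bullet> y"] by linarith
  then have "ennreal (G (norm x) s) <= ennreal (G (norm x) t)"
   using that by (subst (1 2) Gint[symmetric]) (auto intro!: nn_integral_mono ennreal_leI simp: indicator_def)
  moreover have "0 <= G (norm x) t"
  proof (rule ccontr)
   assume n: "\<not> 0 <= G (norm x) t"
   then have "t > 0" using that G0[of "norm x"] by (cases "t = 0") auto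
   have "bess (real ?d / 2) 0 + bess (real ?d / 2) ((t * norm x)\<^sup>2 / 4) < 0"
    using n \<open>t > 0\<close> by (simp add: G_def zero_le_mult_iff not_le)
   moreover have "(RI y. indicator (cball 0 t) y * cos (0 \<bullet> y) + indicator (cball 0 t) y * cos (x \<bullet> y)) = G (norm x) t"
    using \<open>t > 0\<close>
    by (subst Bochner_Integration.integral_add[OF icos icos], subst (1 2) cball_transform)
      (auto simp: G_def algebra_simps)
   moreover have "0 <= (RI y. indicator (cball 0 t) y * cos (0 \<bullet> y) + indicator (cball 0 t) y * cos (x \<bullet> y))"
    using \<open>!!y. 0 <= 1 + cos (x \<bullet> y)\<close> by (intro integral_nonneg_AE AE_I2) (auto simp: indicator_def)
   ultimately show False using n by simp
  qed
  ultimately show ?thesis by (simp add: ennreal_le_iff)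
 qed
 \<comment> \<open>A negative value would make the mass of the ball decrease just to the right of
   \<open>s\<close>.\<close>
 have kap0: "kp (norm x) s >= 0" if "s >= 0" for s and x :: 'a
 proof (rule ccontr)
  assume "\<not> ?thesis"
  then obtain e where "e > 0" "!!h. 0 < h ==> h < e ==> G (norm x) (s + h) < G (norm x) s"
   using DERIV_neg_dec_right[OF Gd[of "norm x" s]] by auto
  from this(2)[of "e / 2"] this(1) Gmono[of s "s + e / 2" x] that show False by simp
 qed
 have bc: "continuous_on UNIV (%s. bess al ((s * r)\<^sup>2 / 4))" for r
  by (intro continuous_at_imp_continuous_on ballI DERIV_isCont[OF bess_scaled_deriv[OF al2(1)]])
 have [measurable]: "(%s. bess al ((s * r)\<^sup>2 / 4)) \<in> borel_measurable borel" for r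
  by (rule borel_measurable_continuous_onI[OF bc])
 have [measurable]: "kp r \<in> borel_measurable borel" for r unfolding kdef[abs_def] by measurable
 let ?M1 = "%x. distr (density lborel (%y. ennreal (indicator (cball 0 N) y * (1 + cos (x \<bullet> y))))) borel (norm :: 'a => real)"
 let ?M2 = "%x. density lborel (%s. ennreal (indicator {0<..N} s * kp (norm x) s))"
 have meq: "?M1 x = ?M2 x" for x :: 'a
 proof (rule measure_eqI_lessThan)
  have cp: "0 <= 1 + cos (x \<bullet> y)" for y using cos_ge_minus_one[of "x \<bullet> y"] by linarith
  have e1: "emeasure (?M1 x) {t<..} = ennreal (G (norm x) N - G (norm x) (max 0 (min t N)))" for t
  proof -
   let ?t = "max 0 (min t N)"
   have t: "0 <= ?t" "?t <= N" using N by auto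
   let ?X = "\<integral>\<^sup>+y. ennreal (indicator (cball 0 N) y * (1 + cos (x \<bullet> y))) * indicator {y. t < norm y} y \<partial>(lborel :: 'a measure)"
   have "emeasure (?M1 x) {t<..} = emeasure (density lborel (%y. ennreal (indicator (cball 0 N) y * (1 + cos (x \<bullet> y))))) {y. t < norm y}"
    by (subst emeasure_distr) (auto simp: vimage_def)
   also have "... = ?X" by (rule emeasure_density) measurable
   finally have X: "emeasure (?M1 x) {t<..} = ?X" .
   have tn: "t < norm y" if "t < 0" for y :: 'a using that norm_ge_zero[of y] by linarith
   have "?X + ennreal (G (norm x) ?t) = ?X + (NI y. ennreal (indicator (cball 0 ?t) y * (1 + cos (x \<bullet> y))))"
    by (simp only: Gint[OF t(1)])
   also have "... = (NI y. ennreal (indicator (cball 0 N) y * (1 + cos (x \<bullet> y))) * indicator {y. t < norm y} y + ennreal (indicator (cball 0 ?t) y * (1 + cos (x \<bullet> y))))"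
    by (rule nn_integral_add[symmetric]) measurable
   also have "... = (NI y. ennreal (indicator (cball 0 N) y * (1 + cos (x \<bullet> y))))"
    by (intro nn_integral_cong_AE eventually_mono[OF AE_lborel_singleton[of 0]])
      (use N in \<open>auto simp: indicator_def min_def max_def not_le tn\<close>)
   also have "... = ennreal (G (norm x) N)" using N by (intro Gint) simp
   finally have "?X + ennreal (G (norm x) ?t) = ennreal (G (norm x) N)" .
   then have "?X = ennreal (G (norm x) N) - ennreal (G (norm x) ?t)"
    using ennreal_add_diff_cancel_right[of "ennreal (G (norm x) ?t)" ?X] by simp
   also have "... = ennreal (G (norm x) N - G (norm x) ?t)"
    using Gmono[of 0 ?t x] t G0 by (intro ennreal_minus) simp
   finally show ?thesis unfolding X .
  qed
  have e2: "emeasure (?M2 x) {t<..} = ennreal (G (norm x) N - G (norm x) (max 0 (min t N)))" for t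
  proof -
   let ?t = "max 0 (min t N)"
   have t: "0 <= ?t" "?t <= N" using N by auto
   have "emeasure (?M2 x) {t<..} = (NI s. ennreal (indicator {0<..N} s * kp (norm x) s) * indicator {t<..} s)"
    by (rule emeasure_density) measurable
   also have "... = (NI s. ennreal (kp (norm x) s) * indicator {?t..N} s)"
    by (intro nn_integral_cong_AE eventually_mono[OF eventually_conj[OF AE_lborel_singleton[of ?t] AE_lborel_singleton[of 0]]])
      (auto simp: indicator_def min_def max_def not_le)
   also have "... = G (norm x) N - G (norm x) ?t"
    using t kap0 Gd by (intro nn_integral_FTC_Icc) (auto intro: has_field_derivative_at_within)
   finally show ?thesis .
  qed
  show "emeasure (?M1 x) {t<..} < \<infinity>" for t unfolding e1 by simp
  show "emeasure (?M1 x) {t<..} = emeasure (?M2 x) {t<..}" for t unfolding e1 e2 ..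
 qed auto
 show "distr (density lborel (%y. ennreal (indicator (cball 0 N) y * (1 + cos (x \<bullet> y))))) borel (norm :: 'a => real)
   = density lborel (%s. ennreal (indicator {0<..N} s * radial_density TYPE('a) (norm x) s))"
  using meq[of x] by (simp only: kp_def)
 show "s >= 0 ==> radial_density TYPE('a) (norm x) s >= 0" using kap0 by (simp add: kp_def)
 show "radial_density TYPE('a) r \<in> borel_measurable borel"
  using \<open>!!r. kp r \<in> borel_measurable borel\<close> by (simp add: kp_def)
qed

text \<open>The change of variables is applied to the weight \<open>1 + cos (x \<bullet> y)\<close>.
  Subtracting half of the instance \<open>x = 0\<close>, where the weight is the constant 2, leaves
  the cosine. This links the Bessel form of the inversion integral with an integral over the
  space.\<close>

lemma radial_cos_integral:
 fixes x :: "'a::euclidean_space" and F :: "real => real"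
 assumes [measurable]: "F \<in> borel_measurable borel" and N: "N > 0"
  and int: "integrable lborel (%y::'a. indicator (cball 0 N) y * F (norm y))"
 shows "(RI y. indicator (cball 0 N) y * (F (norm y) * cos (x \<bullet> y))) =
   (RI s. indicator {0<..N} s * (F s * (2 * pi powr (real DIM('a) / 2) * s ^ (DIM('a) - 1)
     * bess (real DIM('a) / 2 - 1) ((s * norm x)\<^sup>2 / 4))))"
proof -
 let ?d = "DIM('a)" and ?P = "pi powr (real DIM('a) / 2)"
 have [measurable]: "cball 0 s \<in> sets (borel :: 'a measure)" for s by (intro borel_closed closed_cball)
 define kp where "kp = radial_density TYPE('a)"
 have [measurable]: "kp r \<in> borel_measurable borel" for r unfolding kp_def by (rule radial_measure(3)[OF N])
 have kap0: "kp (norm x) s >= 0" if "s >= 0" for s and x :: 'a using radial_measure(2)[OF N that] by (simp add: kp_def)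
 let ?M1 = "%x. distr (density lborel (%y. ennreal (indicator (cball 0 N) y * (1 + cos (x \<bullet> y))))) borel (norm :: 'a => real)"
 let ?M2 = "%x. density lborel (%s. ennreal (indicator {0<..N} s * kp (norm x) s))"
 have meq: "?M1 x = ?M2 x" for x unfolding kp_def by (rule radial_measure(1)[OF N])
 have cp: "0 <= 1 + cos (x \<bullet> y)" for x y :: 'a using cos_ge_minus_one[of "x \<bullet> y"] by linarith
 have I1: "integral\<^sup>L (?M1 x) F = (RI y. indicator (cball 0 N) y * (F (norm y) * (1 + cos (x \<bullet> y))))" for x :: 'a
  by (subst integral_distr, simp, simp, subst integral_density) (auto simp: cp mult_ac)
 have I2: "integral\<^sup>L (?M2 x) F = (RI s. indicator {0<..N} s * (F s * kp (norm x) s))" for x :: 'a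
  by (subst integral_density) (auto simp: indicator_def mult_ac intro!: kap0 AE_I2 Bochner_Integration.integral_cong)
 have iy: "integrable lborel (%y. indicator (cball 0 N) y * (F (norm y) * g y))"
  if [measurable]: "g \<in> borel_measurable borel" and g: "!!y. \<bar>g y\<bar> <= 2" for g :: "'a => real"
 proof (rule Bochner_Integration.integrable_bound[OF integrable_mult_left[OF int, of 2]])
  show "AE y in lborel. norm (indicator (cball 0 N) y * (F (norm y) * g y)) <= norm (indicator (cball 0 N) y * F (norm y) * 2)"
   using g by (intro AE_I2) (auto simp: abs_mult indicator_def intro: mult_left_mono)
 qed measurable
 have "integrable (?M1 x) F" for x :: 'a
 proof -
  have "\<bar>1 + cos (x \<bullet> y)\<bar> <= 2" for y using cos_le_one[of "x \<bullet> y"] cp[of x y] by linarith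
  then have "integrable lborel (%y. indicator (cball 0 N) y * (F (norm y) * (1 + cos (x \<bullet> y))))" by (intro iy) auto
  then show ?thesis
   by (subst integrable_distr_eq, simp, simp, subst integrable_density) (auto simp: cp mult_ac)
 qed
 then have "integrable (?M2 x) F" for x :: 'a by (simp only: meq)
 then have I3: "integrable lborel (%s. indicator {0<..N} s * (F s * kp (norm x) s))" for x :: 'a
  by (subst (asm) integrable_density) (auto simp: indicator_def mult_ac intro!: kap0 AE_I2 cong: if_cong)
 have e: "(RI y. indicator (cball 0 N) y * (F (norm y) * (1 + cos (x \<bullet> y)))) = (RI s. indicator {0<..N} s * (F s * kp (norm x) s))" for x :: 'a
  using I1[of x] I2[of x] by (simp only: meq)
 have "(RI y. indicator (cball 0 N) y * (F (norm y) * cos (x \<bullet> y))) =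
   (RI y. indicator (cball 0 N) y * (F (norm y) * (1 + cos (x \<bullet> y)))) - (RI y. indicator (cball 0 N) y * (F (norm y) * (1 + cos ((0::'a) \<bullet> y))) * (1 / 2))"
 proof (subst Bochner_Integration.integral_diff[symmetric])
  have "\<bar>1 + cos (x \<bullet> y)\<bar> <= 2" for y using cos_le_one[of "x \<bullet> y"] cp[of x y] by linarith
  then show "integrable lborel (%y. indicator (cball 0 N) y * (F (norm y) * (1 + cos (x \<bullet> y))))" by (intro iy) auto
  show "integrable lborel (%y. indicator (cball 0 N) y * (F (norm y) * (1 + cos ((0::'a) \<bullet> y))) * (1 / 2))"
   by (intro integrable_mult_left iy) auto
 qed (auto intro!: Bochner_Integration.integral_cong simp: algebra_simps)
 also have "... = (RI s. indicator {0<..N} s * (F s * kp (norm x) s)) - (RI s. indicator {0<..N} s * (F s * kp (norm (0::'a)) s)) * (1 / 2)"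
  by (simp only: integral_mult_left_zero e)
 also have "... = (RI s. indicator {0<..N} s * (F s * kp (norm x) s) - indicator {0<..N} s * (F s * kp (norm (0::'a)) s) * (1 / 2))"
  by (subst Bochner_Integration.integral_diff) (use I3 in \<open>simp_all only: integrable_mult_left integral_mult_left_zero\<close>)
 also have "... = (RI s. indicator {0<..N} s * (F s * (2 * ?P * s ^ (?d - 1) * bess (real ?d / 2 - 1) ((s * norm x)\<^sup>2 / 4))))"
  by (intro Bochner_Integration.integral_cong) (auto simp: kp_def radial_density_def algebra_simps)
 finally show ?thesis .
qed

text \<open>The case \<open>x = 0\<close> of the change of variables: the density is then a constant
  multiple of \<open>s ^ (d - 1)\<close>.\<close>

lemma radial_integrable:
 fixes F :: "real => real"
 assumes [measurable]: "F \<in> borel_measurable borel" and N: "N > 0"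
  and fin: "(NI s. ennreal (indicator {0<..N} s * (s ^ (DIM('a) - 1) * \<bar>F s\<bar>))) < \<infinity>"
 shows "integrable lborel (%y::'a::euclidean_space. indicator (cball 0 N) y * F (norm y))"
proof -
 have [measurable]: "cball 0 s \<in> sets (borel :: 'a measure)" for s by (intro borel_closed closed_cball)
 define kp where "kp = radial_density TYPE('a) 0"
 have [measurable]: "kp \<in> borel_measurable borel" unfolding kp_def by (rule radial_measure(3)[OF N])
 have kap0: "kp s >= 0" if "s >= 0" for s using radial_measure(2)[OF N that, of "0::'a"] by (simp add: kp_def)
 define K where "K = 2 * pi powr (real DIM('a) / 2) * (bess (real DIM('a) / 2 - 1) 0 + bess (real DIM('a) / 2 - 1) 0)"
 have kK: "kp s = K * s ^ (DIM('a) - 1)" for s by (simp add: kp_def radial_density_def K_def)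
 have K0: "K >= 0" using kap0[of 1] by (simp add: kK)
 have "integrable lborel (%s. indicator {0<..N} s * (F s * kp s))"
 proof (rule integrableI_bounded)
  have "(NI s. ennreal (norm (indicator {0<..N} s * (F s * kp s)))) = (NI s. ennreal K * ennreal (indicator {0<..N} s * (s ^ (DIM('a) - 1) * \<bar>F s\<bar>)))"
   using K0 by (intro nn_integral_cong) (auto simp: indicator_def kK abs_mult ennreal_mult[symmetric] mult_ac)
  also have "... = ennreal K * (NI s. ennreal (indicator {0<..N} s * (s ^ (DIM('a) - 1) * \<bar>F s\<bar>)))"
   by (rule nn_integral_cmult) measurable
  also have "... < \<infinity>" using fin by (simp add: ennreal_mult_less_top)
  finally show "(NI s. ennreal (norm (indicator {0<..N} s * (F s * kp s)))) < \<infinity>" .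
 qed measurable
 moreover have "AE s in lborel. 0 <= indicator {0<..N} s * kp s"
  by (intro AE_I2) (auto simp: indicator_def intro!: kap0)
 ultimately have "integrable (density lborel (%s. ennreal (indicator {0<..N} s * kp s))) F"
  by (subst integrable_density) (auto simp: mult_ac)
 then have "integrable (distr (density lborel (%y. ennreal (indicator (cball 0 N) y * (1 + cos (0 \<bullet> y))))) borel (norm :: 'a => real)) F"
  unfolding radial_measure(1)[OF N, of "0::'a"] kp_def by simp
 then have "integrable (density lborel (%y::'a. ennreal (indicator (cball 0 N) y * (1 + cos (0 \<bullet> y))))) (%y. F (norm y))"
  by (subst (asm) integrable_distr_eq) auto
 then have "integrable lborel (%y::'a. (indicator (cball 0 N) y * (1 + cos (0 \<bullet> y))) *\<^sub>R F (norm y))"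
  by (subst (asm) integrable_density) auto
 from integrable_mult_left[OF this, of "1 / 2"] show ?thesis by simp
qed

section \<open>Finite differences of the transform of a ball\<close>

primrec rdiff :: "nat => 'a::real_vector => ('a => real) => 'a => real" where
 "rdiff 0 h g = g"
| "rdiff (Suc k) h g = (%x. rdiff k h g (x + h) - rdiff k h g x)"

lemma iterated_diff_of_real:
 "iterated_diff k h (%x. complex_of_real (g x)) x = complex_of_real (rdiff k h g x)"
 by (induction k arbitrary: x) auto

lemma rdiff_linear: "rdiff k h (%x. a * g x + b * g' x) x = a * rdiff k h g x + b * rdiff k h g' x"
 by (induction k arbitrary: x) (auto simp: algebra_simps)

lemma rdiff_diff: "rdiff k h (%x. g x - g' x) x = rdiff k h g x - rdiff k h g' x"
 using rdiff_linear[of k h 1 g "-1" g' x] by simp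

lemma rdiff_scale: "rdiff k h (%x. g (s *\<^sub>R x)) x = rdiff k (s *\<^sub>R h) g (s *\<^sub>R x)"
 by (induction k arbitrary: x) (auto simp: scaleR_add_right)

lemma rdiff_bound: "(!!x. \<bar>g x\<bar> <= M) ==> \<bar>rdiff k h g x\<bar> <= 2 ^ k * M"
proof (induction k arbitrary: x)
 case (Suc k)
 have "\<bar>rdiff k h g (x + h)\<bar> <= 2 ^ k * M" "\<bar>rdiff k h g x\<bar> <= 2 ^ k * M" using Suc by auto
 then show ?case by simp
qed simp

lemma rdiff_integral:
 assumes "!!x. integrable M (%y. w y * g x y)"
 shows "integrable M (%y. w y * rdiff k h (%x. g x y) x) \<and>
  rdiff k h (%x. \<integral>y. w y * g x y \<partial>M) x = (\<integral>y. w y * rdiff k h (%x. g x y) x \<partial>M)"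
proof (induction k arbitrary: x)
 case (Suc k)
 have "integrable M (%y. w y * rdiff k h (%x. g x y) (x + h) - w y * rdiff k h (%x. g x y) x)"
  using Suc by (intro Bochner_Integration.integrable_diff) auto
 moreover have "(\<integral>y. w y * rdiff k h (%x. g x y) (x + h) - w y * rdiff k h (%x. g x y) x \<partial>M) =
   rdiff k h (%x. \<integral>y. w y * g x y \<partial>M) (x + h) - rdiff k h (%x. \<integral>y. w y * g x y \<partial>M) x"
  using Suc by (subst Bochner_Integration.integral_diff) auto
 ultimately show ?case by (simp add: right_diff_distrib)
qed (use assms in auto)

lemma rdiff_deriv:
 assumes "!!x ta. ((%ta. g (x + ta *\<^sub>R h)) has_real_derivative g' (x + ta *\<^sub>R h)) (at ta)"
 shows "((%ta. rdiff k h g (x + ta *\<^sub>R h)) has_real_derivative rdiff k h g' (x + ta *\<^sub>R h)) (at ta)"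
proof (induction k arbitrary: x ta)
 case (Suc k)
 show ?case using DERIV_diff[OF Suc[of "x + h" ta] Suc[of x ta]] by (simp add: add_ac)
qed (use assms in auto)

text \<open>The family is closed under differentiation in the direction \<open>h\<close>; with \<open>i \<le> m\<close> the
  growth of \<open>(y \<bullet> h)\<^sup>i\<close> is absorbed by the faster decay of \<open>bess (al + m)\<close>.\<close>

definition bfam :: "real => nat => nat => 'a::euclidean_space => 'a => real" where
 "bfam al m i h y = bess (al + real m) ((norm y)\<^sup>2 / 4) * (y \<bullet> h) ^ i"

lemma bfam_deriv:
 assumes "al >= 1 / 2"
 shows "((%ta. bfam al m i h (x + ta *\<^sub>R h)) has_real_derivative
   (- 1 / 2) * bfam al (Suc m) (Suc i) h (x + ta *\<^sub>R h) + (real i * (norm h)\<^sup>2) * bfam al m (i - 1) h (x + ta *\<^sub>R h)) (at ta)"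
proof -
 let ?y = "%ta. x + ta *\<^sub>R h"
 have e: "(%ta. (norm (?y ta))\<^sup>2 / 4) = (%ta. (x \<bullet> x + 2 * ta * (x \<bullet> h) + ta\<^sup>2 * (h \<bullet> h)) / 4)"
  unfolding power2_norm_eq_inner by (intro ext) (simp add: inner_simps inner_commute power2_eq_square algebra_simps)
 have d1: "((%ta. (norm (?y ta))\<^sup>2 / 4) has_real_derivative (?y ta \<bullet> h) / 2) (at ta)"
  unfolding e by (auto intro!: derivative_eq_intros simp: inner_simps algebra_simps)
 have e2: "(%ta. ?y ta \<bullet> h) = (%ta. x \<bullet> h + ta * (h \<bullet> h))" by (intro ext) (simp add: inner_simps)
 have "((%ta. ?y ta \<bullet> h) has_real_derivative (norm h)\<^sup>2) (at ta)"
  unfolding e2 power2_norm_eq_inner by (auto intro!: derivative_eq_intros)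
 then have d2: "((%ta. (?y ta \<bullet> h) ^ i) has_real_derivative real i * (?y ta \<bullet> h) ^ (i - 1) * (norm h)\<^sup>2) (at ta)"
  by (auto intro!: derivative_eq_intros)
 have d3: "((%ta. bess (al + real m) ((norm (?y ta))\<^sup>2 / 4)) has_real_derivative
   - bess (al + real m + 1) ((norm (?y ta))\<^sup>2 / 4) * ((?y ta \<bullet> h) / 2)) (at ta)"
  by (rule DERIV_chain2[OF bess_deriv d1]) (use assms in simp)
 show ?thesis unfolding bfam_def
  by (rule DERIV_cong[OF DERIV_mult[OF d3 d2]]) (simp add: algebra_simps)
qed

text \<open>By the mean value theorem one difference becomes a derivative in the direction
  \<open>h\<close>, which stays in the family. Both resulting members gain one power of
  \<open>norm h\<close>: raising \<open>i\<close> yields it directly, and lowering \<open>i\<close>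
  loses one power against the factor \<open>(norm h) ^ 2\<close>. For \<open>k = 0\<close> the decay
  of \<open>bess (al + m)\<close> beats the growth of degree \<open>i <= m\<close>.\<close>

lemma bfam_diff_bound:
 fixes al :: real
 assumes a: "al >= 1 / 2"
 shows "i <= m ==> \<exists>C\<ge>0. \<forall>(h::'a::euclidean_space) x. norm h <= 1 \<longrightarrow>
   \<bar>rdiff k h (bfam al m i h) x\<bar> <= C * norm h ^ (k + i) * (1 + norm x) powr - (al + 1 / 2)"
proof (induction k arbitrary: m i)
 case 0
 have "al + real m >= 1 / 2" using a by simp
 from bess_decay[OF this] obtain C where C: "C > 0"
  "!!t. t >= 0 ==> \<bar>bess (al + real m) (t\<^sup>2 / 4)\<bar> <= C * (1 + t) powr - (al + real m + 1 / 2)" by auto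
 have "\<bar>bfam al m i h x\<bar> <= C * norm h ^ i * (1 + norm x) powr - (al + 1 / 2)" for h x :: 'a
 proof -
  have "\<bar>x \<bullet> h\<bar> ^ i <= (norm x * norm h) ^ i" by (intro power_mono Cauchy_Schwarz_ineq2) auto
  also have "... <= (1 + norm x) ^ m * norm h ^ i"
  proof -
   have "norm x ^ i <= (1 + norm x) ^ i" by (intro power_mono) auto
   also have "... <= (1 + norm x) ^ m" using 0 by (intro power_increasing) auto
   finally show ?thesis by (simp add: power_mult_distrib mult_right_mono)
  qed
  finally have "\<bar>bfam al m i h x\<bar> <= (C * (1 + norm x) powr - (al + real m + 1 / 2)) * ((1 + norm x) ^ m * norm h ^ i)"
   unfolding bfam_def abs_mult power_abs using C(2)[of "norm x"] by (intro mult_mono) (auto simp: C(1) less_imp_le)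
  also have "(1 + norm x) ^ m = (1 + norm x) powr real m" by (rule powr_realpow[symmetric]) (simp add: add_pos_nonneg)
  also have "(C * (1 + norm x) powr - (al + real m + 1 / 2)) * ((1 + norm x) powr real m * norm h ^ i) =
    C * norm h ^ i * ((1 + norm x) powr - (al + real m + 1 / 2) * (1 + norm x) powr real m)" by (simp only: mult_ac)
  also have "(1 + norm x) powr - (al + real m + 1 / 2) * (1 + norm x) powr real m = (1 + norm x) powr - (al + 1 / 2)"
   by (simp add: powr_add[symmetric])
  finally show ?thesis .
 qed
 then show ?case using C(1) by (intro exI[of _ C]) auto
next
 case (Suc k)
 let ?w = "%x::'a. (1 + norm x) powr - (al + 1 / 2)"
 obtain C1 where C1: "C1 >= 0" "!!h x::'a. norm h <= 1 ==>
   \<bar>rdiff k h (bfam al (Suc m) (Suc i) h) x\<bar> <= C1 * norm h ^ (k + Suc i) * ?w x"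
  using Suc.IH[OF Suc_le_mono[THEN iffD2, OF Suc.prems]] by blast
 obtain C2 where C2: "C2 >= 0" "!!h x::'a. norm h <= 1 ==>
   \<bar>rdiff k h (bfam al m (i - 1) h) x\<bar> <= C2 * norm h ^ (k + (i - 1)) * ?w x"
  using Suc.IH[OF order_trans[OF diff_le_self Suc.prems], of 1] by blast
 define C where "C = (C1 + real i * C2) * 2 powr (al + 1 / 2)"
 have "\<bar>rdiff (Suc k) h (bfam al m i h) x\<bar> <= C * norm h ^ (Suc k + i) * ?w x" if h: "norm h <= 1" for h x :: 'a
 proof -
  let ?g' = "%y. (- 1 / 2) * bfam al (Suc m) (Suc i) h y + (real i * (norm h)\<^sup>2) * bfam al m (i - 1) h y"
  let ?G = "%ta. rdiff k h (bfam al m i h) (x + ta *\<^sub>R h)"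
  have D: "(?G has_real_derivative rdiff k h ?g' (x + ta *\<^sub>R h)) (at ta)" for ta
   by (rule rdiff_deriv) (rule bfam_deriv[OF a])
  obtain ta where t: "0 < ta" "ta < 1" "?G 1 - ?G 0 = (1 - 0) * rdiff k h ?g' (x + ta *\<^sub>R h)"
   using MVT2[of 0 1 ?G "%ta. rdiff k h ?g' (x + ta *\<^sub>R h)"] D by auto
  let ?y = "x + ta *\<^sub>R h"
  have 1: "\<bar>rdiff k h (bfam al (Suc m) (Suc i) h) ?y\<bar> <= C1 * norm h ^ (Suc k + i) * ?w ?y"
   using C1(2)[OF h, of ?y] by simp
  \<comment> \<open>For \<open>i = 0\<close> the truncated \<open>i - 1\<close> is harmless, since
    the factor \<open>real i\<close> vanishes.\<close>
  have 2: "real i * (norm h)\<^sup>2 * \<bar>rdiff k h (bfam al m (i - 1) h) ?y\<bar> <= real i * C2 * norm h ^ (Suc k + i) * ?w ?y"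
  proof (cases i)
   case (Suc j)
   have "real i * (norm h)\<^sup>2 * \<bar>rdiff k h (bfam al m (i - 1) h) ?y\<bar> <= real i * (norm h)\<^sup>2 * (C2 * norm h ^ (k + (i - 1)) * ?w ?y)"
    by (intro mult_left_mono C2(2) h) auto
   also have "... = real i * C2 * norm h ^ (Suc k + i) * ?w ?y"
    by (simp add: Suc power_add power2_eq_square)
   finally show ?thesis .
  qed simp
  have "rdiff (Suc k) h (bfam al m i h) x = rdiff k h ?g' ?y" using t by simp
  also have "... = (- 1 / 2) * rdiff k h (bfam al (Suc m) (Suc i) h) ?y + (real i * (norm h)\<^sup>2) * rdiff k h (bfam al m (i - 1) h) ?y"
   by (rule rdiff_linear)
  also have "\<bar>...\<bar> <= 1 / 2 * \<bar>rdiff k h (bfam al (Suc m) (Suc i) h) ?y\<bar> + real i * (norm h)\<^sup>2 * \<bar>rdiff k h (bfam al m (i - 1) h) ?y\<bar>"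
   by (rule order_trans[OF abs_triangle_ineq]) (simp add: abs_mult)
  also have "... <= C1 * norm h ^ (Suc k + i) * ?w ?y + real i * C2 * norm h ^ (Suc k + i) * ?w ?y"
   using 1 2 by (intro add_mono) linarith+
  also have "... = (C1 + real i * C2) * norm h ^ (Suc k + i) * ?w ?y" by (simp add: algebra_simps)
  \<comment> \<open>The intermediate point is within distance 1 of \<open>x\<close>, so
    \<open>1 + norm x\<close> is at most twice its value there; this produces
    \<open>2 powr (al + 1 / 2)\<close>.\<close>
  also have "... <= (C1 + real i * C2) * norm h ^ (Suc k + i) * (2 powr (al + 1 / 2) * ?w x)"
  proof (intro mult_left_mono)
   have n1: "norm x <= norm ?y + norm (ta *\<^sub>R h)" using norm_triangle_ineq4[of ?y "ta *\<^sub>R h"] by simp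
   have n2: "norm (ta *\<^sub>R h) <= 1" using t h mult_mono[of ta 1 "norm h" 1] by simp
   have "(1 + a) / 2 <= 1 + b" if "a <= b + c" "c <= 1" "0 <= b" for a b c :: real
    using that by (simp add: field_simps)
   from this[OF n1 n2 norm_ge_zero] have "(1 + norm x) / 2 <= 1 + norm ?y" .
   then have "?w ?y <= ((1 + norm x) / 2) powr - (al + 1 / 2)"
    using a by (intro powr_mono2') (auto simp: add_pos_nonneg)
   also have "... = 2 powr (al + 1 / 2) * ?w x"
    using powr_minus_divide[of 2 "al + 1 / 2"] by (subst powr_divide) (auto simp: add_nonneg_nonneg)
   finally show "?w ?y <= 2 powr (al + 1 / 2) * ?w x" .
  qed (use C1 C2 in auto)
  finally show ?thesis by (simp add: C_def mult_ac)
 qed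
 moreover have "C >= 0" using C1 C2 by (simp add: C_def)
 ultimately show ?case by blast
qed

definition ball_kernel :: "real => 'a::euclidean_space => real" where
 "ball_kernel s x = (RI y. indicator (cball 0 s) y * cos (x \<bullet> y))"

text \<open>Dilation reduces to radius 1, where the kernel is a multiple of
  \<open>bfam (d / 2) 0 0\<close>, and the step becomes \<open>s *\<^sub>R h\<close>. For
  \<open>k = 0\<close> the step is arbitrary, so that one statement also covers the undifferenced
  kernel.\<close>

lemma ball_kernel_diff_bound:
 obtains C where "C > 0" "!!s (h::'a::euclidean_space) x. s > 0 ==> k = 0 \<or> norm h * s <= 1 ==>
   \<bar>rdiff k h (ball_kernel s) x\<bar> <= C * (norm h * s) ^ k * s ^ DIM('a) * (1 + s * norm x) powr - ((real DIM('a) + 1) / 2)"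
proof -
 let ?P = "pi powr (real DIM('a) / 2)" and ?al2 = "real DIM('a) / 2"
 have "real DIM('a) >= 1" by simp
 then have al2: "?al2 >= 1 / 2" by linarith
 obtain C where C: "C >= 0" "!!(h::'a) x. norm h <= 1 ==>
   \<bar>rdiff k h (bfam ?al2 0 0 h) x\<bar> <= C * norm h ^ (k + 0) * (1 + norm x) powr - (?al2 + 1 / 2)"
  using bfam_diff_bound[OF al2, of 0 0 k, where ?'a = 'a] by auto
 have b: "\<bar>rdiff k h (ball_kernel s) x\<bar> <= (?P * (C + 1)) * (norm h * s) ^ k * s ^ DIM('a) * (1 + s * norm x) powr - ((real DIM('a) + 1) / 2)"
  if s: "s > 0" and kh: "k = 0 \<or> norm h * s <= 1" for s and h x :: 'a
 proof -
  \<comment> \<open>When no difference is taken, the step is replaced by 0 in order to satisfy the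
    smallness condition.\<close>
  define h' where "h' = (if k = 0 then 0 else s *\<^sub>R h)"
  have h': "norm h' <= 1" "k \<noteq> 0 ==> norm h' = norm h * s" using kh s by (auto simp: h'_def mult.commute)
  have "ball_kernel s = (%x. (?P * s ^ DIM('a)) * bfam ?al2 0 0 h' (s *\<^sub>R x) + 0 * 0)"
   unfolding ball_kernel_def cball_transform[OF s] bfam_def using s by (intro ext) (simp add: power_mult_distrib)
  then have "rdiff k h (ball_kernel s) x = (?P * s ^ DIM('a)) * rdiff k h (%x. bfam ?al2 0 0 h' (s *\<^sub>R x)) x + 0 * rdiff k h (%_. 0) x"
   by (simp only: rdiff_linear)
  also have "... = (?P * s ^ DIM('a)) * rdiff k (s *\<^sub>R h) (bfam ?al2 0 0 h') (s *\<^sub>R x)"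
   by (simp only: rdiff_scale mult_zero_left add_0_right)
  also have "rdiff k (s *\<^sub>R h) (bfam ?al2 0 0 h') (s *\<^sub>R x) = rdiff k h' (bfam ?al2 0 0 h') (s *\<^sub>R x)"
   by (cases k) (auto simp: h'_def)
  finally have "\<bar>rdiff k h (ball_kernel s) x\<bar> = (?P * s ^ DIM('a)) * \<bar>rdiff k h' (bfam ?al2 0 0 h') (s *\<^sub>R x)\<bar>"
   using s by (simp add: abs_mult)
  also have "... <= (?P * s ^ DIM('a)) * ((C + 1) * norm h' ^ (k + 0) * (1 + norm (s *\<^sub>R x)) powr - (?al2 + 1 / 2))"
   using s C(1) by (intro mult_left_mono order_trans[OF C(2)[OF h'(1)]] mult_right_mono) auto
  also have "... = (?P * (C + 1)) * (norm h * s) ^ k * s ^ DIM('a) * (1 + s * norm x) powr - ((real DIM('a) + 1) / 2)"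
  proof -
   have "norm h' ^ (k + 0) = (norm h * s) ^ k" using h'(2) by (cases k) auto
   moreover have e: "(real DIM('a) + 1) / 2 = ?al2 + 1 / 2" by (simp add: field_simps)
   ultimately show ?thesis unfolding e using s by (simp add: mult_ac)
  qed
  finally show ?thesis .
 qed
 show thesis by (rule that[OF _ b]) (use C(1) in auto)
qed

section \<open>Powers and sums of extended nonnegative reals\<close>

lemma epowr_ennreal: "x >= 0 ==> ennreal x epowr a = ennreal (x powr a)"
 by (simp add: epowr_def)

lemma epowr_top [simp]: "\<infinity> epowr a = \<infinity>" "top epowr a = top"
 by (simp_all add: epowr_def)

lemma epowr_0 [simp]: "0 epowr a = 0"
 by (simp add: epowr_def)

lemma epowr_mono: "a >= 0 ==> x <= y ==> x epowr a <= y epowr a"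
proof (cases y)
 case (real s)
 assume "a >= 0" and xy: "x <= y"
 show ?thesis
 proof (cases x)
  case (real r)
  then have "r <= s" using xy \<open>y = ennreal s\<close> \<open>s >= 0\<close> by (simp add: ennreal_le_iff)
  then show ?thesis using \<open>a >= 0\<close> real \<open>y = ennreal s\<close> \<open>s >= 0\<close>
   by (simp add: epowr_ennreal ennreal_leI powr_mono2)
 qed (use xy real in \<open>simp add: top_unique\<close>)
qed simp

lemma epowr_epowr: "(x epowr a) epowr b = x epowr (a * b)"
 by (cases x) (auto simp: epowr_ennreal powr_powr)

lemma epowr_one [simp]: "x epowr 1 = x"
 by (cases x) (auto simp: epowr_ennreal)

lemma epowr_inverse: "a \<noteq> 0 ==> (x epowr a) epowr (1 / a) = x" "a \<noteq> 0 ==> (x epowr (1 / a)) epowr a = x"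
 by (simp_all add: epowr_epowr)

lemma epowr_mult:
 assumes "a > 0"
 shows "(x * y) epowr a = x epowr a * y epowr a"
proof (cases "x = 0 \<or> y = 0")
 case False
 have ne: "z epowr a \<noteq> 0" if "z \<noteq> 0" for z
  using that by (cases z) (auto simp: epowr_ennreal)
 show ?thesis
 proof (cases x)
  case x: (real r)
  show ?thesis
  proof (cases y)
   case y: (real s)
   have "x * y = ennreal (r * s)" using x y by (simp add: ennreal_mult)
   moreover have "x epowr a * y epowr a = ennreal (r powr a * s powr a)"
    using x y by (simp add: epowr_ennreal ennreal_mult)
   ultimately show ?thesis using x y by (simp add: epowr_ennreal powr_mult)
  next
   case top
   then show ?thesis using False ne[of x] by (simp add: ennreal_mult_top)
  qed
 next
  case top
  then show ?thesis using False ne[of y] by (simp add: ennreal_top_mult)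
 qed
qed auto

lemma epowr_le_swap: "a > 0 ==> x epowr a <= y ==> x <= y epowr (1 / a)"
 using epowr_mono[of "1 / a" "x epowr a" y] by (simp add: epowr_inverse)

lemma epowr_add_le:
 assumes "a > 0"
 shows "(x + y) epowr a <= ennreal (2 powr a) * (x epowr a + y epowr a)"
proof -
 have "(x + y) epowr a <= (ennreal 2 * max x y) epowr a"
 proof (rule epowr_mono)
  have "x + y <= max x y + max x y" by (intro add_mono) auto
  also have "... = ennreal 2 * max x y" by (simp add: mult_2)
  finally show "x + y <= ennreal 2 * max x y" .
 qed (use assms in simp)
 also have "... = ennreal (2 powr a) * (max x y) epowr a"
  using assms epowr_ennreal[of 2 a] by (simp add: epowr_mult)
 also have "... <= ennreal (2 powr a) * (x epowr a + y epowr a)"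
  by (intro mult_left_mono) (simp_all add: max_def)
 finally show ?thesis .
qed

lemma epowr_measurable [measurable]:
 assumes [measurable]: "f \<in> borel_measurable M"
 shows "(%x. f x epowr a) \<in> borel_measurable M"
 unfolding epowr_def by measurable

text \<open>A sum over all integers written as an integral for the counting measure, so that
  exchanging it with other integrals is an instance of Tonelli's theorem.\<close>

definition zsum :: "(int => ennreal) => ennreal" where
 "zsum f = (\<integral>\<^sup>+n. f n \<partial>count_space UNIV)"

lemma zsum_mono: "(!!n. f n <= g n) ==> zsum f <= zsum g"
 unfolding zsum_def by (rule nn_integral_mono) auto

lemma zsum_cmult: "zsum (%n. c * f n) = c * zsum f"
 unfolding zsum_def by (rule nn_integral_cmult) auto

lemma zsum_add: "zsum (%n. f n + g n) = zsum f + zsum g"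
 unfolding zsum_def by (rule nn_integral_add) auto

lemma zsum_shift: "zsum (%n. f (n + m)) = zsum f"
proof -
 have "bij (%n::int. n + m)" by (rule bij_betw_byWitness[where f' = "%n. n - m"]) auto
 from nn_integral_bij_count_space[OF this, of f] show ?thesis by (simp add: zsum_def)
qed

lemma zsum_uminus: "zsum (%n. f (- n)) = zsum f"
proof -
 have "bij (uminus :: int => int)" by (rule bij_betw_byWitness[where f' = uminus]) auto
 from nn_integral_bij_count_space[OF this, of f] show ?thesis by (simp add: zsum_def)
qed

lemma zsum_finite_le: "finite A ==> (\<Sum>n\<in>A. f n) <= zsum f"
proof -
 assume A: "finite A"
 have "(\<Sum>n\<in>A. f n) = (\<integral>\<^sup>+n. f n * indicator A n \<partial>count_space UNIV)"
  using A by (subst nn_integral_count_space'[of A]) auto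
 also have "... <= zsum f" unfolding zsum_def by (intro nn_integral_mono) (auto simp: indicator_def)
 finally show ?thesis .
qed

lemma zsum_term_le: "f n <= zsum f"
 using zsum_finite_le[of "{n}" f] by simp

lemma zsum_nn_integral:
 assumes "!!n. f n \<in> borel_measurable M"
 shows "(\<integral>\<^sup>+x. zsum (%n. f n x) \<partial>M) = zsum (%n. \<integral>\<^sup>+x. f n x \<partial>M)"
 unfolding zsum_def by (rule nn_integral_count_space_nn_integral) (use assms in auto)

lemma zsum_measurable [measurable]:
 assumes [measurable]: "!!n. f n \<in> borel_measurable M"
 shows "(%x. zsum (%n. f n x)) \<in> borel_measurable M"
proof -
 have "(%x. zsum (%n. f n x)) = (%x. \<Sum>i. f (int_decode i) x)"
 proof
  fix x
  have "zsum (%n. f n x) = (\<integral>\<^sup>+i. f (int_decode i) x \<partial>count_space UNIV)"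
   unfolding zsum_def by (rule nn_integral_bij_count_space[symmetric]) (rule bij_int_decode)
  then show "zsum (%n. f n x) = (\<Sum>i. f (int_decode i) x)" by (simp add: nn_integral_count_space_nat)
 qed
 then show ?thesis by simp
qed

lemma zsum_nonneg_part: "zsum (%n. if n >= 0 then f n else 0) = (\<Sum>i. f (int i))"
proof -
 have "zsum (%n. if n >= 0 then f n else 0) = (\<integral>\<^sup>+n. f n * indicator {0..} n \<partial>count_space UNIV)"
  unfolding zsum_def by (intro nn_integral_cong) auto
 also have "... = (\<integral>\<^sup>+n. f n \<partial>count_space {0..})"
  by (simp add: nn_integral_count_space_indicator)
 also have "... = (\<integral>\<^sup>+i. f (int i) \<partial>count_space UNIV)"
  by (rule nn_integral_bij_count_space[symmetric])
    (rule bij_betw_byWitness[where f' = nat], auto)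
 finally show ?thesis by (simp add: nn_integral_count_space_nat)
qed

lemma zsum_split: "zsum f = zsum (%n. if n >= 0 then f n else 0) + zsum (%n. if n < 0 then f n else 0)"
 by (subst zsum_add[symmetric]) (intro arg_cong[where f = zsum], auto)

lemma zsum_geometric:
 assumes "b > 0"
 obtains S where "S > 0" "zsum (%n. ennreal (2 powr - (b * \<bar>real_of_int n\<bar>))) <= ennreal S"
proof -
 define r where "r = 2 powr - b"
 have r: "0 < r" "r < 1" using assms by (auto simp: r_def powr_less_one)
 have e: "2 powr - (b * \<bar>real_of_int (int i)\<bar>) = r ^ i" for i
 proof -
  have "r ^ i = r powr real i" using r by (intro powr_realpow[symmetric])
  then show ?thesis by (simp add: r_def powr_powr)
 qed
 have s: "(\<Sum>i. ennreal (r ^ i)) = ennreal (1 / (1 - r))"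
  using r by (intro suminf_ennreal_eq geometric_sums) auto
 define f where "f n = (if n >= 0 then ennreal (2 powr - (b * \<bar>real_of_int n\<bar>)) else 0)" for n :: int
 have p: "zsum f = ennreal (1 / (1 - r))"
  unfolding f_def[abs_def] zsum_nonneg_part e s ..
 have "zsum (%n. ennreal (2 powr - (b * \<bar>real_of_int n\<bar>)))
   <= zsum (%n. f n + f (- n))"
  by (intro zsum_mono) (auto simp: f_def)
 also have "... = ennreal (1 / (1 - r)) + ennreal (1 / (1 - r))"
  unfolding zsum_add zsum_uminus[of f] p ..
 also have "... = ennreal (2 / (1 - r))" using r by (simp add: ennreal_plus[symmetric] del: ennreal_plus)
 finally show thesis using r by (intro that[of "2 / (1 - r)"]) auto
qed

text \<open>Rounding \<open>t\<close> to an integer changes each exponent by at most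
  \<open>b\<close>. Uniformity in the real shift matters because \<open>t\<close> will be
  \<open>log 2 (norm x)\<close>.\<close>

lemma zsum_geometric_shift:
 fixes t :: real
 assumes "b > 0"
 obtains S where "S > 0" "!!t::real. zsum (%n. ennreal (2 powr - (b * \<bar>real_of_int n + t\<bar>))) <= ennreal S"
proof -
 obtain S where S: "S > 0" "zsum (%n. ennreal (2 powr - (b * \<bar>real_of_int n\<bar>))) <= ennreal S"
  using zsum_geometric[OF assms] .
 have "zsum (%n. ennreal (2 powr - (b * \<bar>real_of_int n + t\<bar>))) <= ennreal (2 powr b * S)" for t :: real
 proof -
  have "zsum (%n. ennreal (2 powr - (b * \<bar>real_of_int n + t\<bar>))) <=
    zsum (%n. ennreal (2 powr b) * (%n. ennreal (2 powr - (b * \<bar>real_of_int n\<bar>))) (n + \<lfloor>t\<rfloor>))"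
  proof (intro zsum_mono)
   fix n :: int
   have "\<bar>real_of_int (n + \<lfloor>t\<rfloor>)\<bar> <= \<bar>real_of_int n + t\<bar> + 1" by linarith
   then have "b * \<bar>real_of_int (n + \<lfloor>t\<rfloor>)\<bar> <= b * (\<bar>real_of_int n + t\<bar> + 1)" using assms by (intro mult_left_mono) auto
   then have "2 powr - (b * \<bar>real_of_int n + t\<bar>) <= 2 powr (b - b * \<bar>real_of_int (n + \<lfloor>t\<rfloor>)\<bar>)"
    by (intro powr_mono) (auto simp: algebra_simps)
   also have "... = 2 powr b * 2 powr - (b * \<bar>real_of_int (n + \<lfloor>t\<rfloor>)\<bar>)" by (simp add: powr_add[symmetric])
   finally show "ennreal (2 powr - (b * \<bar>real_of_int n + t\<bar>)) <= ennreal (2 powr b) * ennreal (2 powr - (b * \<bar>real_of_int (n + \<lfloor>t\<rfloor>)\<bar>))"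
    by (simp add: ennreal_mult[symmetric] ennreal_leI)
  qed
  also have "... = ennreal (2 powr b) * zsum (%n. ennreal (2 powr - (b * \<bar>real_of_int n\<bar>)))"
   unfolding zsum_cmult by (subst zsum_shift) simp
  also have "... <= ennreal (2 powr b) * ennreal S" using S by (intro mult_left_mono) auto
  finally show ?thesis using S by (simp add: ennreal_mult)
 qed
 with S show thesis by (intro that[of "2 powr b * S"]) auto
qed

text \<open>A substitute for Hoelder's inequality that works for all exponents: half of each weight
  is used to sum, the other half to pass from the supremum to the sum of powers.\<close>

lemma zsum_weighted_powr:
 assumes p: "p > 0" and S: "zsum w <= ennreal S" "S > 0"
 shows "zsum (%n. w n * (w n * e n)) epowr p <= ennreal (S powr p) * zsum (%n. (w n * e n) epowr p)"
proof -
 define T where "T = zsum (%n. (w n * e n) epowr p) epowr (1 / p)"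
 have le: "w n * e n <= T" for n
  unfolding T_def using p zsum_term_le[of "%n. (w n * e n) epowr p" n] by (intro epowr_le_swap) auto
 have "w n * (w n * e n) <= T * w n" for n
  using mult_left_mono[OF le[of n] zero_le, of "w n"] by (simp only: mult.commute[of T])
 then have "zsum (%n. w n * (w n * e n)) <= zsum (%n. T * w n)"
  by (rule zsum_mono)
 also have "... <= T * ennreal S" unfolding zsum_cmult using S by (intro mult_left_mono) auto
 finally have "zsum (%n. w n * (w n * e n)) epowr p <= (T * ennreal S) epowr p" using p by (intro epowr_mono) auto
 also have "... = zsum (%n. (w n * e n) epowr p) * ennreal (S powr p)"
  using p S by (simp add: epowr_mult epowr_ennreal T_def epowr_inverse)
 finally show ?thesis by (simp add: mult.commute)
qed

section \<open>Dyadic decomposition of the inversion integral\<close>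

definition tw :: "int => real" where "tw n = 2 powr real_of_int n"

lemma tw_pos [simp]: "tw n > 0" "tw n >= 0" "tw n \<noteq> 0" by (simp_all add: tw_def)

lemma tw_add: "tw (m + n) = tw m * tw n" by (simp add: tw_def powr_add)

lemma tw_Suc: "tw (n + 1) = 2 * tw n" by (simp add: tw_def powr_add)

lemma tw_0 [simp]: "tw 0 = 1" by (simp add: tw_def)

lemma tw_mono: "m <= n ==> tw m <= tw n" by (simp add: tw_def)

lemma tw_minus: "tw (- n) = 1 / tw n" by (simp add: tw_def powr_minus_divide)

lemma tw_nat: "tw (int n) = 2 ^ n" by (simp add: tw_def powr_realpow)

lemma tw_powr: "tw n powr a = 2 powr (a * real_of_int n)" by (simp add: tw_def powr_powr mult.commute)

lemma tw_at_top: "filterlim (%M::nat. tw (m + int M)) at_top sequentially"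
proof -
 have "filterlim (%M::nat. tw m * 2 ^ M) at_top sequentially"
 proof (rule filterlim_tendsto_pos_mult_at_top[OF tendsto_const])
  show "filterlim (%M::nat. 2 ^ M :: real) at_top sequentially"
   by (rule filterlim_at_top_mono[OF filterlim_real_sequentially])
     (simp add: of_nat_less_two_power less_imp_le)
 qed simp
 then show ?thesis by (simp add: tw_add tw_nat)
qed

text \<open>Fixing the constant of the kernel estimate by choice makes it visible that it depends on
  the dimension and the order of the difference alone, not on \<open>F\<close>.\<close>

definition kconst :: "'a::euclidean_space itself => nat => real" where
 "kconst _ k = (SOME C. C > 0 \<and> (\<forall>s (h::'a) x. s > 0 \<longrightarrow> k = 0 \<or> norm h * s <= 1 \<longrightarrow>
   \<bar>rdiff k h (ball_kernel s) x\<bar> <= C * (norm h * s) ^ k * s ^ DIM('a) * (1 + s * norm x) powr - ((real DIM('a) + 1) / 2)))"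

lemma kconst:
 "kconst TYPE('a::euclidean_space) k > 0"
 "s > 0 ==> k = 0 \<or> norm h * s <= 1 ==> \<bar>rdiff k h (ball_kernel s) (x::'a)\<bar> <=
   kconst TYPE('a) k * (norm h * s) ^ k * s ^ DIM('a) * (1 + s * norm x) powr - ((real DIM('a) + 1) / 2)"
proof -
 define P where "P C \<longleftrightarrow> C > 0 \<and> (\<forall>s (h::'a) x. s > 0 \<longrightarrow> k = 0 \<or> norm h * s <= 1 \<longrightarrow>
   \<bar>rdiff k h (ball_kernel s) x\<bar> <= C * (norm h * s) ^ k * s ^ DIM('a) * (1 + s * norm x) powr - ((real DIM('a) + 1) / 2))" for C
 obtain C where "P C"
 proof (rule ball_kernel_diff_bound[of k, where ?'a = 'a])
  fix C :: real
  assume a: "C > 0" "!!s (h::'a) x. s > 0 ==> k = 0 \<or> norm h * s <= 1 ==>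
   \<bar>rdiff k h (ball_kernel s) x\<bar> <= C * (norm h * s) ^ k * s ^ DIM('a) * (1 + s * norm x) powr - ((real DIM('a) + 1) / 2)"
  have "P C" unfolding P_def using a(1) by (intro conjI allI impI a(2))
  then show thesis by (rule that)
 qed
 then have "P (SOME C. P C)" by (rule someI)
 moreover have "kconst TYPE('a) k = (SOME C. P C)" unfolding kconst_def P_def ..
 ultimately have K: "P (kconst TYPE('a) k)" by simp
 show "kconst TYPE('a) k > 0" using K unfolding P_def by (rule conjunct1)
 show "\<bar>rdiff k h (ball_kernel s) (x::'a)\<bar> <=
   kconst TYPE('a) k * (norm h * s) ^ k * s ^ DIM('a) * (1 + s * norm x) powr - ((real DIM('a) + 1) / 2)"
  if "s > 0" "k = 0 \<or> norm h * s <= 1"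
  using K[unfolded P_def, THEN conjunct2, rule_format, OF that] .
qed

lemma rdiff_measurable:
 "(!!x. (%y. g x y) \<in> borel_measurable M) ==> (%y. rdiff k h (%x. g x y) x) \<in> borel_measurable M"
 by (induction k arbitrary: x) auto

text \<open>The constant of one dyadic block. The factor \<open>2 + 2 * C\<close> adds up the two
  boundary terms, \<open>1 + C\<close> and 1, and the variation term \<open>C\<close>; the powers of
  2 come from replacing the outer radius by twice the inner one.\<close>

definition kb :: "'a::euclidean_space itself => real => nat => real" where
 "kb _ C k = (2 + 2 * C) * kconst TYPE('a) k * 2 ^ k * 2 ^ DIM('a)"

definition radial_mass :: "'a::euclidean_space itself => (real => real) => real => real" where
 "radial_mass _ F N = (RI y. indicator (cball 0 N) (y::'a) * F (norm y))"

definition cseq :: "nat => (real => real) => real => int => real" where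
 "cseq d F p n = tw n powr (real d * (1 - 1 / p)) * F (tw n)"

text \<open>The argument \<open>T\<close> records the space, hence the dimension, which
  \<open>F\<close> and \<open>V\<close> do not mention.\<close>

locale gm = bounded_var F V for F V +
 fixes C :: real and T :: "'a::euclidean_space itself"
 assumes C1: "C > 1" and F_pos: "!!s. s > 0 ==> F s > 0"
  and V_double: "!!z. z > 0 ==> V z (2 * z) <= C * F z"
  and F_int: "!!N. integrable lborel (%y::'a. indicator (cball 0 N) y * F (norm y))"
begin

lemma F_nonneg: "F s >= 0"
 using F_pos[of s] F_nonpos[of s] by (cases "s > 0") auto

lemma F_le: "0 < z ==> z <= s ==> s <= 2 * z ==> F s <= (1 + C) * F z"
 using V_ge[of z s] V_mono[of z s "2 * z"] V_double[of z] by (simp add: algebra_simps)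

text \<open>The truncated inversion integral without its constant factor. The sine part is absent
  because the ball and \<open>F (norm y)\<close> are symmetric.\<close>

definition fN :: "real => 'a => real" where
 "fN N x = (RI y. indicator (cball 0 N) y * (F (norm y) * cos (x \<bullet> y)))"

definition PB :: "real => real => 'a => real" where
 "PB a b x = (RI y. indicator (cball 0 b - cball 0 a) y * (F (norm y) * cos (x \<bullet> y)))"

lemma cball_meas [measurable]: "cball 0 s \<in> sets (borel :: 'a measure)" by (intro borel_closed closed_cball)

lemma int_bounded:
 assumes [measurable]: "g \<in> borel_measurable borel" and g: "!!y. \<bar>g y\<bar> <= M"
 shows "integrable lborel (%y. indicator (cball 0 N) y * (F (norm y) * g (y::'a)))"
proof (rule Bochner_Integration.integrable_bound[OF integrable_mult_left[OF F_int[of N], of M]])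
 show "AE y in lborel. norm (indicator (cball 0 N) y * (F (norm y) * g y)) <= norm (indicator (cball (0::'a) N) y * F (norm y) * M)"
 proof (intro AE_I2)
  fix y :: 'a
  have "\<bar>g y\<bar> <= \<bar>M\<bar>" using g[of y] by linarith
  then show "norm (indicator (cball 0 N) y * (F (norm y) * g y)) <= norm (indicator (cball (0::'a) N) y * F (norm y) * M)"
   by (auto simp: abs_mult indicator_def intro!: mult_left_mono)
 qed
qed measurable

lemma int_cos: "integrable lborel (%y. indicator (cball 0 N) y * (F (norm y) * cos ((x::'a) \<bullet> y)))"
 by (rule int_bounded[where M = 1]) auto

lemma shell_ind: "a <= b ==> indicator (cball 0 b - cball 0 a) y = indicator (cball 0 b) y - (indicator (cball 0 a) (y::'a) :: real)"
 by (auto simp: indicator_def)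

lemma fN_diff: "a <= b ==> PB a b x = fN b x - fN a x"
 unfolding PB_def fN_def
 by (subst Bochner_Integration.integral_diff[OF int_cos int_cos, symmetric])
   (auto intro!: Bochner_Integration.integral_cong simp: shell_ind algebra_simps)

lemma PB_int: "a <= b ==> integrable lborel (%y. (indicator (cball 0 b - cball 0 a) y * F (norm y)) * cos ((x::'a) \<bullet> y))"
 using Bochner_Integration.integrable_diff[OF int_cos[of b x] int_cos[of a x]]
 by (simp add: shell_ind algebra_simps)

text \<open>Differences in \<open>x\<close> act on the cosine alone, so summation by parts applies
  with the differenced cosine as integrand and the differenced ball kernel as its radial
  primitive.\<close>

lemma PB_parts:
 assumes ab: "0 < a" "a <= b"
  and B: "!!s. a <= s ==> s <= b ==> \<bar>rdiff k h (ball_kernel s) (x::'a)\<bar> <= B"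
 shows "\<bar>rdiff k h (PB a b) x - (F b * rdiff k h (ball_kernel b) x - F a * rdiff k h (ball_kernel a) x)\<bar> <= B * V a b"
proof -
 define \<psi> where "\<psi> y = rdiff k h (%x. cos (x \<bullet> y)) x" for y
 have m [measurable]: "\<psi> \<in> borel_measurable borel" unfolding \<psi>_def[abs_def] by (rule rdiff_measurable) measurable
 have bd: "\<bar>\<psi> y\<bar> <= 2 ^ k * 1" for y unfolding \<psi>_def by (rule rdiff_bound) auto
 have cb: "integrable lborel (%y. indicator (cball 0 s) y * cos ((x::'a) \<bullet> y))" for s x
 proof (rule Bochner_Integration.integrable_bound)
  show "integrable lborel (%y::'a. indicator (cball 0 s) y :: real)"
   using emeasure_bounded_finite[of "cball (0::'a) s"] bounded_cball
   by (intro integrable_real_indicator) auto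
 qed (auto simp: indicator_def)
 have Psi: "(RI y. indicator (cball 0 s) y * \<psi> y) = rdiff k h (ball_kernel s) x" for s
  using rdiff_integral[where M = lborel and w = "indicator (cball 0 s)" and g = "%x y. cos (x \<bullet> y)" and k = k and h = h and x = x, OF cb]
  by (simp add: \<psi>_def ball_kernel_def[abs_def])
 have P: "(RI y. indicator (cball 0 b - cball 0 a) y * (F (norm y) * \<psi> y)) = rdiff k h (PB a b) x"
  using rdiff_integral[where M = lborel and w = "%y. indicator (cball 0 b - cball 0 a) y * F (norm y)" and g = "%x y. cos (x \<bullet> y)" and k = k and h = h and x = x, OF PB_int[OF ab(2)]]
  by (simp add: \<psi>_def PB_def[abs_def] mult.assoc)
 show ?thesis
  using radial_integral_by_parts(1)[OF m bd ab, where B = B] B unfolding Psi P by blast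
qed

lemma Kb_pos: "kb TYPE('a) C k > 0"
 using kconst(1)[of k, where ?'a = 'a] C1 by (simp add: kb_def)

end

text \<open>The weight \<open>norm x powr - d\<close> is scale invariant, and the second factor
  makes it integrable both at 0 and at infinity. A dilation by \<open>tw (- n)\<close> removes
  \<open>n\<close>, which gives uniformity; the case \<open>n = 0\<close> is summed over dyadic
  balls.\<close>

lemma nn_integral_norm_powr_log:
 assumes g: "\<gamma> > 0"
 obtains J where "J > 0"
  "!!n::int. (\<integral>\<^sup>+x. ennreal (norm x powr - real DIM('a) * 2 powr - (\<gamma> * \<bar>real_of_int n + log 2 (norm x)\<bar>)) \<partial>(lborel :: 'a::euclidean_space measure)) <= ennreal J"
proof -
 let ?d = "DIM('a)"
 let ?f = "%n (x::'a). ennreal (norm x powr - real ?d * 2 powr - (\<gamma> * \<bar>real_of_int n + log 2 (norm x)\<bar>))"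
 have [measurable]: "cball 0 s \<in> sets (borel :: 'a measure)" for s by (intro borel_closed closed_cball)
 obtain S where S: "S > 0" "zsum (%n. ennreal (2 powr - (\<gamma> * \<bar>real_of_int n\<bar>))) <= ennreal S"
  using zsum_geometric[OF g] .
 define kp where "kp = unit_ball_vol (real ?d)"
 have kap: "kp > 0" by (simp add: kp_def)
 define J where "J = 2 powr \<gamma> * kp * 2 ^ ?d * S"
 have J: "J > 0" using kap S by (simp add: J_def)
 have "(NI x. ?f 0 x) <= (\<integral>\<^sup>+x. zsum (%n. ennreal (tw n powr - real ?d * 2 powr (\<gamma> - \<gamma> * \<bar>real_of_int n\<bar>)) * indicator (cball 0 (tw (n + 1))) x) \<partial>(lborel :: 'a measure))"
 proof (intro nn_integral_mono_AE eventually_mono[OF AE_lborel_singleton[of 0]])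
  fix x :: 'a assume x: "x \<noteq> 0"
  define n where "n = \<lfloor>log 2 (norm x)\<rfloor>"
  have n: "real_of_int n <= log 2 (norm x)" "log 2 (norm x) < real_of_int n + 1" by (auto simp: n_def)
  have lo: "tw n <= norm x" unfolding tw_def using n(1) x by (simp add: le_log_iff)
  have hi: "norm x <= tw (n + 1)" unfolding tw_def using n(2) x by (simp add: log_less_iff less_imp_le)
  have "norm x powr - real ?d <= tw n powr - real ?d"
   using lo by (intro powr_mono2') auto
  moreover have "2 powr - (\<gamma> * \<bar>real_of_int 0 + log 2 (norm x)\<bar>) <= 2 powr (\<gamma> - \<gamma> * \<bar>real_of_int n\<bar>)"
  proof (intro powr_mono)
   have "\<bar>real_of_int n\<bar> <= \<bar>log 2 (norm x)\<bar> + 1" using n by linarith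
   then have "\<gamma> * \<bar>real_of_int n\<bar> <= \<gamma> * (\<bar>log 2 (norm x)\<bar> + 1)" using g by (intro mult_left_mono) auto
   then show "- (\<gamma> * \<bar>real_of_int 0 + log 2 (norm x)\<bar>) <= \<gamma> - \<gamma> * \<bar>real_of_int n\<bar>" by (simp add: algebra_simps)
  qed auto
  ultimately have "?f 0 x <= ennreal (tw n powr - real ?d * 2 powr (\<gamma> - \<gamma> * \<bar>real_of_int n\<bar>)) * indicator (cball 0 (tw (n + 1))) x"
   using hi by (auto simp: indicator_def intro!: ennreal_leI mult_mono)
  also have "... <= zsum (%n. ennreal (tw n powr - real ?d * 2 powr (\<gamma> - \<gamma> * \<bar>real_of_int n\<bar>)) * indicator (cball 0 (tw (n + 1))) x)"
   by (rule zsum_term_le)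
  finally show "?f 0 x <= zsum (%n. ennreal (tw n powr - real ?d * 2 powr (\<gamma> - \<gamma> * \<bar>real_of_int n\<bar>)) * indicator (cball 0 (tw (n + 1))) x)" .
 qed
 also have "... = zsum (%n. \<integral>\<^sup>+x. ennreal (tw n powr - real ?d * 2 powr (\<gamma> - \<gamma> * \<bar>real_of_int n\<bar>)) * indicator (cball 0 (tw (n + 1))) x \<partial>(lborel :: 'a measure))"
  by (rule zsum_nn_integral) measurable
 also have "... = zsum (%n. ennreal (2 powr \<gamma> * kp * 2 ^ ?d) * ennreal (2 powr - (\<gamma> * \<bar>real_of_int n\<bar>)))"
 proof (intro arg_cong[where f = zsum] ext)
  fix n
  have e: "tw n powr - real ?d * tw n ^ ?d = 1"
   by (simp add: powr_realpow[symmetric] powr_add[symmetric])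
  have "(\<integral>\<^sup>+x. ennreal (tw n powr - real ?d * 2 powr (\<gamma> - \<gamma> * \<bar>real_of_int n\<bar>)) * indicator (cball 0 (tw (n + 1))) x \<partial>(lborel :: 'a measure)) =
   ennreal (tw n powr - real ?d * 2 powr (\<gamma> - \<gamma> * \<bar>real_of_int n\<bar>)) * ennreal (kp * tw (n + 1) ^ ?d)"
   by (simp add: nn_integral_cmult emeasure_cball kp_def)
  also have "... = ennreal ((tw n powr - real ?d * tw n ^ ?d) * (2 powr (\<gamma> - \<gamma> * \<bar>real_of_int n\<bar>) * kp * 2 ^ ?d))"
   using kap by (simp add: ennreal_mult[symmetric] tw_Suc power_mult_distrib mult_ac)
  also have "... = ennreal (2 powr \<gamma> * kp * 2 ^ ?d) * ennreal (2 powr - (\<gamma> * \<bar>real_of_int n\<bar>))"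
   unfolding e using kap by (simp add: ennreal_mult[symmetric] powr_diff powr_minus field_simps)
  finally show "(\<integral>\<^sup>+x. ennreal (tw n powr - real ?d * 2 powr (\<gamma> - \<gamma> * \<bar>real_of_int n\<bar>)) * indicator (cball 0 (tw (n + 1))) x \<partial>(lborel :: 'a measure)) =
   ennreal (2 powr \<gamma> * kp * 2 ^ ?d) * ennreal (2 powr - (\<gamma> * \<bar>real_of_int n\<bar>))" .
 qed
 also have "... <= ennreal (2 powr \<gamma> * kp * 2 ^ ?d) * ennreal S"
  unfolding zsum_cmult by (intro mult_left_mono S) auto
 also have "... = ennreal J" using kap S by (simp add: ennreal_mult[symmetric] J_def)
 finally have J0: "(NI x. ?f 0 x) <= ennreal J" .
 have "(NI x. ?f n x) = (NI x. ?f 0 x)" for n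
 proof -
  have "(NI x. ?f n x) = ennreal (tw (- n) ^ ?d) * (NI x. ?f n (tw (- n) *\<^sub>R x))"
   by (rule nn_integral_lborel_scale) auto
  also have "(NI x. ?f n (tw (- n) *\<^sub>R x)) = (NI x. ennreal (tw (- n) powr - real ?d) * ?f 0 x)"
  proof (intro nn_integral_cong_AE eventually_mono[OF AE_lborel_singleton[of 0]])
   fix x :: 'a assume x: "x \<noteq> 0"
   have "log 2 (norm (tw (- n) *\<^sub>R x)) = - real_of_int n + log 2 (norm x)"
    using x by (simp add: log_mult) (simp add: tw_def)
   then show "?f n (tw (- n) *\<^sub>R x) = ennreal (tw (- n) powr - real ?d) * ?f 0 x"
    by (simp add: ennreal_mult[symmetric] powr_mult mult_ac)
  qed
  also have "... = ennreal (tw (- n) powr - real ?d) * (NI x. ?f 0 x)"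
   by (rule nn_integral_cmult) measurable
  also have "ennreal (tw (- n) ^ ?d) * ... = ennreal (tw (- n) ^ ?d * tw (- n) powr - real ?d) * (NI x. ?f 0 x)"
   by (simp add: ennreal_mult mult.assoc)
  also have "tw (- n) ^ ?d * tw (- n) powr - real ?d = 1"
   by (simp add: powr_realpow[symmetric] powr_add[symmetric])
  finally show ?thesis by simp
 qed
 with J0 J show thesis by (intro that[of J]) auto
qed

text \<open>The blocks \<open>2\<^sup>n\<^sup>d\<^sup>/\<^sup>p (1 + 2\<^sup>n|x|)\<^sup>-\<^sup>(\<^sup>d\<^sup>+\<^sup>1\<^sup>)\<^sup>/\<^sup>2\<close> are almost orthogonal in \<open>L\<^sub>p\<close>;
  this is where \<open>p > 2d/(d+1)\<close> enters.\<close>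

lemma block_sum_Lp:
 assumes p: "p > 0" "real DIM('a) / p < (real DIM('a) + 1) / 2"
 obtains K where "K > 0" "!!e. (\<integral>\<^sup>+x. zsum (%n. e n * ennreal (tw n powr (real DIM('a) / p) * (1 + tw n * norm x) powr - ((real DIM('a) + 1) / 2))) epowr p \<partial>(lborel :: 'a::euclidean_space measure))
   <= ennreal K * zsum (%n. e n epowr p)"
proof -
 let ?d = "real DIM('a)" and ?E = "(real DIM('a) + 1) / 2"
 \<comment> \<open>The two exponents are the growth of the block for \<open>tw n * norm x\<close>
   below 1 and its decay above 1. The hypothesis relating \<open>p\<close> and \<open>d\<close> is
   the positivity of the second.\<close>
 define \<beta> where "\<beta> = min (?d / p) (?E - ?d / p)"
 have b: "\<beta> > 0" "\<beta> <= ?d / p" "\<beta> <= ?E - ?d / p" using p by (auto simp: \<beta>_def)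
 \<comment> \<open>Half of the decay, raised to the power \<open>p\<close>, is what remains for the
   integral over \<open>x\<close> once the other half has been spent on the sum.\<close>
 define \<gamma> where "\<gamma> = p * (\<beta> / 2)"
 have g: "\<gamma> > 0" using p b by (simp add: \<gamma>_def)
 obtain S where S: "S > 0" "!!t::real. zsum (%n. ennreal (2 powr - (\<beta> / 2 * \<bar>real_of_int n + t\<bar>))) <= ennreal S"
  using zsum_geometric_shift[of "\<beta> / 2"] b by auto
 obtain J where J: "J > 0" "!!n::int. (\<integral>\<^sup>+x. ennreal (norm x powr - ?d * 2 powr - (\<gamma> * \<bar>real_of_int n + log 2 (norm x)\<bar>)) \<partial>(lborel :: 'a measure)) <= ennreal J"
  using nn_integral_norm_powr_log[OF g, where ?'a = 'a] by blast
 \<comment> \<open>Here \<open>v\<close> stands for \<open>n + log 2 (norm x)\<close>: the block is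
   largest where \<open>tw n * norm x\<close> is about 1 and falls off geometrically on both
   sides.\<close>
 have key: "(2 powr v) powr (?d / p) * (1 + 2 powr v) powr - ?E <= 2 powr - (\<beta> * \<bar>v\<bar>)" for v :: real
 proof (cases "v <= 0")
  case True
  have "(1 + 2 powr v) powr - ?E <= 1 powr - ?E" by (intro powr_mono2') auto
  then have "(2 powr v) powr (?d / p) * (1 + 2 powr v) powr - ?E <= (2 powr v) powr (?d / p) * 1" by (intro mult_left_mono) auto
  also have "... = 2 powr (v * (?d / p))" by (simp add: powr_powr)
  also have "... <= 2 powr (v * \<beta>)" using True b by (intro powr_mono mult_left_mono_neg) auto
  finally show ?thesis using True by (simp add: mult.commute)
 next
  case False
  have "(1 + 2 powr v) powr - ?E <= (2 powr v) powr - ?E" by (intro powr_mono2') auto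
  then have "(2 powr v) powr (?d / p) * (1 + 2 powr v) powr - ?E <= (2 powr v) powr (?d / p) * (2 powr v) powr - ?E" by (intro mult_left_mono) auto
  also have "... = 2 powr (v * (?d / p - ?E))" by (simp add: powr_powr powr_add[symmetric] algebra_simps)
  also have "... <= 2 powr (v * - \<beta>)" using False b by (intro powr_mono mult_left_mono) auto
  finally show ?thesis using False by (simp add: mult.commute)
 qed
 have "(\<integral>\<^sup>+x. zsum (%n. e n * ennreal (tw n powr (?d / p) * (1 + tw n * norm x) powr - ?E)) epowr p \<partial>(lborel :: 'a measure))
   <= ennreal (S powr p * J) * zsum (%n. e n epowr p)" for e
 proof -
  have "(\<integral>\<^sup>+x. zsum (%n. e n epowr p * ennreal (norm x powr - ?d * 2 powr - (\<gamma> * \<bar>real_of_int n + log 2 (norm x)\<bar>))) \<partial>(lborel :: 'a measure)) =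
   zsum (%n. \<integral>\<^sup>+x. e n epowr p * ennreal (norm x powr - ?d * 2 powr - (\<gamma> * \<bar>real_of_int n + log 2 (norm x)\<bar>)) \<partial>(lborel :: 'a measure))"
   by (rule zsum_nn_integral) measurable
  also have "... <= zsum (%n. ennreal J * e n epowr p)"
  proof (rule zsum_mono)
   fix n
   have "(\<integral>\<^sup>+x. e n epowr p * ennreal (norm x powr - ?d * 2 powr - (\<gamma> * \<bar>real_of_int n + log 2 (norm x)\<bar>)) \<partial>(lborel :: 'a measure))
    = e n epowr p * (\<integral>\<^sup>+x. ennreal (norm x powr - ?d * 2 powr - (\<gamma> * \<bar>real_of_int n + log 2 (norm x)\<bar>)) \<partial>(lborel :: 'a measure))"
    by (rule nn_integral_cmult) measurable
   also have "... <= e n epowr p * ennreal J" by (intro mult_left_mono J) auto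
   finally show "(\<integral>\<^sup>+x. e n epowr p * ennreal (norm x powr - ?d * 2 powr - (\<gamma> * \<bar>real_of_int n + log 2 (norm x)\<bar>)) \<partial>(lborel :: 'a measure)) <= ennreal J * e n epowr p"
    by (simp only: mult.commute)
  qed
  finally have Z: "(\<integral>\<^sup>+x. zsum (%n. e n epowr p * ennreal (norm x powr - ?d * 2 powr - (\<gamma> * \<bar>real_of_int n + log 2 (norm x)\<bar>))) \<partial>(lborel :: 'a measure)) <= zsum (%n. ennreal J * e n epowr p)" .
  have "(\<integral>\<^sup>+x. zsum (%n. e n * ennreal (tw n powr (?d / p) * (1 + tw n * norm x) powr - ?E)) epowr p \<partial>(lborel :: 'a measure))
   <= (\<integral>\<^sup>+x. ennreal (S powr p) * zsum (%n. e n epowr p * ennreal (norm x powr - ?d * 2 powr - (\<gamma> * \<bar>real_of_int n + log 2 (norm x)\<bar>))) \<partial>(lborel :: 'a measure))"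
  proof (intro nn_integral_mono_AE eventually_mono[OF AE_lborel_singleton[of 0]])
   fix x :: 'a assume x: "x \<noteq> 0"
   define L where "L = log 2 (norm x)"
   define w where "w n = ennreal (2 powr - (\<beta> / 2 * \<bar>real_of_int n + L\<bar>))" for n :: int
   have nx: "norm x = 2 powr L" using x by (simp add: L_def)
   have W: "tw n powr (?d / p) * (1 + tw n * norm x) powr - ?E <= norm x powr - (?d / p) * 2 powr - (\<beta> * \<bar>real_of_int n + L\<bar>)" for n
   proof -
    have tn: "tw n * norm x = 2 powr (real_of_int n + L)" by (simp add: tw_def nx powr_add)
    have "tw n powr (?d / p) = norm x powr - (?d / p) * (2 powr (real_of_int n + L)) powr (?d / p)"
     by (simp add: tw_def nx powr_powr powr_add[symmetric] algebra_simps add_divide_distrib)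
    then have "tw n powr (?d / p) * (1 + tw n * norm x) powr - ?E = norm x powr - (?d / p) * ((2 powr (real_of_int n + L)) powr (?d / p) * (1 + 2 powr (real_of_int n + L)) powr - ?E)"
     by (simp only: tn mult.assoc)
    also have "... <= norm x powr - (?d / p) * 2 powr - (\<beta> * \<bar>real_of_int n + L\<bar>)"
     by (intro mult_left_mono key) auto
    finally show ?thesis .
   qed
   have ww: "ennreal (2 powr - (\<beta> * \<bar>real_of_int n + L\<bar>)) = w n * w n" for n
    by (simp add: w_def ennreal_mult[symmetric] powr_add[symmetric])
   have "zsum (%n. e n * ennreal (tw n powr (?d / p) * (1 + tw n * norm x) powr - ?E)) <= zsum (%n. ennreal (norm x powr - (?d / p)) * (w n * (w n * e n)))"
   proof (intro zsum_mono)
    fix n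
    have "e n * ennreal (tw n powr (?d / p) * (1 + tw n * norm x) powr - ?E) <= e n * ennreal (norm x powr - (?d / p) * 2 powr - (\<beta> * \<bar>real_of_int n + L\<bar>))"
     by (intro mult_left_mono ennreal_leI W) auto
    also have "... = e n * (ennreal (norm x powr - (?d / p)) * (w n * w n))" by (simp only: ennreal_mult ww powr_ge_zero)
    finally show "e n * ennreal (tw n powr (?d / p) * (1 + tw n * norm x) powr - ?E) <= ennreal (norm x powr - (?d / p)) * (w n * (w n * e n))"
     by (simp only: mult_ac)
   qed
   then have "zsum (%n. e n * ennreal (tw n powr (?d / p) * (1 + tw n * norm x) powr - ?E)) epowr p <= (ennreal (norm x powr - (?d / p)) * zsum (%n. w n * (w n * e n))) epowr p"
    using p unfolding zsum_cmult by (intro epowr_mono) auto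
   also have "... = ennreal (norm x powr - ?d) * zsum (%n. w n * (w n * e n)) epowr p"
    using p by (simp add: epowr_mult epowr_ennreal powr_powr)
   also have "... <= ennreal (norm x powr - ?d) * (ennreal (S powr p) * zsum (%n. (w n * e n) epowr p))"
    using S(2)[of L] S(1) p by (intro mult_left_mono zsum_weighted_powr) (auto simp: w_def)
   also have "... = ennreal (S powr p) * zsum (%n. ennreal (norm x powr - ?d) * (w n * e n) epowr p)"
    unfolding zsum_cmult by (simp only: mult_ac)
   also have "(%n. ennreal (norm x powr - ?d) * (w n * e n) epowr p) = (%n. e n epowr p * ennreal (norm x powr - ?d * 2 powr - (\<gamma> * \<bar>real_of_int n + log 2 (norm x)\<bar>)))"
   proof
    fix n
    have "w n epowr p = ennreal (2 powr - (\<gamma> * \<bar>real_of_int n + L\<bar>))"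
     unfolding w_def by (simp add: epowr_ennreal powr_powr \<gamma>_def mult_ac)
    then show "ennreal (norm x powr - ?d) * (w n * e n) epowr p = e n epowr p * ennreal (norm x powr - ?d * 2 powr - (\<gamma> * \<bar>real_of_int n + log 2 (norm x)\<bar>))"
     using p by (simp add: epowr_mult ennreal_mult L_def mult_ac)
   qed
   finally show "zsum (%n. e n * ennreal (tw n powr (?d / p) * (1 + tw n * norm x) powr - ?E)) epowr p <=
    ennreal (S powr p) * zsum (%n. e n epowr p * ennreal (norm x powr - ?d * 2 powr - (\<gamma> * \<bar>real_of_int n + log 2 (norm x)\<bar>)))" .
  qed
  also have "... = ennreal (S powr p) * (\<integral>\<^sup>+x. zsum (%n. e n epowr p * ennreal (norm x powr - ?d * 2 powr - (\<gamma> * \<bar>real_of_int n + log 2 (norm x)\<bar>))) \<partial>(lborel :: 'a measure))"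
   by (rule nn_integral_cmult) measurable
  also have "ennreal (S powr p) * (\<integral>\<^sup>+x. zsum (%n. e n epowr p * ennreal (norm x powr - ?d * 2 powr - (\<gamma> * \<bar>real_of_int n + log 2 (norm x)\<bar>))) \<partial>(lborel :: 'a measure)) <= ennreal (S powr p) * zsum (%n. ennreal J * e n epowr p)"
   by (intro mult_left_mono Z) auto
  also have "... = ennreal (S powr p * J) * zsum (%n. e n epowr p)"
   unfolding zsum_cmult using J(1) by (simp add: ennreal_mult mult.assoc)
  finally show ?thesis .
 qed
 moreover have "S powr p * J > 0" using S(1) J(1) by simp
 ultimately show thesis using that by blast
qed

section \<open>Upper bounds for differences of the inversion integral\<close>

context gm begin

lemma rdiff_PB: "a <= b ==> rdiff k h (PB a b) x = rdiff k h (fN b) x - rdiff k h (fN a) x"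
proof -
 assume "a <= b"
 then have "PB a b = (%x. fN b x - fN a x)" by (intro ext) (rule fN_diff)
 then show ?thesis by (simp only: rdiff_diff)
qed

text \<open>The general monotone condition bounds both boundary terms and the variation across the
  octave by multiples of \<open>F (tw n)\<close>; the kernel estimate supplies the smallness in
  \<open>h\<close> and the decay in \<open>x\<close>.\<close>

lemma block_bound:
 assumes kh: "k = 0 \<or> norm h * tw (n + 1) <= 1"
 shows "\<bar>rdiff k h (PB (tw n) (tw (n + 1))) x\<bar> <=
  kb TYPE('a) C k * F (tw n) * (norm h * tw n) ^ k * tw n ^ DIM('a) * (1 + tw n * norm x) powr - ((real DIM('a) + 1) / 2)"
proof -
 let ?a = "tw n" and ?b = "tw (n + 1)"
 have b: "?b = 2 * ?a" by (rule tw_Suc)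
 have ab: "0 < ?a" "?a <= ?b" using b tw_pos[of n] by auto
 \<comment> \<open>One bound for the whole shell: the growing factors are taken at the outer radius,
   the decaying one at the inner radius.\<close>
 define B where "B = kconst TYPE('a) k * (norm h * ?b) ^ k * ?b ^ DIM('a) * (1 + ?a * norm x) powr - ((real DIM('a) + 1) / 2)"
 have kc: "kconst TYPE('a) k >= 0" using kconst(1)[of k, where ?'a = 'a] by simp
 have B: "\<bar>rdiff k h (ball_kernel s) x\<bar> <= B" if s: "?a <= s" "s <= ?b" for s
 proof -
  have s0: "s > 0" using s ab by linarith
  have nb: "norm h * s <= norm h * ?b" using s by (intro mult_left_mono) auto
  then have "k = 0 \<or> norm h * s <= 1" using kh by auto
  from kconst(2)[OF s0 this, of x]
  have "\<bar>rdiff k h (ball_kernel s) x\<bar> <= kconst TYPE('a) k * (norm h * s) ^ k * s ^ DIM('a) * (1 + s * norm x) powr - ((real DIM('a) + 1) / 2)" .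
  also have "... <= B" unfolding B_def
  proof (intro mult_mono)
   show "(norm h * s) ^ k <= (norm h * ?b) ^ k" using nb s0 by (intro power_mono) auto
   show "s ^ DIM('a) <= ?b ^ DIM('a)" using s s0 by (intro power_mono) auto
   have "?a * norm x <= s * norm x" using s by (intro mult_right_mono) auto
   moreover have "0 < 1 + ?a * norm x" using ab by (intro add_pos_nonneg) auto
   ultimately show "(1 + s * norm x) powr - ((real DIM('a) + 1) / 2) <= (1 + ?a * norm x) powr - ((real DIM('a) + 1) / 2)" by (intro powr_mono2') auto
  qed (use kc s0 ab in auto)
  finally show ?thesis .
 qed
 have B0: "B >= 0" using B[of ?a] ab by linarith
 have Fb: "F ?b <= (1 + C) * F ?a" using F_le[of ?a ?b] ab b by simp
 have Vb: "V ?a ?b <= C * F ?a" using V_double[OF ab(1)] b by simp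
 have 1: "\<bar>F ?b * rdiff k h (ball_kernel ?b) x\<bar> <= (1 + C) * F ?a * B"
  unfolding abs_mult using Fb F_nonneg B[of ?b] ab by (intro mult_mono) (auto intro: order_trans[OF F_nonneg Fb])
 have 2: "\<bar>F ?a * rdiff k h (ball_kernel ?a) x\<bar> <= F ?a * B"
  unfolding abs_mult using F_nonneg B[of ?a] ab by (intro mult_mono) auto
 have 3: "B * V ?a ?b <= C * F ?a * B" using mult_left_mono[OF Vb B0] by (simp add: mult_ac)
 have "\<bar>rdiff k h (PB ?a ?b) x - (F ?b * rdiff k h (ball_kernel ?b) x - F ?a * rdiff k h (ball_kernel ?a) x)\<bar> <= B * V ?a ?b"
  using ab B by (rule PB_parts)
 then have "\<bar>rdiff k h (PB ?a ?b) x\<bar> <= (1 + C) * F ?a * B + F ?a * B + C * F ?a * B" using 1 2 3 by linarith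
 also have "... = (2 + 2 * C) * F ?a * B" by (simp add: algebra_simps)
 also have "... = kb TYPE('a) C k * F ?a * (norm h * ?a) ^ k * ?a ^ DIM('a) * (1 + ?a * norm x) powr - ((real DIM('a) + 1) / 2)"
  unfolding B_def kb_def b by (simp add: power_mult_distrib mult_ac)
 finally show ?thesis .
qed

lemma fN_le_mass: "\<bar>fN N x\<bar> <= radial_mass TYPE('a) F N"
 unfolding fN_def radial_mass_def
proof (rule integral_abs_bound_integral[OF int_cos F_int])
 fix y :: 'a
 have "F (norm y) * \<bar>cos (x \<bullet> y)\<bar> <= F (norm y) * 1" using F_nonneg by (intro mult_left_mono) auto
 then show "\<bar>indicator (cball 0 N) y * (F (norm y) * cos (x \<bullet> y))\<bar> <= indicator (cball 0 N) y * F (norm y)"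
  using F_nonneg[of "norm y"] by (auto simp: indicator_def abs_mult)
qed

lemma mass_tendsto: "(%M::nat. radial_mass TYPE('a) F (tw (m - int M))) \<longlonglongrightarrow> 0"
proof -
 have "(%M::nat. radial_mass TYPE('a) F (tw (m - int M))) \<longlonglongrightarrow> (\<integral>y. 0 \<partial>(lborel :: 'a measure))"
  unfolding radial_mass_def
 proof (rule integral_dominated_convergence[where w = "%y. indicator (cball 0 (tw m)) y * F (norm y)"])
  show "integrable lborel (%y::'a. indicator (cball 0 (tw m)) y * F (norm y))" by (rule F_int)
  show "AE y in lborel. norm (indicator (cball (0::'a) (tw (m - int M))) y * F (norm y)) <= indicator (cball 0 (tw m)) y * F (norm y)" for M
  proof (intro AE_I2)
   fix y :: 'a
   have "tw (m - int M) <= tw m" by (rule tw_mono) simp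
   then show "norm (indicator (cball (0::'a) (tw (m - int M))) y * F (norm y)) <= indicator (cball 0 (tw m)) y * F (norm y)"
    using F_nonneg[of "norm y"] by (auto simp: indicator_def)
  qed
  show "AE y in lborel. (%M. indicator (cball (0::'a) (tw (m - int M))) y * F (norm y)) \<longlonglongrightarrow> 0"
  proof (intro AE_I2)
   fix y :: 'a
   show "(%M. indicator (cball (0::'a) (tw (m - int M))) y * F (norm y)) \<longlonglongrightarrow> 0"
   proof (cases "y = 0")
    case True then show ?thesis by (simp add: F_nonpos)
   next
    case False
    have "\<forall>\<^sub>F M in sequentially. tw (- m + int M) > 1 / norm y"
     using tw_at_top[of "- m"] by (simp add: filterlim_at_top_dense)
    then have "\<forall>\<^sub>F M in sequentially. indicator (cball (0::'a) (tw (m - int M))) y * F (norm y) = 0"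
    proof eventually_elim
     case (elim M)
     have "tw (m - int M) = 1 / tw (- m + int M)" using tw_minus[of "- m + int M"] by simp
     also have "... < norm y" using elim False by (simp add: field_simps)
     finally show ?case by simp
    qed
    then show ?thesis by (rule tendsto_eventually)
   qed
  qed
 qed measurable
 then show ?thesis by simp
qed

text \<open>Telescoping towards frequency 0. The remainder is at most \<open>2 ^ k\<close> times the
  mass of \<open>F\<close> on a shrinking ball, which tends to 0 by integrability near the
  origin.\<close>

lemma low_pointwise:
 "ennreal \<bar>rdiff k h (fN (tw m)) x\<bar> <= zsum (%n. if n < m then ennreal \<bar>rdiff k h (PB (tw n) (tw (n + 1))) x\<bar> else 0)"
proof -
 define f where "f n = (if n < m then ennreal \<bar>rdiff k h (PB (tw n) (tw (n + 1))) x\<bar> else 0)" for n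
 have tele: "rdiff k h (fN (tw m)) x = rdiff k h (fN (tw (m - int M))) x + (\<Sum>i<M. rdiff k h (PB (tw (m - 1 - int i)) (tw (m - 1 - int i + 1))) x)" for M
 proof (induction M)
  case (Suc M)
  have "rdiff k h (PB (tw (m - 1 - int M)) (tw (m - 1 - int M + 1))) x = rdiff k h (fN (tw (m - int M))) x - rdiff k h (fN (tw (m - int (Suc M)))) x"
   by (subst rdiff_PB) (auto intro!: tw_mono simp: algebra_simps)
  then show ?case using Suc by simp
 qed simp
 have "ennreal \<bar>rdiff k h (fN (tw m)) x\<bar> <= ennreal (2 ^ k * radial_mass TYPE('a) F (tw (m - int M))) + zsum f" for M
 proof -
  have "\<bar>rdiff k h (fN (tw m)) x\<bar> <= 2 ^ k * radial_mass TYPE('a) F (tw (m - int M)) + (\<Sum>i<M. \<bar>rdiff k h (PB (tw (m - 1 - int i)) (tw (m - 1 - int i + 1))) x\<bar>)"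
   unfolding tele[of M]
   by (rule order_trans[OF abs_triangle_ineq]) (intro add_mono sum_abs rdiff_bound fN_le_mass)
  then have "ennreal \<bar>rdiff k h (fN (tw m)) x\<bar> <= ennreal (2 ^ k * radial_mass TYPE('a) F (tw (m - int M)) + (\<Sum>i<M. \<bar>rdiff k h (PB (tw (m - 1 - int i)) (tw (m - 1 - int i + 1))) x\<bar>))"
   by (rule ennreal_leI)
  also have "... = ennreal (2 ^ k * radial_mass TYPE('a) F (tw (m - int M))) + (\<Sum>i<M. f (m - 1 - int i))"
  proof -
   have "radial_mass TYPE('a) F N >= 0" for N using fN_le_mass[of N 0] by linarith
   then show ?thesis by (simp add: ennreal_plus sum_nonneg sum_ennreal f_def)
  qed
  also have "(\<Sum>i<M. f (m - 1 - int i)) = (\<Sum>n\<in>(%i. m - 1 - int i) ` {..<M}. f n)"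
   by (subst sum.reindex) (auto simp: inj_on_def)
  also have "... <= zsum f" by (rule zsum_finite_le) simp
  finally show ?thesis by (simp add: add_left_mono)
 qed
 moreover have "(%M. ennreal (2 ^ k * radial_mass TYPE('a) F (tw (m - int M))) + zsum f) \<longlonglongrightarrow> ennreal (2 ^ k * 0) + zsum f"
  by (intro tendsto_intros mass_tendsto)
 ultimately have "ennreal \<bar>rdiff k h (fN (tw m)) x\<bar> <= ennreal (2 ^ k * 0) + zsum f"
  by (intro LIMSEQ_le_const) auto
 then show ?thesis by (simp add: f_def[abs_def])
qed

text \<open>Telescoping upwards. The partial sums converge at this \<open>x\<close> by assumption,
  so the absolute bound survives in the limit without absolute convergence having been
  assumed.\<close>

lemma high_pointwise:
 assumes lim: "((%N. fN N x) \<longlongrightarrow> g) at_top"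
 shows "ennreal \<bar>g - fN (tw m) x\<bar> <= zsum (%n. if m <= n then ennreal \<bar>PB (tw n) (tw (n + 1)) x\<bar> else 0)"
proof -
 define f where "f n = (if m <= n then ennreal \<bar>PB (tw n) (tw (n + 1)) x\<bar> else 0)" for n
 have tele: "fN (tw (m + int M)) x - fN (tw m) x = (\<Sum>i<M. PB (tw (m + int i)) (tw (m + int i + 1)) x)" for M
 proof (induction M)
  case (Suc M)
  have "PB (tw (m + int M)) (tw (m + int M + 1)) x = fN (tw (m + int (Suc M))) x - fN (tw (m + int M)) x"
   by (subst fN_diff) (auto intro!: tw_mono simp: algebra_simps)
  then show ?case using Suc by simp
 qed simp
 have "ennreal \<bar>fN (tw (m + int M)) x - fN (tw m) x\<bar> <= zsum f" for M
 proof -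
  have "ennreal \<bar>fN (tw (m + int M)) x - fN (tw m) x\<bar> <= ennreal (\<Sum>i<M. \<bar>PB (tw (m + int i)) (tw (m + int i + 1)) x\<bar>)"
   unfolding tele by (intro ennreal_leI sum_abs)
  also have "... = (\<Sum>i<M. f (m + int i))" by (simp add: sum_ennreal f_def)
  also have "... = (\<Sum>n\<in>(%i. m + int i) ` {..<M}. f n)"
   by (subst sum.reindex) (auto simp: inj_on_def)
  also have "... <= zsum f" by (rule zsum_finite_le) simp
  finally show ?thesis .
 qed
 moreover have "(%M. ennreal \<bar>fN (tw (m + int M)) x - fN (tw m) x\<bar>) \<longlonglongrightarrow> ennreal \<bar>g - fN (tw m) x\<bar>"
  by (intro tendsto_intros filterlim_compose[OF lim tw_at_top])
 ultimately have "ennreal \<bar>g - fN (tw m) x\<bar> <= zsum f"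
  by - (rule LIMSEQ_le_const2, assumption, blast)
 then show ?thesis by (simp add: f_def[abs_def])
qed

lemma cc_pos: "cseq DIM('a) F p n > 0" by (simp add: cseq_def F_pos)

text \<open>Separates the coefficient from the factor \<open>tw n powr (d / p)\<close>, which
  normalizes the profile of a block in the \<open>p\<close>-th power norm.\<close>

lemma tw_split: "tw n ^ DIM('a) * F (tw n) = cseq DIM('a) F p n * tw n powr (real DIM('a) / p)"
 by (simp add: cseq_def powr_realpow[symmetric] powr_add[symmetric] algebra_simps)

lemma low_Lp:
 assumes p: "p > 0"
  and K: "!!e. (\<integral>\<^sup>+x. zsum (%n. e n * ennreal (tw n powr (real DIM('a) / p) * (1 + tw n * norm x) powr - ((real DIM('a) + 1) / 2))) epowr p \<partial>(lborel :: 'a measure))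
   <= ennreal K * zsum (%n. e n epowr p)"
  and kh: "k = 0 \<or> norm h * tw m <= 1"
 shows "(NI x. ennreal \<bar>rdiff k h (fN (tw m)) x\<bar> epowr p) <=
  ennreal K * zsum (%n. if n < m then ennreal (kb TYPE('a) C k * (norm h * tw n) ^ k * cseq DIM('a) F p n) epowr p else 0)"
proof -
 define e where "e n = (if n < m then ennreal (kb TYPE('a) C k * (norm h * tw n) ^ k * cseq DIM('a) F p n) else 0)" for n
 have "(NI x. ennreal \<bar>rdiff k h (fN (tw m)) x\<bar> epowr p) <=
   (\<integral>\<^sup>+x. zsum (%n. e n * ennreal (tw n powr (real DIM('a) / p) * (1 + tw n * norm x) powr - ((real DIM('a) + 1) / 2))) epowr p \<partial>(lborel :: 'a measure))"
 proof (intro nn_integral_mono epowr_mono)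
  fix x :: 'a
  have "(if n < m then ennreal \<bar>rdiff k h (PB (tw n) (tw (n + 1))) x\<bar> else 0) <= e n * ennreal (tw n powr (real DIM('a) / p) * (1 + tw n * norm x) powr - ((real DIM('a) + 1) / 2))" for n
  proof (cases "n < m")
   case True
   have "norm h * tw (n + 1) <= norm h * tw m" using True by (intro mult_left_mono tw_mono) auto
   then have "k = 0 \<or> norm h * tw (n + 1) <= 1" using kh by auto
   then have "\<bar>rdiff k h (PB (tw n) (tw (n + 1))) x\<bar> <= kb TYPE('a) C k * F (tw n) * (norm h * tw n) ^ k * tw n ^ DIM('a) * (1 + tw n * norm x) powr - ((real DIM('a) + 1) / 2)"
    by (rule block_bound)
   also have "... = (kb TYPE('a) C k * (norm h * tw n) ^ k) * (tw n ^ DIM('a) * F (tw n)) * (1 + tw n * norm x) powr - ((real DIM('a) + 1) / 2)" by (simp only: mult_ac)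
   also have "... = (kb TYPE('a) C k * (norm h * tw n) ^ k * cseq DIM('a) F p n) * (tw n powr (real DIM('a) / p) * (1 + tw n * norm x) powr - ((real DIM('a) + 1) / 2))"
    unfolding tw_split[of n p] by (simp only: mult_ac)
   finally show ?thesis using True Kb_pos[of k] cc_pos[of p n]
    by (simp add: e_def ennreal_mult[symmetric] ennreal_leI)
  qed (simp add: e_def)
  then show "ennreal \<bar>rdiff k h (fN (tw m)) x\<bar> <= zsum (%n. e n * ennreal (tw n powr (real DIM('a) / p) * (1 + tw n * norm x) powr - ((real DIM('a) + 1) / 2)))"
   by (intro order_trans[OF low_pointwise] zsum_mono)
 qed (use p in simp)
 also have "... <= ennreal K * zsum (%n. e n epowr p)" by (rule K)
 also have "(%n. e n epowr p) = (%n. if n < m then ennreal (kb TYPE('a) C k * (norm h * tw n) ^ k * cseq DIM('a) F p n) epowr p else 0)"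
  by (auto simp: e_def)
 finally show ?thesis .
qed

lemma high_Lp:
 assumes p: "p > 0"
  and K: "!!e. (\<integral>\<^sup>+x. zsum (%n. e n * ennreal (tw n powr (real DIM('a) / p) * (1 + tw n * norm x) powr - ((real DIM('a) + 1) / 2))) epowr p \<partial>(lborel :: 'a measure))
   <= ennreal K * zsum (%n. e n epowr p)"
  and lim: "!!x. x \<noteq> 0 ==> ((%N. fN N x) \<longlongrightarrow> g x) at_top"
 shows "(NI x. ennreal \<bar>g x - fN (tw m) x\<bar> epowr p) <=
  ennreal K * zsum (%n. if m <= n then ennreal (kb TYPE('a) C 0 * cseq DIM('a) F p n) epowr p else 0)"
proof -
 define e where "e n = (if m <= n then ennreal (kb TYPE('a) C 0 * cseq DIM('a) F p n) else 0)" for n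
 have "(NI x. ennreal \<bar>g x - fN (tw m) x\<bar> epowr p) <=
   (\<integral>\<^sup>+x. zsum (%n. e n * ennreal (tw n powr (real DIM('a) / p) * (1 + tw n * norm x) powr - ((real DIM('a) + 1) / 2))) epowr p \<partial>(lborel :: 'a measure))"
 proof (intro nn_integral_mono_AE eventually_mono[OF AE_lborel_singleton[of 0]] epowr_mono)
  fix x :: 'a assume x: "x \<noteq> 0"
  have "(if m <= n then ennreal \<bar>PB (tw n) (tw (n + 1)) x\<bar> else 0) <= e n * ennreal (tw n powr (real DIM('a) / p) * (1 + tw n * norm x) powr - ((real DIM('a) + 1) / 2))" for n
  proof (cases "m <= n")
   case True
   have "\<bar>PB (tw n) (tw (n + 1)) x\<bar> <= kb TYPE('a) C 0 * (tw n ^ DIM('a) * F (tw n)) * (1 + tw n * norm x) powr - ((real DIM('a) + 1) / 2)"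
    using block_bound[of 0 0 n x] by (simp add: mult_ac)
   also have "... = (kb TYPE('a) C 0 * cseq DIM('a) F p n) * (tw n powr (real DIM('a) / p) * (1 + tw n * norm x) powr - ((real DIM('a) + 1) / 2))"
    unfolding tw_split[of n p] by (simp only: mult_ac)
   finally show ?thesis using True Kb_pos[of 0] cc_pos[of p n]
    by (simp add: e_def ennreal_mult[symmetric] ennreal_leI)
  qed (simp add: e_def)
  then show "ennreal \<bar>g x - fN (tw m) x\<bar> <= zsum (%n. e n * ennreal (tw n powr (real DIM('a) / p) * (1 + tw n * norm x) powr - ((real DIM('a) + 1) / 2)))"
   by (intro order_trans[OF high_pointwise[OF lim[OF x]]] zsum_mono)
 qed (use p in simp)
 also have "... <= ennreal K * zsum (%n. e n epowr p)" by (rule K)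
 also have "(%n. e n epowr p) = (%n. if m <= n then ennreal (kb TYPE('a) C 0 * cseq DIM('a) F p n) epowr p else 0)"
  by (auto simp: e_def)
 finally show ?thesis .
qed

end

text \<open>The quasi-triangle inequality together with translation invariance: each difference
  costs a factor \<open>2 powr (p + 1)\<close>.\<close>

lemma rdiff_Lp_bound:
 fixes g :: "'a::euclidean_space => real"
 assumes p: "p > 0" and [measurable]: "g \<in> borel_measurable borel"
 shows "(NI x. ennreal \<bar>rdiff k h g x\<bar> epowr p) <= ennreal ((2 powr (p + 1)) ^ k) * (NI x. ennreal \<bar>g x\<bar> epowr p)"
proof (induction k)
 case (Suc k)
 let ?N = "%g. NI x. ennreal \<bar>g (x::'a)\<bar> epowr p"
 have [measurable]: "rdiff k h g \<in> borel_measurable borel"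
 proof (induction k)
  case (Suc k)
  note [measurable] = Suc
  show ?case by simp
 qed simp
 have "?N (rdiff (Suc k) h g) <= (NI x. ennreal (2 powr p) * (ennreal \<bar>rdiff k h g (x + h)\<bar> epowr p + ennreal \<bar>rdiff k h g x\<bar> epowr p))"
 proof (intro nn_integral_mono)
  fix x
  have "ennreal \<bar>rdiff (Suc k) h g x\<bar> <= ennreal \<bar>rdiff k h g (x + h)\<bar> + ennreal \<bar>rdiff k h g x\<bar>"
   by (subst ennreal_plus[symmetric]) (auto intro!: ennreal_leI simp del: ennreal_plus)
  then show "ennreal \<bar>rdiff (Suc k) h g x\<bar> epowr p <= ennreal (2 powr p) * (ennreal \<bar>rdiff k h g (x + h)\<bar> epowr p + ennreal \<bar>rdiff k h g x\<bar> epowr p)"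
   using p by (intro order_trans[OF epowr_mono epowr_add_le]) auto
 qed
 also have "... = ennreal (2 powr p) * (NI x. ennreal \<bar>rdiff k h g (x + h)\<bar> epowr p + ennreal \<bar>rdiff k h g x\<bar> epowr p)"
  by (rule nn_integral_cmult) measurable
 also have "(NI x. ennreal \<bar>rdiff k h g (x + h)\<bar> epowr p + ennreal \<bar>rdiff k h g x\<bar> epowr p)
   = (NI x. ennreal \<bar>rdiff k h g (x + h)\<bar> epowr p) + ?N (rdiff k h g)"
  by (rule nn_integral_add) measurable
 also have "(NI x. ennreal \<bar>rdiff k h g (x + h)\<bar> epowr p) = ?N (rdiff k h g)"
  by (rule nn_integral_lborel_translate[where f = "%x. ennreal \<bar>rdiff k h g x\<bar> epowr p"]) measurable
 also have "ennreal (2 powr p) * (?N (rdiff k h g) + ?N (rdiff k h g)) = ennreal (2 powr (p + 1)) * ?N (rdiff k h g)"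
  by (simp add: mult_2[symmetric] powr_add ennreal_mult mult.assoc)
 also have "... <= ennreal (2 powr (p + 1)) * (ennreal ((2 powr (p + 1)) ^ k) * ?N g)"
  by (intro mult_left_mono Suc) auto
 also have "... = ennreal ((2 powr (p + 1)) ^ Suc k) * ?N g"
  by (simp add: ennreal_mult mult.assoc)
 finally show ?case .
qed simp

text \<open>Frequencies are cut at \<open>tw m\<close> with \<open>norm h * tw m <= 1\<close>. Below
  the cut each block gains \<open>(norm h * tw n) ^ k\<close> from smoothness. Above it nothing is
  gained: the blocks are bounded without differences, and the differences are estimated crudely
  afterwards.\<close>

lemma gm_upper:
 assumes p: "p > 0" "real DIM('a) / p < (real DIM('a) + 1) / 2"
 obtains K where "K > 0"
  "!!F V h m g. gm TYPE('a::euclidean_space) F V C ==>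
   (!!x. x \<noteq> 0 ==> ((%N. gm.fN F N x) \<longlongrightarrow> g x) at_top) ==> g \<in> borel_measurable borel ==>
   k = 0 \<or> norm (h::'a) * tw m <= 1 ==>
   (NI x. ennreal \<bar>rdiff k h g x\<bar> epowr p) <=
    ennreal K * zsum (%n. ennreal ((min 1 (tw (n - m))) ^ k * cseq DIM('a) F p n) epowr p)"
proof -
 obtain K where K: "K > 0" "!!e. (\<integral>\<^sup>+x. zsum (%n. e n * ennreal (tw n powr (real DIM('a) / p) * (1 + tw n * norm x) powr - ((real DIM('a) + 1) / 2))) epowr p \<partial>(lborel :: 'a::euclidean_space measure))
   <= ennreal K * zsum (%n. e n epowr p)"
  using block_sum_Lp[OF p] by blast
 \<comment> \<open>This is \<open>kb\<close> with \<open>\<bar>C\<bar>\<close> in place of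
   \<open>C\<close>: its positivity is needed before any function, and with it the condition
   \<open>C > 1\<close>, is at hand.\<close>
 define A where "A j = (2 + 2 * \<bar>C\<bar>) * kconst TYPE('a) j * 2 ^ j * 2 ^ DIM('a)" for j
 have A: "A j > 0" for j using kconst(1)[of j, where ?'a = 'a] by (simp add: A_def add_pos_nonneg)
 \<comment> \<open>The low part contributes \<open>A k\<close>, the high part \<open>A 0\<close>
   together with the cost of \<open>k\<close> crude differences.\<close>
 define L where "L = 2 powr p * K * (A k powr p + (2 powr (p + 1)) ^ k * A 0 powr p)"
 have L: "L > 0" using K A[of k] A[of 0] by (simp add: L_def add_pos_nonneg)
 have main: "(NI x. ennreal \<bar>rdiff k h g x\<bar> epowr p) <=
    ennreal L * zsum (%n. ennreal ((min 1 (tw (n - m))) ^ k * cseq DIM('a) F p n) epowr p)"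
  if gm: "gm TYPE('a) F V C" and lim: "!!x. x \<noteq> 0 ==> ((%N. gm.fN F N x) \<longlongrightarrow> g x) at_top"
   and gmeas[measurable]: "g \<in> borel_measurable borel" and kh: "k = 0 \<or> norm (h::'a) * tw m <= 1" for F V h m g
 proof -
  interpret gm F V C "TYPE('a)" by fact
  have KbA: "kb TYPE('a) C j = A j" for j using C1 by (simp add: kb_def A_def)
  let ?c = "%n. ennreal ((min 1 (tw (n - m))) ^ k * cseq DIM('a) F p n) epowr p"
  let ?N = "%g. NI x. ennreal \<bar>g (x::'a)\<bar> epowr p"
  have fm [measurable]: "fN N \<in> borel_measurable borel" for N
   unfolding fN_def[abs_def] by measurable
  have rm: "g' \<in> borel_measurable borel ==> rdiff k h g' \<in> borel_measurable borel" for g' :: "'a => real" and k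
  proof (induction k)
   case (Suc k)
   then have [measurable]: "rdiff k h g' \<in> borel_measurable borel" by simp
   show ?case by simp
  qed simp
  have lo: "?N (rdiff k h (fN (tw m))) <= ennreal K * (ennreal (A k powr p) * zsum ?c)"
  proof -
   have "?N (rdiff k h (fN (tw m))) <= ennreal K * zsum (%n. if n < m then ennreal (kb TYPE('a) C k * (norm h * tw n) ^ k * cseq DIM('a) F p n) epowr p else 0)"
    by (rule low_Lp[OF p(1) K(2) kh])
   also have "... <= ennreal K * zsum (%n. ennreal (A k powr p) * ?c n)"
   proof (intro mult_left_mono zsum_mono)
    fix n
    show "(if n < m then ennreal (kb TYPE('a) C k * (norm h * tw n) ^ k * cseq DIM('a) F p n) epowr p else 0) <= ennreal (A k powr p) * ?c n"
    proof (cases "n < m")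
     case True
     have "(norm h * tw n) ^ k <= (min 1 (tw (n - m))) ^ k"
     proof (cases "k = 0")
      case False
      then have "norm h * tw m <= 1" using kh by simp
      then have "norm h <= tw (- m)" by (simp add: tw_minus field_simps)
      then have "norm h * tw n <= tw (- m) * tw n" by (intro mult_right_mono) auto
      also have "... = tw (n - m)" by (simp add: tw_add[symmetric])
      also have "... = min 1 (tw (n - m))" using True tw_mono[of "n - m" 0] by simp
      finally show ?thesis by (intro power_mono) auto
     qed simp
     then have "A k * (norm h * tw n) ^ k * cseq DIM('a) F p n <= A k * (min 1 (tw (n - m))) ^ k * cseq DIM('a) F p n"
      using A[of k] cc_pos[of p n] by (intro mult_right_mono mult_left_mono) auto
     then have "ennreal (kb TYPE('a) C k * (norm h * tw n) ^ k * cseq DIM('a) F p n) epowr p <= ennreal (A k * ((min 1 (tw (n - m))) ^ k * cseq DIM('a) F p n)) epowr p"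
      using p unfolding KbA by (intro epowr_mono ennreal_leI) (auto simp: mult.assoc)
     also have "... = ennreal (A k powr p) * ?c n"
      using A[of k] p cc_pos[of p n] by (simp add: ennreal_mult epowr_mult epowr_ennreal)
     finally show ?thesis using True by simp
    qed simp
   qed simp
   finally show ?thesis unfolding zsum_cmult .
  qed
  have hi: "?N (%x. g x - fN (tw m) x) <= ennreal K * (ennreal (A 0 powr p) * zsum ?c)"
  proof -
   have "?N (%x. g x - fN (tw m) x) <= ennreal K * zsum (%n. if m <= n then ennreal (kb TYPE('a) C 0 * cseq DIM('a) F p n) epowr p else 0)"
    by (rule high_Lp[OF p(1) K(2) lim])
   also have "... <= ennreal K * zsum (%n. ennreal (A 0 powr p) * ?c n)"
   proof (intro mult_left_mono zsum_mono)
    fix n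
    show "(if m <= n then ennreal (kb TYPE('a) C 0 * cseq DIM('a) F p n) epowr p else 0) <= ennreal (A 0 powr p) * ?c n"
    proof (cases "m <= n")
     case True
     then have "min 1 (tw (n - m)) = 1" using tw_mono[of 0 "n - m"] by simp
     then show ?thesis using True A[of 0] p cc_pos[of p n]
      by (simp add: KbA ennreal_mult epowr_mult epowr_ennreal)
    qed simp
   qed simp
   finally show ?thesis unfolding zsum_cmult .
  qed
  have "?N (rdiff k h g) <= (NI x. ennreal (2 powr p) * (ennreal \<bar>rdiff k h (fN (tw m)) x\<bar> epowr p + ennreal \<bar>rdiff k h (%x. g x - fN (tw m) x) x\<bar> epowr p))"
  proof (intro nn_integral_mono)
   fix x
   have "rdiff k h g x = rdiff k h (fN (tw m)) x + rdiff k h (%x. g x - fN (tw m) x) x" by (simp add: rdiff_diff)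
   then have "ennreal \<bar>rdiff k h g x\<bar> <= ennreal \<bar>rdiff k h (fN (tw m)) x\<bar> + ennreal \<bar>rdiff k h (%x. g x - fN (tw m) x) x\<bar>"
    by (subst ennreal_plus[symmetric]) (auto intro!: ennreal_leI simp del: ennreal_plus)
   then show "ennreal \<bar>rdiff k h g x\<bar> epowr p <= ennreal (2 powr p) * (ennreal \<bar>rdiff k h (fN (tw m)) x\<bar> epowr p + ennreal \<bar>rdiff k h (%x. g x - fN (tw m) x) x\<bar> epowr p)"
    using p by (intro order_trans[OF epowr_mono epowr_add_le]) auto
  qed
  also have "... = ennreal (2 powr p) * (?N (rdiff k h (fN (tw m))) + ?N (rdiff k h (%x. g x - fN (tw m) x)))"
  proof -
   have [measurable]: "rdiff k h (fN (tw m)) \<in> borel_measurable borel" "rdiff k h (%x. g x - fN (tw m) x) \<in> borel_measurable borel"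
    by (intro rm; measurable)+
   show ?thesis by (subst nn_integral_cmult, simp, subst nn_integral_add) simp_all
  qed
  also have "... <= ennreal (2 powr p) * (ennreal K * (ennreal (A k powr p) * zsum ?c) + ennreal ((2 powr (p + 1)) ^ k) * (ennreal K * (ennreal (A 0 powr p) * zsum ?c)))"
   by (intro mult_left_mono add_mono lo order_trans[OF rdiff_Lp_bound[OF p(1)] mult_left_mono[OF hi]]) (auto, measurable)
  also have "... = ennreal L * zsum ?c"
  proof -
   have "ennreal L = ennreal (2 powr p) * (ennreal K * ennreal (A k powr p) + ennreal ((2 powr (p + 1)) ^ k) * (ennreal K * ennreal (A 0 powr p)))"
    using K(1) by (simp add: L_def ennreal_mult[symmetric] ennreal_plus[symmetric] algebra_simps del: ennreal_plus)
   then show ?thesis by (simp only: distrib_right distrib_left mult.assoc)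
  qed
  finally show ?thesis .
 qed
 show thesis by (rule that[OF L]) (rule main)
qed

text \<open>The oscillation is controlled on whole dyadic intervals, not just at their ends, so
  summability gives convergence along all real arguments and the tail sum as its rate at dyadic
  points.\<close>

lemma dyadic_convergence:
 fixes u :: "real => real" and \<beta> :: "nat => real"
 assumes b: "summable \<beta>" "!!n. \<beta> n >= 0"
  and u: "!!n s. tw (int n) <= s ==> s <= tw (int n + 1) ==> \<bar>u s - u (tw (int n))\<bar> <= \<beta> n"
 obtains L where "(u \<longlongrightarrow> L) at_top" "!!M. \<bar>L - u (tw (int M))\<bar> <= (\<Sum>j. \<beta> (j + M))"
proof -
 define T where "T M = (\<Sum>j. \<beta> (j + M))" for M
 have sM: "summable (%j. \<beta> (j + M))" for M using b(1) by (subst summable_iff_shift)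
 have T0: "T \<longlonglongrightarrow> 0"
  unfolding T_def by (rule suminf_exist_split2[OF b(1)])
 have step: "\<bar>u (tw (int (M + i))) - u (tw (int M))\<bar> <= (\<Sum>j<i. \<beta> (j + M))" for M i
 proof (induction i)
  case (Suc i)
  have "\<bar>u (tw (int (M + i) + 1)) - u (tw (int (M + i)))\<bar> <= \<beta> (M + i)"
   by (rule u) (auto intro: tw_mono)
  moreover have "int (M + i) + 1 = int (M + Suc i)" by simp
  ultimately show ?case using Suc by (simp add: add.commute)
 qed simp
 have fT: "(\<Sum>j<i. \<beta> (j + M)) <= T M" for i M
  unfolding T_def by (rule sum_le_suminf[OF sM]) (auto intro: b)
 have le: "\<bar>u (tw (int (M + i))) - u (tw (int M))\<bar> <= T M" for M i
  by (rule order_trans[OF step fT])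
 have "Cauchy (%n. u (tw (int n)))"
 proof (rule metric_CauchyI)
  fix e :: real assume e: "e > 0"
  have "\<forall>\<^sub>F M in sequentially. dist (T M) 0 < e / 2" using tendstoD[OF T0, of "e / 2"] e by simp
  then obtain M where M: "\<bar>T M\<bar> < e / 2" by (auto simp: eventually_sequentially)
  have "dist (u (tw (int m))) (u (tw (int n))) < e" if "m >= M" "n >= M" for m n
  proof -
   obtain i j where "m = M + i" "n = M + j" using \<open>m >= M\<close> \<open>n >= M\<close> le_Suc_ex by blast
   then show ?thesis using le[of M i] le[of M j] M unfolding dist_real_def by (simp add: abs_le_iff abs_less_iff)
  qed
  then show "\<exists>M. \<forall>m\<ge>M. \<forall>n\<ge>M. dist (u (tw (int m))) (u (tw (int n))) < e" by blast
 qed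
 then obtain L where L: "(%n. u (tw (int n))) \<longlonglongrightarrow> L"
  using Cauchy_convergent convergent_def by blast
 have LM: "\<bar>L - u (tw (int M))\<bar> <= T M" for M
 proof (rule LIMSEQ_le_const2)
  show "(%i. \<bar>u (tw (int (i + M))) - u (tw (int M))\<bar>) \<longlonglongrightarrow> \<bar>L - u (tw (int M))\<bar>"
   by (intro tendsto_intros LIMSEQ_ignore_initial_segment[OF L])
  show "\<exists>N. \<forall>i\<ge>N. \<bar>u (tw (int (i + M))) - u (tw (int M))\<bar> <= T M"
   using le[of M] by (auto simp: add.commute)
 qed
 have bT: "\<beta> M <= T M" for M using fT[of M 1] by simp
 have "(u \<longlongrightarrow> L) at_top"
 proof (rule tendstoI)
  fix e :: real assume e: "e > 0"
  have "\<forall>\<^sub>F M in sequentially. dist (T M) 0 < e / 2" using tendstoD[OF T0, of "e / 2"] e by simp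
  then obtain M where M: "!!m. m >= M ==> \<bar>T m\<bar> < e / 2" by (auto simp: eventually_sequentially)
  have "dist (u s) L < e" if s: "s >= tw (int M)" for s
  proof -
   have s1: "s >= 1" using s tw_mono[of 0 "int M"] by simp
   define n where "n = nat \<lfloor>log 2 s\<rfloor>"
   have l0: "log 2 s >= 0" using s1 by simp
   have n: "int n = \<lfloor>log 2 s\<rfloor>" using l0 by (simp add: n_def)
   have lo: "tw (int n) <= s" unfolding n tw_def using s1 by (simp add: le_log_iff[symmetric])
   have "log 2 s < real_of_int \<lfloor>log 2 s\<rfloor> + 1" by linarith
   then have "2 powr log 2 s <= 2 powr (real_of_int \<lfloor>log 2 s\<rfloor> + 1)" by (intro powr_mono) auto
   then have hi: "s <= tw (int n + 1)" unfolding n tw_def using s1 by simp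
   have "real M <= log 2 s" using s s1 by (simp add: tw_def le_log_iff)
   then have "n >= M" using n by linarith
   then show ?thesis using u[OF lo hi] LM[of n] bT[of n] M[of n] unfolding dist_real_def
    by (simp add: abs_le_iff abs_less_iff)
  qed
  then show "\<forall>\<^sub>F s in at_top. dist (u s) L < e" unfolding eventually_at_top_linorder by blast
 qed
 then show thesis using LM by (rule that[unfolded T_def[symmetric]])
qed

text \<open>The dyadic form of the integral of \<open>u powr ((d - 1) / 2)\<close> against the
  variation measure of \<open>F\<close> over arguments beyond \<open>tw M\<close>.\<close>

definition vtail :: "nat => (real => real => real) => nat => real" where
 "vtail d V M = (\<Sum>j. tw (int (j + M)) powr ((real d - 1) / 2) * V (tw (int (j + M))) (tw (int (j + M) + 1)))"

locale gm_tail = gm F V C T for F V C and T :: "'a::euclidean_space itself" +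
 assumes V_tail: "summable (%n. tw (int n) powr ((real DIM('a) - 1) / 2) * V (tw (int n)) (tw (int n + 1)))"
begin

lemma eta_nonneg: "((real DIM('a) - 1) / 2) >= 0"
proof -
 have "real DIM('a) - 1 >= 0" by simp
 then show ?thesis by (intro divide_nonneg_nonneg) simp_all
qed

lemma tw_ge1: "tw (int n) >= 1" using tw_mono[of 0 "int n"] by simp

lemma Vn_nonneg: "V (tw (int n)) (tw (int n + 1)) >= 0" by (intro V_nonneg tw_mono) auto

lemma V_summable: "summable (%n. V (tw (int n)) (tw (int n + 1)))"
proof (rule summable_comparison_test'[OF V_tail])
 fix n :: nat
 have "1 <= tw (int n) powr ((real DIM('a) - 1) / 2)" using tw_ge1 eta_nonneg by (intro ge_one_powr_ge_zero)
 then have "1 * V (tw (int n)) (tw (int n + 1)) <= tw (int n) powr ((real DIM('a) - 1) / 2) * V (tw (int n)) (tw (int n + 1))"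
  using Vn_nonneg by (intro mult_right_mono)
 then show "norm (V (tw (int n)) (tw (int n + 1))) <= tw (int n) powr ((real DIM('a) - 1) / 2) * V (tw (int n)) (tw (int n + 1))"
  using Vn_nonneg[of n] by simp
qed

text \<open>For fixed \<open>x\<close> the volume factor \<open>s ^ d\<close> and the decay of order
  (d + 1)/2 combine to growth of order (d - 1)/2 in \<open>s\<close>. This is the origin of the
  weight in the integrability condition on the variation.\<close>

lemma kernel_decay:
 assumes "s > 0" "x \<noteq> 0"
 shows "\<bar>ball_kernel s (x::'a)\<bar> <= kconst TYPE('a) 0 * norm x powr - ((real DIM('a) + 1) / 2) * s powr ((real DIM('a) - 1) / 2)"
proof -
 have "\<bar>ball_kernel s x\<bar> <= kconst TYPE('a) 0 * s ^ DIM('a) * (1 + s * norm x) powr - ((real DIM('a) + 1) / 2)"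
  using kconst(2)[OF assms(1), of 0 0 x] by simp
 also have "... <= kconst TYPE('a) 0 * s ^ DIM('a) * (s * norm x) powr - ((real DIM('a) + 1) / 2)"
  using kconst(1)[of 0, where ?'a = 'a] assms by (intro mult_left_mono powr_mono2') auto
 also have "... = kconst TYPE('a) 0 * norm x powr - ((real DIM('a) + 1) / 2) * (s ^ DIM('a) * s powr - ((real DIM('a) + 1) / 2))"
  using assms by (simp add: powr_mult mult_ac)
 also have "s ^ DIM('a) * s powr - ((real DIM('a) + 1) / 2) = s powr (real DIM('a) - ((real DIM('a) + 1) / 2))"
  using assms by (simp add: powr_realpow[symmetric] powr_add[symmetric])
 also have "real DIM('a) - ((real DIM('a) + 1) / 2) = ((real DIM('a) - 1) / 2)" by (simp add: field_simps)
 finally show ?thesis .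
qed

definition beta :: "'a => nat => real" where
 "beta x n = kconst TYPE('a) 0 * norm x powr - ((real DIM('a) + 1) / 2) * 2 powr ((real DIM('a) - 1) / 2) * (tw (int n) powr ((real DIM('a) - 1) / 2) * V (tw (int n)) (tw (int n + 1)))"

lemma beta: "summable (beta x)" "beta x n >= 0"
proof -
 show "summable (beta x)" unfolding beta_def[abs_def] by (intro summable_mult V_tail)
 show "beta x n >= 0" unfolding beta_def
  using kconst(1)[of 0, where ?'a = 'a] Vn_nonneg[of n] by (intro mult_nonneg_nonneg) auto
qed

text \<open>Up to a constant, \<open>F s * ball_kernel s x - fN s x\<close> is the integral of the
  kernel against the differential of \<open>F\<close>. In contrast to \<open>fN\<close>, it
  converges absolutely under the variation condition.\<close>

lemma u_osc:
 assumes x: "x \<noteq> 0" and s: "tw (int n) <= s" "s <= tw (int n + 1)"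
 shows "\<bar>(F s * ball_kernel s x - fN s x) - (F (tw (int n)) * ball_kernel (tw (int n)) x - fN (tw (int n)) x)\<bar> <= beta x n"
proof -
 let ?a = "tw (int n)" and ?k = "kconst TYPE('a) 0"
 define B where "B = ?k * norm x powr - ((real DIM('a) + 1) / 2) * (2 powr ((real DIM('a) - 1) / 2) * ?a powr ((real DIM('a) - 1) / 2))"
 have kc: "?k >= 0" using kconst(1)[of 0, where ?'a = 'a] by simp
 have "\<bar>rdiff 0 0 (PB ?a s) x - (F s * rdiff 0 0 (ball_kernel s) x - F ?a * rdiff 0 0 (ball_kernel ?a) x)\<bar> <= B * V ?a s"
 proof (rule PB_parts)
  fix r assume r: "?a <= r" "r <= s"
  have r0: "r > 0" using r tw_pos(1)[of "int n"] by linarith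
  have "r powr ((real DIM('a) - 1) / 2) <= (2 * ?a) powr ((real DIM('a) - 1) / 2)" using r s r0 eta_nonneg by (intro powr_mono2) (auto simp: tw_Suc)
  also have "... = 2 powr ((real DIM('a) - 1) / 2) * ?a powr ((real DIM('a) - 1) / 2)" by (simp add: powr_mult)
  finally have "?k * norm x powr - ((real DIM('a) + 1) / 2) * r powr ((real DIM('a) - 1) / 2) <= B" unfolding B_def using kc by (intro mult_left_mono) auto
  then show "\<bar>rdiff 0 0 (ball_kernel r) x\<bar> <= B" using kernel_decay[OF r0 x] by simp
 qed (use s in auto)
 also have "... <= B * V ?a (tw (int n + 1))"
  using s kc by (intro mult_left_mono V_mono) (auto simp: B_def)
 also have "... = beta x n" by (simp add: B_def beta_def mult_ac)
 finally have "\<bar>PB ?a s x - (F s * ball_kernel s x - F ?a * ball_kernel ?a x)\<bar> <= beta x n" by simp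
 then show ?thesis unfolding fN_diff[OF s(1)] by (simp add: abs_le_iff)
qed

text \<open>If \<open>F\<close> had a positive limit, the convergence of the inversion integral would force
  the oscillating solution of the Bessel equation to converge.\<close>

lemma F_tendsto_0:
 assumes x: "norm (x::'a) = 1" and lim: "((%N. fN N x) \<longlongrightarrow> g) at_top"
 shows "(F \<longlongrightarrow> 0) at_top"
proof -
 have x0: "x \<noteq> 0" using x by auto
 obtain c where c: "(F \<longlongrightarrow> c) at_top"
 proof (rule dyadic_convergence[OF V_summable Vn_nonneg, of F])
  fix n s assume s: "tw (int n) <= s" "s <= tw (int n + 1)"
  then show "\<bar>F s - F (tw (int n))\<bar> <= V (tw (int n)) (tw (int n + 1))"
   using V_ge[of "tw (int n)" s] V_mono[of "tw (int n)" s "tw (int n + 1)"] by simp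
 qed (rule that)
 obtain u where u: "((%s. F s * ball_kernel s x - fN s x) \<longlongrightarrow> u) at_top"
 proof (rule dyadic_convergence[OF beta(1)[of x] beta(2)[of x], of "%s. F s * ball_kernel s x - fN s x"])
  fix n s assume s: "tw (int n) <= s" "s <= tw (int n + 1)"
  show "\<bar>(F s * ball_kernel s x - fN s x) - (F (tw (int n)) * ball_kernel (tw (int n)) x - fN (tw (int n)) x)\<bar> <= beta x n"
   by (rule u_osc[OF x0 s])
 qed (rule that)
 \<comment> \<open>Since \<open>fN\<close> converges and so does its sum by parts, the boundary term
   converges; if \<open>F\<close> had a nonzero limit, the kernel itself would converge.\<close>
 have Fb: "((%s. F s * ball_kernel s x) \<longlongrightarrow> u + g) at_top"
  using tendsto_add[OF u lim] by simp
 show ?thesis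
 proof (cases "c = 0")
  case False
  let ?P = "pi powr (real DIM('a) / 2)"
  have al2: "real DIM('a) / 2 >= 1 / 2"
  proof -
   have "real DIM('a) >= 1" by simp
   then show ?thesis by linarith
  qed
  have "((%s. (F s * ball_kernel s x) / F s) \<longlongrightarrow> (u + g) / c) at_top"
   by (intro tendsto_divide Fb c False)
  moreover have "\<forall>\<^sub>F s in at_top. (F s * ball_kernel s x) / F s = ball_kernel s x"
   using eventually_gt_at_top[of 0] by eventually_elim (use F_pos in force)
  ultimately have bl: "((%s. ball_kernel s x) \<longlongrightarrow> (u + g) / c) at_top"
   by (rule Lim_transform_eventually)
  \<comment> \<open>Multiplying the kernel by this power of \<open>s\<close> produces
    \<open>bw\<close> up to a constant. The power converges, to 1 in dimension one and to 0
    otherwise, so convergence of the kernel would carry over to \<open>bw\<close>.\<close>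
  obtain e where e: "((%s::real. s powr - ((real DIM('a) - 1) / 2)) \<longlongrightarrow> e) at_top"
  proof (cases "((real DIM('a) - 1) / 2) = 0")
   case True
   have "\<forall>\<^sub>F s::real in at_top. 1 = s powr - ((real DIM('a) - 1) / 2)"
    using eventually_gt_at_top[of 0] by eventually_elim (simp only: True, simp)
   then have "((%s::real. s powr - ((real DIM('a) - 1) / 2)) \<longlongrightarrow> 1) at_top"
    by (rule Lim_transform_eventually[OF tendsto_const])
   then show ?thesis by (rule that)
  next
   case False
   then have "(real DIM('a) - 1) / 2 > 0" using eta_nonneg by (metis order_le_less)
   then have "- ((real DIM('a) - 1) / 2) < 0" by (rule neg_less_0_iff_less[THEN iffD2])
   then have "((%s::real. s powr - ((real DIM('a) - 1) / 2)) \<longlongrightarrow> 0) at_top" by (intro tendsto_neg_powr filterlim_ident)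
   then show ?thesis by (rule that)
  qed
  have "((%s. s powr - ((real DIM('a) - 1) / 2) * ball_kernel s x / ?P) \<longlongrightarrow> e * ((u + g) / c) / ?P) at_top"
   by (intro tendsto_intros e bl) auto
  moreover have "\<forall>\<^sub>F s in at_top. s powr - ((real DIM('a) - 1) / 2) * ball_kernel s x / ?P = bw (real DIM('a) / 2) s"
   using eventually_gt_at_top[of 0]
  proof eventually_elim
   case (elim s)
   have "s powr - ((real DIM('a) - 1) / 2) * s ^ DIM('a) = s powr (- ((real DIM('a) - 1) / 2) + real DIM('a))" using elim by (simp only: powr_add powr_realpow)
   also have "- ((real DIM('a) - 1) / 2) + real DIM('a) = real DIM('a) / 2 + 1 / 2" by (simp add: field_simps)
   finally have e: "s powr - ((real DIM('a) - 1) / 2) * s ^ DIM('a) = s powr (real DIM('a) / 2 + 1 / 2)" .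
   have "s powr - ((real DIM('a) - 1) / 2) * ball_kernel s x / ?P = (s powr - ((real DIM('a) - 1) / 2) * s ^ DIM('a)) * bess (real DIM('a) / 2) (s\<^sup>2 / 4)"
    unfolding ball_kernel_def cball_transform[OF elim] x by simp
   then show ?case unfolding e bw_def .
  qed
  ultimately have "(bw (real DIM('a) / 2) \<longlongrightarrow> e * ((u + g) / c) / ?P) at_top" by (rule Lim_transform_eventually)
  then show ?thesis using bw_not_convergent[OF al2] by blast
 qed (use c in simp)
qed

lemma tail_tendsto: "vtail DIM('a) V \<longlonglongrightarrow> 0"
 unfolding vtail_def[abs_def] by (rule suminf_exist_split2[OF V_tail])

text \<open>As \<open>F\<close> tends to 0, its value is at most the total variation still to come,
  and the weight only increases along the tail.\<close>

lemma F_tail: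
 assumes F0: "(F \<longlongrightarrow> 0) at_top"
 shows "tw (int M) powr ((real DIM('a) - 1) / 2) * F (tw (int M)) <= vtail DIM('a) V M"
proof -
 obtain L where L: "(F \<longlongrightarrow> L) at_top" "!!M. \<bar>L - F (tw (int M))\<bar> <= (\<Sum>j. V (tw (int (j + M))) (tw (int (j + M) + 1)))"
 proof (rule dyadic_convergence[OF V_summable Vn_nonneg, of F])
  fix n s assume s: "tw (int n) <= s" "s <= tw (int n + 1)"
  then show "\<bar>F s - F (tw (int n))\<bar> <= V (tw (int n)) (tw (int n + 1))"
   using V_ge[of "tw (int n)" s] V_mono[of "tw (int n)" s "tw (int n + 1)"] by simp
 qed (rule that)
 have "L = 0" using tendsto_unique[OF _ L(1) F0] by simp
 have sV: "summable (%j. V (tw (int (j + M))) (tw (int (j + M) + 1)))"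
  using summable_iff_shift[of "%n. V (tw (int n)) (tw (int n + 1))" M] V_summable by blast
 have sT: "summable (%j. tw (int (j + M)) powr ((real DIM('a) - 1) / 2) * V (tw (int (j + M))) (tw (int (j + M) + 1)))"
  using summable_iff_shift[of "%n. tw (int n) powr ((real DIM('a) - 1) / 2) * V (tw (int n)) (tw (int n + 1))" M] V_tail by blast
 have "tw (int M) powr ((real DIM('a) - 1) / 2) * F (tw (int M)) <= tw (int M) powr ((real DIM('a) - 1) / 2) * (\<Sum>j. V (tw (int (j + M))) (tw (int (j + M) + 1)))"
  using L(2)[of M] \<open>L = 0\<close> by (intro mult_left_mono) auto
 also have "... = (\<Sum>j. tw (int M) powr ((real DIM('a) - 1) / 2) * V (tw (int (j + M))) (tw (int (j + M) + 1)))"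
  by (rule suminf_mult[symmetric, OF sV])
 also have "... <= vtail DIM('a) V M" unfolding vtail_def
 proof (rule suminf_le[OF _ summable_mult[OF sV] sT])
  fix j
  have "tw (int M) powr ((real DIM('a) - 1) / 2) <= tw (int (j + M)) powr ((real DIM('a) - 1) / 2)" using eta_nonneg by (intro powr_mono2 tw_mono) auto
  then show "tw (int M) powr ((real DIM('a) - 1) / 2) * V (tw (int (j + M))) (tw (int (j + M) + 1)) <= tw (int (j + M)) powr ((real DIM('a) - 1) / 2) * V (tw (int (j + M))) (tw (int (j + M) + 1))"
   using Vn_nonneg by (intro mult_right_mono)
 qed
 finally show ?thesis .
qed

text \<open>The boundary term vanishes along dyadic radii, so the limit of the sum by parts is
  \<open>- g\<close>. The error of truncation is then the tail of the oscillation bounds plus the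
  boundary term, and both are multiples of \<open>vtail\<close>.\<close>

lemma fN_rate:
 assumes F0: "(F \<longlongrightarrow> 0) at_top" and x: "x \<noteq> 0" and lim: "((%N. fN N x) \<longlongrightarrow> g) at_top"
 shows "\<bar>g - fN (tw (int M)) x\<bar> <= (kconst TYPE('a) 0 * (1 + 2 powr ((real DIM('a) - 1) / 2)) * vtail DIM('a) V M) * norm x powr - ((real DIM('a) + 1) / 2)"
proof -
 let ?k = "kconst TYPE('a) 0" and ?u = "%s. F s * ball_kernel s x - fN s x"
 have kc: "?k >= 0" using kconst(1)[of 0, where ?'a = 'a] by simp
 obtain u where u: "(?u \<longlongrightarrow> u) at_top" "!!M. \<bar>u - ?u (tw (int M))\<bar> <= (\<Sum>j. beta x (j + M))"
 proof (rule dyadic_convergence[OF beta(1)[of x] beta(2)[of x], of "?u"])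
  fix n s assume s: "tw (int n) <= s" "s <= tw (int n + 1)"
  show "\<bar>(F s * ball_kernel s x - fN s x) - (F (tw (int n)) * ball_kernel (tw (int n)) x - fN (tw (int n)) x)\<bar> <= beta x n"
   by (rule u_osc[OF x s])
 qed (rule that)
 have FB: "\<bar>F (tw (int M)) * ball_kernel (tw (int M)) x\<bar> <= ?k * norm x powr - ((real DIM('a) + 1) / 2) * vtail DIM('a) V M" for M
 proof -
  have "\<bar>F (tw (int M)) * ball_kernel (tw (int M)) x\<bar> <= F (tw (int M)) * (?k * norm x powr - ((real DIM('a) + 1) / 2) * tw (int M) powr ((real DIM('a) - 1) / 2))"
   unfolding abs_mult using kernel_decay[OF tw_pos(1) x] F_nonneg by (intro mult_mono) auto
  also have "... = ?k * norm x powr - ((real DIM('a) + 1) / 2) * (tw (int M) powr ((real DIM('a) - 1) / 2) * F (tw (int M)))" by (simp only: mult_ac)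
  also have "... <= ?k * norm x powr - ((real DIM('a) + 1) / 2) * vtail DIM('a) V M" using kc F_tail[OF F0] by (intro mult_left_mono) auto
  finally show ?thesis .
 qed
 have sub: "filterlim (%M::nat. tw (int M)) at_top sequentially" using tw_at_top[of 0] by simp
 have "(%M. ?k * norm x powr - ((real DIM('a) + 1) / 2) * vtail DIM('a) V M) \<longlonglongrightarrow> ?k * norm x powr - ((real DIM('a) + 1) / 2) * 0"
  by (rule tendsto_mult_left[OF tail_tendsto])
 then have vt: "(%M. ?k * norm x powr - ((real DIM('a) + 1) / 2) * vtail DIM('a) V M) \<longlonglongrightarrow> 0" by simp
 have "(%M. F (tw (int M)) * ball_kernel (tw (int M)) x) \<longlonglongrightarrow> 0"
 proof (rule Lim_null_comparison[OF _ vt])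
  show "\<forall>\<^sub>F M in sequentially. norm (F (tw (int M)) * ball_kernel (tw (int M)) x) <=
    ?k * norm x powr - ((real DIM('a) + 1) / 2) * vtail DIM('a) V M"
   using FB by (intro always_eventually allI) simp
 qed
 from tendsto_diff[OF this filterlim_compose[OF lim sub]]
 have "(%M. ?u (tw (int M))) \<longlonglongrightarrow> - g" by simp
 then have "u = - g" using filterlim_compose[OF u(1) sub] LIMSEQ_unique by blast
 have "(\<Sum>j. beta x (j + M)) = ?k * norm x powr - ((real DIM('a) + 1) / 2) * 2 powr ((real DIM('a) - 1) / 2) * vtail DIM('a) V M"
  unfolding beta_def vtail_def
  using summable_iff_shift[of "%n. tw (int n) powr ((real DIM('a) - 1) / 2) * V (tw (int n)) (tw (int n + 1))" M] V_tail
  by (intro suminf_mult) blast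
 then have "\<bar>- g - (F (tw (int M)) * ball_kernel (tw (int M)) x - fN (tw (int M)) x)\<bar> <= ?k * norm x powr - ((real DIM('a) + 1) / 2) * 2 powr ((real DIM('a) - 1) / 2) * vtail DIM('a) V M"
  using u(2)[of M] \<open>u = - g\<close> by simp
 then have "\<bar>g - fN (tw (int M)) x\<bar> <= ?k * norm x powr - ((real DIM('a) + 1) / 2) * 2 powr ((real DIM('a) - 1) / 2) * vtail DIM('a) V M + ?k * norm x powr - ((real DIM('a) + 1) / 2) * vtail DIM('a) V M"
  using FB[of M] by (simp add: abs_le_iff)
 also have "... = (?k * (1 + 2 powr ((real DIM('a) - 1) / 2)) * vtail DIM('a) V M) * norm x powr - ((real DIM('a) + 1) / 2)" by (simp add: algebra_simps)
 finally show ?thesis .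
qed

end

section \<open>Testing against Gaussians\<close>

definition gauss :: "real => 'a::euclidean_space => real" where
 "gauss c x = exp (- (norm x / c)\<^sup>2)"

lemma gauss_bounds: "0 < gauss c x" "0 <= gauss c x" "gauss c x <= 1" "gauss c 0 = 1"
 by (simp_all add: gauss_def)

lemma gauss_measurable [measurable]: "gauss c \<in> borel_measurable borel"
 unfolding gauss_def[abs_def] by measurable

text \<open>The mean value theorem with \<open>|2 z| <= 1 + z ^ 2 <= exp (z ^ 2)\<close>.\<close>

lemma exp_square_lipschitz: "\<bar>exp (- a\<^sup>2) - exp (- b\<^sup>2)\<bar> <= \<bar>a - (b::real)\<bar>"
proof -
 have *: "\<bar>exp (- b\<^sup>2) - exp (- a\<^sup>2)\<bar> <= \<bar>b - a\<bar>" if ab: "a < b" for a b :: real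
 proof -
  have D: "((%z. exp (- z\<^sup>2)) has_real_derivative - (2 * z) * exp (- z\<^sup>2)) (at z)" for z :: real
   by (auto intro!: derivative_eq_intros)
  obtain z where z: "exp (- b\<^sup>2) - exp (- a\<^sup>2) = (b - a) * (- (2 * z) * exp (- z\<^sup>2))"
   using MVT2[OF ab, of "%z. exp (- z\<^sup>2)" "%z. - (2 * z) * exp (- z\<^sup>2)"] D by blast
  have "\<bar>2 * z\<bar> <= 1 + z\<^sup>2" using sum_squares_bound[of 1 "\<bar>z\<bar>"] by (simp add: abs_mult)
  also have "... <= exp (z\<^sup>2)" by (rule exp_ge_add_one_self)
  finally have "\<bar>2 * z\<bar> * exp (- z\<^sup>2) <= 1" by (simp add: exp_minus field_simps)
  then have "\<bar>b - a\<bar> * (\<bar>2 * z\<bar> * exp (- z\<^sup>2)) <= \<bar>b - a\<bar> * 1" by (intro mult_left_mono) auto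
  then show ?thesis unfolding z by (simp add: abs_mult)
 qed
 show ?thesis using *[of a b] *[of b a] by (cases a b rule: linorder_cases) (auto simp: abs_minus_commute)
qed

lemma lborel_integrable_translate:
 fixes f :: "'a::euclidean_space => real"
 assumes "integrable lborel f"
 shows "integrable lborel (%x. f (x + t))" and "(RI x. f (x + t)) = (RI x. f x)"
proof -
 have m: "f \<in> borel_measurable borel" using assms by simp
 have "integrable (distr lborel borel ((+) t)) f" using assms by (simp add: lborel_distr_plus)
 then show "integrable lborel (%x. f (x + t))"
  using m by (subst (asm) integrable_distr_eq) (auto simp: add.commute)
 have "(RI x. f x) = integral\<^sup>L (distr lborel borel ((+) t)) f" by (simp add: lborel_distr_plus)
 also have "... = (RI x. f (t + x))" using m by (subst integral_distr) auto
 finally show "(RI x. f (x + t)) = (RI x. f x)" by (simp add: add.commute)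
qed

lemma gauss_integral:
 assumes "c > 0"
 shows "integrable lborel (gauss c :: 'a::euclidean_space => real)"
  and "(RI x. gauss c (x::'a)) = pi powr (real DIM('a) / 2) * c ^ DIM('a)"
  and "integrable lborel (%x. gauss c (x - x0 :: 'a))"
proof -
 show *: "integrable lborel (gauss c :: 'a => real)"
  using gauss_transform(1)[OF assms, of "0::'a"] by (simp add: gauss_def[abs_def])
 show "(RI x. gauss c (x::'a)) = pi powr (real DIM('a) / 2) * c ^ DIM('a)"
  using gauss_transform(2)[OF assms, of "0::'a"] by (simp add: gauss_def[abs_def])
 show "integrable lborel (%x. gauss c (x - x0 :: 'a))"
  using lborel_integrable_translate(1)[OF *, of "- x0"] by simp
qed

primrec sdiff :: "nat => 'a::real_vector => ('a => real) => 'a => real" where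
 "sdiff 0 h g = g"
| "sdiff (Suc k) h g = (%x. 2 * sdiff k h g x - sdiff k h g (x + h) - sdiff k h g (x - h))"

lemma sdiff_cos: "sdiff k h (%x. cos (x \<bullet> y)) x = (2 - 2 * cos (h \<bullet> y)) ^ k * cos (x \<bullet> (y::'a::real_inner))"
proof (induction k arbitrary: x)
 case (Suc k)
 have "cos ((x + h) \<bullet> y) + cos ((x - h) \<bullet> y) = 2 * cos (x \<bullet> y) * cos (h \<bullet> y)"
  by (simp add: inner_add_left inner_diff_left cos_add cos_diff)
 then have "2 * cos (x \<bullet> y) - cos ((x + h) \<bullet> y) - cos ((x - h) \<bullet> y) = (2 - 2 * cos (h \<bullet> y)) * cos (x \<bullet> y)"
  by (simp add: algebra_simps)
 then have "(2 - 2 * cos (h \<bullet> y)) ^ k * (2 * cos (x \<bullet> y) - cos ((x + h) \<bullet> y) - cos ((x - h) \<bullet> y)) = (2 - 2 * cos (h \<bullet> y)) ^ Suc k * cos (x \<bullet> y)"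
  by simp
 then show ?case by (simp add: Suc algebra_simps)
qed simp

lemma sdiff_integral:
 assumes "!!x. integrable M (%y. w y * g x y)"
 shows "integrable M (%y. w y * sdiff k h (%x. g x y) x) \<and>
  sdiff k h (%x. \<integral>y. w y * g x y \<partial>M) x = (\<integral>y. w y * sdiff k h (%x. g x y) x \<partial>M)"
proof (induction k arbitrary: x)
 case (Suc k)
 note i = Suc[THEN conjunct1] and e = Suc[THEN conjunct2]
 have i2: "integrable M (%y. 2 * (w y * sdiff k h (%x. g x y) x) - w y * sdiff k h (%x. g x y) (x + h))"
  by (intro Bochner_Integration.integrable_diff integrable_mult_right i)
 have "integrable M (%y. 2 * (w y * sdiff k h (%x. g x y) x) - w y * sdiff k h (%x. g x y) (x + h) - w y * sdiff k h (%x. g x y) (x - h))"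
  by (intro Bochner_Integration.integrable_diff i2 i)
 moreover have "(\<integral>y. 2 * (w y * sdiff k h (%x. g x y) x) - w y * sdiff k h (%x. g x y) (x + h) - w y * sdiff k h (%x. g x y) (x - h) \<partial>M) =
   sdiff (Suc k) h (%x. \<integral>y. w y * g x y \<partial>M) x"
  by (subst Bochner_Integration.integral_diff[OF i2 i], subst Bochner_Integration.integral_diff[OF integrable_mult_right[OF i] i])
    (simp add: e)
 ultimately show ?case by (simp add: right_diff_distrib mult.left_commute)
qed (use assms in auto)

lemma rdiff_translate: "rdiff k h (%x. v (x + a)) x = rdiff k h v (x + a)"
 by (induction k arbitrary: x) (auto simp: add_ac)

text \<open>The second difference factors into a forward and a backward one. This lets its norm be
  bounded by that of the forward difference appearing in the modulus of smoothness.\<close>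

lemma sdiff_rdiff: "sdiff k h g x = rdiff k (- h) (rdiff k h g) x"
proof (induction k arbitrary: x)
 case (Suc k)
 let ?v = "rdiff k h g"
 have D: "rdiff k (- h) (%x. ?v (x + h) - ?v x) x = sdiff k h g (x + h) - sdiff k h g x" for x
  by (simp add: rdiff_diff rdiff_translate Suc)
 have "rdiff (Suc k) (- h) (rdiff (Suc k) h g) x = (sdiff k h g (x - h + h) - sdiff k h g (x - h)) - (sdiff k h g (x + h) - sdiff k h g x)"
  using D[of "x - h"] D[of x] by simp
 then show ?case by simp
qed simp

lemma sdiff_Lp_bound:
 fixes g :: "'a::euclidean_space => real"
 assumes p: "p > 0" and [measurable]: "g \<in> borel_measurable borel"
 shows "(NI x. ennreal \<bar>sdiff k h g x\<bar> epowr p) <= ennreal ((2 powr (p + 1)) ^ k) * (NI x. ennreal \<bar>rdiff k h g x\<bar> epowr p)"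
proof -
 have "rdiff k h g \<in> borel_measurable borel"
 proof (induction k)
  case (Suc k)
  note [measurable] = Suc
  show ?case by simp
 qed simp
 from rdiff_Lp_bound[OF p this, of k "- h"] show ?thesis by (simp add: sdiff_rdiff)
qed

context gm
begin

text \<open>Fubini's theorem moves the pairing to the frequency side, where the Gaussian becomes a
  positive Gaussian. For a nonnegative symbol the right-hand integrand is therefore
  nonnegative.\<close>

lemma gauss_pair:
 assumes [measurable]: "\<psi> \<in> borel_measurable borel" and B: "!!y. \<bar>\<psi> y\<bar> <= B" and c: "c > 0"
 shows "(RI x. (RI y. indicator (cball 0 N) y * (F (norm y) * (\<psi> y * cos (x \<bullet> y)))) * gauss c (x::'a)) =
   (RI y. indicator (cball 0 N) y * (F (norm y) * \<psi> y) * (pi powr (real DIM('a) / 2) * c ^ DIM('a) * exp (- (c * norm y / 2)\<^sup>2)))"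
proof -
 define f where "f x y = indicator (cball 0 N) y * (F (norm y) * (\<psi> y * cos (x \<bullet> y))) * gauss c x" for x y :: 'a
 have B0: "B >= 0" using B[of 0] by linarith
 have fm [measurable]: "case_prod f \<in> borel_measurable (lborel \<Otimes>\<^sub>M lborel)"
  unfolding f_def[abs_def] by measurable
 have bound: "\<bar>f x y\<bar> <= (indicator (cball 0 N) y * F (norm y) * B) * gauss c x" for x y
 proof -
  have "\<bar>\<psi> y\<bar> * \<bar>cos (x \<bullet> y)\<bar> <= B * 1" using B[of y] B0 by (intro mult_mono) auto
  then have "F (norm y) * (\<bar>\<psi> y\<bar> * \<bar>cos (x \<bullet> y)\<bar>) <= F (norm y) * B" using F_nonneg by (intro mult_left_mono) auto
  then show ?thesis using F_nonneg[of "norm y"] gauss_bounds(2)[of c x]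
   by (auto simp: f_def abs_mult indicator_def intro!: mult_right_mono)
 qed
 have int: "integrable (lborel \<Otimes>\<^sub>M lborel) (case_prod f)"
 proof (rule lborel_pair.Fubini_integrable)
  have iy: "integrable lborel (f x)" for x
  proof (rule Bochner_Integration.integrable_bound[OF integrable_mult_left[OF integrable_mult_left[OF F_int[of N], of B], of "gauss c x"]])
   show "f x \<in> borel_measurable lborel" unfolding f_def[abs_def] by measurable
   show "AE y in lborel. norm (f x y) <= norm (indicator (cball (0::'a) N) y * F (norm y) * B * gauss c x)"
   proof (intro AE_I2)
    fix y :: 'a show "norm (f x y) <= norm (indicator (cball 0 N) y * F (norm y) * B * gauss c x)"
     using bound[of x y] by simp
   qed
  qed
  show "AE x in lborel. integrable lborel (%y. case (x, y) of (x, y) => f x y)" using iy by simp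
  show "integrable lborel (%x. RI y. norm (case (x, y) of (x, y) => f x y))"
  proof (rule Bochner_Integration.integrable_bound[OF integrable_mult_right[OF gauss_integral(1)[OF c], of "radial_mass TYPE('a) F N * B"]])
   show "AE x in lborel. norm (RI y. norm (case (x, y) of (x, y) => f x y)) <= norm (radial_mass TYPE('a) F N * B * gauss c (x::'a))"
   proof (intro AE_I2)
    fix x :: 'a
    have "(RI y. norm (f x y)) <= (RI y. (indicator (cball 0 N) (y::'a) * F (norm y) * B) * gauss c x)"
     using bound iy by (intro integral_mono integrable_norm integrable_mult_left F_int) auto
    also have "... = radial_mass TYPE('a) F N * B * gauss c x" by (simp add: radial_mass_def)
    finally have "(RI y. norm (f x y)) <= radial_mass TYPE('a) F N * B * gauss c x" .
    moreover have "0 <= (RI y. norm (f x y))" by (intro integral_nonneg_AE) simp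
    ultimately show "norm (RI y. norm (case (x, y) of (x, y) => f x y)) <= norm (radial_mass TYPE('a) F N * B * gauss c (x::'a))"
     by simp
   qed
  qed measurable
 qed measurable
 have "(RI x. (RI y. indicator (cball 0 N) y * (F (norm y) * (\<psi> y * cos (x \<bullet> y)))) * gauss c (x::'a)) = (RI x. (RI y. f x y))"
  by (simp add: f_def)
 also have "... = (RI y. (RI x. f x y))"
  by (rule lborel_pair.Fubini_integral[OF int, symmetric])
 also have "... = (RI y. indicator (cball 0 N) y * (F (norm y) * \<psi> y) * (pi powr (real DIM('a) / 2) * c ^ DIM('a) * exp (- (c * norm y / 2)\<^sup>2)))"
 proof (intro Bochner_Integration.integral_cong refl)
  fix y :: 'a
  have "(RI x. f x y) = (RI x. (indicator (cball 0 N) y * (F (norm y) * \<psi> y)) * (exp (- (norm x / c)\<^sup>2) * cos (y \<bullet> x)))"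
   by (simp add: f_def gauss_def inner_commute mult_ac)
  also have "... = (indicator (cball 0 N) y * (F (norm y) * \<psi> y)) * (pi powr (real DIM('a) / 2) * c ^ DIM('a) * exp (- (c * norm y / 2)\<^sup>2))"
   by (simp only: integral_mult_right_zero gauss_transform(2)[OF c])
  finally show "(RI x. f x y) = indicator (cball 0 N) y * (F (norm y) * \<psi> y) * (pi powr (real DIM('a) / 2) * c ^ DIM('a) * exp (- (c * norm y / 2)\<^sup>2))" .
 qed
 finally show ?thesis .
qed

lemma fN_measurable [measurable]: "fN N \<in> borel_measurable borel"
 unfolding fN_def[abs_def] by measurable

lemma mass_nonneg: "radial_mass TYPE('a) F N >= 0" using fN_le_mass[of N 0] by linarith

lemma fN_gauss_integrable: "c > 0 ==> integrable lborel (%x. fN N x * gauss c (x - x0))"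
proof (rule Bochner_Integration.integrable_bound)
 assume "c > 0"
 show "integrable lborel (%x. radial_mass TYPE('a) F N * gauss c (x - x0 :: 'a))"
  by (intro integrable_mult_right gauss_integral(3) \<open>c > 0\<close>)
 show "AE x in lborel. norm (fN N x * gauss c (x - x0)) <= norm (radial_mass TYPE('a) F N * gauss c (x - x0 :: 'a))"
  using fN_le_mass[of N] mass_nonneg[of N] gauss_bounds(2)
  by (intro AE_I2) (auto simp: abs_mult intro!: mult_right_mono)
qed measurable

text \<open>The transform of a Gaussian of width \<open>c\<close> has height of order
  \<open>c ^ d\<close> and mass independent of \<open>c\<close>. The mass of \<open>F\<close> on a
  fixed ball is damped by \<open>c ^ d\<close>, and outside that ball \<open>F\<close> is already
  small. Positivity makes both bounds uniform in \<open>N\<close>.\<close>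

lemma fN_gauss_small:
 assumes F0: "(F \<longlongrightarrow> 0) at_top" and e: "e > 0"
 obtains c0 where "c0 > 0" "!!c N. 0 < c ==> c <= c0 ==> \<bar>RI x. fN N x * gauss c x\<bar> <= e"
proof -
 let ?P = "pi powr (real DIM('a) / 2)"
 define \<epsilon> where "\<epsilon> = e / (2 * (?P * ?P * 2 ^ DIM('a)))"
 have eps: "\<epsilon> > 0" using e by (simp add: \<epsilon>_def)
 have "\<forall>\<^sub>F s in at_top. \<bar>F s\<bar> < \<epsilon>" using tendstoD[OF F0 eps] by (simp add: dist_real_def)
 then obtain R where R: "!!s. s >= R ==> \<bar>F s\<bar> < \<epsilon>" by (auto simp: eventually_at_top_linorder)
 \<comment> \<open>The bound \<open>c0 <= 1\<close> allows \<open>c ^ d <= c\<close>; the other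
   entry makes the part inside radius \<open>R\<close> at most \<open>e / 2\<close>.\<close>
 define c0 where "c0 = min 1 (e / (2 * (?P * radial_mass TYPE('a) F R + 1)))"
 have Pm: "?P * radial_mass TYPE('a) F R + 1 > 0" using mass_nonneg[of R] by (intro add_nonneg_pos) auto
 have c0: "c0 > 0" "c0 <= 1" using e Pm by (auto simp: c0_def)
 have "\<bar>RI x. fN N x * gauss c x\<bar> <= e" if c: "0 < c" "c <= c0" for c N
 proof -
  let ?x = "%y::'a. exp (- (c * norm y / 2)\<^sup>2)"
  have c2: "2 / c > 0" using c by simp
  have gx: "gauss (2 / c) y = ?x y" for y :: 'a by (simp add: gauss_def mult.commute)
  have ig: "integrable lborel ?x" using gauss_integral(1)[OF c2, where ?'a = 'a] by (simp add: gx[abs_def])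
  have vg: "(RI y. ?x y) = ?P * (2 / c) ^ DIM('a)"
   using gauss_integral(2)[OF c2, where ?'a = 'a] by (simp add: gx)
  have "(RI x. fN N x * gauss c x) = (RI y. indicator (cball 0 N) y * F (norm y) * (?P * c ^ DIM('a) * ?x y))"
   using gauss_pair[of "%_. 1" 1 c N] c by (simp add: fN_def)
  also have "... = ?P * c ^ DIM('a) * (RI y. indicator (cball 0 N) y * F (norm y) * ?x y)"
   by (subst integral_mult_right_zero[symmetric]) (simp add: mult_ac)
  finally have eq: "(RI x. fN N x * gauss c x) = ?P * c ^ DIM('a) * (RI y. indicator (cball 0 N) y * F (norm y) * ?x y)" .
  have iF: "integrable lborel (%y. indicator (cball 0 N) y * F (norm y) * ?x y)"
   using int_bounded[of ?x 1 N] by (simp add: mult.assoc)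
  have "(RI y. indicator (cball 0 N) y * F (norm y) * ?x y) <= (RI y. indicator (cball 0 R) y * F (norm y) + \<epsilon> * ?x y)"
  proof (rule integral_mono[OF iF])
   show "integrable lborel (%y. indicator (cball (0::'a) R) y * F (norm y) + \<epsilon> * ?x y)"
    by (intro Bochner_Integration.integrable_add F_int integrable_mult_right ig)
   fix y :: 'a
   have x01: "0 <= ?x y" "?x y <= 1" by simp_all
   show "indicator (cball 0 N) y * F (norm y) * ?x y <= indicator (cball 0 R) y * F (norm y) + \<epsilon> * ?x y"
   proof (cases "norm y <= R")
    case True
    have "indicator (cball 0 N) y * F (norm y) * ?x y <= F (norm y) * 1"
     using F_nonneg[of "norm y"] x01 by (intro mult_mono) (auto simp: indicator_def)
    then show ?thesis using True eps x01 by (simp add: add_increasing2)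
   next
    case False
    then have "F (norm y) <= \<epsilon>" using R[of "norm y"] by simp
    then have "indicator (cball 0 N) y * F (norm y) * ?x y <= \<epsilon> * ?x y"
     using F_nonneg[of "norm y"] x01 eps by (intro mult_right_mono) (auto simp: indicator_def)
    then show ?thesis using False by simp
   qed
  qed
  also have "... = radial_mass TYPE('a) F R + \<epsilon> * (?P * (2 / c) ^ DIM('a))"
   by (subst Bochner_Integration.integral_add[OF F_int integrable_mult_right[OF ig]]) (simp add: radial_mass_def vg)
  finally have "?P * c ^ DIM('a) * (RI y. indicator (cball 0 N) y * F (norm y) * ?x y) <= ?P * c ^ DIM('a) * (radial_mass TYPE('a) F R + \<epsilon> * (?P * (2 / c) ^ DIM('a)))"
   using c by (intro mult_left_mono) auto
  also have "... = ?P * radial_mass TYPE('a) F R * c ^ DIM('a) + \<epsilon> * (?P * ?P * 2 ^ DIM('a))"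
   using c by (simp add: algebra_simps power_divide)
  also have "... <= e / 2 + e / 2"
  proof (rule add_mono)
   have "c ^ DIM('a) <= c ^ 1" using c c0 DIM_positive[where 'a = 'a] by (intro power_decreasing) (auto simp: Suc_le_eq)
   also have "... <= e / (2 * (?P * radial_mass TYPE('a) F R + 1))" using c by (simp add: c0_def)
   finally have "?P * radial_mass TYPE('a) F R * c ^ DIM('a) <= (?P * radial_mass TYPE('a) F R + 1) * (e / (2 * (?P * radial_mass TYPE('a) F R + 1)))"
    using mass_nonneg[of R] c by (intro mult_mono) auto
   moreover have "z * (e / (2 * z)) = e / 2" if "z > 0" for z using that by simp
   ultimately show "?P * radial_mass TYPE('a) F R * c ^ DIM('a) <= e / 2" using Pm by metis
   show "\<epsilon> * (?P * ?P * 2 ^ DIM('a)) <= e / 2" by (simp add: \<epsilon>_def)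
  qed
  finally have "(RI x. fN N x * gauss c x) <= e" unfolding eq by simp
  moreover have "0 <= (RI x. fN N x * gauss c x)"
   unfolding eq using c F_nonneg by (intro mult_nonneg_nonneg integral_nonneg_AE AE_I2) auto
  ultimately show ?thesis by simp
 qed
 then show thesis using c0(1) that by blast
qed

end

section \<open>The limit function tested against Gaussians\<close>

locale gm_Lp = gm_tail F V C T for F V C and T :: "'a::euclidean_space itself" +
 fixes g :: "'a => real" and p :: real
 assumes p1: "p > 1" and g_meas [measurable]: "g \<in> borel_measurable borel"
  and lim: "!!x. x \<noteq> 0 ==> ((%N. fN N x) \<longlongrightarrow> g x) at_top"
  and g_Lp: "(NI x. ennreal \<bar>g x\<bar> epowr p) < \<infinity>"
begin

lemma F0: "(F \<longlongrightarrow> 0) at_top"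
proof -
 obtain b :: 'a where "b \<in> Basis" using nonempty_Basis by blast
 then have "norm b = 1" by simp
 moreover from this have "b \<noteq> 0" by auto
 ultimately show ?thesis using F_tendsto_0 lim by blast
qed

lemma g_powr_integrable: "integrable lborel (%x. \<bar>g x\<bar> powr p)"
proof (rule integrableI_nonneg)
 show "(NI x. ennreal (\<bar>g x\<bar> powr p)) < \<infinity>" using g_Lp by (simp add: epowr_ennreal)
qed auto

text \<open>From \<open>|g| <= 1 + |g| powr p\<close> and a Gaussian factor at most 1. This gives
  integrability of \<open>g\<close> against Gaussians without duality.\<close>

lemma g_gauss_bound: "\<bar>g x\<bar> * gauss c y <= gauss c y + \<bar>g x\<bar> powr p"
proof (cases "\<bar>g x\<bar> <= 1")
 case True
 then have "\<bar>g x\<bar> * gauss c y <= 1 * gauss c y" using gauss_bounds(2) by (intro mult_right_mono)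
 then show ?thesis by (simp add: add_increasing2)
next
 case False
 then have "\<bar>g x\<bar> powr 1 <= \<bar>g x\<bar> powr p" using p1 by (intro powr_mono) auto
 moreover have "\<bar>g x\<bar> * gauss c y <= \<bar>g x\<bar> * 1" using gauss_bounds by (intro mult_left_mono) auto
 ultimately show ?thesis using gauss_bounds(2)[of c y] False by simp
qed

lemma g_gauss_integrable: "c > 0 ==> integrable lborel (%x. g x * gauss c (x - x0))"
proof (rule Bochner_Integration.integrable_bound)
 assume "c > 0"
 show "integrable lborel (%x. gauss c (x - x0) + \<bar>g x\<bar> powr p)"
  by (intro Bochner_Integration.integrable_add gauss_integral(3) g_powr_integrable \<open>c > 0\<close>)
 show "AE x in lborel. norm (g x * gauss c (x - x0)) <= norm (gauss c (x - x0) + \<bar>g x\<bar> powr p)"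
 proof (intro AE_I2)
  fix x
  have "0 <= gauss c (x - x0) + \<bar>g x\<bar> powr p" using gauss_bounds(2) by (intro add_nonneg_nonneg) auto
  then show "norm (g x * gauss c (x - x0)) <= norm (gauss c (x - x0) + \<bar>g x\<bar> powr p)"
   using g_gauss_bound[of x c "x - x0"] gauss_bounds(2)[of c "x - x0"] by (simp add: abs_mult)
 qed
qed measurable

lemma g_gauss_small:
 assumes e: "e > 0" and c0: "c0 > 0"
 obtains c where "0 < c" "c <= c0" "\<bar>RI x. g x * gauss c x\<bar> <= e"
proof -
 define c where "c n = c0 / real (Suc n)" for n
 have cp: "c n > 0" "c n <= c0" for n using c0 by (auto simp: c_def field_simps)
 have "(%n. RI x. g x * gauss (c n) x) \<longlonglongrightarrow> (\<integral>x. 0 \<partial>(lborel :: 'a measure))"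
 proof (rule integral_dominated_convergence[where w = "%x. \<bar>g x * gauss c0 x\<bar>"])
  show "integrable lborel (%x. \<bar>g x * gauss c0 x\<bar>)"
   using g_gauss_integrable[OF c0, of 0] by (intro integrable_abs) simp
  show "AE x in lborel. norm (g x * gauss (c n) x) <= \<bar>g x * gauss c0 x\<bar>" for n
  proof (intro AE_I2)
   fix x :: 'a
   have "(norm x / c0)\<^sup>2 <= (norm x / c n)\<^sup>2" using cp c0 by (intro power_mono divide_left_mono) auto
   then have "gauss (c n) x <= gauss c0 x" by (simp add: gauss_def)
   then show "norm (g x * gauss (c n) x) <= \<bar>g x * gauss c0 x\<bar>"
    using gauss_bounds(2)[of "c n" x] gauss_bounds(2)[of c0 x] by (simp add: abs_mult mult_left_mono)
  qed
  show "AE x in lborel. (%n. g x * gauss (c n) x) \<longlonglongrightarrow> 0"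
  proof (rule eventually_mono[OF AE_lborel_singleton[of 0]])
   fix x :: 'a assume x: "x \<noteq> 0"
   have "filterlim (%n. real (Suc n)) at_top sequentially"
    by (rule filterlim_compose[OF filterlim_real_sequentially filterlim_Suc])
   then have "filterlim (%n. (norm x / c0) * real (Suc n)) at_top sequentially"
    using x c0 by (intro filterlim_tendsto_pos_mult_at_top[OF tendsto_const]) auto
   then have "filterlim (%n. ((norm x / c0) * real (Suc n))\<^sup>2) at_top sequentially"
    by (intro filterlim_pow_at_top) auto
   then have "(%n. exp (- ((norm x / c0) * real (Suc n))\<^sup>2)) \<longlonglongrightarrow> 0"
    by (intro filterlim_compose[OF exp_at_bot]) (simp add: filterlim_uminus_at_bot)
   moreover have "gauss (c n) x = exp (- ((norm x / c0) * real (Suc n))\<^sup>2)" for n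
    by (simp add: gauss_def c_def)
   ultimately show "(%n. g x * gauss (c n) x) \<longlonglongrightarrow> 0" by (intro tendsto_mult_right_zero) simp
  qed
 qed measurable
 then have "(%n. RI x. g x * gauss (c n) x) \<longlonglongrightarrow> 0" by simp
 from tendstoD[OF this e] obtain n where "\<bar>RI x. g x * gauss (c n) x\<bar> < e"
  by (auto simp: eventually_sequentially)
 then show thesis using cp[of n] by (intro that[of "c n"]) auto
qed

text \<open>Near the origin \<open>|g - fN|\<close> is only known to be \<open>O(|x|\<^sup>-\<^sup>(\<^sup>d\<^sup>+\<^sup>1\<^sup>)\<^sup>/\<^sup>2)\<close>, which is not
  integrable for \<open>d = 1\<close>. Subtracting a narrow Gaussian makes the test function vanish at the
  origin; positivity of its Fourier transform keeps the correction small uniformly in \<open>N\<close>.\<close>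

lemma limit_gauss:
 assumes c: "c > 0"
 shows "(%M. RI x. fN (tw (int M)) x * gauss c (x - x0)) \<longlonglongrightarrow> (RI x. g x * gauss c (x - x0))"
proof (rule LIMSEQ_I)
 fix r :: real assume r: "r > 0"
 define e where "e = r / 3"
 have e: "e > 0" using r by (simp add: e_def)
 obtain c1 where c1: "c1 > 0" "!!c N. 0 < c ==> c <= c1 ==> \<bar>RI x. fN N x * gauss c x\<bar> <= e"
  using fN_gauss_small[OF F0 e] by blast
 obtain a where a: "0 < a" "a <= c1" "\<bar>RI x. g x * gauss a x\<bar> <= e"
  using g_gauss_small[OF e c1(1)] by blast
 define \<omega> where "\<omega> = gauss c x0"
 have om: "0 <= \<omega>" "\<omega> <= 1" using gauss_bounds by (auto simp: \<omega>_def)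
 \<comment> \<open>Since the narrow Gaussian is 1 at the origin, the coefficient
   \<open>\<omega>\<close> is exactly the one that makes \<open>W\<close> vanish there.\<close>
 define W where "W x = gauss c (x - x0) - \<omega> * gauss a x" for x
 have Wm [measurable]: "W \<in> borel_measurable borel" unfolding W_def[abs_def] by measurable
 define Lc where "Lc = 1 / c + 1 / a"
 have Lc: "Lc > 0" using c a by (simp add: Lc_def add_pos_pos)
 have W1: "\<bar>W x\<bar> <= Lc * norm x" for x
 proof -
  have "\<bar>gauss c (x - x0) - gauss c x0\<bar> <= \<bar>norm (x - x0) / c - norm x0 / c\<bar>"
   unfolding gauss_def by (rule exp_square_lipschitz)
  also have "... = \<bar>norm (x - x0) - norm x0\<bar> / c" using c by (simp add: diff_divide_distrib[symmetric])
  also have "... <= norm x / c"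
   using c norm_triangle_ineq3[of "x - x0" "- x0"] by (intro divide_right_mono) auto
  finally have 1: "\<bar>gauss c (x - x0) - gauss c x0\<bar> <= norm x / c" .
  have "\<bar>gauss a (0::'a) - gauss a x\<bar> <= \<bar>norm (0::'a) / a - norm x / a\<bar>"
   unfolding gauss_def by (rule exp_square_lipschitz)
  then have "\<bar>1 - gauss a x\<bar> <= norm x / a" using a by (simp add: gauss_def)
  then have "\<omega> * \<bar>1 - gauss a x\<bar> <= 1 * (norm x / a)" using om a by (intro mult_mono) auto
  then have 2: "\<bar>\<omega> * (1 - gauss a x)\<bar> <= norm x / a" using om by (simp add: abs_mult)
  have "W x = (gauss c (x - x0) - gauss c x0) + \<omega> * (1 - gauss a x)"
   by (simp add: W_def \<omega>_def algebra_simps)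
  then have "\<bar>W x\<bar> <= norm x / c + norm x / a" using 1 2 by linarith
  then show ?thesis by (simp add: Lc_def algebra_simps)
 qed
 have W2: "\<bar>W x\<bar> <= gauss c (x - x0) + gauss a x" for x
 proof -
  have "\<omega> * gauss a x <= 1 * gauss a x" "0 <= \<omega> * gauss a x" using om gauss_bounds(2)[of a x] by (intro mult_right_mono mult_nonneg_nonneg; simp)+
  then show ?thesis using gauss_bounds(2)[of c "x - x0"] by (simp add: W_def abs_le_iff)
 qed
 \<comment> \<open>An integrable majorant of
   \<open>norm x powr - ((d + 1) / 2) * \<bar>W x\<bar>\<close>: near 0 the Lipschitz bound on
   \<open>W\<close> leaves the power \<open>- d + (d + 1) / 2\<close>, written in logarithmic form
   so that \<open>nn_integral_norm_powr_log\<close> applies; elsewhere the Gaussians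
   dominate.\<close>
 define Q where "Q x = Lc * (norm x powr - real DIM('a) * 2 powr - (((real DIM('a) + 1) / 2) * \<bar>real_of_int 0 + log 2 (norm x)\<bar>)) + (gauss c (x - x0) + gauss a x)" for x :: 'a
 obtain J where J: "J > 0" "!!n::int. (\<integral>\<^sup>+x. ennreal (norm x powr - real DIM('a) * 2 powr - (((real DIM('a) + 1) / 2) * \<bar>real_of_int n + log 2 (norm x)\<bar>)) \<partial>(lborel :: 'a measure)) <= ennreal J"
  using nn_integral_norm_powr_log[of "(real DIM('a) + 1) / 2", where ?'a = 'a] by auto
 have iJ: "integrable lborel (%x::'a. norm x powr - real DIM('a) * 2 powr - (((real DIM('a) + 1) / 2) * \<bar>real_of_int 0 + log 2 (norm x)\<bar>))"
  by (rule integrableI_nonneg) (use J(2)[of 0] in \<open>auto intro: le_less_trans\<close>)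
 have iQ: "integrable lborel Q" unfolding Q_def[abs_def]
  by (intro Bochner_Integration.integrable_add integrable_mult_right iJ gauss_integral c a)
 have QW: "norm x powr - ((real DIM('a) + 1) / 2) * \<bar>W x\<bar> <= Q x" if x: "x \<noteq> 0" for x
 proof (cases "norm x <= 1")
  case True
  have nx: "norm x > 0" using x by simp
  have l: "log 2 (norm x) <= 0" using True nx by (simp add: log_le_zero_cancel_iff)
  have "norm x powr - ((real DIM('a) + 1) / 2) * \<bar>W x\<bar> <= norm x powr - ((real DIM('a) + 1) / 2) * (Lc * norm x)" by (intro mult_left_mono W1) auto
  also have "... = Lc * (norm x powr - ((real DIM('a) + 1) / 2) * norm x powr 1)" using nx by simp
  also have "norm x powr - ((real DIM('a) + 1) / 2) * norm x powr 1 = norm x powr (- real DIM('a) + ((real DIM('a) + 1) / 2))"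
  proof -
   have "- ((real DIM('a) + 1) / 2) + 1 = - real DIM('a) + (real DIM('a) + 1) / 2" by (simp add: field_simps)
   then show ?thesis by (simp only: powr_add[symmetric])
  qed
  also have "... = norm x powr - real DIM('a) * (2 powr (log 2 (norm x))) powr ((real DIM('a) + 1) / 2)"
  proof -
   have "2 powr (log 2 (norm x)) = norm x" using nx by simp
   then show ?thesis by (simp only: powr_add)
  qed
  also have "(2 powr (log 2 (norm x))) powr ((real DIM('a) + 1) / 2) = 2 powr - (((real DIM('a) + 1) / 2) * \<bar>real_of_int 0 + log 2 (norm x)\<bar>)"
   using l by (simp only: powr_powr) (simp add: mult.commute)
  also have "Lc * (norm x powr - real DIM('a) * 2 powr - (((real DIM('a) + 1) / 2) * \<bar>real_of_int 0 + log 2 (norm x)\<bar>)) <= Q x"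
   using gauss_bounds(2)[of c "x - x0"] gauss_bounds(2)[of a x] by (simp add: Q_def)
  finally show ?thesis .
 next
  case False
  have E0: "((real DIM('a) + 1) / 2) >= 0" by simp
  have "norm x powr - ((real DIM('a) + 1) / 2) <= 1 powr - ((real DIM('a) + 1) / 2)" using False E0 by (intro powr_mono2') auto
  then have "norm x powr - ((real DIM('a) + 1) / 2) * \<bar>W x\<bar> <= 1 * (gauss c (x - x0) + gauss a x)" using W2[of x] by (intro mult_mono) auto
  also have "... <= Q x" using Lc by (simp add: Q_def)
  finally show ?thesis .
 qed
 define Z where "Z = (RI x. Q x)"
 define \<rho> where "\<rho> M = kconst TYPE('a) 0 * (1 + 2 powr ((real DIM('a) - 1) / 2)) * vtail DIM('a) V M" for M
 have rho0: "\<rho> \<longlonglongrightarrow> 0"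
 proof -
  have "(%M. kconst TYPE('a) 0 * (1 + 2 powr ((real DIM('a) - 1) / 2)) * vtail DIM('a) V M) \<longlonglongrightarrow> kconst TYPE('a) 0 * (1 + 2 powr ((real DIM('a) - 1) / 2)) * 0"
   by (intro tendsto_intros tail_tendsto)
  then show ?thesis by (simp add: \<rho>_def[abs_def])
 qed
 have "(%M. \<rho> M * Z) \<longlonglongrightarrow> 0 * Z" by (intro tendsto_intros rho0)
 then have "\<forall>\<^sub>F M in sequentially. \<bar>\<rho> M * Z\<bar> < e" using tendstoD[OF _ e] by fastforce
 moreover have "\<bar>(RI x. fN (tw (int M)) x * gauss c (x - x0)) - (RI x. g x * gauss c (x - x0))\<bar> <= \<rho> M * Z + 2 * e" for M
 proof -
  let ?f = "fN (tw (int M))"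
  have i1: "integrable lborel (%x. ?f x * gauss c (x - x0))" "integrable lborel (%x. g x * gauss c (x - x0))"
   "integrable lborel (%x. ?f x * gauss a x)" "integrable lborel (%x. g x * gauss a x)"
   using fN_gauss_integrable[OF c] g_gauss_integrable[OF c] fN_gauss_integrable[OF a(1), of _ 0] g_gauss_integrable[OF a(1), of 0] by auto
  let ?D = "%x. (?f x - g x) * W x"
  have Deq: "?D = (%x. (?f x * gauss c (x - x0) - g x * gauss c (x - x0)) - \<omega> * (?f x * gauss a x - g x * gauss a x))"
   by (intro ext) (simp add: W_def algebra_simps)
  have iD: "integrable lborel ?D" unfolding Deq
   by (intro Bochner_Integration.integrable_diff integrable_mult_right i1)
  have "(RI x. ?D x) = ((RI x. ?f x * gauss c (x - x0)) - (RI x. g x * gauss c (x - x0))) - \<omega> * ((RI x. ?f x * gauss a x) - (RI x. g x * gauss a x))"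
   unfolding Deq
   by (simp only: Bochner_Integration.integral_diff[OF Bochner_Integration.integrable_diff[OF i1(1,2)] integrable_mult_right[OF Bochner_Integration.integrable_diff[OF i1(3,4)]]]
     integral_mult_right_zero Bochner_Integration.integral_diff[OF i1(1,2)] Bochner_Integration.integral_diff[OF i1(3,4)])
  moreover have "\<bar>RI x. ?D x\<bar> <= (RI x. \<rho> M * Q x)"
  proof -
   have "\<bar>RI x. ?D x\<bar> <= (RI x. \<bar>?D x\<bar>)" by (rule integral_abs_bound)
   also have "... <= (RI x. \<rho> M * Q x)"
   proof (rule integral_mono_AE)
    show "integrable lborel (%x. \<bar>?D x\<bar>)" using iD by (rule integrable_abs)
    show "integrable lborel (%x. \<rho> M * Q x)" by (intro integrable_mult_right iQ)
    show "AE x in lborel. \<bar>?D x\<bar> <= \<rho> M * Q x"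
    proof (rule eventually_mono[OF AE_lborel_singleton[of 0]])
     fix x :: 'a assume x: "x \<noteq> 0"
     have k: "\<bar>?f x - g x\<bar> <= \<rho> M * norm x powr - ((real DIM('a) + 1) / 2)"
      using fN_rate[OF F0 x lim[OF x], of M] by (simp add: \<rho>_def abs_minus_commute)
     have rp: "\<rho> M >= 0"
     proof -
      have "vtail DIM('a) V M >= 0" using F_tail[OF F0, of M] F_nonneg[of "tw (int M)"]
       by (meson mult_nonneg_nonneg order_trans powr_ge_zero)
      then show ?thesis using kconst(1)[of 0, where ?'a = 'a] by (simp add: \<rho>_def)
     qed
     have "\<bar>?D x\<bar> <= \<rho> M * norm x powr - ((real DIM('a) + 1) / 2) * \<bar>W x\<bar>" unfolding abs_mult using k by (intro mult_right_mono) auto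
     also have "... <= \<rho> M * Q x" using QW[OF x] rp by (simp add: mult.assoc mult_left_mono)
     finally show "\<bar>?D x\<bar> <= \<rho> M * Q x" .
    qed
   qed
   finally show ?thesis .
  qed
  moreover have "\<bar>\<omega> * ((RI x. ?f x * gauss a x) - (RI x. g x * gauss a x))\<bar> <= 2 * e"
  proof -
   have "\<bar>(RI x. ?f x * gauss a x) - (RI x. g x * gauss a x)\<bar> <= 2 * e"
    using c1(2)[OF a(1,2), of "tw (int M)"] a(3) by (simp add: abs_le_iff)
   then have "\<omega> * \<bar>(RI x. ?f x * gauss a x) - (RI x. g x * gauss a x)\<bar> <= 1 * (2 * e)"
    using om by (intro mult_mono) auto
   then show ?thesis using om by (simp add: abs_mult)
  qed
  ultimately show ?thesis unfolding Z_def integral_mult_right_zero by linarith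
 qed
 ultimately have "\<forall>\<^sub>F M in sequentially. norm ((RI x. fN (tw (int M)) x * gauss c (x - x0)) - (RI x. g x * gauss c (x - x0))) < r"
 proof (elim eventually_mono)
  fix M assume a: "\<bar>\<rho> M * Z\<bar> < e"
  have b: "\<bar>(RI x. fN (tw (int M)) x * gauss c (x - x0)) - (RI x. g x * gauss c (x - x0))\<bar> <= \<rho> M * Z + 2 * e"
   using \<open>!!M. \<bar>(RI x. fN (tw (int M)) x * gauss c (x - x0)) - (RI x. g x * gauss c (x - x0))\<bar> <= \<rho> M * Z + 2 * e\<close> .
  have "r = e + 2 * e" by (simp add: e_def)
  then show "norm ((RI x. fN (tw (int M)) x * gauss c (x - x0)) - (RI x. g x * gauss c (x - x0))) < r"
   using a b unfolding real_norm_def by linarith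
 qed
 then show "\<exists>no. \<forall>M\<ge>no. norm ((RI x. fN (tw (int M)) x * gauss c (x - x0)) - (RI x. g x * gauss c (x - x0))) < r"
  by (simp only: eventually_sequentially)
qed

text \<open>Translating the function is the same as moving the centre of the Gaussian, so the
  induction on \<open>k\<close> requires arbitrary centres \<open>x0\<close>.\<close>

lemma limit_sdiff:
 assumes c: "c > 0"
 shows "(\<forall>M. integrable lborel (%x. sdiff k h (fN (tw (int M))) x * gauss c (x - x0))) \<and>
  integrable lborel (%x. sdiff k h g x * gauss c (x - x0)) \<and>
  (%M. RI x. sdiff k h (fN (tw (int M))) x * gauss c (x - x0)) \<longlonglongrightarrow> (RI x. sdiff k h g x * gauss c (x - x0))"
proof (induction k arbitrary: x0)
 case 0
 show ?case using fN_gauss_integrable[OF c] g_gauss_integrable[OF c] limit_gauss[OF c] by simp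
next
 case (Suc k)
 have tr: "integrable lborel (%x. v (x + a) * gauss c (x - x0)) \<and> (RI x. v (x + a) * gauss c (x - x0)) = (RI x. v x * gauss c (x - (x0 + a)))"
  if "integrable lborel (%x. v x * gauss c (x - (x0 + a)))" for v :: "'a => real" and a
  using lborel_integrable_translate[OF that, of a] by simp
 have step: "integrable lborel (%x. (2 * v x - v (x + h) - v (x - h)) * gauss c (x - x0)) \<and>
   (RI x. (2 * v x - v (x + h) - v (x - h)) * gauss c (x - x0)) =
   2 * (RI x. v x * gauss c (x - x0)) - (RI x. v x * gauss c (x - (x0 + h))) - (RI x. v x * gauss c (x - (x0 + - h)))"
  if i: "!!x0. integrable lborel (%x. v x * gauss c (x - x0))" for v
 proof -
  note t1 = tr[OF i, of h] and t2 = tr[OF i, of "- h"]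
  have eq: "(%x. (2 * v x - v (x + h) - v (x - h)) * gauss c (x - x0)) = (%x. 2 * (v x * gauss c (x - x0)) - v (x + h) * gauss c (x - x0) - v (x + - h) * gauss c (x - x0))"
   by (intro ext) (simp add: algebra_simps)
  have i2: "integrable lborel (%x. 2 * (v x * gauss c (x - x0)) - v (x + h) * gauss c (x - x0))"
   by (intro Bochner_Integration.integrable_diff integrable_mult_right i t1[THEN conjunct1])
  show ?thesis unfolding eq
   by (simp only: Bochner_Integration.integral_diff[OF i2 t2[THEN conjunct1]] Bochner_Integration.integrable_diff[OF i2 t2[THEN conjunct1]]
     Bochner_Integration.integral_diff[OF integrable_mult_right[OF i] t1[THEN conjunct1]] integral_mult_right_zero t1[THEN conjunct2] t2[THEN conjunct2] simp_thms)
 qed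
 have iM: "integrable lborel (%x. sdiff k h (fN (tw (int M))) x * gauss c (x - x0))" for M x0 using Suc by blast
 have ig: "integrable lborel (%x. sdiff k h g x * gauss c (x - x0))" for x0 using Suc by blast
 have l: "(%M. RI x. sdiff k h (fN (tw (int M))) x * gauss c (x - x0)) \<longlonglongrightarrow> (RI x. sdiff k h g x * gauss c (x - x0))" for x0
  using Suc by blast
 show ?case unfolding sdiff.simps
 proof (intro conjI allI)
  show "integrable lborel (%x. (2 * sdiff k h (fN (tw (int M))) x - sdiff k h (fN (tw (int M))) (x + h) - sdiff k h (fN (tw (int M))) (x - h)) * gauss c (x - x0))" for M
   using step[OF iM] by blast
  show "integrable lborel (%x. (2 * sdiff k h g x - sdiff k h g (x + h) - sdiff k h g (x - h)) * gauss c (x - x0))"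
   using step[OF ig] by blast
  show "(%M. RI x. (2 * sdiff k h (fN (tw (int M))) x - sdiff k h (fN (tw (int M))) (x + h) - sdiff k h (fN (tw (int M))) (x - h)) * gauss c (x - x0))
    \<longlonglongrightarrow> (RI x. (2 * sdiff k h g x - sdiff k h g (x + h) - sdiff k h g (x - h)) * gauss c (x - x0))"
   unfolding step[OF iM, THEN conjunct2] step[OF ig, THEN conjunct2]
   by (intro tendsto_intros l)
 qed
qed

text \<open>With nonnegative symbol, \<open>F\<close> and Gaussian, the integral over a fixed ball
  is at most the one over any larger ball, and the latter converge to the test of \<open>g\<close>.
  Any part of the frequency side may thus be discarded.\<close>

lemma test_lower:
 assumes c: "c > 0"
 shows "(RI y. indicator (cball 0 N) y * (F (norm y) * (2 - 2 * cos (h \<bullet> y)) ^ k) * (pi powr (real DIM('a) / 2) * c ^ DIM('a) * exp (- (c * norm y / 2)\<^sup>2)))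
  <= (RI x. sdiff k h g x * gauss c x)"
proof -
 let ?\<psi> = "%y. (2 - 2 * cos (h \<bullet> y)) ^ k"
 let ?A = "%N y. indicator (cball 0 N) y * (F (norm y) * ?\<psi> y) * (pi powr (real DIM('a) / 2) * c ^ DIM('a) * exp (- (c * norm y / 2)\<^sup>2))"
 have psi: "0 <= ?\<psi> y" "\<bar>?\<psi> y\<bar> <= 4 ^ k" for y
 proof -
  have "0 <= 2 - 2 * cos (h \<bullet> y)" "2 - 2 * cos (h \<bullet> y) <= 4"
   using cos_le_one[of "h \<bullet> y"] cos_ge_minus_one[of "h \<bullet> y"] by linarith+
  then show "0 <= ?\<psi> y" "\<bar>?\<psi> y\<bar> <= 4 ^ k" by (auto simp: power_mono)
 qed
 have sd: "sdiff k h (fN N) x = (RI y. indicator (cball 0 N) y * (F (norm y) * (?\<psi> y * cos (x \<bullet> y))))" for N x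
 proof -
  have "integrable lborel (%y. (indicator (cball 0 N) y * F (norm y)) * cos (x \<bullet> y))" for x :: 'a
   using int_cos[of N x] by (simp add: mult.assoc)
  from sdiff_integral[where M = lborel and w = "%y. indicator (cball 0 N) y * F (norm y)" and g = "%x y. cos (x \<bullet> y)" and k = k and h = h and x = x, OF this]
  show ?thesis by (simp add: fN_def[abs_def] sdiff_cos mult.assoc)
 qed
 have T: "(RI x. sdiff k h (fN N) x * gauss c x) = (RI y. ?A N y)" for N
  unfolding sd by (rule gauss_pair[OF _ psi(2) c]) measurable
 have iA: "integrable lborel (?A N)" for N
 proof (rule Bochner_Integration.integrable_bound[OF integrable_mult_left[OF F_int[of N], of "4 ^ k * (pi powr (real DIM('a) / 2) * c ^ DIM('a))"]])
  show "AE y in lborel. norm (?A N y) <= norm (indicator (cball 0 N) (y::'a) * F (norm y) * (4 ^ k * (pi powr (real DIM('a) / 2) * c ^ DIM('a))))"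
  proof (intro AE_I2)
   fix y :: 'a
   have "?\<psi> y * exp (- (c * norm y / 2)\<^sup>2) <= 4 ^ k * 1" using psi[of y] by (intro mult_mono) auto
   then have "(indicator (cball 0 N) y * F (norm y) * (pi powr (real DIM('a) / 2) * c ^ DIM('a))) * (?\<psi> y * exp (- (c * norm y / 2)\<^sup>2))
    <= (indicator (cball 0 N) y * F (norm y) * (pi powr (real DIM('a) / 2) * c ^ DIM('a))) * (4 ^ k * 1)"
    using F_nonneg c by (intro mult_left_mono) auto
   moreover have "0 <= ?A N y" using psi(1) F_nonneg c by (intro mult_nonneg_nonneg) auto
   moreover have "0 <= indicator (cball 0 N) y * F (norm y) * (4 ^ k * (pi powr (real DIM('a) / 2) * c ^ DIM('a)))" using F_nonneg c by (intro mult_nonneg_nonneg) auto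
   ultimately show "norm (?A N y) <= norm (indicator (cball 0 N) (y::'a) * F (norm y) * (4 ^ k * (pi powr (real DIM('a) / 2) * c ^ DIM('a))))"
    unfolding real_norm_def by (simp add: mult_ac)
  qed
 qed measurable
 have "(%M. RI x. sdiff k h (fN (tw (int M))) x * gauss c x) \<longlonglongrightarrow> (RI x. sdiff k h g x * gauss c x)"
  using limit_sdiff[OF c, of k h 0] by simp
 then have "(%M. RI y. ?A (tw (int M)) y) \<longlonglongrightarrow> (RI x. sdiff k h g x * gauss c x)" unfolding T .
 moreover have "\<forall>\<^sub>F M in sequentially. tw (int M) >= N"
  using tw_at_top[of 0] by (simp add: filterlim_at_top)
 then have "\<forall>\<^sub>F M in sequentially. (RI y. ?A N y) <= (RI y. ?A (tw (int M)) y)"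
 proof eventually_elim
  case (elim M)
  show ?case
  proof (rule integral_mono[OF iA iA])
   fix y :: 'a
   have "indicator (cball 0 N) y <= (indicator (cball 0 (tw (int M))) y :: real)" using elim by (auto simp: indicator_def)
   then show "?A N y <= ?A (tw (int M)) y" using psi(1) F_nonneg c by (intro mult_right_mono) auto
  qed
 qed
 ultimately show ?thesis by (rule tendsto_lowerbound) simp
qed

end

text \<open>Hoelder's inequality with respect to a measure of mass at most \<open>a\<close>, up to
  the factor \<open>2 powr p\<close>, obtained by splitting at a level and then choosing the
  level.\<close>

lemma nn_integral_powr_le:
 fixes X v :: "'a => ennreal"
 assumes [measurable]: "X \<in> borel_measurable M" "v \<in> borel_measurable M"
  and p: "p > 1" and a: "(\<integral>\<^sup>+x. v x \<partial>M) <= ennreal a" "a > 0"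
 shows "(\<integral>\<^sup>+x. X x * v x \<partial>M) epowr p <= ennreal (2 powr p * a powr (p - 1)) * (\<integral>\<^sup>+x. X x epowr p * v x \<partial>M)"
proof -
 let ?B = "\<integral>\<^sup>+x. X x epowr p * v x \<partial>M"
 \<comment> \<open>Below the level \<open>l\<close> this is trivial; above it
   \<open>x = x powr (1 - p) * x powr p\<close> with a negative first exponent.\<close>
 have pt: "x <= ennreal l + ennreal (l powr (1 - p)) * x epowr p" if l: "l > 0" for x l
 proof (cases x)
  case (real r)
  show ?thesis
  proof (cases "r <= l")
   case True
   then have "x <= ennreal l" using real l by (simp add: ennreal_le_iff)
   then show ?thesis by (simp add: add_increasing2)
  next
   case False
   then have "r powr (1 - p) <= l powr (1 - p)" using l p by (intro powr_mono2') auto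
   then have "r powr (1 - p) * r powr p <= l powr (1 - p) * r powr p" by (intro mult_right_mono) auto
   moreover have "r powr (1 - p) * r powr p = r" using False l by (simp add: powr_add[symmetric])
   ultimately have "ennreal r <= ennreal (l powr (1 - p) * r powr p)" by (simp add: ennreal_leI)
   also have "... = ennreal (l powr (1 - p)) * x epowr p" using real by (simp add: epowr_ennreal ennreal_mult)
   finally show ?thesis using real by (simp add: add_increasing)
  qed
 next
  case top
  have "ennreal (l powr (1 - p)) \<noteq> 0" using l by simp
  then show ?thesis using top by (simp add: ennreal_mult_top)
 qed
 have est: "(\<integral>\<^sup>+x. X x * v x \<partial>M) <= ennreal l * ennreal a + ennreal (l powr (1 - p)) * ?B" if l: "l > 0" for l
 proof -
  have "(\<integral>\<^sup>+x. X x * v x \<partial>M) <= (\<integral>\<^sup>+x. ennreal l * v x + ennreal (l powr (1 - p)) * (X x epowr p * v x) \<partial>M)"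
  proof (intro nn_integral_mono)
   fix x
   have "X x * v x <= (ennreal l + ennreal (l powr (1 - p)) * X x epowr p) * v x" by (intro mult_right_mono pt l) auto
   then show "X x * v x <= ennreal l * v x + ennreal (l powr (1 - p)) * (X x epowr p * v x)"
    by (simp only: distrib_right mult.assoc)
  qed
  also have "... = ennreal l * (\<integral>\<^sup>+x. v x \<partial>M) + ennreal (l powr (1 - p)) * ?B"
   by (subst nn_integral_add, simp, simp, subst nn_integral_cmult, simp, subst nn_integral_cmult) simp_all
  also have "... <= ennreal l * ennreal a + ennreal (l powr (1 - p)) * ?B"
   by (intro add_right_mono mult_left_mono a) auto
  finally show ?thesis .
 qed
 show ?thesis
 proof (cases "?B = \<infinity>")
  case True
  have "ennreal (2 powr p * a powr (p - 1)) \<noteq> 0" using a(2) by simp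
  then have "ennreal (2 powr p * a powr (p - 1)) * ?B = \<infinity>" using True by (simp add: ennreal_mult_top)
  then show ?thesis by simp
 next
  case False
  then obtain b where b: "?B = ennreal b" "b >= 0" by (cases ?B) auto
  show ?thesis
  proof (cases "b = 0")
   case True
   then have "AE x in M. X x epowr p * v x = 0" using b by (subst nn_integral_0_iff_AE[symmetric]) auto
   then have "AE x in M. X x * v x = 0"
   proof (rule eventually_mono)
    fix x assume "X x epowr p * v x = 0"
    moreover have "X x = 0" if "X x epowr p = 0"
     using that by (cases "X x") (auto simp: epowr_ennreal)
    ultimately show "X x * v x = 0" by auto
   qed
   then have "(\<integral>\<^sup>+x. X x * v x \<partial>M) = 0" by (subst nn_integral_0_iff_AE) auto
   then show ?thesis by simp
  next
   case False
   then have b0: "b > 0" using b by simp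
   \<comment> \<open>The level balances the two terms: both become
     \<open>b powr (1 / p) * a powr (1 - 1 / p)\<close>.\<close>
   define l where "l = (b / a) powr (1 / p)"
   have l: "l > 0" using b0 a by (simp add: l_def)
   let ?Q = "b powr (1 / p) * a powr (1 - 1 / p)"
   have e1: "l * a = ?Q"
   proof -
    have "l * a = b powr (1 / p) * (a powr 1 / a powr (1 / p))" using a b0 by (simp add: l_def powr_divide)
    then show ?thesis by (simp only: powr_diff)
   qed
   have e2: "l powr (1 - p) * b = ?Q"
   proof -
    have lp: "l powr p = b / a" using p b0 a by (simp add: l_def powr_powr)
    have "l powr (1 - p) * b = l * (b / l powr p)" using l by (simp add: powr_diff)
    also have "... = l * a" using lp b0 a by simp
    finally show ?thesis using e1 by simp
   qed
   have "(\<integral>\<^sup>+x. X x * v x \<partial>M) <= ennreal l * ennreal a + ennreal (l powr (1 - p)) * ennreal b" using est[OF l] b by simp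
   also have "... = ennreal (l * a) + ennreal (l powr (1 - p) * b)" using l a b by (simp add: ennreal_mult)
   also have "... = ennreal (2 * ?Q)" unfolding e1 e2 by (subst ennreal_plus[symmetric]) auto
   finally have "(\<integral>\<^sup>+x. X x * v x \<partial>M) epowr p <= ennreal (2 * ?Q) epowr p" using p by (intro epowr_mono) auto
   also have "... = ennreal ((2 * ?Q) powr p)" by (rule epowr_ennreal) simp
   also have "(2 * ?Q) powr p = 2 powr p * a powr (p - 1) * b"
   proof -
    have "(1 - 1 / p) * p = p - 1" using p by (simp add: field_simps)
    then show ?thesis using p b0 a by (simp add: powr_mult powr_powr mult_ac)
   qed
   also have "ennreal (2 powr p * a powr (p - 1) * b) = ennreal (2 powr p * a powr (p - 1)) * ?B"
    using b by (simp add: ennreal_mult)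
   finally show ?thesis .
  qed
 qed
qed

text \<open>For \<open>u <= 1\<close> the power alone has the required size. For
  \<open>u > 1\<close> a single term of the exponential series shows that
  \<open>u powr (2 * b)\<close> is at most a constant times \<open>exp (u ^ 2)\<close>. The result
  replaces Gaussians by geometric weights in dyadic scales.\<close>

lemma powr_gauss_bound:
 assumes b: "b > 0"
 obtains K where "K > 0" "!!u::real. u > 0 ==> u powr b * exp (- u\<^sup>2) <= K * 2 powr - (b * \<bar>log 2 u\<bar>)"
proof -
 define m where "m = nat \<lceil>b\<rceil>"
 have bm: "b <= real m" unfolding m_def by (rule real_nat_ceiling_ge)
 have main: "u powr b * exp (- u\<^sup>2) <= fact m * 2 powr - (b * \<bar>log 2 u\<bar>)" if u: "u > 0" for u :: real
 proof (cases "u <= 1")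
  case True
  have l: "log 2 u <= 0" using True u by (simp add: log_le_zero_cancel_iff)
  have ub: "u powr b = 2 powr - (b * \<bar>log 2 u\<bar>)"
  proof -
   have "u powr b = (2 powr log 2 u) powr b" using u by simp
   also have "... = 2 powr - (b * \<bar>log 2 u\<bar>)" using l by (simp only: powr_powr) (simp add: mult.commute)
   finally show ?thesis .
  qed
  have "u powr b * exp (- u\<^sup>2) <= u powr b * 1" by (intro mult_left_mono) auto
  also have "... <= fact m * u powr b" by (simp add: fact_ge_1 mult_le_cancel_right1)
  finally show ?thesis unfolding ub .
 next
  case False
  have l: "log 2 u >= 0" using False by simp
  have ub: "u powr - b = 2 powr - (b * \<bar>log 2 u\<bar>)"
  proof -
   have "u powr - b = (2 powr log 2 u) powr - b" using u by simp
   also have "... = 2 powr - (b * \<bar>log 2 u\<bar>)" using l by (simp only: powr_powr) (simp add: mult.commute)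
   finally show ?thesis .
  qed
  have "(u\<^sup>2) powr b <= (u\<^sup>2) powr real m" using bm False by (intro powr_mono) (auto simp: one_le_power)
  also have "... = (u\<^sup>2) ^ m" using u by (intro powr_realpow) simp
  also have "(u\<^sup>2) ^ m <= fact m * exp (u\<^sup>2)"
  proof -
   have "(\<Sum>n\<in>{m}. (u\<^sup>2) ^ n /\<^sub>R fact n) <= (\<Sum>n. (u\<^sup>2) ^ n /\<^sub>R fact n)"
    using exp_converges[of "u\<^sup>2"] by (intro sum_le_suminf) (auto simp: sums_iff)
   also have "... = exp (u\<^sup>2)" using exp_converges[of "u\<^sup>2"] by (simp add: sums_iff)
   finally show ?thesis by (simp add: field_simps)
  qed
  finally have "(u\<^sup>2) powr b * exp (- u\<^sup>2) <= fact m" by (simp add: exp_minus field_simps)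
  moreover have "(u\<^sup>2) powr b = u powr b * u powr b" using u by (simp add: power2_eq_square powr_mult)
  ultimately have "(u powr b * exp (- u\<^sup>2)) * u powr b <= fact m" by (simp add: mult_ac)
  then have "(u powr b * exp (- u\<^sup>2)) * u powr b * u powr - b <= fact m * u powr - b" by (intro mult_right_mono) auto
  moreover have "(u powr b * exp (- u\<^sup>2)) * u powr b * u powr - b = u powr b * exp (- u\<^sup>2)"
   using u by (simp add: powr_minus)
  ultimately show ?thesis unfolding ub by simp
 qed
 show thesis by (rule that[OF _ main]) auto
qed

text \<open>Averaging over the step needs measurability in \<open>h\<close> and \<open>x\<close>
  jointly.\<close>

lemma sdiff_measurable_pair:
 fixes g :: "'a::euclidean_space => real"
 assumes [measurable]: "g \<in> borel_measurable borel"
 shows "(%(h, x). sdiff k h g x) \<in> borel_measurable (borel \<Otimes>\<^sub>M borel)"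
proof (induction k)
 case (Suc k)
 define G where "G = (%(h, x). sdiff k h g x)"
 have [measurable]: "G \<in> borel_measurable (borel \<Otimes>\<^sub>M borel)" unfolding G_def by (rule Suc)
 have eq: "(%(h, x). sdiff (Suc k) h g x) = (%z. 2 * G (fst z, snd z) - G (fst z, snd z + fst z) - G (fst z, snd z - fst z))"
  by (auto simp: fun_eq_iff G_def)
 show ?case unfolding eq by measurable
qed simp

text \<open>Bernoulli's inequality bounds the symbol below by
  \<open>1 + k * (1 - 2 * cos (h \<bullet> y))\<close>. The average of the cosine over the ball is
  the normalized ball kernel, at most 1/2 once \<open>norm y * t\<close> is large, so the average of
  the symbol is at least 1.\<close>

lemma ball_average_lower:
 obtains R0 where "R0 > 0" "!!t (y::'a::euclidean_space). t > 0 ==> R0 <= norm y * t ==>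
  ennreal (unit_ball_vol (real DIM('a)) * t ^ DIM('a)) <= (NI h. ennreal ((2 - 2 * cos (h \<bullet> y)) ^ k) * indicator (cball 0 t) h)"
proof -
 let ?d = "DIM('a)" and ?E = "(real DIM('a) + 1) / 2"
 have [measurable]: "cball 0 s \<in> sets (borel :: 'a measure)" for s by (intro borel_closed closed_cball)
 define kp where "kp = unit_ball_vol (real ?d)"
 have kap: "kp > 0" by (simp add: kp_def)
 define kc where "kc = kconst TYPE('a) 0"
 have kc: "kc > 0" by (simp add: kc_def kconst)
 \<comment> \<open>From here on the decay of the ball kernel keeps it below half the volume of the
   ball.\<close>
 define R0 where "R0 = (2 * kc / kp) powr (1 / ?E)"
 have E0: "?E > 0" by (intro divide_pos_pos add_nonneg_pos) auto
 have R0: "R0 > 0" using kap kc by (simp add: R0_def)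
 have main: "ennreal (kp * t ^ ?d) <= (NI h. ennreal ((2 - 2 * cos (h \<bullet> y)) ^ k) * indicator (cball 0 t) h)"
  if t: "t > 0" and y: "R0 <= norm y * t" for t and y :: 'a
 proof -
  have ny: "norm y * t > 0" using y R0 by linarith
  have "\<bar>ball_kernel t y\<bar> <= kc * t ^ ?d * (1 + t * norm y) powr - ?E"
   using kconst(2)[OF t, of 0 0 y] by (simp add: kc_def)
  also have "... <= kc * t ^ ?d * R0 powr - ?E"
   using kc t y R0 E0 by (intro mult_left_mono powr_mono2') (auto simp: mult.commute)
  also have "R0 powr - ?E = kp / (2 * kc)"
  proof -
   have "R0 powr - ?E = (2 * kc / kp) powr (1 / ?E * - ?E)" unfolding R0_def by (rule powr_powr)
   also have "1 / ?E * - ?E = - 1" using E0 by simp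
   also have "(2 * kc / kp) powr - 1 = kp / (2 * kc)" using kap kc by (simp add: powr_minus)
   finally show ?thesis .
  qed
  finally have bk: "\<bar>ball_kernel t y\<bar> <= kp * t ^ ?d / 2" using kc by (simp add: mult.commute)
  have i0: "integrable lborel (%h::'a. indicator (cball 0 t) h :: real)"
   using emeasure_bounded_finite[of "cball (0::'a) t"] bounded_cball by (intro integrable_real_indicator) auto
  have i1: "integrable lborel (%h. indicator (cball 0 t) h * cos (y \<bullet> h))"
   by (rule Bochner_Integration.integrable_bound[OF i0]) (auto simp: indicator_def)
  have pos: "0 <= 2 - 2 * cos (h \<bullet> y)" for h using cos_le_one[of "h \<bullet> y"] by linarith
  have i2: "integrable lborel (%h. indicator (cball 0 t) h * (2 - 2 * cos (h \<bullet> y)) ^ k)"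
  proof (rule Bochner_Integration.integrable_bound[OF integrable_mult_left[OF i0, of "4 ^ k"]])
   show "AE h in lborel. norm (indicator (cball 0 t) h * (2 - 2 * cos (h \<bullet> y)) ^ k) <= norm (indicator (cball (0::'a) t) h * 4 ^ k :: real)"
   proof (intro AE_I2)
    fix h :: 'a
    have "2 - 2 * cos (h \<bullet> y) <= 4" using cos_ge_minus_one[of "h \<bullet> y"] by linarith
    then have "(2 - 2 * cos (h \<bullet> y)) ^ k <= 4 ^ k" using pos by (intro power_mono) auto
    then show "norm (indicator (cball 0 t) h * (2 - 2 * cos (h \<bullet> y)) ^ k) <= norm (indicator (cball (0::'a) t) h * 4 ^ k :: real)"
     using pos[of h] by (auto simp: indicator_def)
   qed
  qed measurable
  have v: "(RI h. indicator (cball 0 t) (h::'a)) = kp * t ^ ?d"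
   using content_cball[of t "0::'a"] t by (simp add: kp_def)
  have "(\<integral>h. indicator (cball 0 t) h * (1 + real k) - 2 * real k * (indicator (cball 0 t) h * cos (y \<bullet> h)) \<partial>(lborel :: 'a measure))
    <= (RI h. indicator (cball 0 t) h * (2 - 2 * cos (h \<bullet> y)) ^ k)"
  proof (rule integral_mono)
   fix h :: 'a
   have "1 + real k * (1 - 2 * cos (h \<bullet> y)) <= (1 + (1 - 2 * cos (h \<bullet> y))) ^ k"
    using pos[of h] by (intro Bernoulli_inequality) simp
   then show "indicator (cball 0 t) h * (1 + real k) - 2 * real k * (indicator (cball 0 t) h * cos (y \<bullet> h)) <= indicator (cball 0 t) h * (2 - 2 * cos (h \<bullet> y)) ^ k"
    by (auto simp: indicator_def inner_commute algebra_simps)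
  qed (use i0 i1 i2 in \<open>auto intro!: Bochner_Integration.integrable_diff integrable_mult_left integrable_mult_right\<close>)
  moreover have "(\<integral>h. indicator (cball 0 t) h * (1 + real k) - 2 * real k * (indicator (cball 0 t) h * cos (y \<bullet> h)) \<partial>(lborel :: 'a measure))
    = kp * t ^ ?d * (1 + real k) - 2 * real k * ball_kernel t y"
   by (subst Bochner_Integration.integral_diff[OF integrable_mult_left[OF i0] integrable_mult_right[OF i1]])
     (simp only: integral_mult_left_zero integral_mult_right_zero v ball_kernel_def)
  moreover have "kp * t ^ ?d <= kp * t ^ ?d * (1 + real k) - 2 * real k * ball_kernel t y"
  proof -
   have "2 * real k * ball_kernel t y <= 2 * real k * (kp * t ^ ?d / 2)" using bk by (intro mult_left_mono) auto
   then show ?thesis by (simp add: algebra_simps)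
  qed
  ultimately have "kp * t ^ ?d <= (RI h. indicator (cball 0 t) h * (2 - 2 * cos (h \<bullet> y)) ^ k)" by linarith
  then have "ennreal (kp * t ^ ?d) <= ennreal (RI h. indicator (cball 0 t) h * (2 - 2 * cos (h \<bullet> y)) ^ k)" by (rule ennreal_leI)
  also have "... = (NI h. ennreal (indicator (cball 0 t) h * (2 - 2 * cos (h \<bullet> y)) ^ k))"
   using i2 pos by (intro nn_integral_eq_integral[symmetric]) auto
  also have "... = (NI h. ennreal ((2 - 2 * cos (h \<bullet> y)) ^ k) * indicator (cball 0 t) h)"
   by (intro nn_integral_cong) (auto simp: indicator_def)
  finally show ?thesis .
 qed
 show thesis by (rule that[OF R0]) (rule main[unfolded kp_def])
qed

section \<open>Lower bounds for the dyadic coefficients\<close>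

context gm_Lp
begin

text \<open>The test integral is restricted to one shell. There the transformed Gaussian of width
  \<open>tw (- n)\<close> is at least a constant times \<open>exp (- 1 / 4)\<close>, and
  \<open>F (tw n) <= (1 + C) * F (norm y)\<close> because the outer radius is at most twice
  \<open>norm y\<close>.\<close>

lemma shell_lower:
 "ennreal (pi powr (real DIM('a) / 2) * tw (- n) ^ DIM('a) * exp (- 1 / 4) * (F (tw n) / (1 + C)))
   * (NI y. ennreal ((2 - 2 * cos (h \<bullet> y)) ^ k) * indicator (cball 0 (tw n) - cball 0 (tw (n - 1))) y)
  <= (NI x. ennreal \<bar>sdiff k h g x\<bar> * ennreal (gauss (tw (- n)) x))"
proof -
 let ?c = "tw (- n)" and ?P = "pi powr (real DIM('a) / 2)"
 let ?\<psi> = "%y. (2 - 2 * cos (h \<bullet> y)) ^ k"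
 let ?q = "?P * ?c ^ DIM('a) * exp (- 1 / 4) * (F (tw n) / (1 + C))"
 let ?A = "%y. indicator (cball 0 (tw n)) y * (F (norm y) * ?\<psi> y) * (?P * ?c ^ DIM('a) * exp (- (?c * norm y / 2)\<^sup>2))"
 have cn: "?c * tw n = 1" by (simp add: tw_add[symmetric])
 have q0: "?q >= 0" using F_nonneg C1 by simp
 have psi: "0 <= ?\<psi> y" "?\<psi> y <= 4 ^ k" for y
 proof -
  have "0 <= 2 - 2 * cos (h \<bullet> y)" "2 - 2 * cos (h \<bullet> y) <= 4"
   using cos_le_one[of "h \<bullet> y"] cos_ge_minus_one[of "h \<bullet> y"] by linarith+
  then show "0 <= ?\<psi> y" "?\<psi> y <= 4 ^ k" by (auto simp: power_mono)
 qed
 have A0: "0 <= ?A y" for y using psi(1) F_nonneg by (intro mult_nonneg_nonneg) auto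
 have iA: "integrable lborel ?A"
 proof -
  have "integrable lborel (%y. indicator (cball 0 (tw n)) y * (F (norm y) * (?\<psi> y * (?P * ?c ^ DIM('a) * exp (- (?c * norm y / 2)\<^sup>2)))))"
  proof (rule int_bounded[where M = "4 ^ k * (?P * ?c ^ DIM('a) * 1)"])
   fix y :: 'a
   have "?\<psi> y * (?P * ?c ^ DIM('a) * exp (- (?c * norm y / 2)\<^sup>2)) <= 4 ^ k * (?P * ?c ^ DIM('a) * 1)"
    using psi[of y] by (intro mult_mono mult_left_mono) auto
   then show "\<bar>?\<psi> y * (?P * ?c ^ DIM('a) * exp (- (?c * norm y / 2)\<^sup>2))\<bar> <= 4 ^ k * (?P * ?c ^ DIM('a) * 1)"
    using psi(1)[of y] by (simp add: abs_mult)
  qed measurable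
  then show ?thesis by (simp add: mult.assoc)
 qed
 have pt: "ennreal ?q * (ennreal (?\<psi> y) * indicator (cball 0 (tw n) - cball 0 (tw (n - 1))) y) <= ennreal (?A y)" for y
 proof (cases "norm y <= tw n \<and> tw (n - 1) < norm y")
  case True
  have t2: "tw n = 2 * tw (n - 1)" using tw_Suc[of "n - 1"] by simp
  have ny: "norm y > 0" using True tw_pos(1)[of "n - 1"] by linarith
  have "F (tw n) <= (1 + C) * F (norm y)" using True t2 ny by (intro F_le) auto
  then have f: "F (tw n) / (1 + C) <= F (norm y)" using C1 by (simp add: pos_divide_le_eq mult.commute)
  have "?c * norm y <= ?c * tw n" using True by (intro mult_left_mono) auto
  then have "(?c * norm y / 2)\<^sup>2 <= (1 / 2)\<^sup>2" unfolding cn by (intro power_mono) auto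
  then have e: "exp (- 1 / 4 :: real) <= exp (- (?c * norm y / 2)\<^sup>2)" by (simp add: power2_eq_square)
  have "?q * ?\<psi> y = (?P * ?c ^ DIM('a)) * ((F (tw n) / (1 + C)) * (exp (- 1 / 4) * ?\<psi> y))" by (simp only: mult_ac)
  also have "... <= (?P * ?c ^ DIM('a)) * (F (norm y) * (exp (- (?c * norm y / 2)\<^sup>2) * ?\<psi> y))"
   using f e psi(1)[of y] F_nonneg C1 by (intro mult_left_mono mult_mono mult_right_mono) auto
  also have "... = ?A y" using True by (simp add: mult_ac)
  finally have "ennreal (?q * ?\<psi> y) <= ennreal (?A y)" by (rule ennreal_leI)
  moreover have "indicator (cball 0 (tw n) - cball 0 (tw (n - 1))) y = (1::ennreal)" using True by simp
  ultimately show ?thesis by (simp only: mult_1_right ennreal_mult[OF q0 psi(1)])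
 next
  case False
  then have "y \<notin> cball 0 (tw n) - cball 0 (tw (n - 1))" by auto
  then show ?thesis by simp
 qed
 have "ennreal ?q * (NI y. ennreal (?\<psi> y) * indicator (cball 0 (tw n) - cball 0 (tw (n - 1))) y)
   = (NI y. ennreal ?q * (ennreal (?\<psi> y) * indicator (cball 0 (tw n) - cball 0 (tw (n - 1))) y))"
  by (rule nn_integral_cmult[symmetric]) measurable
 also have "... <= (NI y. ennreal (?A y))" by (intro nn_integral_mono pt)
 also have "... = ennreal (RI y. ?A y)" using A0 by (intro nn_integral_eq_integral iA) auto
 also have "... <= ennreal (RI x. \<bar>sdiff k h g x * gauss ?c x\<bar>)"
  by (intro ennreal_leI) (rule order_trans[OF test_lower[OF tw_pos(1)] order_trans[OF abs_ge_self integral_abs_bound]])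
 also have "... = (NI x. ennreal \<bar>sdiff k h g x * gauss ?c x\<bar>)"
 proof (rule nn_integral_eq_integral[symmetric])
  show "integrable lborel (%x. \<bar>sdiff k h g x * gauss ?c x\<bar>)"
   using limit_sdiff[of ?c k h 0] by (intro integrable_abs) simp
 qed auto
 also have "... = (NI x. ennreal \<bar>sdiff k h g x\<bar> * ennreal (gauss ?c x))"
 proof -
  have "ennreal \<bar>sdiff k h g x * gauss ?c x\<bar> = ennreal \<bar>sdiff k h g x\<bar> * ennreal (gauss ?c x)" for x :: 'a
   using gauss_bounds(2)[of ?c x] by (simp add: abs_mult ennreal_mult)
  then show ?thesis by (simp only:)
 qed
 finally show ?thesis .
qed

lemma sd_meas [measurable]: "(%(h, x). sdiff k h g x) \<in> borel_measurable (borel \<Otimes>\<^sub>M borel)"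
 by (rule sdiff_measurable_pair) (rule g_meas)

text \<open>Integrating over the steps and exchanging the order turns the symbol into its average,
  which is bounded below for every \<open>y\<close> of the shell since \<open>norm y * t\<close>
  exceeds \<open>R0\<close> there.\<close>

lemma average_lower:
 assumes R: "!!y::'a. R0 <= norm y * t ==>
  ennreal (unit_ball_vol (real DIM('a)) * t ^ DIM('a)) <= (NI h. ennreal ((2 - 2 * cos (h \<bullet> y)) ^ k) * indicator (cball 0 t) h)"
  and t: "t > 0" and n: "R0 <= tw (n - 1) * t"
 shows "ennreal (pi powr (real DIM('a) / 2) * exp (- 1 / 4) * unit_ball_vol (real DIM('a)) / (2 * (1 + C)) * (unit_ball_vol (real DIM('a)) * t ^ DIM('a)) * F (tw n))
  <= (NI h. (NI x. ennreal \<bar>sdiff k h g x\<bar> * ennreal (gauss (tw (- n)) x)) * indicator (cball 0 t) h)"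
proof -
 let ?d = "DIM('a)" and ?P = "pi powr (real DIM('a) / 2)"
 let ?q = "?P * tw (- n) ^ ?d * exp (- 1 / 4) * (F (tw n) / (1 + C))"
 define kp where "kp = unit_ball_vol (real ?d)"
 have kap: "kp > 0" by (simp add: kp_def)
 let ?S = "cball 0 (tw n) - cball (0::'a) (tw (n - 1))"
 let ?\<psi> = "%h y. ennreal ((2 - 2 * cos (h \<bullet> y)) ^ k)"
 have q0: "?q >= 0" using F_nonneg C1 by simp
 have t2: "tw n = 2 * tw (n - 1)" using tw_Suc[of "n - 1"] by simp
 \<comment> \<open>As \<open>2 ^ d >= 2\<close>, the shell carries at least half of the volume of
   the ball.\<close>
 have vol: "ennreal (kp * tw n ^ ?d / 2) <= emeasure lborel ?S"
 proof -
  have "emeasure lborel ?S = emeasure lborel (cball (0::'a) (tw n)) - emeasure lborel (cball (0::'a) (tw (n - 1)))"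
   using tw_mono[of "n - 1" n] emeasure_bounded_finite[of "cball (0::'a) (tw (n - 1))"] bounded_cball
   by (intro emeasure_Diff subset_cball) auto
  also have "... = ennreal (kp * tw n ^ ?d - kp * tw (n - 1) ^ ?d)"
   using kap by (simp add: emeasure_cball kp_def ennreal_minus)
  finally have e: "emeasure lborel ?S = ennreal (kp * tw n ^ ?d - kp * tw (n - 1) ^ ?d)" .
  have "2 * tw (n - 1) ^ ?d <= 2 ^ ?d * tw (n - 1) ^ ?d"
  proof (rule mult_right_mono)
   have "(2::real) ^ 1 <= 2 ^ ?d" using DIM_positive[where 'a = 'a] by (intro power_increasing) (auto simp: Suc_le_eq)
   then show "(2::real) <= 2 ^ ?d" by simp
  qed simp
  also have "... = tw n ^ ?d" by (simp add: t2 power_mult_distrib)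
  finally have "kp * (2 * tw (n - 1) ^ ?d) <= kp * tw n ^ ?d" using kap by (intro mult_left_mono) auto
  then show ?thesis unfolding e by (intro ennreal_leI) simp
 qed
 have cn: "tw (- n) ^ ?d * tw n ^ ?d = 1" by (simp add: power_mult_distrib[symmetric] tw_add[symmetric])
 have E: "?P * exp (- 1 / 4) * kp / (2 * (1 + C)) * (kp * t ^ ?d) * F (tw n) = ?q * (kp * t ^ ?d) * (kp * tw n ^ ?d / 2)"
 proof -
  have "?q * (kp * t ^ ?d) * (kp * tw n ^ ?d / 2) = (?P * exp (- 1 / 4) * kp / (2 * (1 + C)) * (kp * t ^ ?d) * F (tw n)) * (tw (- n) ^ ?d * tw n ^ ?d)"
   using C1 by (simp add: field_simps)
  then show ?thesis unfolding cn by simp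
 qed
 have a: "0 <= kp * t ^ ?d" and b: "0 <= kp * tw n ^ ?d / 2" using kap t by simp_all
 have "ennreal (?P * exp (- 1 / 4) * kp / (2 * (1 + C)) * (kp * t ^ ?d) * F (tw n)) = ennreal ?q * (ennreal (kp * t ^ ?d) * ennreal (kp * tw n ^ ?d / 2))"
  unfolding E by (subst ennreal_mult[OF mult_nonneg_nonneg[OF q0 a] b], subst ennreal_mult[OF q0 a], rule mult.assoc)
 also have "... <= ennreal ?q * (ennreal (kp * t ^ ?d) * emeasure lborel ?S)"
  by (intro mult_left_mono vol) auto
 also have "ennreal (kp * t ^ ?d) * emeasure lborel ?S = (NI y. ennreal (kp * t ^ ?d) * indicator ?S y)"
  by (simp add: nn_integral_cmult)
 also have "ennreal ?q * ... <= ennreal ?q * (NI y. (NI h. ?\<psi> h y * indicator (cball 0 t) h) * indicator ?S y)"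
 proof (intro mult_left_mono nn_integral_mono)
  fix y :: 'a
  show "ennreal (kp * t ^ ?d) * indicator ?S y <= (NI h. ?\<psi> h y * indicator (cball 0 t) h) * indicator ?S y"
  proof (cases "y \<in> ?S")
   case True
   then have "tw (n - 1) * t <= norm y * t" using t by (intro mult_right_mono) auto
   then have "R0 <= norm y * t" using n by linarith
   from R[OF this] show ?thesis using True by (simp add: kp_def)
  qed simp
 qed simp
 also have "(NI y. (NI h. ?\<psi> h y * indicator (cball 0 t) h) * indicator ?S y)
   = (NI y. NI h. (?\<psi> h y * indicator ?S y) * indicator (cball 0 t) h)"
  by (intro nn_integral_cong) (subst nn_integral_multc[symmetric], simp, simp add: mult_ac)
 also have "... = (NI h. NI y. (?\<psi> h y * indicator ?S y) * indicator (cball 0 t) h)"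
  by (rule lborel_pair.Fubini') measurable
 also have "... = (NI h. (NI y. ?\<psi> h y * indicator ?S y) * indicator (cball 0 t) h)"
  by (intro nn_integral_cong nn_integral_multc) measurable
 also have "ennreal ?q * ... = (NI h. ennreal ?q * ((NI y. ?\<psi> h y * indicator ?S y) * indicator (cball 0 t) h))"
  by (rule nn_integral_cmult[symmetric]) measurable
 also have "... <= (NI h. (NI x. ennreal \<bar>sdiff k h g x\<bar> * ennreal (gauss (tw (- n)) x)) * indicator (cball 0 t) h)"
  unfolding mult.assoc[symmetric] by (intro nn_integral_mono mult_right_mono shell_lower) simp
 finally show ?thesis unfolding kp_def .
qed

text \<open>Hoelder's inequality with the weight \<open>norm x powr - (d / 2)\<close> times the
  Gaussian. The bare Gaussian would leave a factor tending to 1 as \<open>n\<close> decreases, so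
  the sum over \<open>n\<close> would diverge. The extra power leaves
  \<open>(tw n * norm x) powr (d / 2 * (p - 1))\<close> times the Gaussian, which decays
  geometrically in both directions.\<close>

lemma weighted_powr:
 assumes K: "!!u::real. u > 0 ==> u powr (real DIM('a) / 2) * exp (- u\<^sup>2) <= K * 2 powr - (real DIM('a) / 2 * \<bar>log 2 u\<bar>)" "K > 0"
  and J: "!!n::int. (\<integral>\<^sup>+x. ennreal (norm x powr - real DIM('a) * 2 powr - (real DIM('a) / 2 * \<bar>real_of_int n + log 2 (norm x)\<bar>)) \<partial>(lborel :: 'a measure)) <= ennreal J" "J > 0"
  and K': "!!u::real. u > 0 ==> u powr (real DIM('a) / 2 * (p - 1)) * exp (- u\<^sup>2) <= K' * 2 powr - (real DIM('a) / 2 * (p - 1) * \<bar>log 2 u\<bar>)" "K' > 0"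
 shows "ennreal (tw n powr (real DIM('a) * (p - 1))) * (NI x. ennreal \<bar>sdiff k h g x\<bar> * ennreal (gauss (tw (- n)) x)) epowr p
  <= ennreal (2 powr p * (K * J) powr (p - 1) * K') * (NI x. ennreal \<bar>sdiff k h g x\<bar> epowr p * ennreal (2 powr - (real DIM('a) / 2 * (p - 1) * \<bar>real_of_int n + log 2 (norm x)\<bar>)))"
proof -
 let ?d = "real DIM('a)" and ?X = "%x. ennreal \<bar>sdiff k h g x\<bar>"
 define v where "v x = norm x powr - (?d / 2) * gauss (tw (- n)) x" for x :: 'a
 have v0: "v x >= 0" for x unfolding v_def by (intro mult_nonneg_nonneg gauss_bounds(2)) simp
 have [measurable]: "v \<in> borel_measurable borel" unfolding v_def[abs_def] by measurable
 have [measurable]: "sdiff k h g \<in> borel_measurable borel"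
  using measurable_compose[OF measurable_Pair1'[of h] sd_meas[of k]] by simp
 have gu: "gauss (tw (- n)) x = exp (- (tw n * norm x)\<^sup>2)" for x :: 'a
  by (simp add: gauss_def tw_minus mult.commute)
 have lg: "log 2 (tw n * norm x) = real_of_int n + log 2 (norm x)" if "x \<noteq> 0" for x :: 'a
  using that by (simp add: log_mult) (simp add: tw_def)
 have Iv: "(NI x. ennreal (v x)) <= ennreal (tw n powr - (?d / 2) * (K * J))"
 proof -
  have "(NI x. ennreal (v x)) <= (\<integral>\<^sup>+x. ennreal (tw n powr - (?d / 2) * K) * ennreal (norm x powr - ?d * 2 powr - (?d / 2 * \<bar>real_of_int n + log 2 (norm x)\<bar>)) \<partial>(lborel :: 'a measure))"
  proof (intro nn_integral_mono_AE eventually_mono[OF AE_lborel_singleton[of 0]])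
   fix x :: 'a assume x: "x \<noteq> 0"
   let ?u = "tw n * norm x"
   have u: "?u > 0" using x by simp
   have "norm x powr - (?d / 2) = norm x powr - ?d * norm x powr (?d / 2)" by (simp add: powr_add[symmetric])
   also have "norm x powr (?d / 2) = tw n powr - (?d / 2) * ?u powr (?d / 2)"
    by (simp add: powr_mult powr_minus)
   finally have "v x = (norm x powr - ?d * tw n powr - (?d / 2)) * (?u powr (?d / 2) * exp (- ?u\<^sup>2))"
    by (simp add: v_def gu)
   also have "... <= (norm x powr - ?d * tw n powr - (?d / 2)) * (K * 2 powr - (?d / 2 * \<bar>log 2 ?u\<bar>))"
    by (intro mult_left_mono K(1)[OF u]) auto
   also have "... = (tw n powr - (?d / 2) * K) * (norm x powr - ?d * 2 powr - (?d / 2 * \<bar>real_of_int n + log 2 (norm x)\<bar>))"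
    unfolding lg[OF x] by (simp only: mult_ac)
   finally show "ennreal (v x) <= ennreal (tw n powr - (?d / 2) * K) * ennreal (norm x powr - ?d * 2 powr - (?d / 2 * \<bar>real_of_int n + log 2 (norm x)\<bar>))"
    using K(2) by (simp add: ennreal_mult[symmetric] ennreal_leI)
  qed
  also have "... = ennreal (tw n powr - (?d / 2) * K) * (\<integral>\<^sup>+x. ennreal (norm x powr - ?d * 2 powr - (?d / 2 * \<bar>real_of_int n + log 2 (norm x)\<bar>)) \<partial>(lborel :: 'a measure))"
   by (rule nn_integral_cmult) measurable
  also have "... <= ennreal (tw n powr - (?d / 2) * K) * ennreal J" by (intro mult_left_mono J) auto
  also have "... = ennreal (tw n powr - (?d / 2) * (K * J))" using K(2) J(2) by (simp add: ennreal_mult[symmetric] mult.assoc)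
  finally show ?thesis .
 qed
 have a0: "tw n powr - (?d / 2) * (K * J) > 0" using K(2) J(2) by simp
 have "ennreal (tw n powr (?d / 2 * (p - 1))) * (NI x. (?X x * ennreal (norm x powr (?d / 2))) epowr p * ennreal (v x))
   = (NI x. ennreal (tw n powr (?d / 2 * (p - 1))) * ((?X x * ennreal (norm x powr (?d / 2))) epowr p * ennreal (v x)))"
  by (rule nn_integral_cmult[symmetric]) measurable
 also have "... <= (NI x. ennreal K' * (?X x epowr p * ennreal (2 powr - (?d / 2 * (p - 1) * \<bar>real_of_int n + log 2 (norm x)\<bar>))))"
 proof (intro nn_integral_mono_AE eventually_mono[OF AE_lborel_singleton[of 0]])
  fix x :: 'a assume x: "x \<noteq> 0"
  let ?u = "tw n * norm x"
  have u: "?u > 0" using x by simp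
  have "tw n powr (?d / 2 * (p - 1)) * ((norm x powr (?d / 2)) powr p * v x) = ?u powr (?d / 2 * (p - 1)) * exp (- ?u\<^sup>2)"
  proof -
   have "(norm x powr (?d / 2)) powr p * norm x powr - (?d / 2) = norm x powr (?d / 2 * (p - 1))"
    by (simp add: powr_powr powr_add[symmetric] algebra_simps diff_divide_distrib)
   then have "(norm x powr (?d / 2)) powr p * v x = norm x powr (?d / 2 * (p - 1)) * exp (- ?u\<^sup>2)"
    unfolding v_def gu by (simp only: mult.assoc[symmetric])
   then show ?thesis by (simp add: powr_mult mult.assoc)
  qed
  also have "... <= K' * 2 powr - (?d / 2 * (p - 1) * \<bar>real_of_int n + log 2 (norm x)\<bar>)"
   using K'(1)[OF u] unfolding lg[OF x] .
  finally have "ennreal (tw n powr (?d / 2 * (p - 1)) * ((norm x powr (?d / 2)) powr p * v x)) <= ennreal (K' * 2 powr - (?d / 2 * (p - 1) * \<bar>real_of_int n + log 2 (norm x)\<bar>))"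
   by (rule ennreal_leI)
  then have *: "ennreal (tw n powr (?d / 2 * (p - 1))) * (ennreal ((norm x powr (?d / 2)) powr p) * ennreal (v x)) <= ennreal K' * ennreal (2 powr - (?d / 2 * (p - 1) * \<bar>real_of_int n + log 2 (norm x)\<bar>))"
   using v0[of x] K'(2) by (simp add: ennreal_mult)
  have "ennreal (tw n powr (?d / 2 * (p - 1))) * ((?X x * ennreal (norm x powr (?d / 2))) epowr p * ennreal (v x))
    = ?X x epowr p * (ennreal (tw n powr (?d / 2 * (p - 1))) * (ennreal ((norm x powr (?d / 2)) powr p) * ennreal (v x)))"
   using p1 by (simp add: epowr_mult epowr_ennreal mult_ac)
  also have "... <= ?X x epowr p * (ennreal K' * ennreal (2 powr - (?d / 2 * (p - 1) * \<bar>real_of_int n + log 2 (norm x)\<bar>)))"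
   using * by (intro mult_left_mono) auto
  finally show "ennreal (tw n powr (?d / 2 * (p - 1))) * ((?X x * ennreal (norm x powr (?d / 2))) epowr p * ennreal (v x))
    <= ennreal K' * (?X x epowr p * ennreal (2 powr - (?d / 2 * (p - 1) * \<bar>real_of_int n + log 2 (norm x)\<bar>)))"
   by (simp only: mult_ac)
 qed
 also have "... = ennreal K' * (NI x. ?X x epowr p * ennreal (2 powr - (?d / 2 * (p - 1) * \<bar>real_of_int n + log 2 (norm x)\<bar>)))"
  by (rule nn_integral_cmult) measurable
 finally have H: "ennreal (tw n powr (?d / 2 * (p - 1))) * (NI x. (?X x * ennreal (norm x powr (?d / 2))) epowr p * ennreal (v x))
   <= ennreal K' * (NI x. ?X x epowr p * ennreal (2 powr - (?d / 2 * (p - 1) * \<bar>real_of_int n + log 2 (norm x)\<bar>)))" .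
 have "(NI x. ?X x * ennreal (gauss (tw (- n)) x)) = (NI x. (?X x * ennreal (norm x powr (?d / 2))) * ennreal (v x))"
 proof (intro nn_integral_cong_AE eventually_mono[OF AE_lborel_singleton[of 0]])
  fix x :: 'a assume x: "x \<noteq> 0"
  have vg: "norm x powr (?d / 2) * v x = gauss (tw (- n)) x" using x by (simp add: v_def powr_minus)
  have "ennreal (norm x powr (?d / 2)) * ennreal (v x) = ennreal (gauss (tw (- n)) x)"
   unfolding vg[symmetric] by (rule ennreal_mult[symmetric]) (simp_all add: v0)
  then show "?X x * ennreal (gauss (tw (- n)) x) = (?X x * ennreal (norm x powr (?d / 2))) * ennreal (v x)"
   by (simp only: mult.assoc)
 qed
 then have "(NI x. ?X x * ennreal (gauss (tw (- n)) x)) epowr p = (NI x. (?X x * ennreal (norm x powr (?d / 2))) * ennreal (v x)) epowr p"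
  by simp
 also have "... <= ennreal (2 powr p * (tw n powr - (?d / 2) * (K * J)) powr (p - 1)) * (NI x. (?X x * ennreal (norm x powr (?d / 2))) epowr p * ennreal (v x))"
  using p1 Iv a0 by (intro nn_integral_powr_le) auto
 finally have "ennreal (tw n powr (?d * (p - 1))) * (NI x. ?X x * ennreal (gauss (tw (- n)) x)) epowr p <=
  ennreal (tw n powr (?d * (p - 1))) * (ennreal (2 powr p * (tw n powr - (?d / 2) * (K * J)) powr (p - 1)) * (NI x. (?X x * ennreal (norm x powr (?d / 2))) epowr p * ennreal (v x)))"
  by (intro mult_left_mono) auto
 also have "... = ennreal (2 powr p * (K * J) powr (p - 1)) * (ennreal (tw n powr (?d / 2 * (p - 1))) * (NI x. (?X x * ennreal (norm x powr (?d / 2))) epowr p * ennreal (v x)))"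
 proof -
  have "tw n powr (?d * (p - 1)) * (2 powr p * (tw n powr - (?d / 2) * (K * J)) powr (p - 1)) = (2 powr p * (K * J) powr (p - 1)) * (tw n powr (?d * (p - 1)) * tw n powr (- (?d / 2) * (p - 1)))"
   using K(2) J(2) by (simp add: powr_mult powr_powr mult_ac)
  also have "tw n powr (?d * (p - 1)) * tw n powr (- (?d / 2) * (p - 1)) = tw n powr (?d / 2 * (p - 1))"
   by (simp only: powr_add[symmetric], rule arg_cong[where f = "(powr) (tw n)"], simp add: field_simps)
  finally have "ennreal (tw n powr (?d * (p - 1))) * ennreal (2 powr p * (tw n powr - (?d / 2) * (K * J)) powr (p - 1)) = ennreal (2 powr p * (K * J) powr (p - 1)) * ennreal (tw n powr (?d / 2 * (p - 1)))"
   by (simp only: ennreal_mult[symmetric] powr_ge_zero mult_nonneg_nonneg zero_le_numeral)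
  then show ?thesis by (simp only: mult.assoc[symmetric])
 qed
 also have "... <= ennreal (2 powr p * (K * J) powr (p - 1)) * (ennreal K' * (NI x. ?X x epowr p * ennreal (2 powr - (?d / 2 * (p - 1) * \<bar>real_of_int n + log 2 (norm x)\<bar>))))"
  by (intro mult_left_mono H) auto
 also have "... = ennreal (2 powr p * (K * J) powr (p - 1) * K') * (NI x. ?X x epowr p * ennreal (2 powr - (?d / 2 * (p - 1) * \<bar>real_of_int n + log 2 (norm x)\<bar>)))"
  using K'(2) by (simp add: ennreal_mult mult.assoc)
 finally show ?thesis .
qed

end

text \<open>Each coefficient with \<open>tw n * t\<close> large is bounded by an integral over
  \<open>x\<close> and \<open>h\<close> of the difference with a geometric weight centred at
  \<open>tw n * norm x = 1\<close>. Summed over \<open>n\<close>, the weights are bounded uniformly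
  in \<open>x\<close>, and the plain norm of the difference remains.\<close>

lemma gm_lower:
 assumes p: "p > 1"
 obtains K R0 where "K > 0" "R0 > 0"
  "!!F V g t D. gm_Lp F V C (g :: 'a::euclidean_space => real) p ==> t > 0 ==>
   (!!h::'a. norm h <= t ==> (NI x. ennreal \<bar>rdiff k h g x\<bar> epowr p) <= D) ==>
   zsum (%n. if R0 <= tw (n - 1) * t then ennreal (cseq DIM('a) F p n) epowr p else 0) <= ennreal K * D"
proof -
 let ?d = "DIM('a)" and ?P = "pi powr (real DIM('a) / 2)"
 define b where "b = real ?d / 2 * (p - 1)"
 have d0: "real ?d / 2 > 0" using DIM_positive[where 'a = 'a] by simp
 have b0: "b > 0" using d0 p by (simp add: b_def)
 obtain K1 where K1: "K1 > 0" "!!u::real. u > 0 ==> u powr (real ?d / 2) * exp (- u\<^sup>2) <= K1 * 2 powr - (real ?d / 2 * \<bar>log 2 u\<bar>)"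
  using powr_gauss_bound[OF d0] by blast
 obtain K2 where K2: "K2 > 0" "!!u::real. u > 0 ==> u powr b * exp (- u\<^sup>2) <= K2 * 2 powr - (b * \<bar>log 2 u\<bar>)"
  using powr_gauss_bound[OF b0] by blast
 obtain J where J: "J > 0" "!!n::int. (\<integral>\<^sup>+x. ennreal (norm x powr - real ?d * 2 powr - (real ?d / 2 * \<bar>real_of_int n + log 2 (norm x)\<bar>)) \<partial>(lborel :: 'a measure)) <= ennreal J"
  using nn_integral_norm_powr_log[OF d0, where ?'a = 'a] by blast
 obtain S where S: "S > 0" "!!t::real. zsum (%n. ennreal (2 powr - (b * \<bar>real_of_int n + t\<bar>))) <= ennreal S"
  using zsum_geometric_shift[OF b0] by blast
 obtain R0 where R0: "R0 > 0" "!!t (y::'a). t > 0 ==> R0 <= norm y * t ==>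
  ennreal (unit_ball_vol (real ?d) * t ^ ?d) <= (NI h. ennreal ((2 - 2 * cos (h \<bullet> y)) ^ k) * indicator (cball 0 t) h)"
  using ball_average_lower[of k, where ?'a = 'a] by blast
 define kp where "kp = unit_ball_vol (real ?d)"
 have kap: "kp > 0" by (simp add: kp_def)
 define c1 where "c1 = ?P * exp (- 1 / 4) * kp / (2 * (1 + \<bar>C\<bar>))"
 have c1: "c1 > 0" using kap by (simp add: c1_def add_pos_nonneg)
 define L where "L = 2 powr p * (K1 * J) powr (p - 1) * K2"
 have L: "L > 0" using K1 K2 J by (simp add: L_def)
 define M where "M = (2 powr (p + 1)) ^ k"
 have M: "M > 0" by (simp add: M_def)
 define K where "K = 2 powr p * L * S * M / c1 powr p"
 have K: "K > 0" using L S(1) M c1 by (simp add: K_def)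
 have main: "zsum (%n. if R0 <= tw (n - 1) * t then ennreal (cseq ?d F p n) epowr p else 0) <= ennreal K * D"
  if loc: "gm_Lp F V C (g :: 'a => real) p" and t: "t > 0"
   and D: "!!h::'a. norm h <= t ==> (NI x. ennreal \<bar>rdiff k h g x\<bar> epowr p) <= D" for F V g t D
 proof -
  interpret gm_Lp F V C "TYPE('a)" g p by fact
  have CC: "\<bar>C\<bar> = C" using C1 by simp
  define ta where "ta = kp * t ^ ?d"
  have tau: "ta > 0" using kap t by (simp add: ta_def)
  let ?B = "cball (0::'a) t"
  let ?X = "%n h. NI x. ennreal \<bar>sdiff k h g x\<bar> * ennreal (gauss (tw (- n)) x)"
  let ?I = "%n h. NI x. ennreal \<bar>sdiff k h g x\<bar> epowr p * ennreal (2 powr - (b * \<bar>real_of_int n + log 2 (norm x)\<bar>))"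
  have volB: "(NI h. indicator ?B h) = ennreal ta"
   using t by (simp add: emeasure_cball ta_def kp_def)
  \<comment> \<open>Two applications of Hoelder: in \<open>h\<close> over the ball of volume
    \<open>ta\<close>, then in \<open>x\<close> for each fixed \<open>h\<close>.\<close>
  have one: "ennreal ((c1 * ta) powr p) * (if R0 <= tw (n - 1) * t then ennreal (cseq ?d F p n) epowr p else 0)
    <= ennreal (2 powr p * ta powr (p - 1) * L) * (NI h. ?I n h * indicator ?B h)" for n
  proof (cases "R0 <= tw (n - 1) * t")
   case True
   have "ennreal (c1 * ta * F (tw n)) <= (NI h. ?X n h * indicator ?B h)"
    using average_lower[OF R0(2)[OF t] t True] unfolding c1_def ta_def kp_def CC by (simp only: mult.assoc)
   then have "ennreal (c1 * ta * F (tw n)) epowr p <= (NI h. ?X n h * indicator ?B h) epowr p"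
    using p by (intro epowr_mono) auto
   also have "... <= ennreal (2 powr p * ta powr (p - 1)) * (NI h. ?X n h epowr p * indicator ?B h)"
    using p tau volB by (intro nn_integral_powr_le) auto
   finally have 1: "ennreal (c1 * ta * F (tw n)) epowr p <= ennreal (2 powr p * ta powr (p - 1)) * (NI h. ?X n h epowr p * indicator ?B h)" .
   let ?T = "ennreal (tw n powr (real ?d * (p - 1)))"
   have cs: "tw n powr (real ?d * (p - 1)) * (F (tw n)) powr p = (cseq ?d F p n) powr p"
   proof -
    have "(1 - 1 / p) * p = p - 1" using p by (simp add: field_simps)
    then have e: "real ?d * (1 - 1 / p) * p = real ?d * (p - 1)" by (simp only: mult.assoc)
    show ?thesis using F_nonneg[of "tw n"] by (simp only: cseq_def powr_mult powr_powr powr_ge_zero e)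
   qed
   have "ennreal ((c1 * ta) powr p) * ennreal (cseq ?d F p n) epowr p = ?T * ennreal (c1 * ta * F (tw n)) epowr p"
   proof -
    have "cseq ?d F p n >= 0" using F_nonneg by (simp add: cseq_def)
    then have "ennreal (cseq ?d F p n) epowr p = ennreal (tw n powr (real ?d * (p - 1)) * (F (tw n)) powr p)"
     unfolding cs by (rule epowr_ennreal)
    moreover have "ennreal (c1 * ta * F (tw n)) epowr p = ennreal ((c1 * ta) powr p * (F (tw n)) powr p)"
     using c1 tau F_nonneg[of "tw n"] by (simp add: epowr_ennreal powr_mult)
    ultimately show ?thesis by (simp add: ennreal_mult[symmetric] mult_ac)
   qed
   also have "... <= ?T * (ennreal (2 powr p * ta powr (p - 1)) * (NI h. ?X n h epowr p * indicator ?B h))"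
    by (intro mult_left_mono 1) auto
   also have "... = ennreal (2 powr p * ta powr (p - 1)) * (NI h. ?T * (?X n h epowr p * indicator ?B h))"
    by (subst nn_integral_cmult) (simp, simp only: mult_ac)
   also have "... <= ennreal (2 powr p * ta powr (p - 1)) * (NI h. ennreal L * (?I n h * indicator ?B h))"
   proof (intro mult_left_mono nn_integral_mono)
    fix h
    have "?T * ?X n h epowr p <= ennreal L * ?I n h"
     unfolding L_def b_def
     by (rule weighted_powr) (use K1 K2 J in \<open>auto simp: b_def\<close>)
    then show "?T * (?X n h epowr p * indicator ?B h) <= ennreal L * (?I n h * indicator ?B h)"
     unfolding mult.assoc[symmetric] by (rule mult_right_mono) simp
   qed simp
   also have "... = ennreal (2 powr p * ta powr (p - 1) * L) * (NI h. ?I n h * indicator ?B h)"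
    using L by (subst nn_integral_cmult) (simp, simp add: ennreal_mult mult.assoc)
   finally show ?thesis using True by simp
  qed simp
  have "ennreal ((c1 * ta) powr p) * zsum (%n. if R0 <= tw (n - 1) * t then ennreal (cseq ?d F p n) epowr p else 0)
    <= zsum (%n. ennreal (2 powr p * ta powr (p - 1) * L) * (NI h. ?I n h * indicator ?B h))"
   unfolding zsum_cmult[symmetric] by (intro zsum_mono one)
  also have "... = ennreal (2 powr p * ta powr (p - 1) * L) * zsum (%n. NI h. ?I n h * indicator ?B h)"
   by (rule zsum_cmult)
  also have "zsum (%n. NI h. ?I n h * indicator ?B h) = (NI h. zsum (%n. ?I n h * indicator ?B h))"
   by (rule zsum_nn_integral[symmetric]) measurable
  also have "ennreal (2 powr p * ta powr (p - 1) * L) * ... <= ennreal (2 powr p * ta powr (p - 1) * L) * (NI h. (ennreal S * (ennreal M * D)) * indicator ?B h)"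
  proof (intro mult_left_mono nn_integral_mono)
   fix h :: 'a
   have [measurable]: "sdiff k h g \<in> borel_measurable borel"
    using measurable_compose[OF measurable_Pair1'[of h] sd_meas[of k]] by simp
   show "zsum (%n. ?I n h * indicator ?B h) <= (ennreal S * (ennreal M * D)) * indicator ?B h"
   proof (cases "h \<in> ?B")
    case True
    have "zsum (%n. ?I n h) = (NI x. zsum (%n. ennreal \<bar>sdiff k h g x\<bar> epowr p * ennreal (2 powr - (b * \<bar>real_of_int n + log 2 (norm x)\<bar>))))"
     by (rule zsum_nn_integral[symmetric]) measurable
    \<comment> \<open>The sum over \<open>n\<close> of the weights is at most \<open>S\<close>,
      whatever the shift \<open>log 2 (norm x)\<close>.\<close>
    also have "... <= (NI x. ennreal S * ennreal \<bar>sdiff k h g x\<bar> epowr p)"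
     unfolding zsum_cmult by (intro nn_integral_mono) (subst mult.commute[of "ennreal S"], intro mult_left_mono S, simp)
    also have "... = ennreal S * (NI x. ennreal \<bar>sdiff k h g x\<bar> epowr p)"
     by (rule nn_integral_cmult) measurable
    also have "... <= ennreal S * (ennreal M * (NI x. ennreal \<bar>rdiff k h g x\<bar> epowr p))"
     using p unfolding M_def by (intro mult_left_mono sdiff_Lp_bound) auto
    also have "... <= ennreal S * (ennreal M * D)" using True by (intro mult_left_mono D) auto
    finally show ?thesis using True by simp
   qed (simp add: zsum_def)
  qed simp
  also have "(NI h. (ennreal S * (ennreal M * D)) * indicator ?B h) = (ennreal S * (ennreal M * D)) * ennreal ta"
   using volB by (subst nn_integral_cmult) auto
  finally have fin: "ennreal ((c1 * ta) powr p) * zsum (%n. if R0 <= tw (n - 1) * t then ennreal (cseq ?d F p n) epowr p else 0)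
   <= ennreal (2 powr p * ta powr (p - 1) * L) * ((ennreal S * (ennreal M * D)) * ennreal ta)" .
  let ?Z = "zsum (%n. if R0 <= tw (n - 1) * t then ennreal (cseq ?d F p n) epowr p else 0)"
  have ct: "(c1 * ta) powr p > 0" using c1 tau by simp
  have "?Z = ennreal (1 / (c1 * ta) powr p * (c1 * ta) powr p) * ?Z" using ct by simp
  also have "... = ennreal (1 / (c1 * ta) powr p) * (ennreal ((c1 * ta) powr p) * ?Z)"
   by (subst ennreal_mult) (auto simp: mult.assoc)
  also have "... <= ennreal (1 / (c1 * ta) powr p) * (ennreal (2 powr p * ta powr (p - 1) * L) * ((ennreal S * (ennreal M * D)) * ennreal ta))"
   by (intro mult_left_mono fin) auto
  also have "... = ennreal (1 / (c1 * ta) powr p * (2 powr p * ta powr (p - 1) * L * (S * M * ta))) * D"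
  proof -
   have gen: "ennreal a * (ennreal b * ((ennreal S * (ennreal M * D)) * ennreal ta)) = ennreal (a * (b * (S * M * ta))) * D"
    if "a >= 0" "b >= 0" for a b
    using S(1) M tau that by (simp add: ennreal_mult mult_ac)
   show ?thesis by (rule gen) (use L in auto)
  qed
  \<comment> \<open>All powers of the ball volume \<open>ta\<close> cancel, so the constant does not
    depend on \<open>t\<close>.\<close>
  also have "1 / (c1 * ta) powr p * (2 powr p * ta powr (p - 1) * L * (S * M * ta)) = K"
  proof -
   have "ta powr (p - 1) * ta = ta powr p" using tau by (simp add: powr_diff)
   then have e: "2 powr p * ta powr (p - 1) * L * (S * M * ta) = 2 powr p * L * S * M * ta powr p" by (simp add: mult_ac)
   have m: "(c1 * ta) powr p = c1 powr p * ta powr p" using c1 tau by (simp add: powr_mult)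
   have "1 / (c1 powr p * ta powr p) * (z * ta powr p) = z / c1 powr p" for z using tau by simp
   then show ?thesis unfolding m e K_def .
  qed
  finally show ?thesis .
 qed
 show thesis by (rule that[OF K R0(1)]) (rule main)
qed

section \<open>Weighted sequence norms\<close>

lemma ennreal_le_suminf: "f n <= (\<Sum>n. f n :: ennreal)"
 using sum_le_suminf[of f "{n}"] by (simp add: summableI)

lemma ennreal_suminf_mono: "(!!n. f n <= g n) ==> (\<Sum>n. f n :: ennreal) <= (\<Sum>n. g n)"
 by (intro suminf_le summableI)

lemma ennreal_suminf_swap: "(\<Sum>m. \<Sum>n. f m n :: ennreal) = (\<Sum>n. \<Sum>m. f m n)"
 using nn_integral_suminf[of "%n m. f m n" "count_space UNIV"] by (simp add: nn_integral_count_space_nat)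

lemma dominated_trans:
 assumes "X <= ennreal K * Y" "Y <= ennreal L * Z" "K >= 0" "L >= 0"
 shows "X <= ennreal (K * L) * Z"
proof -
 have "X <= ennreal K * (ennreal L * Z)" using assms(1) mult_left_mono[OF assms(2), of "ennreal K"] by (auto intro: order_trans)
 then show ?thesis using assms by (simp add: ennreal_mult mult.assoc)
qed

lemma dominated_add:
 assumes "X <= ennreal K * Z" "Y <= ennreal L * Z" "K >= 0" "L >= 0"
 shows "X + Y <= ennreal (K + L) * Z"
 using add_mono[OF assms(1,2)] assms by (simp add: ring_distribs)

lemma dominated_weaken:
 assumes "X <= ennreal K * Y" "K <= L"
 shows "X <= ennreal L * Y"
 using assms(1) mult_right_mono[OF ennreal_leI[OF assms(2)], of Y] by (auto intro: order_trans)

definition seq_norm :: "ennreal => (nat => ennreal) => ennreal" where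
 "seq_norm q x = (if q = \<infinity> then SUP n. x n
   else (\<Sum>n. x n epowr enn2real q) epowr (1 / enn2real q))"

lemma enn2real_pos: "0 < q ==> q \<noteq> \<infinity> ==> enn2real q > 0"
 by (simp add: enn2real_positive_iff less_top)

lemma seq_norm_mono: "0 < q ==> (!!n. x n <= y n) ==> seq_norm q x <= seq_norm q y"
 using enn2real_pos[of q]
 by (auto simp: seq_norm_def intro!: SUP_mono' epowr_mono ennreal_suminf_mono)

lemma seq_norm_cmult: "0 < q ==> seq_norm q (%n. c * x n) = c * seq_norm q x"
 using enn2real_pos[of q]
 by (auto simp: seq_norm_def epowr_mult epowr_inverse SUP_mult_left_ennreal)

lemma seq_norm_le_cmult:
 "0 < q ==> (!!n. x n <= c * y n) ==> seq_norm q x <= c * seq_norm q y"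
 using seq_norm_mono[of q x "%n. c * y n"] by (simp add: seq_norm_cmult)

lemma seq_norm_term: "0 < q ==> x n <= seq_norm q x"
 using enn2real_pos[of q] ennreal_le_suminf[of "%n. x n epowr enn2real q" n]
 by (auto simp: seq_norm_def intro!: epowr_le_swap SUP_upper)

lemma seq_norm_single: "0 < q ==> seq_norm q (%n. if n = m then c else 0) = c"
proof -
 assume q: "0 < q"
 have s: "(%n. (if n = m then c else 0) epowr a) = (%n. if n = m then c epowr a else 0)" for a
  by auto
 have "(\<Sum>n. if n = m then c epowr a else 0) = c epowr a" for a
  using suminf_finite[of "{m}" "%n. if n = m then c epowr a else 0"] by simp
 moreover have "(SUP n. if n = m then c else 0) = c"
  by (intro antisym SUP_least) (auto intro: SUP_upper2[of m])
 ultimately have sums: "(\<Sum>n. if n = m then c epowr a else 0) = c epowr a" "(SUP n. if n = m then c else 0) = c" for a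
  by blast+
 show ?thesis
 proof (cases "q = \<infinity>")
  case False
  then have "enn2real q \<noteq> 0" using enn2real_pos[OF q] by simp
  then show ?thesis unfolding seq_norm_def if_not_P[OF False] s sums by (rule epowr_inverse)
 qed (simp only: seq_norm_def sums if_True simp_thms)
qed

lemma seq_norm_add:
 assumes q: "0 < q"
 obtains K where "K > 0" "!!x y. seq_norm q (%n. x n + y n) <= ennreal K * (seq_norm q x + seq_norm q y)"
proof (cases "q = \<infinity>")
 case True
 have "seq_norm q (%n. x n + y n) <= ennreal 1 * (seq_norm q x + seq_norm q y)" for x y
  using True by (auto simp: seq_norm_def intro!: SUP_least add_mono SUP_upper)
 then show thesis by (intro that[of 1]) auto
next
 case False
 define r where "r = enn2real q"
 have r: "r > 0" using enn2real_pos[OF q False] by (simp add: r_def)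
 have "seq_norm q (%n. x n + y n) <= ennreal (2 * 2 powr (1 / r)) * (seq_norm q x + seq_norm q y)" for x y
 proof -
  have "(\<Sum>n. (x n + y n) epowr r) <= (\<Sum>n. ennreal (2 powr r) * (x n epowr r + y n epowr r))"
   using r by (intro ennreal_suminf_mono epowr_add_le)
  also have "... = ennreal (2 powr r) * ((\<Sum>n. x n epowr r) + (\<Sum>n. y n epowr r))"
   by (simp add: suminf_add[symmetric] summableI)
  finally have "(\<Sum>n. (x n + y n) epowr r) epowr (1 / r) <=
    (ennreal (2 powr r) * ((\<Sum>n. x n epowr r) + (\<Sum>n. y n epowr r))) epowr (1 / r)"
   using r by (intro epowr_mono) auto
  also have "... = ennreal 2 * ((\<Sum>n. x n epowr r) + (\<Sum>n. y n epowr r)) epowr (1 / r)"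
   using r by (simp add: epowr_mult epowr_ennreal powr_powr)
  finally have "seq_norm q (%n. x n + y n) <= ennreal 2 * ((\<Sum>n. x n epowr r) + (\<Sum>n. y n epowr r)) epowr (1 / r)"
   using False by (simp add: seq_norm_def r_def)
  moreover have "((\<Sum>n. x n epowr r) + (\<Sum>n. y n epowr r)) epowr (1 / r)
    <= ennreal (2 powr (1 / r)) * (seq_norm q x + seq_norm q y)"
   using epowr_add_le[of "1 / r"] r False by (simp add: seq_norm_def r_def)
  ultimately show ?thesis by (intro dominated_trans) auto
 qed
 then show thesis using r by (intro that[of "2 * 2 powr (1 / r)"]) auto
qed

lemma seq_norm_Suc: "0 < q ==> seq_norm q (%n. x (Suc n)) <= seq_norm q x"
proof (cases "q = \<infinity>")
 case False
 assume "0 < q"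
 have "(\<Sum>n. x (Suc n) epowr a) <= (\<Sum>n. x n epowr a)" for a
  using suminf_offset[of "%n. x n epowr a" 1] by (simp add: summableI add_increasing2)
 then show ?thesis using False enn2real_pos[OF \<open>0 < q\<close> False] by (auto simp: seq_norm_def intro!: epowr_mono)
qed (auto simp: seq_norm_def intro!: SUP_least SUP_upper)

lemma seq_norm_head:
 assumes q: "0 < q"
 obtains K where "K > 0" "!!x. seq_norm q x <= ennreal K * (x 0 + seq_norm q (%n. x (Suc n)))"
proof (cases "q = \<infinity>")
 case True
 have "seq_norm q x <= ennreal 1 * (x 0 + seq_norm q (%n. x (Suc n)))" for x
 proof -
  have "x n <= x 0 + (SUP n. x (Suc n))" for n
  proof (cases n)
   case (Suc j)
   have "x (Suc j) <= (SUP n. x (Suc n))" by (rule SUP_upper) simp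
   then show ?thesis using Suc by (simp add: add_increasing)
  qed simp
  then show ?thesis using True by (auto simp: seq_norm_def intro!: SUP_least)
 qed
 then show thesis by (intro that[of 1]) auto
next
 case False
 define r where "r = enn2real q"
 have r: "r > 0" using enn2real_pos[OF q False] by (simp add: r_def)
 have "seq_norm q x <= ennreal (2 powr (1 / r)) * (x 0 + seq_norm q (%n. x (Suc n)))" for x
 proof -
  have "(\<Sum>n. x n epowr r) = x 0 epowr r + (\<Sum>n. x (Suc n) epowr r)"
   using suminf_offset[of "%n. x n epowr r" 1] by (simp add: summableI)
  then show ?thesis using epowr_add_le[of "1 / r" "x 0 epowr r" "\<Sum>n. x (Suc n) epowr r"] r False
   by (simp add: seq_norm_def r_def[symmetric] epowr_inverse)
 qed
 then show thesis using r by (intro that[of "2 powr (1 / r)"]) auto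
qed

text \<open>Bounding the supremum by a sum makes the convolution estimate work for all exponents.\<close>

lemma seq_norm_sup_convolution:
 assumes q: "0 < q" and dl: "dl > 0"
 obtains K where "K > 0"
  "!!y. seq_norm q (%m. SUP n. ennreal (2 powr - (dl * \<bar>real n - real m\<bar>)) * y n) <= ennreal K * seq_norm q y"
proof (cases "q = \<infinity>")
 case True
 have "ennreal (2 powr - (dl * \<bar>real n - real m\<bar>)) * y n <= (SUP n. y n)" for m n and y :: "nat => ennreal"
 proof -
  have "(2::real) powr - (dl * \<bar>real n - real m\<bar>) <= 2 powr 0" using dl by (intro powr_mono) auto
  then have "ennreal (2 powr - (dl * \<bar>real n - real m\<bar>)) * y n <= 1 * y n"
   by (intro mult_right_mono) (auto simp: ennreal_leI simp flip: ennreal_1)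
  then show ?thesis by (auto intro: SUP_upper2[of n])
 qed
 then have "seq_norm q (%m. SUP n. ennreal (2 powr - (dl * \<bar>real n - real m\<bar>)) * y n) <= ennreal 1 * seq_norm q y" for y
  using True by (auto simp: seq_norm_def intro!: SUP_least)
 then show thesis by (intro that[of 1]) auto
next
 case False
 define r where "r = enn2real q"
 have r: "r > 0" using enn2real_pos[OF q False] by (simp add: r_def)
 obtain S where S: "S > 0" "!!t::real. zsum (%n. ennreal (2 powr - (dl * r * \<bar>real_of_int n + t\<bar>))) <= ennreal S"
  by (rule zsum_geometric_shift[OF mult_pos_pos[OF dl r]], rule that)
 have row: "(\<Sum>m. ennreal (2 powr - (dl * r * \<bar>real n - real m\<bar>))) <= ennreal S" for n
 proof -
  let ?f = "%m::int. ennreal (2 powr - (dl * r * \<bar>real_of_int m + - real n\<bar>))"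
  have "(\<Sum>m. ennreal (2 powr - (dl * r * \<bar>real n - real m\<bar>))) = (\<Sum>m. ?f (int m))"
   by (intro suminf_cong) (simp add: abs_minus_commute)
  also have "... = zsum (%m. if m >= 0 then ?f m else 0)" by (rule zsum_nonneg_part[symmetric])
  also have "... <= zsum ?f" by (intro zsum_mono) auto
  also have "... <= ennreal S" by (rule S(2))
  finally show ?thesis .
 qed
 have "seq_norm q (%m. SUP n. ennreal (2 powr - (dl * \<bar>real n - real m\<bar>)) * y n) <= ennreal (S powr (1 / r)) * seq_norm q y" for y
 proof -
  let ?z = "%m n. ennreal (2 powr - (dl * \<bar>real n - real m\<bar>)) * y n"
  have zr: "?z m n epowr r = ennreal (2 powr - (dl * r * \<bar>real n - real m\<bar>)) * y n epowr r" for m n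
   using r by (simp add: epowr_mult epowr_ennreal powr_powr mult_ac)
  \<comment> \<open>Bounding the supremum by a sum of powers reduces the claim to exchanging two
    sums of nonnegative terms.\<close>
  have "(SUP n. ?z m n) epowr r <= (\<Sum>n. ?z m n epowr r)" for m
  proof -
   have "(SUP n. ?z m n) <= (\<Sum>n. ?z m n epowr r) epowr (1 / r)"
    using r by (intro SUP_least epowr_le_swap ennreal_le_suminf)
   then have "(SUP n. ?z m n) epowr r <= ((\<Sum>n. ?z m n epowr r) epowr (1 / r)) epowr r"
    using r by (intro epowr_mono) auto
   then show ?thesis using r by (simp add: epowr_inverse)
  qed
  then have "(\<Sum>m. (SUP n. ?z m n) epowr r) <= (\<Sum>m. \<Sum>n. ?z m n epowr r)"
   by (rule ennreal_suminf_mono)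
  also have "... = (\<Sum>n. \<Sum>m. ?z m n epowr r)" by (rule ennreal_suminf_swap)
  also have "... = (\<Sum>n. y n epowr r * (\<Sum>m. ennreal (2 powr - (dl * r * \<bar>real n - real m\<bar>))))"
   unfolding zr by (simp add: mult.commute)
  also have "... <= (\<Sum>n. y n epowr r * ennreal S)"
   by (intro ennreal_suminf_mono mult_left_mono row) auto
  also have "... = ennreal S * (\<Sum>n. y n epowr r)" by (simp add: mult.commute)
  finally have "(\<Sum>m. (SUP n. ?z m n) epowr r) epowr (1 / r) <= (ennreal S * (\<Sum>n. y n epowr r)) epowr (1 / r)"
   using r by (intro epowr_mono) auto
  then show ?thesis using False r S by (simp add: seq_norm_def r_def[symmetric] epowr_mult epowr_ennreal)
 qed
 then show thesis using S by (intro that[of "S powr (1 / r)"]) auto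
qed

text \<open>A discrete Hardy inequality. Half of the off-diagonal decay bounds the inner sum by a
  supremum, and the other half serves \<open>seq_norm_sup_convolution\<close>; no relation between
  \<open>p\<close> and \<open>q\<close> enters.\<close>

lemma seq_norm_convolution:
 assumes q: "0 < q" and \<eta>: "\<eta> > 0" and p: "p > 0"
 obtains K where "K > 0"
  "!!z. seq_norm q (%m. (\<Sum>n. (ennreal (2 powr - (\<eta> * \<bar>real n - real m\<bar>)) * z n) epowr p) epowr (1 / p))
   <= ennreal K * seq_norm q z"
proof -
 obtain K where K: "K > 0"
  "!!y. seq_norm q (%m. SUP n. ennreal (2 powr - (\<eta> / 2 * \<bar>real n - real m\<bar>)) * y n) <= ennreal K * seq_norm q y"
  by (rule seq_norm_sup_convolution[OF q half_gt_zero[OF \<eta>]], rule that)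
 obtain S where S: "S > 0" "!!t::real. zsum (%n. ennreal (2 powr - (\<eta> / 2 * p * \<bar>real_of_int n + t\<bar>))) <= ennreal S"
  by (rule zsum_geometric_shift[OF mult_pos_pos[OF half_gt_zero[OF \<eta>] p]], rule that)
 have row: "(\<Sum>n. ennreal (2 powr - (\<eta> / 2 * p * \<bar>real n - real m\<bar>))) <= ennreal S" for m
 proof -
  let ?f = "%n::int. ennreal (2 powr - (\<eta> / 2 * p * \<bar>real_of_int n + - real m\<bar>))"
  have "(\<Sum>n. ennreal (2 powr - (\<eta> / 2 * p * \<bar>real n - real m\<bar>))) = zsum (%n. if n >= 0 then ?f n else 0)"
   unfolding zsum_nonneg_part by simp
  also have "... <= zsum ?f" by (intro zsum_mono) auto
  also have "... <= ennreal S" by (rule S(2))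
  finally show ?thesis .
 qed
 have "seq_norm q (%m. (\<Sum>n. (ennreal (2 powr - (\<eta> * \<bar>real n - real m\<bar>)) * z n) epowr p) epowr (1 / p))
   <= ennreal (S powr (1 / p) * K) * seq_norm q z" for z
 proof (rule dominated_trans)
  let ?s = "%m. SUP n. ennreal (2 powr - (\<eta> / 2 * \<bar>real n - real m\<bar>)) * z n"
  show "seq_norm q (%m. (\<Sum>n. (ennreal (2 powr - (\<eta> * \<bar>real n - real m\<bar>)) * z n) epowr p) epowr (1 / p))
   <= ennreal (S powr (1 / p)) * seq_norm q ?s"
  proof (rule seq_norm_le_cmult[OF q])
   fix m
   have "(ennreal (2 powr - (\<eta> * \<bar>real n - real m\<bar>)) * z n) epowr p <=
     ennreal (2 powr - (\<eta> / 2 * p * \<bar>real n - real m\<bar>)) * ?s m epowr p" for n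
   proof -
    have e: "2 powr - (\<eta> * \<bar>real n - real m\<bar>) = 2 powr - (\<eta> / 2 * \<bar>real n - real m\<bar>) * 2 powr - (\<eta> / 2 * \<bar>real n - real m\<bar>)"
     by (simp add: powr_add[symmetric])
    have "(ennreal (2 powr - (\<eta> * \<bar>real n - real m\<bar>)) * z n) epowr p =
     ennreal (2 powr - (\<eta> / 2 * p * \<bar>real n - real m\<bar>)) * (ennreal (2 powr - (\<eta> / 2 * \<bar>real n - real m\<bar>)) * z n) epowr p"
     unfolding e using p by (simp add: ennreal_mult epowr_mult epowr_ennreal powr_powr mult_ac)
    also have "... <= ennreal (2 powr - (\<eta> / 2 * p * \<bar>real n - real m\<bar>)) * ?s m epowr p"
     using p by (intro mult_left_mono epowr_mono SUP_upper) auto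
    finally show ?thesis .
   qed
   then have "(\<Sum>n. (ennreal (2 powr - (\<eta> * \<bar>real n - real m\<bar>)) * z n) epowr p) <=
     (\<Sum>n. ennreal (2 powr - (\<eta> / 2 * p * \<bar>real n - real m\<bar>)) * ?s m epowr p)"
    by (rule ennreal_suminf_mono)
   also have "... = (\<Sum>n. ennreal (2 powr - (\<eta> / 2 * p * \<bar>real n - real m\<bar>))) * ?s m epowr p"
    by simp
   also have "... <= ennreal S * ?s m epowr p" by (intro mult_right_mono row) auto
   finally have "(\<Sum>n. (ennreal (2 powr - (\<eta> * \<bar>real n - real m\<bar>)) * z n) epowr p) epowr (1 / p)
     <= (ennreal S * ?s m epowr p) epowr (1 / p)" using p by (intro epowr_mono) auto
   then show "(\<Sum>n. (ennreal (2 powr - (\<eta> * \<bar>real n - real m\<bar>)) * z n) epowr p) epowr (1 / p)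
     <= ennreal (S powr (1 / p)) * ?s m"
    using p S by (simp add: epowr_mult epowr_ennreal epowr_inverse)
  qed
  show "seq_norm q ?s <= ennreal K * seq_norm q z" by (rule K(2))
 qed (use K S in auto)
 then show thesis using S K by (intro that[of "S powr (1 / p) * K"]) auto
qed

text \<open>Up to constants, the size of \<open>t powr - s * (1 - ln t) powr b\<close> at
  \<open>t = tw (- m)\<close>.\<close>

definition lam :: "real => real => nat => real" where
 "lam s b m = 2 powr (real m * s) * (1 + real m) powr b"

lemma lam_pos [simp]: "lam s b m > 0" "lam s b m >= 0" by (simp_all add: lam_def add_pos_nonneg less_imp_le)

lemma lam_0 [simp]: "lam s b 0 = 1" by (simp add: lam_def)

text \<open>The elementary bound \<open>1 + i <= (1 + \<bar>i - j\<bar>) * (1 + j)\<close>, used in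
  either direction according to the sign of \<open>b\<close>, reduces the ratio to a power of the
  distance. Such a power is dominated by an exponential of arbitrarily small rate.\<close>

lemma log_weight_ratio:
 assumes dl: "dl > 0"
 obtains K where "K > 0" "!!m n. (1 + real m) powr b <= K * 2 powr (dl * \<bar>real m - real n\<bar>) * (1 + real n) powr b"
proof -
 define \<beta> where "\<beta> = \<bar>b\<bar>"
 \<comment> \<open>The estimate \<open>\<epsilon> * (1 + x) <= exp (\<epsilon> * x)\<close> raised
   to the power \<open>\<beta>\<close> has rate \<open>\<epsilon> * \<beta>\<close>, which must not
   exceed \<open>dl * ln 2\<close>.\<close>
 define \<epsilon> where "\<epsilon> = min 1 (dl * ln 2 / (\<beta> + 1))"
 have \<beta>: "\<beta> >= 0" by (simp add: \<beta>_def)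
 have \<epsilon>: "\<epsilon> > 0" "\<epsilon> <= 1" "\<epsilon> * \<beta> <= dl * ln 2"
 proof -
  show "\<epsilon> > 0" "\<epsilon> <= 1" using dl \<beta> by (auto simp: \<epsilon>_def)
  have "\<epsilon> * \<beta> <= dl * ln 2 / (\<beta> + 1) * \<beta>" using \<beta> by (intro mult_right_mono) (auto simp: \<epsilon>_def)
  also have "... = dl * ln 2 * (\<beta> / (\<beta> + 1))" by simp
  also have "... <= dl * ln 2 * 1" using dl \<beta> by (intro mult_left_mono) (auto simp: divide_simps)
  finally show "\<epsilon> * \<beta> <= dl * ln 2" by simp
 qed
 have grow: "(1 + x) powr \<beta> <= \<epsilon> powr - \<beta> * 2 powr (dl * x)" if x: "x >= 0" for x
 proof -
  have "\<epsilon> * (1 + x) <= 1 + \<epsilon> * x" using \<epsilon> by (simp add: algebra_simps)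
  also have "... <= exp (\<epsilon> * x)" by (rule exp_ge_add_one_self)
  finally have "(\<epsilon> * (1 + x)) powr \<beta> <= exp (\<epsilon> * x) powr \<beta>" using \<epsilon> \<beta> x by (intro powr_mono2) auto
  also have "... = exp (\<epsilon> * \<beta> * x)" by (simp add: powr_def mult_ac)
  also have "... <= exp (dl * ln 2 * x)" using mult_right_mono[OF \<epsilon>(3) x] by simp
  also have "... = 2 powr (dl * x)" by (simp add: powr_def mult_ac)
  finally have "\<epsilon> powr \<beta> * (1 + x) powr \<beta> <= 2 powr (dl * x)" using \<epsilon> x by (simp add: powr_mult)
  then show ?thesis using \<epsilon> by (simp add: powr_minus field_simps)
 qed
 have "(1 + real m) powr b <= \<epsilon> powr - \<beta> * 2 powr (dl * \<bar>real m - real n\<bar>) * (1 + real n) powr b" for m n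
 proof -
  have r: "1 + real i <= (1 + \<bar>real m - real n\<bar>) * (1 + real j)" if "\<bar>real i - real j\<bar> = \<bar>real m - real n\<bar>" for i j
  proof -
   have "1 + real i <= 1 + \<bar>real m - real n\<bar> + real j" using that by linarith
   also have "... <= (1 + \<bar>real m - real n\<bar>) * (1 + real j)" by (simp add: algebra_simps)
   finally show ?thesis .
  qed
  have "(1 + real m) powr b <= (1 + \<bar>real m - real n\<bar>) powr \<beta> * (1 + real n) powr b"
  proof (cases "b >= 0")
   case True
   then have "(1 + real m) powr b <= ((1 + \<bar>real m - real n\<bar>) * (1 + real n)) powr b"
    using r[of m n] by (intro powr_mono2) auto
   then show ?thesis using True by (simp add: powr_mult \<beta>_def)
  next
   case False
   then have "(1 + real n) powr - b <= ((1 + \<bar>real m - real n\<bar>) * (1 + real m)) powr - b"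
    using r[of n m] by (intro powr_mono2) (auto simp: abs_minus_commute)
   then have "(1 + real n) powr - b <= (1 + \<bar>real m - real n\<bar>) powr \<beta> * (1 + real m) powr - b"
    using False by (simp add: powr_mult \<beta>_def)
   moreover have "(1 + real m) powr b > 0" "(1 + real n) powr b > 0" by (simp_all add: add_pos_nonneg)
   ultimately show ?thesis by (simp add: powr_minus field_simps)
  qed
  also have "... <= (\<epsilon> powr - \<beta> * 2 powr (dl * \<bar>real m - real n\<bar>)) * (1 + real n) powr b"
   by (intro mult_right_mono grow) auto
  finally show ?thesis by (simp add: mult.assoc)
 qed
 then show thesis using \<epsilon> by (intro that[of "\<epsilon> powr - \<beta>"]) auto
qed

lemma lam_shift:
 obtains K where "K > 0" "!!m. lam s b (m + M) <= K * lam s b m"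
proof -
 obtain K where K: "K > 0" "!!m n. (1 + real m) powr b <= K * 2 powr (1 * \<bar>real m - real n\<bar>) * (1 + real n) powr b"
  by (rule log_weight_ratio[OF zero_less_one, where b = b], rule that)
 have "lam s b (m + M) <= (2 powr (real M * s) * (K * 2 powr real M)) * lam s b m" for m
 proof -
  have "lam s b (m + M) = 2 powr (real M * s) * 2 powr (real m * s) * (1 + real (m + M)) powr b"
   by (simp add: lam_def powr_add[symmetric] algebra_simps)
  also have "... <= 2 powr (real M * s) * 2 powr (real m * s) * (K * 2 powr (1 * \<bar>real (m + M) - real m\<bar>) * (1 + real m) powr b)"
   by (intro mult_left_mono K) auto
  finally show ?thesis by (simp add: lam_def mult_ac)
 qed
 then show thesis using K by (intro that[of "2 powr (real M * s) * (K * 2 powr real M)"]) auto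
qed

text \<open>The strict inequalities \<open>s < k\<close> and \<open>0 < s\<close> leave an
  exponential gap, on the low and on the high frequency side respectively. For \<open>s = 0\<close>
  the second gap is missing, which is why tail norms appear in that case.\<close>

lemma lam_ratio:
 assumes s: "0 <= s" "s < real k"
 obtains K \<eta> where "K > 0" "\<eta> > 0"
  "!!m n. n <= m ==> lam s b m * 2 powr - (real k * (real m - real n)) <= K * 2 powr - (\<eta> * \<bar>real n - real m\<bar>) * lam s b n"
  "!!m n. 0 < s ==> m <= n ==> lam s b m <= K * 2 powr - (\<eta> * \<bar>real n - real m\<bar>) * lam s b n"
proof -
 \<comment> \<open>Half of the smaller gap: one half absorbs the logarithmic weights, the other
   becomes the decay \<open>\<eta>\<close>. For \<open>s = 0\<close> only the gap towards
   \<open>k\<close> counts.\<close>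
 define dl where "dl = (if s > 0 then min s (real k - s) else real k) / 2"
 have dl: "dl > 0" "2 * dl <= real k - s" "s > 0 ==> 2 * dl <= s" using s by (auto simp: dl_def)
 obtain K where K: "K > 0" "!!m n. (1 + real m) powr b <= K * 2 powr (dl * \<bar>real m - real n\<bar>) * (1 + real n) powr b"
  by (rule log_weight_ratio[OF dl(1), where b = b], rule that)
 have main: "lam s b m * 2 powr a <= K * 2 powr - (dl * \<bar>real n - real m\<bar>) * lam s b n"
  if a: "real m * s + a + dl * \<bar>real m - real n\<bar> <= real n * s - dl * \<bar>real n - real m\<bar>" for m n a
 proof -
  have "lam s b m * 2 powr a = 2 powr (real m * s + a) * (1 + real m) powr b"
   by (simp add: lam_def powr_add)
  also have "... <= 2 powr (real m * s + a) * (K * 2 powr (dl * \<bar>real m - real n\<bar>) * (1 + real n) powr b)"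
   by (intro mult_left_mono K) auto
  also have "... = K * 2 powr (real m * s + a + dl * \<bar>real m - real n\<bar>) * (1 + real n) powr b"
   by (simp add: powr_add)
  also have "... <= K * 2 powr (real n * s - dl * \<bar>real n - real m\<bar>) * (1 + real n) powr b"
   using K a by (intro mult_right_mono mult_left_mono powr_mono) auto
  also have "... = K * 2 powr - (dl * \<bar>real n - real m\<bar>) * lam s b n"
   by (simp add: lam_def powr_diff powr_minus field_simps)
  finally show ?thesis .
 qed
 show thesis
 proof (rule that[OF K(1) dl(1)])
  fix m n :: nat assume "n <= m"
  then have "2 * dl * (real m - real n) <= (real k - s) * (real m - real n)"
   using dl(2) by (intro mult_right_mono) auto
  then show "lam s b m * 2 powr - (real k * (real m - real n)) <= K * 2 powr - (dl * \<bar>real n - real m\<bar>) * lam s b n"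
   using \<open>n <= m\<close> by (intro main) (simp add: algebra_simps)
 next
  fix m n :: nat assume "0 < s" "m <= n"
  then have "2 * dl * (real n - real m) <= s * (real n - real m)"
   using dl(3) by (intro mult_right_mono) auto
  then show "lam s b m <= K * 2 powr - (dl * \<bar>real n - real m\<bar>) * lam s b n"
   using \<open>m <= n\<close> main[of m 0 n] by (simp add: algebra_simps)
 qed
qed

text \<open>Discretization shifts indices, and this lemma undoes a shift by \<open>M\<close> at the
  price of the first \<open>M\<close> terms. The induction splits off the head and compares
  neighbouring weights.\<close>

lemma seq_norm_fill:
 assumes q: "0 < q"
 obtains K where "K > 0"
  "!!y. seq_norm q (%m. ennreal (lam s b m) * y m) <= ennreal K * ((\<Sum>m<M. y m) + seq_norm q (%m. ennreal (lam s b m) * y (m + M)))"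
proof -
 obtain H where H: "H > 0" "!!x. seq_norm q x <= ennreal H * (x 0 + seq_norm q (%n. x (Suc n)))"
  by (rule seq_norm_head[OF q], rule that)
 obtain L where L: "L > 0" "!!m. lam s b (m + 1) <= L * lam s b m"
  by (rule lam_shift[where s = s and b = b and M = 1], rule that)
 have "\<exists>K>0. \<forall>y. seq_norm q (%m. ennreal (lam s b m) * y m) <= ennreal K * ((\<Sum>m<M. y m) + seq_norm q (%m. ennreal (lam s b m) * y (m + M)))"
 proof (induction M)
  case 0
  show ?case by (intro exI[of _ 1]) auto
 next
  case (Suc M)
  then obtain K where K: "K > 0"
   "!!y. seq_norm q (%m. ennreal (lam s b m) * y m) <= ennreal K * ((\<Sum>m<M. y m) + seq_norm q (%m. ennreal (lam s b m) * y (m + M)))"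
   by auto
  have "seq_norm q (%m. ennreal (lam s b m) * y m) <=
    ennreal (K * (1 + H * (1 + L))) * ((\<Sum>m<Suc M. y m) + seq_norm q (%m. ennreal (lam s b m) * y (m + Suc M)))" for y
  proof (rule dominated_trans[OF K(2)])
   let ?Z = "(\<Sum>m<Suc M. y m) + seq_norm q (%m. ennreal (lam s b m) * y (m + Suc M))"
   have "seq_norm q (%m. ennreal (lam s b m) * y (m + M)) <= ennreal H * (y M + seq_norm q (%m. ennreal (lam s b (Suc m)) * y (Suc m + M)))"
    using H(2)[of "%m. ennreal (lam s b m) * y (m + M)"] by simp
   moreover have "y M + seq_norm q (%m. ennreal (lam s b (Suc m)) * y (Suc m + M)) <= ennreal (1 + L) * ?Z"
   proof (rule dominated_add)
    show "y M <= ennreal 1 * ?Z" by (simp add: add_increasing add_increasing2)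
    have "seq_norm q (%m. ennreal (lam s b (Suc m)) * y (Suc m + M)) <= ennreal L * seq_norm q (%m. ennreal (lam s b m) * y (m + Suc M))"
    proof (rule seq_norm_le_cmult[OF q])
     fix m
     have "ennreal (lam s b (Suc m)) <= ennreal L * ennreal (lam s b m)"
      using L(2)[of m] L(1) by (simp add: ennreal_mult[symmetric] ennreal_leI)
     from mult_right_mono[OF this, of "y (Suc m + M)"]
     show "ennreal (lam s b (Suc m)) * y (Suc m + M) <= ennreal L * (ennreal (lam s b m) * y (m + Suc M))"
      by (simp add: mult.assoc)
    qed
    then show "seq_norm q (%m. ennreal (lam s b (Suc m)) * y (Suc m + M)) <= ennreal L * ?Z"
     by (rule order_trans) (intro mult_left_mono, auto simp: add_increasing)
   qed (use L in auto)
   ultimately have "seq_norm q (%m. ennreal (lam s b m) * y (m + M)) <= ennreal (H * (1 + L)) * ?Z"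
    using H L by (intro dominated_trans) auto
   moreover have "(\<Sum>m<M. y m) <= ennreal 1 * ?Z" by (simp add: add_increasing2 add.assoc)
   ultimately show "(\<Sum>m<M. y m) + seq_norm q (%m. ennreal (lam s b m) * y (m + M)) <= ennreal (1 + H * (1 + L)) * ?Z"
    using H L by (intro dominated_add) auto
  qed (use K H L in auto)
  then show ?case using K H L by (intro exI[of _ "K * (1 + H * (1 + L))"]) (auto intro!: mult_pos_pos add_pos_pos)
 qed
 then obtain K where "K > 0" "!!y. seq_norm q (%m. ennreal (lam s b m) * y m) <= ennreal K * ((\<Sum>m<M. y m) + seq_norm q (%m. ennreal (lam s b m) * y (m + M)))"
  by auto
 then show thesis by (rule that)
qed

lemma zsum_halves: "zsum f = (\<Sum>i. f (int i)) + (\<Sum>i. f (- int i - 1))"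
proof -
 define g where "g n = (if n < 0 then f n else 0)" for n
 have "zsum g = zsum (%n. g (- n))" by (rule zsum_uminus[symmetric])
 also have "... = zsum (%n. (%n. g (- n)) (n + 1))" by (rule zsum_shift[symmetric])
 also have "... = zsum (%n. if n >= 0 then f (- n - 1) else 0)"
  by (intro arg_cong[where f = zsum] ext) (auto simp: g_def algebra_simps)
 also have "... = (\<Sum>i. f (- int i - 1))" by (rule zsum_nonneg_part)
 finally have "zsum g = (\<Sum>i. f (- int i - 1))" .
 then show ?thesis using zsum_split[of f] by (simp add: g_def[abs_def] zsum_nonneg_part)
qed

lemma zsum_tail: "zsum (%n. if n >= m then f n else 0) = (\<Sum>i. f (m + int i))"
proof -
 have "zsum (%n. if n >= m then f n else 0) = zsum (%n. (%n. if n >= m then f n else 0) (n + m))"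
  by (rule zsum_shift[symmetric])
 also have "... = zsum (%n. if n >= 0 then f (m + n) else 0)"
  by (intro arg_cong[where f = zsum] ext) (auto simp: add.commute)
 also have "... = (\<Sum>i. f (m + int i))" by (rule zsum_nonneg_part)
 finally show ?thesis .
qed

section \<open>Discretization of integrals over dyadic intervals\<close>

lemma tw_less_iff: "tw m < tw n \<longleftrightarrow> m < n" by (simp add: tw_def)

lemma dyadic_interval:
 assumes "t > 0"
 obtains n where "tw n < t" "t <= tw (n + 1)"
proof -
 define n where "n = \<lceil>log 2 t\<rceil> - 1"
 have "real_of_int n < log 2 t" "log 2 t <= real_of_int (n + 1)" unfolding n_def by linarith+
 then have "2 powr real_of_int n < 2 powr log 2 t" "2 powr log 2 t <= 2 powr real_of_int (n + 1)"
  by (auto simp del: powr_log_cancel)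
 then show thesis using assms by (intro that[of n]) (auto simp: tw_def)
qed

definition int_norm :: "ennreal => real set => (real => ennreal) => ennreal" where
 "int_norm q A f = (if q = \<infinity> then SUP t\<in>A. f t
   else (\<integral>\<^sup>+t\<in>A. f t epowr enn2real q * ennreal (1 / t) \<partial>lborel) epowr (1 / enn2real q))"

text \<open>The map \<open>sg\<close> enumerates the dyadic intervals that cover \<open>A\<close>;
  each has measure at most 1 for \<open>dt / t\<close>.\<close>

lemma int_norm_upper:
 fixes sg :: "nat => int"
 assumes q: "0 < q" and A: "A \<subseteq> (\<Union>m. {tw (sg m)<..tw (sg m + 1)})"
  and f: "!!m t. t \<in> A ==> tw (sg m) < t ==> t <= tw (sg m + 1) ==> f t <= x m"
 shows "int_norm q A f <= seq_norm q x"
proof (cases "q = \<infinity>")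
 case True
 have "f t <= (SUP m. x m)" if tA: "t \<in> A" for t
 proof -
  obtain m where "tw (sg m) < t" "t <= tw (sg m + 1)" using subsetD[OF A tA] by auto
  then show ?thesis using f[of t m] tA by (auto intro: SUP_upper2[of m])
 qed
 then show ?thesis using True by (auto simp: int_norm_def seq_norm_def intro!: SUP_least)
next
 case False
 define r where "r = enn2real q"
 have r: "r > 0" using enn2real_pos[OF q False] by (simp add: r_def)
 let ?J = "%m. {tw (sg m)<..tw (sg m + 1)}"
 let ?g = "%m t. (x m epowr r * ennreal (1 / tw (sg m))) * indicator (?J m) t"
 have "(\<integral>\<^sup>+t\<in>A. f t epowr r * ennreal (1 / t) \<partial>lborel) <= (NI t. (\<Sum>m. ?g m t))"
 proof (rule nn_integral_mono)
  fix t
  show "f t epowr r * ennreal (1 / t) * indicator A t <= (\<Sum>m. ?g m t)"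
  proof (cases "t \<in> A")
   case True
   obtain m where m: "tw (sg m) < t" "t <= tw (sg m + 1)" using subsetD[OF A True] by auto
   have t: "t > 0" using m tw_pos(1)[of "sg m"] by linarith
   have "f t epowr r * ennreal (1 / t) <= x m epowr r * ennreal (1 / tw (sg m))"
    using f[OF True m] m r t by (intro mult_mono epowr_mono ennreal_leI frac_le) auto
   then have "f t epowr r * ennreal (1 / t) * indicator A t <= ?g m t" using True m by simp
   also have "... <= (\<Sum>m. ?g m t)" by (rule ennreal_le_suminf)
   finally show ?thesis .
  qed simp
 qed
 also have "... = (\<Sum>m. NI t. ?g m t)" by (intro nn_integral_suminf) measurable
 also have "... = (\<Sum>m. x m epowr r)"
 proof (intro suminf_cong)
  fix m
  have "tw (sg m) <= tw (sg m + 1)" by (intro tw_mono) simp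
  then have "emeasure lborel (?J m) = ennreal (tw (sg m))" by (simp add: tw_Suc)
  then have "(NI t. ?g m t) = x m epowr r * ennreal (1 / tw (sg m)) * ennreal (tw (sg m))"
   by (simp add: nn_integral_cmult_indicator)
  also have "... = x m epowr r * ennreal (1 / tw (sg m) * tw (sg m))"
   by (simp only: mult.assoc ennreal_mult tw_pos zero_le_divide_iff zero_le_one simp_thms)
  finally show "(NI t. ?g m t) = x m epowr r" by simp
 qed
 finally show ?thesis using False r by (auto simp: int_norm_def seq_norm_def r_def[symmetric] intro!: epowr_mono)
qed

text \<open>A dyadic interval has measure at least 1/2 for \<open>dt / t\<close>; the root of 2
  compensates for this.\<close>

definition step_const :: "ennreal => real" where
 "step_const q = (if q = \<infinity> then 1 else 2 powr (1 / enn2real q))"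

lemma step_const_pos: "step_const q > 0" by (simp add: step_const_def)

text \<open>Injectivity of \<open>sg\<close> makes the intervals disjoint, so at most one term of
  the step function is nonzero at each point. They are open in order to fit into sets such as
  \<open>{0<..<1}\<close>.\<close>

lemma int_norm_lower:
 fixes sg :: "nat => int"
 assumes q: "0 < q" and sg: "inj sg" and A: "!!m. {tw (sg m)<..<tw (sg m + 1)} \<subseteq> A"
  and f: "!!m t. tw (sg m) < t ==> t < tw (sg m + 1) ==> x m <= f t"
 shows "seq_norm q x <= ennreal (step_const q) * int_norm q A f"
proof (cases "q = \<infinity>")
 case True
  have "x m <= (SUP t\<in>A. f t)" for m
  proof -
   have "tw (sg m) < 3 / 2 * tw (sg m)" "3 / 2 * tw (sg m) < tw (sg m + 1)"
    using tw_pos(1)[of "sg m"] by (simp_all add: tw_Suc)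
   then show ?thesis using A[of m] f[of m "3 / 2 * tw (sg m)"]
    by (intro SUP_upper2[of "3 / 2 * tw (sg m)"]) auto
  qed
 then show ?thesis using True by (auto simp: int_norm_def seq_norm_def step_const_def intro!: SUP_least)
next
 case False
 define r where "r = enn2real q"
 have r: "r > 0" using enn2real_pos[OF q False] by (simp add: r_def)
  let ?J = "%m. {tw (sg m)<..<tw (sg m + 1)}"
  let ?g = "%m t. (x m epowr r * ennreal (1 / tw (sg m + 1))) * indicator (?J m) t"
  have "(\<Sum>m. x m epowr r) = (\<Sum>m. ennreal 2 * (NI t. ?g m t))"
  proof (intro suminf_cong)
   fix m
   have "tw (sg m) <= tw (sg m + 1)" by (intro tw_mono) simp
   then have "emeasure lborel (?J m) = ennreal (tw (sg m))" by (simp add: tw_Suc)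
   then have "(NI t. ?g m t) = x m epowr r * ennreal (1 / tw (sg m + 1)) * ennreal (tw (sg m))"
    by (simp add: nn_integral_cmult_indicator)
   then have "ennreal 2 * (NI t. ?g m t) = x m epowr r * (ennreal (1 / tw (sg m + 1)) * ennreal (tw (sg m)) * ennreal 2)"
    by (simp only: mult_ac)
   also have "ennreal (1 / tw (sg m + 1)) * ennreal (tw (sg m)) * ennreal 2 = ennreal (1 / tw (sg m + 1) * tw (sg m) * 2)"
    by (subst ennreal_mult, simp, simp, subst ennreal_mult) auto
   also have "1 / tw (sg m + 1) * tw (sg m) * 2 = 1" by (simp add: tw_Suc)
   finally show "x m epowr r = ennreal 2 * (NI t. ?g m t)" by simp
  qed
  also have "... = ennreal 2 * (NI t. (\<Sum>m. ?g m t))"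
  proof -
   have "(NI t. (\<Sum>m. ?g m t)) = (\<Sum>m. NI t. ?g m t)"
    by (intro nn_integral_suminf) measurable
   then show ?thesis by (simp del: ennreal_numeral)
  qed
  also have "... <= ennreal 2 * (\<integral>\<^sup>+t\<in>A. f t epowr r * ennreal (1 / t) \<partial>lborel)"
  proof (intro mult_left_mono nn_integral_mono)
   fix t
   show "(\<Sum>m. ?g m t) <= f t epowr r * ennreal (1 / t) * indicator A t"
   proof (cases "\<exists>m. t \<in> ?J m")
    case True
    then obtain m where m: "t \<in> ?J m" by blast
    have g0: "?g i t = 0" if "i \<noteq> m" for i
    proof -
     have "t \<notin> ?J i"
     proof
      assume i: "t \<in> ?J i"
      have "tw (sg i) < tw (sg m + 1)" "tw (sg m) < tw (sg i + 1)" using i m by auto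
      then have "sg i = sg m" unfolding tw_less_iff by linarith
      then show False using sg that by (auto dest: injD)
     qed
     then show ?thesis by simp
    qed
    have "(\<Sum>i. ?g i t) = (\<Sum>i\<in>{m}. ?g i t)" by (rule suminf_finite, simp, rule g0, simp)
    also have "... = ?g m t"
     by (simp only: sum.insert[OF finite.emptyI] sum.empty add_0_right empty_iff not_False_eq_True)
    also have "... <= f t epowr r * ennreal (1 / t)"
    proof -
     have "t > 0" using m less_trans[OF tw_pos(1)[of "sg m"], of t] by auto
     then have "x m epowr r * ennreal (1 / tw (sg m + 1)) <= f t epowr r * ennreal (1 / t)"
      using m r f[of m t] by (intro mult_mono epowr_mono ennreal_leI frac_le) auto
     then show ?thesis using m by simp
    qed
    also have "... = f t epowr r * ennreal (1 / t) * indicator A t" using A[of m] m by auto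
    finally show ?thesis .
   next
    case False
    then have z: "?g i t = 0" for i by auto
    show ?thesis unfolding z by simp
   qed
  qed simp
  finally have "(\<Sum>m. x m epowr r) epowr (1 / r) <= (ennreal 2 * (\<integral>\<^sup>+t\<in>A. f t epowr r * ennreal (1 / t) \<partial>lborel)) epowr (1 / r)"
   using r by (intro epowr_mono) auto
  also have "... = ennreal (2 powr (1 / r)) * (\<integral>\<^sup>+t\<in>A. f t epowr r * ennreal (1 / t) \<partial>lborel) epowr (1 / r)"
   using r by (simp add: epowr_mult epowr_ennreal flip: ennreal_numeral)
  finally show ?thesis using False by (simp add: int_norm_def seq_norm_def r_def step_const_def)
qed

section \<open>The discrete form of the equivalence\<close>

definition tail_norm :: "real => (int => real) => int => ennreal" where
 "tail_norm p c m = seq_norm (ennreal p) (%j. ennreal (c (m + int j)))"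

text \<open>Index 0 is included deliberately: the discretized high frequency side starts only at
  index 1 or 2, and \<open>low_norm\<close> then supplies \<open>c 0\<close>.\<close>

definition low_norm :: "real => (int => real) => ennreal" where
 "low_norm p c = seq_norm (ennreal p) (%j. ennreal (c (- int j)))"

lemma seq_norm_epowr: "p > 0 ==> seq_norm (ennreal p) x epowr p = (\<Sum>n. x n epowr p)"
 by (simp add: seq_norm_def epowr_inverse)

lemma seq_norm_real: "p > 0 ==> seq_norm (ennreal p) x = (\<Sum>n. x n epowr p) epowr (1 / p)"
 by (simp add: seq_norm_def)

lemma tail_norm_ge: "p > 0 ==> ennreal (c m) <= tail_norm p c m"
 using seq_norm_term[of "ennreal p" "%j. ennreal (c (m + int j))" 0] by (simp add: tail_norm_def)

lemma low_norm_ge: "p > 0 ==> ennreal (c 0) <= low_norm p c"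
 using seq_norm_term[of "ennreal p" "%j. ennreal (c (- int j))" 0] by (simp add: low_norm_def)

lemma tail_norm_Suc: "p > 0 ==> tail_norm p c (m + 1) <= tail_norm p c m"
 using seq_norm_Suc[of "ennreal p" "%j. ennreal (c (m + int j))"] by (simp add: tail_norm_def add_ac)

text \<open>For \<open>n >= 0\<close> the product of \<open>lam s b m\<close> with the cut-off
  factor is at most \<open>lam s b n\<close> with geometric decay in
  \<open>\<bar>n - m\<bar>\<close>, so the discrete Hardy inequality applies. The exception is
  \<open>s = 0\<close> with \<open>n >= m\<close>, where there is no decay and the terms are
  collected in a tail norm. All negative \<open>n\<close> are treated as sitting at index 0.\<close>

lemma discrete_upper:
 assumes q: "0 < q" and s: "0 <= s" "s < real k" and p: "p > 0"
 obtains K where "K > 0"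
  "!!(c :: int => real). (!!n. c n >= 0) ==>
   seq_norm q (%m. ennreal (lam s b m) * zsum (%n. ennreal ((min 1 (tw (n - int m))) ^ k * c n) epowr p) epowr (1 / p))
   <= ennreal K * (low_norm p c + seq_norm q (%m. ennreal (lam s b m) * (if s > 0 then ennreal (c (int m)) else tail_norm p c (int m))))"
proof -
 obtain L \<eta> where L: "L > 0" "\<eta> > 0"
  "!!m n. n <= m ==> lam s b m * 2 powr - (real k * (real m - real n)) <= L * 2 powr - (\<eta> * \<bar>real n - real m\<bar>) * lam s b n"
  "!!m n. 0 < s ==> m <= n ==> lam s b m <= L * 2 powr - (\<eta> * \<bar>real n - real m\<bar>) * lam s b n"
  by (rule lam_ratio[OF s, where b = b], rule that)
 obtain K1 where K1: "K1 > 0"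
  "!!z. seq_norm q (%m. (\<Sum>n. (ennreal (2 powr - (\<eta> * \<bar>real n - real m\<bar>)) * z n) epowr p) epowr (1 / p))
   <= ennreal K1 * seq_norm q z"
  by (rule seq_norm_convolution[OF q L(2) p], rule that)
 obtain K2 where K2: "K2 > 0" "!!x y. seq_norm q (%n. x n + y n) <= ennreal K2 * (seq_norm q x + seq_norm q y)"
  by (rule seq_norm_add[OF q], rule that)
 \<comment> \<open>The nonnegative indices contribute \<open>L powr p + 1\<close>, the negative ones
   another \<open>L powr p\<close>.\<close>
 define A where "A = (2 * L powr p + 1) powr (1 / p)"
 have A: "A > 0" by (simp add: A_def add_pos_nonneg add_nonneg_eq_0_iff)
 show thesis
 proof (rule that[of "A * K1 * K2"])
  show "A * K1 * K2 > 0" using A K1 K2 by simp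
 next
  fix c :: "int => real" assume c: "!!n. c n >= 0"
  define y where "y m = (if s > 0 then ennreal (c (int m)) else tail_norm p c (int m))" for m
  define z where "z m = ennreal (lam s b m) * y m" for m
  \<comment> \<open>The whole low frequency norm is placed at index 0, so that negative
    \<open>n\<close> enter the same convolution.\<close>
  define w where "w m = (if m = 0 then low_norm p c else 0) + z m" for m
  define B where "B m = (\<Sum>n. (ennreal (2 powr - (\<eta> * \<bar>real n - real m\<bar>)) * w n) epowr p)" for m
  have yc: "ennreal (c (int m)) <= y m" for m using tail_norm_ge[OF p, of c "int m"] by (simp add: y_def)
  have tw_k: "tw (i - int m) ^ k = 2 powr - (real k * (real m - real_of_int i))" for i m
   by (simp add: tw_def powr_power algebra_simps)
  have min_le: "(min 1 (tw i)) ^ k <= tw i ^ k" "(min 1 (tw i)) ^ k <= 1" for i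
   by (auto intro!: power_mono power_le_one)
  have pos: "ennreal (lam s b m) epowr p * (\<Sum>i. ennreal ((min 1 (tw (int i - int m))) ^ k * c (int i)) epowr p)
    <= ennreal (L powr p + 1) * B m" for m
  proof -
   define a where "a i = (ennreal (2 powr - (\<eta> * \<bar>real i - real m\<bar>)) * w i) epowr p" for i
   \<comment> \<open>The terms without decay, present only for \<open>s = 0\<close>.\<close>
   define e where "e i = (if s = 0 \<and> i >= m then (ennreal (lam s b m) * ennreal (c (int i))) epowr p else 0)" for i
   have "ennreal (lam s b m) epowr p * ennreal ((min 1 (tw (int i - int m))) ^ k * c (int i)) epowr p
     <= ennreal (L powr p) * a i + e i" for i
   proof (cases "s = 0 \<and> i >= m")
    case True
    have "(min 1 (tw (int i - int m))) ^ k * c (int i) <= c (int i)"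
     using mult_right_mono[OF min_le(2) c] by simp
    then have "ennreal (lam s b m) * ennreal ((min 1 (tw (int i - int m))) ^ k * c (int i)) <= ennreal (lam s b m) * ennreal (c (int i))"
     by (intro mult_left_mono ennreal_leI) auto
    then have "ennreal (lam s b m) epowr p * ennreal ((min 1 (tw (int i - int m))) ^ k * c (int i)) epowr p <= e i"
     using True p by (auto simp: e_def epowr_mult[symmetric] intro!: epowr_mono)
    then show ?thesis by (simp add: add_increasing)
   next
    case False
    have "lam s b m * (min 1 (tw (int i - int m))) ^ k <= L * 2 powr - (\<eta> * \<bar>real i - real m\<bar>) * lam s b i"
    proof (cases "i <= m")
     case True
     have "lam s b m * (min 1 (tw (int i - int m))) ^ k <= lam s b m * 2 powr - (real k * (real m - real i))"
      using min_le(1)[of "int i - int m"] unfolding tw_k by (intro mult_left_mono) auto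
     then show ?thesis using L(3)[OF True] by linarith
    next
     case i: False
     then have "s > 0" using False s by auto
     have "lam s b m * (min 1 (tw (int i - int m))) ^ k <= lam s b m * 1"
      by (intro mult_left_mono min_le) auto
     moreover have "m <= i" using i by simp
     ultimately show ?thesis using L(4)[OF \<open>s > 0\<close>, of m i] by linarith
    qed
    from mult_right_mono[OF this c[of "int i"]]
    have "lam s b m * ((min 1 (tw (int i - int m))) ^ k * c (int i)) <= L * (2 powr - (\<eta> * \<bar>real i - real m\<bar>) * (lam s b i * c (int i)))"
     by (simp add: mult_ac)
    then have "ennreal (lam s b m) * ennreal ((min 1 (tw (int i - int m))) ^ k * c (int i)) <=
      ennreal L * (ennreal (2 powr - (\<eta> * \<bar>real i - real m\<bar>)) * (ennreal (lam s b i) * ennreal (c (int i))))"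
     using L c by (simp add: ennreal_mult[symmetric] ennreal_leI)
    also have "... <= ennreal L * (ennreal (2 powr - (\<eta> * \<bar>real i - real m\<bar>)) * w i)"
     using yc[of i] by (intro mult_left_mono) (auto simp: w_def z_def intro!: add_increasing mult_left_mono)
    finally have "ennreal (lam s b m) epowr p * ennreal ((min 1 (tw (int i - int m))) ^ k * c (int i)) epowr p <=
      (ennreal L * (ennreal (2 powr - (\<eta> * \<bar>real i - real m\<bar>)) * w i)) epowr p"
     using p by (simp only: epowr_mult[symmetric]) (intro epowr_mono, auto)
    also have "... = ennreal (L powr p) * a i" using p L unfolding a_def by (simp add: epowr_mult epowr_ennreal)
    finally show ?thesis by (simp add: add_increasing2)
   qed
   then have "(\<Sum>i. ennreal (lam s b m) epowr p * ennreal ((min 1 (tw (int i - int m))) ^ k * c (int i)) epowr p)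
     <= (\<Sum>i. ennreal (L powr p) * a i + e i)" by (rule ennreal_suminf_mono)
   also have "... = ennreal (L powr p) * B m + (\<Sum>i. e i)"
    by (simp add: suminf_add[symmetric] summableI B_def a_def)
   finally have 1: "ennreal (lam s b m) epowr p * (\<Sum>i. ennreal ((min 1 (tw (int i - int m))) ^ k * c (int i)) epowr p)
     <= ennreal (L powr p) * B m + (\<Sum>i. e i)" by simp
   \<comment> \<open>For \<open>s = 0\<close> these terms add up to the \<open>p\<close>-th power of
     \<open>lam s b m * y m\<close>, which is bounded by the diagonal entry \<open>n = m\<close> of
     \<open>B m\<close>.\<close>
   have 2: "(\<Sum>i. e i) <= ennreal 1 * B m"
   proof (cases "s = 0")
    case True
    have "(\<Sum>i. e i) = (\<Sum>i. e (m + i))"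
    proof -
     have "(\<Sum>i<m. e i) = 0" by (auto simp: e_def)
     then show ?thesis using suminf_offset[of e m] by (simp add: summableI add.commute)
    qed
    also have "... = ennreal (lam s b m) epowr p * (\<Sum>i. ennreal (c (int m + int i)) epowr p)"
     using True p by (simp add: e_def epowr_mult)
    also have "... = (ennreal (lam s b m) * y m) epowr p"
     using True p by (simp add: epowr_mult y_def tail_norm_def seq_norm_epowr)
    also have "... <= a m" using p by (auto simp: a_def w_def z_def intro!: epowr_mono)
    also have "... <= (\<Sum>i. a i)" by (rule ennreal_le_suminf)
    finally show ?thesis by (simp add: B_def a_def)
   qed (simp add: e_def)
   show ?thesis using add_left_mono[OF 2, of "ennreal (L powr p) * B m"] 1
    by (auto simp: ring_distribs intro: order_trans)
  qed
  have neg: "ennreal (lam s b m) epowr p * (\<Sum>i. ennreal ((min 1 (tw (- int i - 1 - int m))) ^ k * c (- int i - 1)) epowr p)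
    <= ennreal (L powr p) * B m" for m
  proof -
   define a where "a i = (ennreal (2 powr - (\<eta> * \<bar>real i - real m\<bar>)) * w i) epowr p" for i
   \<comment> \<open>For negative \<open>n\<close> the cut-off factor is at most its value at
     \<open>n = 0\<close>, whose decay in \<open>m\<close> is already known.\<close>
   have "ennreal (lam s b m) epowr p * ennreal ((min 1 (tw (- int i - 1 - int m))) ^ k * c (- int i - 1)) epowr p
     <= (ennreal L * ennreal (2 powr - (\<eta> * \<bar>real 0 - real m\<bar>))) epowr p * ennreal (c (- int (Suc i))) epowr p" for i
   proof -
    have "(min 1 (tw (- int i - 1 - int m))) ^ k <= tw (0 - int m) ^ k"
     by (intro power_mono) (auto intro!: min.coboundedI2 tw_mono)
    then have "lam s b m * (min 1 (tw (- int i - 1 - int m))) ^ k <= lam s b m * 2 powr - (real k * (real m - real 0))"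
     unfolding tw_k by (intro mult_left_mono) auto
    also have "... <= L * 2 powr - (\<eta> * \<bar>real 0 - real m\<bar>)" using L(3)[of 0 m] by simp
    finally have "lam s b m * (min 1 (tw (- int i - 1 - int m))) ^ k <= L * 2 powr - (\<eta> * \<bar>real 0 - real m\<bar>)" .
    from mult_right_mono[OF this c[of "- int i - 1"]]
    have "ennreal (lam s b m) * ennreal ((min 1 (tw (- int i - 1 - int m))) ^ k * c (- int i - 1)) <=
      ennreal L * ennreal (2 powr - (\<eta> * \<bar>real 0 - real m\<bar>)) * ennreal (c (- int i - 1))"
     using L c by (simp add: ennreal_mult[symmetric] ennreal_leI mult.assoc)
    moreover have "- int i - 1 = - int (Suc i)" by simp
    ultimately show ?thesis using p by (simp only: epowr_mult[symmetric]) (intro epowr_mono, auto)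
   qed
   then have "(\<Sum>i. ennreal (lam s b m) epowr p * ennreal ((min 1 (tw (- int i - 1 - int m))) ^ k * c (- int i - 1)) epowr p)
     <= (\<Sum>i. (ennreal L * ennreal (2 powr - (\<eta> * \<bar>real 0 - real m\<bar>))) epowr p * ennreal (c (- int (Suc i))) epowr p)"
    by (rule ennreal_suminf_mono)
   also have "... = (ennreal L * ennreal (2 powr - (\<eta> * \<bar>real 0 - real m\<bar>))) epowr p * (\<Sum>i. ennreal (c (- int (Suc i))) epowr p)"
    by (rule ennreal_suminf_cmult)
   also have "(\<Sum>i. ennreal (c (- int (Suc i))) epowr p) = seq_norm (ennreal p) (%i. ennreal (c (- int (Suc i)))) epowr p"
    using p by (simp add: seq_norm_epowr)
   also have "... <= low_norm p c epowr p"
    unfolding low_norm_def using p seq_norm_Suc[of "ennreal p" "%j. ennreal (c (- int j))"] by (intro epowr_mono) auto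
   finally have "ennreal (lam s b m) epowr p * (\<Sum>i. ennreal ((min 1 (tw (- int i - 1 - int m))) ^ k * c (- int i - 1)) epowr p)
     <= (ennreal L * ennreal (2 powr - (\<eta> * \<bar>real 0 - real m\<bar>))) epowr p * low_norm p c epowr p"
    by (simp add: mult_left_mono)
   also have "... = ennreal (L powr p) * (ennreal (2 powr - (\<eta> * \<bar>real 0 - real m\<bar>)) * low_norm p c) epowr p"
    using p L by (simp add: epowr_mult epowr_ennreal mult.assoc)
   also have "... <= ennreal (L powr p) * a 0"
    using p by (intro mult_left_mono) (auto simp: a_def w_def intro!: epowr_mono mult_left_mono)
   also have "... <= ennreal (L powr p) * (\<Sum>i. a i)"
    by (intro mult_left_mono ennreal_le_suminf) auto
   finally show ?thesis by (simp add: B_def a_def)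
  qed
  have W: "ennreal (lam s b m) * zsum (%n. ennreal ((min 1 (tw (n - int m))) ^ k * c n) epowr p) epowr (1 / p) <=
    ennreal A * B m epowr (1 / p)" for m
  proof -
   have "ennreal (lam s b m) epowr p * zsum (%n. ennreal ((min 1 (tw (n - int m))) ^ k * c n) epowr p)
     <= ennreal ((L powr p + 1) + L powr p) * B m"
    unfolding zsum_halves ring_distribs(1) by (rule dominated_add[OF pos neg]) auto
   then have "(ennreal (lam s b m) epowr p * zsum (%n. ennreal ((min 1 (tw (n - int m))) ^ k * c n) epowr p)) epowr (1 / p)
     <= (ennreal (2 * L powr p + 1) * B m) epowr (1 / p)" using p by (intro epowr_mono) (auto simp: algebra_simps)
   moreover have "(ennreal (lam s b m) epowr p) epowr (1 / p) = ennreal (lam s b m)"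
    using p by (intro epowr_inverse(1)) simp
   moreover have "ennreal (2 * L powr p + 1) epowr (1 / p) = ennreal A"
    unfolding A_def by (rule epowr_ennreal) simp
   moreover have "1 / p > 0" using p by simp
   ultimately show ?thesis by (simp only: epowr_mult)
  qed
  have "seq_norm q (%m. ennreal (lam s b m) * zsum (%n. ennreal ((min 1 (tw (n - int m))) ^ k * c n) epowr p) epowr (1 / p))
    <= ennreal A * seq_norm q (%m. B m epowr (1 / p))"
   by (rule seq_norm_le_cmult[OF q W])
  moreover have "seq_norm q (%m. B m epowr (1 / p)) <= ennreal K1 * seq_norm q w"
   unfolding B_def by (rule K1(2))
  moreover have "seq_norm q w <= ennreal K2 * (low_norm p c + seq_norm q z)"
   using K2(2)[of "%m. if m = 0 then low_norm p c else 0" z] seq_norm_single[OF q, of 0 "low_norm p c"]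
   by (simp add: w_def[abs_def])
  ultimately show "seq_norm q (%m. ennreal (lam s b m) * zsum (%n. ennreal ((min 1 (tw (n - int m))) ^ k * c n) epowr p) epowr (1 / p))
   <= ennreal (A * K1 * K2) * (low_norm p c + seq_norm q (%m. ennreal (lam s b m) * (if s > 0 then ennreal (c (int m)) else tail_norm p c (int m))))"
   using A K1 K2 unfolding z_def[abs_def] y_def[abs_def] by (intro dominated_trans[where K = "A * K1" and L = K2] dominated_trans[where K = A and L = K1]) auto
 qed
qed

lemma tail_norm_le_zsum: "p > 0 ==> tail_norm p c m <= zsum (%n. ennreal (c n) epowr p) epowr (1 / p)"
proof -
 assume p: "p > 0"
 have "(\<Sum>i. ennreal (c (m + int i)) epowr p) <= zsum (%n. ennreal (c n) epowr p)"
  unfolding zsum_tail[of m "%n. ennreal (c n) epowr p", symmetric] by (intro zsum_mono) auto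
 then show ?thesis using p unfolding tail_norm_def by (simp add: seq_norm_real epowr_mono)
qed

lemma low_norm_le_zsum: "p > 0 ==> low_norm p c <= zsum (%n. ennreal (c n) epowr p) epowr (1 / p)"
proof -
 assume p: "p > 0"
 have "(\<Sum>i. ennreal (c (- int i)) epowr p) = zsum (%n. if n >= 0 then ennreal (c (- n)) epowr p else 0)"
  by (rule zsum_nonneg_part[symmetric])
 also have "... <= zsum (%n. ennreal (c (- n)) epowr p)" by (intro zsum_mono) auto
 also have "... = zsum (%n. ennreal (c n) epowr p)" by (rule zsum_uminus)
 finally show ?thesis using p unfolding low_norm_def by (simp add: seq_norm_real epowr_mono)
qed

lemma zsum_le_tail_low:
 assumes p: "p > 0"
 shows "zsum (%n. ennreal (c n) epowr p) epowr (1 / p) <= ennreal (2 powr (1 / p)) * (tail_norm p c 0 + low_norm p c)"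
proof -
 have "(\<Sum>i. ennreal (c (- int i - 1)) epowr p) = seq_norm (ennreal p) (%i. ennreal (c (- int (Suc i)))) epowr p"
 proof -
  have "- int i - 1 = - int (Suc i)" for i by simp
  then show ?thesis by (simp only: seq_norm_epowr[OF p])
 qed
 also have "... <= low_norm p c epowr p"
  unfolding low_norm_def using p seq_norm_Suc[of "ennreal p" "%j. ennreal (c (- int j))"] by (intro epowr_mono) auto
 finally have "zsum (%n. ennreal (c n) epowr p) <= tail_norm p c 0 epowr p + low_norm p c epowr p"
  unfolding zsum_halves using p by (intro add_mono) (simp_all add: tail_norm_def seq_norm_epowr)
 then have "zsum (%n. ennreal (c n) epowr p) epowr (1 / p) <= (tail_norm p c 0 epowr p + low_norm p c epowr p) epowr (1 / p)"
  using p by (intro epowr_mono) auto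
 also have "... <= ennreal (2 powr (1 / p)) * (tail_norm p c 0 + low_norm p c)"
  using epowr_add_le[of "1 / p" "tail_norm p c 0 epowr p" "low_norm p c epowr p"] p by (simp add: epowr_inverse)
 finally show ?thesis .
qed

text \<open>The whole argument in terms of sequences: \<open>om m\<close> is the modulus at
  \<open>tw (- m)\<close>, \<open>BI\<close> the smoothness term, \<open>I0\<close> and
  \<open>R1\<close> the two terms of the right-hand side. Three index losses are repaired by
  \<open>seq_norm_fill\<close>: \<open>M\<close> octaves in the lower bound for the modulus, one
  step from its monotonicity, and \<open>N\<close> steps in \<open>R1\<close>, namely 1 for values
  and 2 for tails. The missing first terms come from \<open>Lp\<close> on one side and from
  \<open>low_norm\<close> with \<open>c 1 <= K0 * c 0\<close> on the other.\<close>

lemma discrete_equivalence: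
 fixes N M :: nat
 assumes q: "0 < q" and s: "0 <= s" "s < real k" and p: "p > 0" and K0: "K0 > 0"
  and N: "N = (if s > 0 then 1 else 2)"
 obtains K where "K > 0"
  "!!(c :: int => real) A Lp om BI I0 R1. (!!n. c n >= 0) ==> c 1 <= K0 * c 0 ==>
   A = (%m::nat. if s > 0 then ennreal (c (int m)) else tail_norm p c (int m)) ==>
   Lp <= ennreal K0 * zsum (%n. ennreal (c n) epowr p) epowr (1 / p) ==>
   zsum (%n. ennreal (c n) epowr p) epowr (1 / p) <= ennreal K0 * Lp ==>
   (!!m. om m <= ennreal K0 * zsum (%n. ennreal ((min 1 (tw (n - int m))) ^ k * c n) epowr p) epowr (1 / p)) ==>
   (!!m. Lp < \<infinity> ==> tail_norm p c (int (m + M)) <= ennreal K0 * om m) ==>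
   BI <= ennreal K0 * seq_norm q (%m. ennreal (lam s b m) * om m) ==>
   seq_norm q (%m. ennreal (lam s b m) * om (Suc m)) <= ennreal K0 * BI ==>
   I0 <= ennreal K0 * low_norm p c ==> low_norm p c <= ennreal K0 * I0 ==>
   R1 <= ennreal K0 * seq_norm q (%m. ennreal (lam s b m) * A m) ==>
   seq_norm q (%m. ennreal (lam s b m) * A (m + N)) <= ennreal K0 * R1 ==>
   Lp + BI <= ennreal K * (I0 + R1) \<and> I0 + R1 <= ennreal K * (Lp + BI)"
proof -
 obtain U where U: "U > 0"
  "!!(c :: int => real). (!!n. c n >= 0) ==>
   seq_norm q (%m. ennreal (lam s b m) * zsum (%n. ennreal ((min 1 (tw (n - int m))) ^ k * c n) epowr p) epowr (1 / p))
   <= ennreal U * (low_norm p c + seq_norm q (%m. ennreal (lam s b m) * (if s > 0 then ennreal (c (int m)) else tail_norm p c (int m))))"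
  by (rule discrete_upper[OF q s p, where b = b], rule that, assumption, blast)
 obtain E where E: "E > 0"
  "!!y. seq_norm q (%m. ennreal (lam s b m) * y m) <= ennreal E * ((\<Sum>m<N. y m) + seq_norm q (%m. ennreal (lam s b m) * y (m + N)))"
  by (rule seq_norm_fill[OF q, where s = s and b = b and M = N], rule that)
 obtain G where G: "G > 0"
  "!!y. seq_norm q (%m. ennreal (lam s b m) * y m) <= ennreal G * ((\<Sum>m<Suc M. y m) + seq_norm q (%m. ennreal (lam s b m) * y (m + Suc M)))"
  by (rule seq_norm_fill[OF q, where s = s and b = b and M = "Suc M"], rule that)
 have ep: "0 < ennreal p" using p by simp
 obtain H where H: "H > 0" "!!x. seq_norm (ennreal p) x <= ennreal H * (x 0 + seq_norm (ennreal p) (%n. x (Suc n)))"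
  by (rule seq_norm_head[OF ep], rule that)
 define B1 where "B1 = 2 powr (1 / p)"
 \<comment> \<open>Needed for \<open>s = 0\<close>: the tails at 0 and 1 are rebuilt from
   \<open>c 0\<close>, \<open>c 1\<close> and the tail at 2. Each head that is put back costs
   \<open>H\<close>; the doubling is for the two tails.\<close>
 define X where "X = H * (1 + H * (K0 + 1)) + H * (1 + H * (K0 + 1))"
 define K1 where "K1 = K0 * (B1 * (U + 1)) + K0 * (K0 * U)"
 define K2 where "K2 = K1 * ((1 + E * ((1 + X) + 1)) * K0)"
 define K3 where "K3 = K0 * K0 + K0 * (G * (real (Suc M) * K0 + K0 * K0))"
 have B1: "B1 > 0" by (simp add: B1_def)
 have X: "X > 0" unfolding X_def using H(1) K0 by (intro add_pos_pos mult_pos_pos) simp_all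
 have K1: "K1 > 0" unfolding K1_def using K0 U(1) B1 by (intro add_pos_pos mult_pos_pos) simp_all
 have K2: "K2 > 0" unfolding K2_def using K0 K1 E(1) X by (intro add_pos_pos mult_pos_pos) simp_all
 have K3: "K3 > 0" unfolding K3_def using K0 G(1) by (intro add_pos_pos mult_pos_pos) simp_all
 note pos = B1 X K1 K2 K3
 show thesis
 proof (rule that[of "max K2 K3"])
  show "max K2 K3 > 0" using pos by simp
 next
  fix c :: "int => real" and A om Lp BI I0 R1
  assume c: "!!n. c n >= 0" and c1: "c 1 <= K0 * c 0"
   and A: "A = (%m::nat. if s > 0 then ennreal (c (int m)) else tail_norm p c (int m))"
   and a2: "Lp <= ennreal K0 * zsum (%n. ennreal (c n) epowr p) epowr (1 / p)"
   "zsum (%n. ennreal (c n) epowr p) epowr (1 / p) <= ennreal K0 * Lp"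
   and a3: "!!m. om m <= ennreal K0 * zsum (%n. ennreal ((min 1 (tw (n - int m))) ^ k * c n) epowr p) epowr (1 / p)"
   and a4: "!!m. Lp < \<infinity> ==> tail_norm p c (int (m + M)) <= ennreal K0 * om m"
   and a5: "BI <= ennreal K0 * seq_norm q (%m. ennreal (lam s b m) * om m)"
   "seq_norm q (%m. ennreal (lam s b m) * om (Suc m)) <= ennreal K0 * BI"
   and a6: "I0 <= ennreal K0 * low_norm p c" "low_norm p c <= ennreal K0 * I0"
   and a7: "R1 <= ennreal K0 * seq_norm q (%m. ennreal (lam s b m) * A m)"
   "seq_norm q (%m. ennreal (lam s b m) * A (m + N)) <= ennreal K0 * R1"
  let ?Y = "seq_norm q (%m. ennreal (lam s b m) * A m)"
  let ?Z = "low_norm p c + ?Y"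
  let ?S = "zsum (%n. ennreal (c n) epowr p) epowr (1 / p)"
  define W where "W m = zsum (%n. ennreal ((min 1 (tw (n - int m))) ^ k * c n) epowr p) epowr (1 / p)" for m :: nat
  have UW: "seq_norm q (%m. ennreal (lam s b m) * W m) <= ennreal U * ?Z"
   unfolding W_def A by (rule U(2)[OF c])
  have AS: "A m <= ?S" for m
   using tail_norm_le_zsum[OF p, of c "int m"] tail_norm_ge[OF p, of c "int m"] by (auto simp: A intro: order_trans)
  \<comment> \<open>For \<open>m = 0\<close> the cut-off factor is 1 at all nonnegative
    indices.\<close>
  have "tail_norm p c 0 <= W 0"
  proof -
   have "(\<Sum>i. ennreal (c (0 + int i)) epowr p) = zsum (%n. if n >= 0 then ennreal (c n) epowr p else 0)"
    by (simp add: zsum_nonneg_part)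
   also have "... <= zsum (%n. ennreal ((min 1 (tw (n - int 0))) ^ k * c n) epowr p)"
   proof (intro zsum_mono)
    fix n
    have "min 1 (tw n) = 1" if "n >= 0" using tw_mono[OF that] by simp
    then show "(if n >= 0 then ennreal (c n) epowr p else 0) <= ennreal ((min 1 (tw (n - int 0))) ^ k * c n) epowr p" by simp
   qed
   finally show ?thesis using p unfolding tail_norm_def W_def seq_norm_real[OF p] by (intro epowr_mono) auto
  qed
  also have "W 0 <= seq_norm q (%m. ennreal (lam s b m) * W m)"
   using seq_norm_term[OF q, of "%m. ennreal (lam s b m) * W m" 0] by simp
  finally have T0: "tail_norm p c 0 <= ennreal U * ?Z" using UW by (rule order_trans)
  have L1: "low_norm p c <= ennreal 1 * ?Z" by (simp add: add_increasing2)
  have S: "?S <= ennreal (B1 * (U + 1)) * ?Z"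
   using U pos unfolding B1_def
   by (intro dominated_trans[OF zsum_le_tail_low[OF p] dominated_add[OF T0 L1]]) auto
  have LB: "Lp + BI <= ennreal K1 * ?Z"
   unfolding K1_def
  proof (rule dominated_add)
   show "Lp <= ennreal (K0 * (B1 * (U + 1))) * ?Z" using K0 U pos by (intro dominated_trans[OF a2(1) S]) auto
   have "ennreal (lam s b m) * om m <= ennreal K0 * (ennreal (lam s b m) * W m)" for m
    using mult_left_mono[OF a3[of m], of "ennreal (lam s b m)"] by (simp add: W_def mult_ac)
   from seq_norm_le_cmult[OF q this]
   have "seq_norm q (%m. ennreal (lam s b m) * om m) <= ennreal K0 * seq_norm q (%m. ennreal (lam s b m) * W m)" .
   from dominated_trans[OF this UW] K0 U
   have "seq_norm q (%m. ennreal (lam s b m) * om m) <= ennreal (K0 * U) * ?Z" by simp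
   from dominated_trans[OF a5(1) this] K0 U
   show "BI <= ennreal (K0 * (K0 * U)) * ?Z" by simp
  qed (use K0 U pos in auto)
  let ?R = "low_norm p c + seq_norm q (%m. ennreal (lam s b m) * A (m + N))"
  have c0: "ennreal (c 0) <= ennreal 1 * ?R" using low_norm_ge[OF p, of c] by (simp add: add_increasing2)
  have c1': "ennreal (c 1) <= ennreal K0 * ?R"
  proof -
   have "ennreal (c 1) <= ennreal K0 * ennreal (c 0)" using c1 c K0 by (simp add: ennreal_mult[symmetric] ennreal_leI)
   from dominated_trans[OF this c0] K0 show ?thesis by simp
  qed
  have first: "(\<Sum>m<N. A m) <= ennreal (1 + X) * ?R"
  proof (cases "s > 0")
   case True
   then have "(\<Sum>m<N. A m) = ennreal (c 0)" by (simp add: N A)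
   then show ?thesis using dominated_weaken[OF c0, of "1 + X"] pos by simp
  next
   case False
   have t2: "tail_norm p c 2 <= ennreal 1 * ?R"
    using seq_norm_term[OF q, of "%m. ennreal (lam s b m) * A (m + N)" 0] False
    by (simp add: N A add_increasing)
   have h: "tail_norm p c m <= ennreal H * (ennreal (c m) + tail_norm p c (m + 1))" for m
    using H(2)[of "%j. ennreal (c (m + int j))"] by (simp add: tail_norm_def add_ac)
   have "ennreal (c 1) + tail_norm p c 2 <= ennreal (K0 + 1) * ?R"
    using K0 by (intro dominated_add[OF c1' t2]) auto
   then have "tail_norm p c 1 <= ennreal (H * (K0 + 1)) * ?R"
    using h[of 1] H K0 by (intro dominated_trans[of _ H]) auto
   then have "ennreal (c 0) + tail_norm p c 1 <= ennreal (1 + H * (K0 + 1)) * ?R"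
    using H K0 by (intro dominated_add[OF c0]) auto
   then have t0: "tail_norm p c 0 <= ennreal (H * (1 + H * (K0 + 1))) * ?R"
    using h[of 0] H K0 by (intro dominated_trans[of _ H]) auto
   have "(\<Sum>m<N. A m) = tail_norm p c 0 + tail_norm p c 1" using False by (simp add: N A numeral_2_eq_2)
   also have "... <= tail_norm p c 0 + tail_norm p c 0" using tail_norm_Suc[OF p, of c 0] by (intro add_left_mono) simp
   also have "... <= ennreal (H * (1 + H * (K0 + 1)) + H * (1 + H * (K0 + 1))) * ?R"
    using H K0 by (intro dominated_add t0) auto
   finally show ?thesis by (rule dominated_weaken) (simp add: X_def)
  qed
  have Y: "?Y <= ennreal (E * ((1 + X) + 1)) * ?R"
  proof (rule dominated_trans[OF E(2)])
   have "seq_norm q (%m. ennreal (lam s b m) * A (m + N)) <= ennreal 1 * ?R" by (simp add: add_increasing)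
   with first show "(\<Sum>m<N. A m) + seq_norm q (%m. ennreal (lam s b m) * A (m + N)) <= ennreal ((1 + X) + 1) * ?R"
    using pos by (intro dominated_add) auto
  qed (use E pos in auto)
  have "low_norm p c <= ennreal 1 * ?R" by (simp add: add_increasing2)
  then have Z: "?Z <= ennreal (1 + E * ((1 + X) + 1)) * ?R"
   using Y E pos by (intro dominated_add) auto
  have R: "?R <= ennreal K0 * (I0 + R1)"
   using add_mono[OF a6(2) a7(2)] by (simp add: ring_distribs)
  have "?Z <= ennreal ((1 + E * ((1 + X) + 1)) * K0) * (I0 + R1)"
   using E K0 pos by (intro dominated_trans[OF Z R]) auto
  then have upper: "Lp + BI <= ennreal K2 * (I0 + R1)"
   unfolding K2_def using E K0 pos by (intro dominated_trans[OF LB]) auto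
  have lower: "I0 + R1 <= ennreal K3 * (Lp + BI)"
  proof (cases "Lp < \<infinity>")
   case False
   then have "Lp = top" by (simp add: less_top[symmetric])
   then show ?thesis using pos by (simp add: ennreal_mult_top)
  next
   case True
   let ?B = "Lp + BI"
   have Lp: "Lp <= ennreal 1 * ?B" and BI: "BI <= ennreal 1 * ?B" by (simp_all add: add_increasing add_increasing2)
   have S: "?S <= ennreal K0 * ?B" using dominated_trans[OF a2(2) Lp] K0 by simp
   have "I0 <= ennreal (K0 * K0) * ?B"
    using K0 low_norm_le_zsum[OF p, of c] S by (intro dominated_trans[OF a6(1)]) auto
   moreover have "R1 <= ennreal (K0 * (G * (real (Suc M) * K0 + K0 * K0))) * ?B"
   proof (intro dominated_trans[OF a7(1)] dominated_trans[OF G(2)] dominated_add)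
    have "(\<Sum>m<Suc M. A m) <= (\<Sum>m<Suc M. ?S)" by (intro sum_mono AS)
    also have "... = ennreal (real (Suc M)) * ?S" by (simp add: ennreal_of_nat_eq_real_of_nat)
    finally show "(\<Sum>m<Suc M. A m) <= ennreal (real (Suc M) * K0) * ?B"
     using K0 S by (intro dominated_trans[of _ "real (Suc M)"]) auto
    \<comment> \<open>The extra step in \<open>Suc M\<close> matches the modulus at
      \<open>Suc m\<close>, the index at which the integral controls it.\<close>
    have "ennreal (lam s b m) * A (m + Suc M) <= ennreal K0 * (ennreal (lam s b m) * om (Suc m))" for m
    proof -
     have "A (m + Suc M) <= tail_norm p c (int (Suc m + M))"
      using tail_norm_ge[OF p, of c "int (Suc m + M)"] by (simp add: A)
     also have "... <= ennreal K0 * om (Suc m)" by (rule a4[OF True])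
     finally show ?thesis
      using mult_left_mono[of "A (m + Suc M)" "ennreal K0 * om (Suc m)" "ennreal (lam s b m)"] by (simp add: mult_ac)
    qed
    from seq_norm_le_cmult[OF q this]
    have "seq_norm q (%m. ennreal (lam s b m) * A (m + Suc M)) <= ennreal K0 * seq_norm q (%m. ennreal (lam s b m) * om (Suc m))" .
    moreover have "seq_norm q (%m. ennreal (lam s b m) * om (Suc m)) <= ennreal K0 * ?B"
     using dominated_trans[OF a5(2) BI] K0 by simp
    ultimately show "seq_norm q (%m. ennreal (lam s b m) * A (m + Suc M)) <= ennreal (K0 * K0) * ?B"
     using K0 by (intro dominated_trans) auto
   qed (use K0 G in auto)
   ultimately show ?thesis unfolding K3_def using K0 G by (intro dominated_add) auto
  qed
  show "Lp + BI <= ennreal (max K2 K3) * (I0 + R1) \<and> I0 + R1 <= ennreal (max K2 K3) * (Lp + BI)"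
   using dominated_weaken[OF upper, of "max K2 K3"] dominated_weaken[OF lower, of "max K2 K3"] by simp
 qed
qed

section \<open>Discretization of the two sides\<close>

lemma int_norm_upper_const:
 assumes q: "0 < q" and "L >= 0" and "A \<subseteq> (\<Union>m. {tw (sg m)<..tw (sg m + 1)})"
  and f: "!!m t. t \<in> A ==> tw (sg m) < t ==> t <= tw (sg m + 1) ==> f t <= ennreal L * x m"
 shows "int_norm q A f <= ennreal L * seq_norm q (x :: nat => ennreal)"
 using int_norm_upper[OF q assms(3), of f "%m. ennreal L * x m"] f by (simp add: seq_norm_cmult[OF q])

lemma int_norm_lower_const:
 fixes sg :: "nat => int"
 assumes q: "0 < q" and L: "L > 0" and sg: "inj sg" and A: "!!m. {tw (sg m)<..<tw (sg m + 1)} \<subseteq> A"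
  and x: "!!m t. tw (sg m) < t ==> t < tw (sg m + 1) ==> x m <= ennreal L * f t"
 shows "seq_norm q x <= ennreal (L * step_const q) * int_norm q A f"
proof -
 have one: "ennreal (1 / L) * ennreal L = 1" "ennreal L * ennreal (1 / L) = 1"
  using L by (simp_all add: ennreal_mult[symmetric])
 have "ennreal (1 / L) * x m <= f t" if "tw (sg m) < t" "t < tw (sg m + 1)" for m t
  using mult_left_mono[OF x[OF that], of "ennreal (1 / L)"] by (simp add: mult.assoc[symmetric] one)
 from int_norm_lower[OF q sg A, of "%m. ennreal (1 / L) * x m" f, OF this]
 have "ennreal (1 / L) * seq_norm q x <= ennreal (step_const q) * int_norm q A f" by (simp add: seq_norm_cmult[OF q])
 from mult_left_mono[OF this, of "ennreal L"] show ?thesis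
  using L step_const_pos[of q] by (simp add: mult.assoc[symmetric] one ennreal_mult)
qed

text \<open>Since 1/2 <= ln 2 <= 1, the quantities \<open>1 + x\<close> and
  \<open>1 + real m\<close> differ by at most a factor 2.\<close>

lemma log_weight:
 assumes "real m * ln 2 <= x" "x <= (real m + 1) * ln 2"
 shows "(1 + x) powr b <= 2 powr \<bar>b\<bar> * (1 + real m) powr b" "(1 + real m) powr b <= 2 powr \<bar>b\<bar> * (1 + x) powr b"
proof -
 have compare: "v powr b <= 2 powr \<bar>b\<bar> * u powr b" if "u > 0" "v <= 2 * u" "u <= 2 * v" for u v :: real
 proof (cases "b >= 0")
  case True
  have "v powr b <= (2 * u) powr b" using that True by (intro powr_mono2) auto
  then show ?thesis using True that by (simp add: powr_mult)
 next
  case False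
  have "v powr b <= (u / 2) powr b" using that False by (intro powr_mono2') auto
  then show ?thesis using False that by (simp add: powr_divide powr_minus_divide)
 qed
 have ln2: "(1 / 2 :: real) <= ln 2" "ln 2 <= (1::real)" using ln2_ge_two_thirds ln_2_less_1 by linarith+
 have "real m * (1 / 2) <= real m * ln 2" using ln2 by (intro mult_left_mono) simp_all
 also note assms(1)
 finally have lo: "real m <= 2 * x" by simp
 note assms(2)
 also have "(real m + 1) * ln 2 <= (real m + 1) * 1" using ln2 by (intro mult_left_mono) simp_all
 finally have hi: "x <= real m + 1" by simp
 have "1 + real m <= 2 * (1 + x)" using lo by (simp add: algebra_simps)
 moreover have "1 + x <= 2 * (1 + real m)"
 proof -
  note hi
  also have "real m + 1 <= 2 * real m + 1" by simp
  finally show ?thesis by simp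
 qed
 moreover have "1 + x > 0"
  using order_trans[OF of_nat_0_le_iff lo] by simp
 ultimately
 show "(1 + x) powr b <= 2 powr \<bar>b\<bar> * (1 + real m) powr b" "(1 + real m) powr b <= 2 powr \<bar>b\<bar> * (1 + x) powr b"
  by (auto intro!: compare)
qed

lemma ln_tw: "ln (tw n) = real_of_int n * ln 2" by (simp add: tw_def ln_powr)

lemma ln_dyadic:
 assumes "tw n <= t" "t <= tw (n + 1)"
 shows "real_of_int n * ln 2 <= ln t" "ln t <= (real_of_int n + 1) * ln 2"
proof -
 have t: "t > 0" using assms(1) tw_pos(1)[of n] by linarith
 have "ln (tw n) <= ln t" "ln t <= ln (tw (n + 1))" using assms t by simp_all
 then show "real_of_int n * ln 2 <= ln t" "ln t <= (real_of_int n + 1) * ln 2" by (simp_all add: ln_tw)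
qed

text \<open>On a dyadic interval the weight is constant up to a factor and the modulus lies between
  its values at the ends. The upper estimate uses the right end, the lower one the left end, hence
  the shifted index.\<close>

lemma modulus_integral_discrete:
 assumes q: "0 < q" and s: "0 <= s"
 obtains K where "K > 0"
  "!!\<omega> :: real => ennreal. mono \<omega> ==> int_norm q {0<..<1} (%t. ennreal (t powr (- s) * (1 - ln t) powr b) * \<omega> t)
    <= ennreal K * seq_norm q (%m. ennreal (lam s b m) * \<omega> (tw (- int m)))"
  "!!\<omega> :: real => ennreal. mono \<omega> ==> seq_norm q (%m. ennreal (lam s b m) * \<omega> (tw (- int (Suc m))))
    <= ennreal K * int_norm q {0<..<1} (%t. ennreal (t powr (- s) * (1 - ln t) powr b) * \<omega> t)"
proof -
 define L where "L = 2 powr s * 2 powr \<bar>b\<bar>"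
 have L: "L > 0" by (simp add: L_def)
 define K where "K = L * step_const q"
 have K: "K > 0" using L step_const_pos by (simp add: K_def)
 note K_lower = int_norm_lower_const[OF q L, folded K_def]
 define sg where "sg m = - int (Suc m)" for m
 have sg1: "sg m + 1 = - int m" for m by (simp add: sg_def)
 have w: "t powr (- s) * (1 - ln t) powr b <= L * lam s b m" "lam s b m <= L * (t powr (- s) * (1 - ln t) powr b)"
  if t: "tw (sg m) < t" "t <= tw (sg m + 1)" for m t
 proof -
  have t0: "t > 0" using t tw_pos(1)[of "sg m"] by linarith
  have x: "real m * ln 2 <= - ln t" "- ln t <= (real m + 1) * ln 2"
   using ln_dyadic[of "sg m" t] t by (simp_all add: sg_def algebra_simps)
  have e: "tw n powr (- s) = 2 powr (- real_of_int n * s)" for n by (simp add: tw_powr mult.commute)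
  have "t powr (- s) <= tw (sg m) powr (- s)" using t s by (intro powr_mono2') auto
  also have "... = 2 powr s * 2 powr (real m * s)" by (simp add: e sg_def powr_add[symmetric] algebra_simps)
  finally have u: "t powr (- s) <= 2 powr s * 2 powr (real m * s)" .
  have "tw (- int m) powr (- s) <= t powr (- s)" using t t0 s unfolding sg1 by (intro powr_mono2') auto
  then have l: "2 powr (real m * s) <= t powr (- s)" by (simp add: e)
  have lw: "(1 - ln t) powr b <= 2 powr \<bar>b\<bar> * (1 + real m) powr b" "(1 + real m) powr b <= 2 powr \<bar>b\<bar> * (1 - ln t) powr b"
   using log_weight[OF x, of b] by simp_all
  have "t powr (- s) * (1 - ln t) powr b <= (2 powr s * 2 powr (real m * s)) * (2 powr \<bar>b\<bar> * (1 + real m) powr b)"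
   by (intro mult_mono u lw) auto
  then show "t powr (- s) * (1 - ln t) powr b <= L * lam s b m" by (simp add: L_def lam_def mult_ac)
  have "lam s b m <= t powr (- s) * (2 powr \<bar>b\<bar> * (1 - ln t) powr b)"
   unfolding lam_def by (intro mult_mono l lw) auto
  also have "... = 1 * (2 powr \<bar>b\<bar> * (t powr (- s) * (1 - ln t) powr b))" by simp
  also have "... <= 2 powr s * (2 powr \<bar>b\<bar> * (t powr (- s) * (1 - ln t) powr b))"
   using s by (intro mult_right_mono ge_one_powr_ge_zero) auto
  finally show "lam s b m <= L * (t powr (- s) * (1 - ln t) powr b)" by (simp add: L_def mult_ac)
 qed
 show thesis
 proof (rule that[of "max L K"])
  show "max L K > 0" using L by simp
 next
  fix \<omega> :: "real => ennreal" assume mono: "mono \<omega>"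
  have "int_norm q {0<..<1} (%t. ennreal (t powr (- s) * (1 - ln t) powr b) * \<omega> t)
    <= ennreal L * seq_norm q (%m. ennreal (lam s b m) * \<omega> (tw (- int m)))"
  proof (rule int_norm_upper_const[OF q, where sg = sg])
   show "{0<..<1} \<subseteq> (\<Union>m. {tw (sg m)<..tw (sg m + 1)})"
   proof
    fix t :: real assume t: "t \<in> {0<..<1}"
    then obtain n where n: "tw n < t" "t <= tw (n + 1)" using dyadic_interval[of t] by auto
    have "tw n < tw 0" using n(1) t by simp
    then have "n < 0" unfolding tw_less_iff .
    then have "sg (nat (- n - 1)) = n" by (simp add: sg_def)
    then show "t \<in> (\<Union>m. {tw (sg m)<..tw (sg m + 1)})" using n by (intro UN_I[of "nat (- n - 1)"]) auto
   qed
   fix m t assume t: "tw (sg m) < t" "t <= tw (sg m + 1)"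
   have "ennreal (t powr (- s) * (1 - ln t) powr b) * \<omega> t <= ennreal (L * lam s b m) * \<omega> (tw (sg m + 1))"
    using t by (intro mult_mono ennreal_leI w(1) monoD[OF mono]) auto
   then show "ennreal (t powr (- s) * (1 - ln t) powr b) * \<omega> t <= ennreal L * (ennreal (lam s b m) * \<omega> (tw (- int m)))"
    using L by (simp add: sg1 ennreal_mult mult.assoc)
  qed (use L in auto)
  then show "int_norm q {0<..<1} (%t. ennreal (t powr (- s) * (1 - ln t) powr b) * \<omega> t)
    <= ennreal (max L K) * seq_norm q (%m. ennreal (lam s b m) * \<omega> (tw (- int m)))"
   by (rule dominated_weaken) simp
 next
  fix \<omega> :: "real => ennreal" assume mono: "mono \<omega>"
  have "seq_norm q (%m. ennreal (lam s b m) * \<omega> (tw (- int (Suc m))))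
    <= ennreal K * int_norm q {0<..<1} (%t. ennreal (t powr (- s) * (1 - ln t) powr b) * \<omega> t)"
  proof (rule K_lower[where sg = sg])
   show "inj sg" by (auto simp: inj_def sg_def)
   show "{tw (sg m)<..<tw (sg m + 1)} \<subseteq> {0<..<1}" for m
   proof -
    have "tw (sg m + 1) <= tw 0" by (intro tw_mono) (simp add: sg_def)
    then show ?thesis by (auto intro: less_trans[OF tw_pos(1)])
   qed
   fix m t assume t: "tw (sg m) < t" "t < tw (sg m + 1)"
   have "ennreal (lam s b m) * \<omega> (tw (sg m)) <= ennreal (L * (t powr (- s) * (1 - ln t) powr b)) * \<omega> t"
    using t by (intro mult_mono ennreal_leI w(2) monoD[OF mono]) auto
   then show "ennreal (lam s b m) * \<omega> (tw (- int (Suc m))) <= ennreal L * (ennreal (t powr (- s) * (1 - ln t) powr b) * \<omega> t)"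
    using L unfolding sg_def by (simp add: ennreal_mult'' ennreal_mult' mult.assoc)
  qed
  then show "seq_norm q (%m. ennreal (lam s b m) * \<omega> (tw (- int (Suc m))))
    <= ennreal (max L K) * int_norm q {0<..<1} (%t. ennreal (t powr (- s) * (1 - ln t) powr b) * \<omega> t)"
   by (rule dominated_weaken) simp
 qed
qed

text \<open>The general monotone condition bounds \<open>F\<close> by earlier values only. Thus
  \<open>F\<close> on an octave is bounded above through its left end, but bounded below only
  through its right end, which costs one index.\<close>

lemma gm_dyadic:
 assumes gm: "gm TYPE('a::euclidean_space) F V C" and p: "p > 1" and t: "tw n <= t" "t <= tw (n + 1)"
 defines "e \<equiv> real DIM('a) * (1 - 1 / p)"
 shows "t powr e * F t <= (2 powr e * (1 + C)) * cseq DIM('a) F p n"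
  "cseq DIM('a) F p (n + 1) <= (2 powr e * (1 + C)) * (t powr e * F t)"
proof -
 interpret gm F V C "TYPE('a)" by fact
 have e: "e >= 0" using p by (simp add: e_def)
 have t0: "t > 0" using t tw_pos(1)[of n] by linarith
 have t2: "t <= 2 * tw n" "tw (n + 1) <= 2 * t" using t by (simp_all add: tw_Suc)
 have "t powr e * F t <= (2 * tw n) powr e * ((1 + C) * F (tw n))"
  using t t2 t0 e F_le[of "tw n" t] F_nonneg by (intro mult_mono powr_mono2) auto
 then show "t powr e * F t <= (2 powr e * (1 + C)) * cseq DIM('a) F p n"
  by (simp add: powr_mult cseq_def e_def mult_ac)
 have "tw (n + 1) powr e * F (tw (n + 1)) <= (2 * t) powr e * ((1 + C) * F t)"
  using t t2 t0 e F_le[of t "tw (n + 1)"] F_nonneg by (intro mult_mono powr_mono2) auto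
 then show "cseq DIM('a) F p (n + 1) <= (2 powr e * (1 + C)) * (t powr e * F t)"
  using t0 by (simp add: powr_mult cseq_def e_def mult_ac)
qed

text \<open>Octave by octave comparison of the right-hand side with the coefficients. Upper and
  lower estimates differ by the index shift of \<open>gm_dyadic\<close>, and the tails in the case
  \<open>s = 0\<close> lose one more.\<close>

lemma gm_integrals_discrete:
 assumes p: "p > 1" and q: "0 < q" and s: "0 <= s" and C: "C > 1"
 defines "e \<equiv> real DIM('a::euclidean_space) * (1 - 1 / p)"
 obtains K where "K > 0"
  "!!F V. gm TYPE('a) F V C ==> int_norm (ennreal p) {0<..<1} (%t. ennreal (t powr e * F t)) <= ennreal K * low_norm p (cseq DIM('a) F p)"
  "!!F V. gm TYPE('a) F V C ==> low_norm p (cseq DIM('a) F p) <= ennreal K * int_norm (ennreal p) {0<..<1} (%t. ennreal (t powr e * F t))"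
  "!!F V. gm TYPE('a) F V C ==> int_norm q {1<..} (%t. ennreal (t powr (s + e) * (1 + ln t) powr b * F t))
    <= ennreal K * seq_norm q (%m. ennreal (lam s b m) * ennreal (cseq DIM('a) F p (int m)))"
  "!!F V. gm TYPE('a) F V C ==> seq_norm q (%m. ennreal (lam s b m) * ennreal (cseq DIM('a) F p (int (m + 1))))
    <= ennreal K * int_norm q {1<..} (%t. ennreal (t powr (s + e) * (1 + ln t) powr b * F t))"
  "!!F V. gm TYPE('a) F V C ==> int_norm q {1<..} (%t. ennreal ((1 + ln t) powr b) * int_norm (ennreal p) {t<..} (%u. ennreal (u powr e * F u)))
    <= ennreal K * seq_norm q (%m. ennreal (lam 0 b m) * tail_norm p (cseq DIM('a) F p) (int m))"
  "!!F V. gm TYPE('a) F V C ==> seq_norm q (%m. ennreal (lam 0 b m) * tail_norm p (cseq DIM('a) F p) (int (m + 2)))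
    <= ennreal K * int_norm q {1<..} (%t. ennreal ((1 + ln t) powr b) * int_norm (ennreal p) {t<..} (%u. ennreal (u powr e * F u)))"
proof -
 define L where "L = 2 powr e * (1 + C)"
 have L: "L > 0" using C by (simp add: L_def)
 have e: "e >= 0" using p by (simp add: e_def)
 have ep: "0 < ennreal p" using p by simp
 define P where "P = L * step_const (ennreal p)"
 have P: "P > 0" using L step_const_pos by (simp add: P_def)
 note P_lower = int_norm_lower_const[OF ep L, folded P_def]
 define L2 where "L2 = 2 powr s * 2 powr \<bar>b\<bar> * L"
 have L2: "L2 > 0" using L by (simp add: L2_def)
 define Q where "Q = L2 * step_const q"
 have Q: "Q > 0" using L2 step_const_pos by (simp add: Q_def)
 note Q_lower = int_norm_lower_const[OF q L2, folded Q_def]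
 define L3 where "L3 = 2 powr \<bar>b\<bar> * (L + P)"
 have L3: "L3 > 0" using L P by (simp add: L3_def)
 define R where "R = L3 * step_const q"
 have R: "R > 0" using L3 step_const_pos by (simp add: R_def)
 note R_lower = int_norm_lower_const[OF q L3, folded R_def]
 define K where "K = Max {L, P, L2, Q, L3, R}"
 have K: "L <= K" "P <= K" "L2 <= K" "Q <= K" "L3 <= K" "R <= K" by (auto simp: K_def)
 have cover: "{1<..} \<subseteq> (\<Union>m. {tw (int m)<..tw (int m + 1)})"
 proof
  fix t :: real assume t: "t \<in> {1<..}"
  then obtain n where n: "tw n < t" "t <= tw (n + 1)" using dyadic_interval[of t] by auto
  have "tw 0 < tw (n + 1)" using n(2) t by simp
  then have "0 <= n" unfolding tw_less_iff by simp
  then show "t \<in> (\<Union>m. {tw (int m)<..tw (int m + 1)})" using n by (intro UN_I[of "nat n"]) auto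
 qed
 have sub1: "{tw (int m)<..<tw (int m + 1)} \<subseteq> {1<..}" for m
  using tw_mono[of 0 "int m"] by auto
 have inj: "inj int" by simp
 have lw: "(1 + ln t) powr b <= 2 powr \<bar>b\<bar> * (1 + real m) powr b" "(1 + real m) powr b <= 2 powr \<bar>b\<bar> * (1 + ln t) powr b"
  if "tw (int m) <= t" "t <= tw (int m + 1)" for m t
  using log_weight[of m "ln t" b] ln_dyadic[OF that] by simp_all
 show thesis
 proof (rule that)
  show "K > 0" using K(1) L by linarith
 next
  fix F V assume gm: "gm TYPE('a) F V C"
  define c where "c = cseq DIM('a) F p"
  interpret gm F V C "TYPE('a)" by (rule gm)
  have c0: "c n >= 0" for n using F_nonneg by (simp add: c_def cseq_def)
  define \<phi> where "\<phi> t = ennreal (t powr e * F t)" for t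
  have \<phi>: "\<phi> t <= ennreal L * ennreal (c n)" "ennreal (c (n + 1)) <= ennreal L * \<phi> t"
   if "tw n <= t" "t <= tw (n + 1)" for n t
   using gm_dyadic[OF gm p that] L c0 F_nonneg
   by (simp_all add: \<phi>_def c_def e_def L_def ennreal_mult[symmetric] ennreal_leI)
  have "int_norm (ennreal p) {0<..<1} \<phi> <= ennreal L * seq_norm (ennreal p) (%j. ennreal (c (- int (Suc j))))"
  proof (rule int_norm_upper_const[OF ep, where sg = "%j. - int (Suc j)"])
   show "{0<..<1} \<subseteq> (\<Union>m. {tw (- int (Suc m))<..tw (- int (Suc m) + 1)})"
   proof
    fix t :: real assume t: "t \<in> {0<..<1}"
    then obtain n where n: "tw n < t" "t <= tw (n + 1)" using dyadic_interval[of t] by auto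
    have "tw n < tw 0" using n(1) t by simp
    then have "n < 0" unfolding tw_less_iff .
    then have "- int (Suc (nat (- n - 1))) = n" by simp
    then show "t \<in> (\<Union>m. {tw (- int (Suc m))<..tw (- int (Suc m) + 1)})" using n by (intro UN_I[of "nat (- n - 1)"]) auto
   qed
   show "\<phi> t <= ennreal L * ennreal (c (- int (Suc m)))" if "tw (- int (Suc m)) < t" "t <= tw (- int (Suc m) + 1)" for m t
    by (rule \<phi>(1)[OF less_imp_le[OF that(1)] that(2)])
  qed (use L in simp)
  moreover have "seq_norm (ennreal p) (%j. ennreal (c (- int (Suc j)))) <= low_norm p c"
   unfolding low_norm_def by (rule seq_norm_Suc[OF ep])
  ultimately have "int_norm (ennreal p) {0<..<1} \<phi> <= ennreal L * low_norm p c"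
   using mult_left_mono[of "seq_norm (ennreal p) (%j. ennreal (c (- int (Suc j))))" "low_norm p c" "ennreal L"] by auto
  then show "int_norm (ennreal p) {0<..<1} (%t. ennreal (t powr e * F t)) <= ennreal K * low_norm p (cseq DIM('a) F p)"
   unfolding \<phi>_def[abs_def] c_def using K(1) by (rule dominated_weaken)
  have "low_norm p c <= ennreal P * int_norm (ennreal p) {0<..<1} \<phi>"
   unfolding low_norm_def
  proof (rule P_lower[where sg = "%j. - int j - 1"])
   show "inj (%j. - int j - 1)" by (auto simp: inj_def)
   show "{tw (- int m - 1)<..<tw (- int m - 1 + 1)} \<subseteq> {0<..<1}" for m
    using tw_mono[of "- int m" 0] by (auto intro: less_trans[OF tw_pos(1)])
   show "ennreal (c (- int m)) <= ennreal L * \<phi> t" if "tw (- int m - 1) < t" "t < tw (- int m - 1 + 1)" for m t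
    using \<phi>(2)[of "- int m - 1" t] that by simp
  qed
  then show "low_norm p (cseq DIM('a) F p) <= ennreal K * int_norm (ennreal p) {0<..<1} (%t. ennreal (t powr e * F t))"
   unfolding \<phi>_def[abs_def] c_def using K(2) by (rule dominated_weaken)
  define w where "w t = t powr s * (1 + ln t) powr b" for t
  have w: "w t <= 2 powr s * 2 powr \<bar>b\<bar> * lam s b m" "lam s b m <= 2 powr s * 2 powr \<bar>b\<bar> * w t"
   if t: "tw (int m) <= t" "t <= tw (int m + 1)" for m t
  proof -
   have t0: "t > 0" using t tw_pos(1)[of "int m"] by linarith
   have "t powr s <= tw (int m + 1) powr s" using t t0 s by (intro powr_mono2) auto
   also have "... = 2 powr s * 2 powr (real m * s)" by (simp add: tw_powr powr_add[symmetric] algebra_simps)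
   finally have "w t <= (2 powr s * 2 powr (real m * s)) * (2 powr \<bar>b\<bar> * (1 + real m) powr b)"
    unfolding w_def by (intro mult_mono lw t) auto
   then show "w t <= 2 powr s * 2 powr \<bar>b\<bar> * lam s b m" by (simp add: lam_def mult_ac)
   have "tw (int m) powr s <= t powr s" using t s by (intro powr_mono2) auto
   then have "2 powr (real m * s) <= t powr s" by (simp add: tw_powr mult.commute)
   then have "lam s b m <= t powr s * (2 powr \<bar>b\<bar> * (1 + ln t) powr b)"
    unfolding lam_def by (intro mult_mono lw t) auto
   also have "... = 1 * (2 powr \<bar>b\<bar> * w t)" by (simp add: w_def)
   also have "... <= 2 powr s * (2 powr \<bar>b\<bar> * w t)"
    using s by (intro mult_right_mono ge_one_powr_ge_zero) (auto simp: w_def)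
   finally show "lam s b m <= 2 powr s * 2 powr \<bar>b\<bar> * w t" by (simp add: mult_ac)
  qed
  have w0: "w t >= 0" for t by (simp add: w_def)
  have split: "ennreal (t powr (s + e) * (1 + ln t) powr b * F t) = ennreal (w t) * \<phi> t" for t
   using F_nonneg w0 by (simp add: w_def \<phi>_def powr_add ennreal_mult[symmetric] mult_ac)
  have "int_norm q {1<..} (%t. ennreal (w t) * \<phi> t) <= ennreal L2 * seq_norm q (%m. ennreal (lam s b m) * ennreal (c (int m)))"
  proof (rule int_norm_upper_const[OF q _ cover])
   fix m t assume t: "tw (int m) < t" "t <= tw (int m + 1)"
   have "ennreal (w t) * \<phi> t <= ennreal (2 powr s * 2 powr \<bar>b\<bar> * lam s b m) * (ennreal L * ennreal (c (int m)))"
    using t by (intro mult_mono ennreal_leI w(1) \<phi>(1)) auto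
   also have "... = ennreal L2 * (ennreal (lam s b m) * ennreal (c (int m)))"
    using L c0 by (simp add: L2_def ennreal_mult[symmetric] mult_ac)
   finally show "ennreal (w t) * \<phi> t <= ennreal L2 * (ennreal (lam s b m) * ennreal (c (int m)))" .
  qed (use L2 in simp)
  then show "int_norm q {1<..} (%t. ennreal (t powr (s + e) * (1 + ln t) powr b * F t))
    <= ennreal K * seq_norm q (%m. ennreal (lam s b m) * ennreal (cseq DIM('a) F p (int m)))"
   unfolding split c_def using K(3) by (rule dominated_weaken)
  have "seq_norm q (%m. ennreal (lam s b m) * ennreal (c (int (m + 1)))) <= ennreal Q * int_norm q {1<..} (%t. ennreal (w t) * \<phi> t)"
  proof (rule Q_lower[OF inj sub1])
   fix m t assume t: "tw (int m) < t" "t < tw (int m + 1)"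
   have "ennreal (lam s b m) * ennreal (c (int m + 1)) <= ennreal (2 powr s * 2 powr \<bar>b\<bar> * w t) * (ennreal L * \<phi> t)"
    using t by (intro mult_mono ennreal_leI w(2) \<phi>(2)) auto
   also have "... = ennreal L2 * (ennreal (w t) * \<phi> t)"
    using L w0 F_nonneg by (simp add: L2_def \<phi>_def ennreal_mult[symmetric] mult_ac)
   finally show "ennreal (lam s b m) * ennreal (c (int (m + 1))) <= ennreal L2 * (ennreal (w t) * \<phi> t)"
    by (simp add: add.commute)
  qed
  then show "seq_norm q (%m. ennreal (lam s b m) * ennreal (cseq DIM('a) F p (int (m + 1))))
    <= ennreal K * int_norm q {1<..} (%t. ennreal (t powr (s + e) * (1 + ln t) powr b * F t))"
   unfolding split c_def using K(4) by (rule dominated_weaken)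
  define G where "G t = int_norm (ennreal p) {t<..} \<phi>" for t
  have G_eq: "G t = (\<integral>\<^sup>+u\<in>{t<..}. \<phi> u epowr p * ennreal (1 / u) \<partial>lborel) epowr (1 / p)" for t
   using p by (simp add: G_def int_norm_def)
  have G_mono: "G t <= G t'" if "t' <= t" for t t'
   unfolding G_eq using that p by (intro epowr_mono nn_integral_mono mult_left_mono) (auto simp: indicator_def)
  have G_upper: "G (tw n) <= ennreal L * tail_norm p c n" for n
   unfolding G_def tail_norm_def
  proof (rule int_norm_upper_const[OF ep, where sg = "%j. n + int j"])
   show "{tw n<..} \<subseteq> (\<Union>m. {tw (n + int m)<..tw (n + int m + 1)})"
   proof
    fix t :: real assume t: "t \<in> {tw n<..}"
    then have "t > 0" by (auto intro: less_trans[OF tw_pos(1)])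
    then obtain i where i: "tw i < t" "t <= tw (i + 1)" using dyadic_interval[of t] by auto
    have "tw n < tw (i + 1)" using i(2) t by simp
    then have "n <= i" unfolding tw_less_iff by simp
    then have "n + int (nat (i - n)) = i" by simp
    then show "t \<in> (\<Union>m. {tw (n + int m)<..tw (n + int m + 1)})" using i by (intro UN_I[of "nat (i - n)"]) auto
   qed
   show "\<phi> t <= ennreal L * ennreal (c (n + int m))" if "tw (n + int m) < t" "t <= tw (n + int m + 1)" for m t
    by (rule \<phi>(1)[OF less_imp_le[OF that(1)] that(2)])
  qed (use L in simp)
  have G_lower: "tail_norm p c (n + 1) <= ennreal P * G (tw n)" for n
   unfolding G_def tail_norm_def
  proof (rule P_lower[where sg = "%j. n + int j"])
   show "inj (%j. n + int j)" by (auto simp: inj_def)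
   show "{tw (n + int m)<..<tw (n + int m + 1)} \<subseteq> {tw n<..}" for m
    using tw_mono[of n "n + int m"] by auto
   show "ennreal (c (n + 1 + int m)) <= ennreal L * \<phi> t" if "tw (n + int m) < t" "t < tw (n + int m + 1)" for m t
    using \<phi>(2)[of "n + int m" t] that by (simp add: add_ac)
  qed
  have lam0: "lam 0 b m = (1 + real m) powr b" for m by (simp add: lam_def)
  have "int_norm q {1<..} (%t. ennreal ((1 + ln t) powr b) * G t)
    <= ennreal L3 * seq_norm q (%m. ennreal (lam 0 b m) * tail_norm p c (int m))"
  proof (rule int_norm_upper_const[OF q _ cover])
   fix m t assume t: "tw (int m) < t" "t <= tw (int m + 1)"
   have "G t <= ennreal L * tail_norm p c (int m)" using G_mono[of "tw (int m)" t] G_upper[of "int m"] t by auto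
   then have Gt: "G t <= ennreal (L + P) * tail_norm p c (int m)" by (rule dominated_weaken) (use P in simp)
   have "ennreal ((1 + ln t) powr b) * G t <= ennreal (2 powr \<bar>b\<bar> * lam 0 b m) * (ennreal (L + P) * tail_norm p c (int m))"
    using t lw(1)[of m t] by (intro mult_mono ennreal_leI Gt) (auto simp: lam0)
   also have "... = ennreal L3 * (ennreal (lam 0 b m) * tail_norm p c (int m))"
    using L P by (simp add: L3_def ennreal_mult mult_ac del: ennreal_plus)
   finally show "ennreal ((1 + ln t) powr b) * G t <= ennreal L3 * (ennreal (lam 0 b m) * tail_norm p c (int m))" .
  qed (use L3 in simp)
  then show "int_norm q {1<..} (%t. ennreal ((1 + ln t) powr b) * int_norm (ennreal p) {t<..} (%u. ennreal (u powr e * F u)))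
    <= ennreal K * seq_norm q (%m. ennreal (lam 0 b m) * tail_norm p (cseq DIM('a) F p) (int m))"
   unfolding G_def c_def \<phi>_def[abs_def] using K(5) by (rule dominated_weaken)
  have "seq_norm q (%m. ennreal (lam 0 b m) * tail_norm p c (int (m + 2)))
    <= ennreal R * int_norm q {1<..} (%t. ennreal ((1 + ln t) powr b) * G t)"
  proof (rule R_lower[OF inj sub1])
   fix m t assume t: "tw (int m) < t" "t < tw (int m + 1)"
   \<comment> \<open>One index is lost in \<open>G_lower\<close>, and one because \<open>t\<close>
     may lie close to the right end of its octave.\<close>
   have "tail_norm p c (int m + 1 + 1) <= ennreal P * G (tw (int m + 1))" by (rule G_lower)
   also have "... <= ennreal P * G t" using t by (intro mult_left_mono G_mono) auto
   finally have "tail_norm p c (int (m + 2)) <= ennreal P * G t" by (simp add: add_ac)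
   then have Gt: "tail_norm p c (int (m + 2)) <= ennreal (L + P) * G t"
    by (rule dominated_weaken) (use L in simp)
   have "ennreal (lam 0 b m) * tail_norm p c (int (m + 2)) <= ennreal (2 powr \<bar>b\<bar> * (1 + ln t) powr b) * (ennreal (L + P) * G t)"
    using t lw(2)[of m t] by (intro mult_mono ennreal_leI Gt) (auto simp: lam0)
   also have "... = ennreal L3 * (ennreal ((1 + ln t) powr b) * G t)"
    using L P by (simp add: L3_def ennreal_mult mult_ac del: ennreal_plus)
   finally show "ennreal (lam 0 b m) * tail_norm p c (int (m + 2)) <= ennreal L3 * (ennreal ((1 + ln t) powr b) * G t)" .
  qed
  then show "seq_norm q (%m. ennreal (lam 0 b m) * tail_norm p (cseq DIM('a) F p) (int (m + 2)))
    <= ennreal K * int_norm q {1<..} (%t. ennreal ((1 + ln t) powr b) * int_norm (ennreal p) {t<..} (%u. ennreal (u powr e * F u)))"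
   unfolding G_def c_def \<phi>_def[abs_def] using K(6) by (rule dominated_weaken)
 qed
qed

section \<open>Functions with general monotone Fourier transform\<close>

text \<open>Integrability on balls comes from the assumed integral near 0 and from local boundedness
  elsewhere. The weighted variation is summable over octaves because the dyadic partition gives a
  lower Darboux sum of the variation integral.\<close>

lemma GM_hat_gm_tail:
 assumes f: "GM_hat C F0 (f :: real ^ 'n => complex)"
 defines "F \<equiv> %s. if s > 0 then F0 s else (0::real)"
 defines "V \<equiv> %a b. enn2real (total_variation (%u. complex_of_real (F0 u)) a b)"
 shows "gm_tail TYPE(real ^ 'n) F V C"
proof -
 let ?d = "CARD('n)" and ?tv = "total_variation (%u. complex_of_real (F0 u))"
 have C: "C > 1" and fin: "!!a b. 0 < a ==> a <= b ==> ?tv a b < \<infinity>"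
  and dbl: "!!z. z > 0 ==> ?tv z (2 * z) <= ennreal (C * norm (complex_of_real (F0 z)))"
  and pos: "!!u. u > 0 ==> F0 u > 0"
  using f by (auto simp: GM_hat_def GM_with_def)
 have low: "(\<integral>\<^sup>+ u\<in>{0<..<1}. ennreal (u ^ (?d - 1) * F0 u) \<partial>lborel) < \<infinity>"
  and high: "(SUP N\<in>{1..}. variation_integral (%u. u powr ((real ?d - 1) / 2)) (%u. complex_of_real (F0 u)) 1 N) < \<infinity>"
  using f by (auto simp: GM_hat_def ennreal_add_eq_top less_top)
 have tvV: "?tv a b = ennreal (V a b)" if "0 < a" "a <= b" for a b
  using fin[OF that] by (simp add: V_def)
 interpret bounded_var F V
 proof
  fix a b :: real assume ab: "0 < a" "a <= b"
  have "ennreal (norm (complex_of_real (F0 b) - complex_of_real (F0 a))) <= ennreal (V a b)"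
   using total_variation_ge[OF ab(2), of "%u. complex_of_real (F0 u)"] tvV[OF ab] by simp
  then have "norm (complex_of_real (F0 b) - complex_of_real (F0 a)) <= V a b"
   by (simp add: V_def)
  then show "\<bar>F b - F a\<bar> <= V a b" using ab by (simp add: F_def flip: of_real_diff)
 next
  fix a b c :: real assume abc: "0 < a" "a <= b" "b <= c"
  have e: "?tv a b = ennreal (V a b)" "?tv b c = ennreal (V b c)" "?tv a c = ennreal (V a c)"
   using abc by (auto intro!: tvV)
  have p: "V x y >= 0" for x y by (simp add: V_def)
  have "ennreal (V a b) + ennreal (V b c) <= ennreal (V a c)"
   using total_variation_add[OF abc(2,3), of "%u. complex_of_real (F0 u)"] unfolding e .
  then have "ennreal (V a b + V b c) <= ennreal (V a c)" by (simp only: ennreal_plus[OF p p])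
  then show "V a b + V b c <= V a c" by (simp only: ennreal_le_iff[OF p])
 qed (simp add: F_def)
 have F0: "F s >= 0" for s using pos[of s] by (simp add: F_def less_imp_le)
 have int: "integrable lborel (%y::real ^ 'n. indicator (cball 0 N) y * F (norm y))" for N
 proof (cases "N > 0")
  case True
  define M where "M = \<bar>F 1\<bar> + V 1 (max 1 N)"
  have "(NI s. ennreal (indicator {0<..N} s * (s ^ (?d - 1) * \<bar>F s\<bar>))) <=
    (NI s. ennreal (s ^ (?d - 1) * F0 s) * indicator {0<..<1} s + ennreal (N ^ (?d - 1) * M) * indicator {1..N} s)"
  proof (rule nn_integral_mono)
   fix s :: real
   show "ennreal (indicator {0<..N} s * (s ^ (?d - 1) * \<bar>F s\<bar>)) <=
     ennreal (s ^ (?d - 1) * F0 s) * indicator {0<..<1} s + ennreal (N ^ (?d - 1) * M) * indicator {1..N} s"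
   proof (cases "0 < s \<and> s <= N")
    case s: True
    show ?thesis
    proof (cases "s < 1")
     case True
     then show ?thesis using s F0[of s] by (simp add: F_def)
    next
     case False
     have "\<bar>F s\<bar> <= M" using F_bounded[of 1 s "max 1 N"] False s by (simp add: M_def)
     then have "s ^ (?d - 1) * \<bar>F s\<bar> <= N ^ (?d - 1) * M" using s by (intro mult_mono power_mono) auto
     then show ?thesis using s False by (simp add: ennreal_leI)
    qed
   qed simp
  qed
  also have "... = (NI s. ennreal (s ^ (?d - 1) * F s) * indicator {0<..<1} s)
    + (NI s. ennreal (N ^ (?d - 1) * M) * indicator {1..N} s)"
  proof -
   have "(NI s. ennreal (s ^ (?d - 1) * F0 s) * indicator {0<..<1} s + ennreal (N ^ (?d - 1) * M) * indicator {1..N} s)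
    = (NI s. ennreal (s ^ (?d - 1) * F s) * indicator {0<..<1} s + ennreal (N ^ (?d - 1) * M) * indicator {1..N} s)"
    by (intro nn_integral_cong) (auto simp: F_def indicator_def)
   then show ?thesis by (subst (asm) (2) nn_integral_add) auto
  qed
  also have "(NI s. ennreal (s ^ (?d - 1) * F s) * indicator {0<..<1} s) =
    (\<integral>\<^sup>+ u\<in>{0<..<1}. ennreal (u ^ (?d - 1) * F0 u) \<partial>lborel)"
   by (intro nn_integral_cong) (auto simp: F_def indicator_def)
  also have "... + (NI s. ennreal (N ^ (?d - 1) * M) * indicator {1..N} s) < \<infinity>"
  proof -
   have "(NI s. ennreal (N ^ (?d - 1) * M) * indicator {1..N} s) = ennreal (N ^ (?d - 1) * M) * emeasure lborel {1..N}"
    by (rule nn_integral_cmult_indicator) simp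
   also have "... < \<infinity>" by (simp add: ennreal_mult_less_top emeasure_lborel_Icc_eq)
   finally show ?thesis using low by simp
  qed
  finally have "(NI s. ennreal (indicator {0<..N} s * (s ^ (DIM(real ^ 'n) - 1) * \<bar>F s\<bar>))) < \<infinity>" by simp
  then show ?thesis by (rule radial_integrable[OF F_measurable True])
 next
  case False
  have z: "indicator (cball 0 N) y * F (norm y) = 0" for y :: "real ^ 'n"
  proof (cases "norm y <= N")
   case True
   then have "norm y <= 0" using False by linarith
   then have "F (norm y) = 0" by (rule F_nonpos)
   then show ?thesis by (simp only: mult_zero_right)
  qed simp
  show ?thesis unfolding z by simp
 qed
 have gm: "gm_axioms TYPE(real ^ 'n) F V C"
 proof
  fix z :: real assume z: "z > 0"
  have "ennreal (V z (2 * z)) <= ennreal (C * F z)"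
   using dbl[OF z] tvV[of z "2 * z"] z pos[OF z] by (simp add: F_def)
  then show "V z (2 * z) <= C * F z" using C F0[of z] by (simp add: ennreal_le_iff)
 qed (use C pos int in \<open>auto simp: F_def\<close>)
 let ?a = "%n. tw (int n) powr ((real ?d - 1) / 2) * V (tw (int n)) (tw (int n + 1))"
 let ?S = "SUP N\<in>{1..}. variation_integral (%u. u powr ((real ?d - 1) / 2)) (%u. complex_of_real (F0 u)) 1 N"
 have V0: "V a b >= 0" for a b by (simp add: V_def)
 have "summable ?a"
 proof (rule summableI_nonneg_bounded)
  show "0 <= ?a n" for n using V0 by simp
  fix M
  have "ennreal (\<Sum>i<M. ?a i) = (\<Sum>i<M. ennreal (?a i))" using V0 by (intro sum_ennreal[symmetric]) simp
  also have "... <= (\<Sum>i<M. (INF u\<in>{tw (int i)..tw (int (Suc i))}. ennreal (u powr ((real ?d - 1) / 2))) * ?tv (tw (int i)) (tw (int (Suc i))))"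
  proof (rule sum_mono)
   fix i
   have le: "tw (int i) <= tw (int (Suc i))" by (intro tw_mono) simp
   \<comment> \<open>The weight is nondecreasing, so its infimum over the octave is attained at the
     left end.\<close>
   have "ennreal (tw (int i) powr ((real ?d - 1) / 2)) <= (INF u\<in>{tw (int i)..tw (int (Suc i))}. ennreal (u powr ((real ?d - 1) / 2)))"
    by (intro INF_greatest ennreal_leI powr_mono2) auto
   from mult_right_mono[OF this, of "?tv (tw (int i)) (tw (int (Suc i)))"]
   show "ennreal (?a i) <= (INF u\<in>{tw (int i)..tw (int (Suc i))}. ennreal (u powr ((real ?d - 1) / 2))) * ?tv (tw (int i)) (tw (int (Suc i)))"
    using V0 le by (simp add: tvV ennreal_mult add.commute)
  qed
  also have "... <= variation_integral (%u. u powr ((real ?d - 1) / 2)) (%u. complex_of_real (F0 u)) 1 (tw (int M))"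
  proof -
   have "(M, %i. tw (int i)) \<in> partitions 1 (tw (int M))" by (auto simp: partitions_def intro!: tw_mono)
   from SUP_upper[OF this, of "%(n, x). \<Sum>i<n. (INF u\<in>{x i..x (Suc i)}. ennreal (u powr ((real ?d - 1) / 2))) * ?tv (x i) (x (Suc i))"]
   show ?thesis by (simp add: variation_integral_def)
  qed
  also have "... <= ?S" using tw_mono[of 0 "int M"] by (intro SUP_upper) auto
  also have "... = ennreal (enn2real ?S)" using high by simp
  finally show "(\<Sum>i<M. ?a i) <= enn2real ?S" by simp
 qed
 then have "gm_tail_axioms TYPE(real ^ 'n) V" by unfold_locales simp
 then show ?thesis using gm bounded_var_axioms by (simp add: gm_tail_def gm_def)
qed

text \<open>This equals \<open>(2 * pi) powr - d\<close>: the constant of the Bessel form divided by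
  the constant that converts the radial integral into one over the space.\<close>

definition inversion_const :: "nat => real" where
 "inversion_const d = 1 / ((2 * sqrt pi) ^ d * pi powr (real d / 2))"

lemma inversion_const_pos [simp]: "inversion_const d > 0" "inversion_const d >= 0" "inversion_const d \<noteq> 0"
 by (simp_all add: inversion_const_def)

text \<open>Through the polar formula the Bessel integral becomes \<open>fN\<close> times a
  constant. As a limit of real numbers, \<open>f\<close> is real away from the origin.\<close>

lemma GM_hat_inversion:
 assumes f: "GM_hat C F0 (f :: real ^ 'n => complex)"
 defines "F \<equiv> %s. if s > 0 then F0 s else (0::real)"
 defines "g \<equiv> %x. Re (f x) / inversion_const CARD('n)"
 assumes x: "x \<noteq> 0"
 shows "((%N. gm.fN F N x) \<longlongrightarrow> g x) at_top" "f x = complex_of_real (inversion_const CARD('n) * g x)"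
proof -
 let ?d = "CARD('n)"
 interpret gm_tail F "%a b. enn2real (total_variation (%u. complex_of_real (F0 u)) a b)" C "TYPE(real ^ 'n)"
  unfolding F_def by (rule GM_hat_gm_tail[OF f])
 obtain f0 where f0: "!!x. f x = f0 (norm x)"
  "!!z. z > 0 ==> ((%N. complex_of_real
         (2 / (Gamma (real ?d / 2) * (2 * sqrt pi) ^ ?d) *
          (LBINT s:{0<..N}. F0 s * normalized_Bessel (real ?d / 2 - 1) (z * s) * s ^ (?d - 1))))
        \<longlongrightarrow> f0 z) at_top"
  using f by (auto simp: GM_hat_def)
 have z: "norm x > 0" using x by simp
 have d1: "real ?d >= 1" by simp
 have G: "Gamma (real ?d / 2) > 0" using d1 by (intro Gamma_real_pos) linarith
 have eq: "2 / (Gamma (real ?d / 2) * (2 * sqrt pi) ^ ?d) *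
   (LBINT s:{0<..N}. F0 s * normalized_Bessel (real ?d / 2 - 1) (norm x * s) * s ^ (?d - 1)) = inversion_const ?d * fN N x"
  if N: "N > 0" for N
 proof -
  have "fN N x = (RI s. indicator {0<..N} s * (F s * (2 * pi powr (real ?d / 2) * s ^ (?d - 1)
     * bess (real ?d / 2 - 1) ((s * norm x)\<^sup>2 / 4))))"
   using radial_cos_integral[OF F_measurable N F_int[of N], of x] by (simp add: fN_def)
  also have "... = (RI s. (2 * pi powr (real ?d / 2) / Gamma (real ?d / 2)) *
    (indicator {0<..N} s *\<^sub>R (F0 s * normalized_Bessel (real ?d / 2 - 1) (norm x * s) * s ^ (?d - 1))))"
  proof (intro Bochner_Integration.integral_cong refl)
   fix s :: real
   show "indicator {0<..N} s * (F s * (2 * pi powr (real ?d / 2) * s ^ (?d - 1)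
     * bess (real ?d / 2 - 1) ((s * norm x)\<^sup>2 / 4))) =
     (2 * pi powr (real ?d / 2) / Gamma (real ?d / 2)) *
    (indicator {0<..N} s *\<^sub>R (F0 s * normalized_Bessel (real ?d / 2 - 1) (norm x * s) * s ^ (?d - 1)))"
   proof (cases "0 < s \<and> s <= N")
    case True
    have B: "normalized_Bessel (real ?d / 2 - 1) (norm x * s) = Gamma (real ?d / 2) * bess (real ?d / 2 - 1) ((s * norm x)\<^sup>2 / 4)"
     using normalized_Bessel_bess[of "real ?d / 2 - 1" "norm x * s"] True z d1 by (simp add: mult.commute)
    have i: "indicator {0<..N} s = (1::real)" and Fs: "F s = F0 s" using True by (simp_all add: F_def)
    have alg: "v * (2 * P * u * w) = (2 * P / y) * (v * (y * w) * u)" if "y \<noteq> 0" for v P u w y :: real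
     using that by simp
    show ?thesis unfolding i Fs B mult_1_left real_scaleR_def by (rule alg[OF less_imp_neq[THEN not_sym, OF G]])
   qed auto
  qed
  also have "... = (2 * pi powr (real ?d / 2) / Gamma (real ?d / 2)) *
    (LBINT s:{0<..N}. F0 s * normalized_Bessel (real ?d / 2 - 1) (norm x * s) * s ^ (?d - 1))"
   unfolding set_lebesgue_integral_def by (rule integral_mult_right_zero)
  finally have H: "fN N x = (2 * pi powr (real ?d / 2) / Gamma (real ?d / 2)) *
    (LBINT s:{0<..N}. F0 s * normalized_Bessel (real ?d / 2 - 1) (norm x * s) * s ^ (?d - 1))" .
  have alg: "2 / (y * D) * I = 1 / (D * P) * (2 * P / y * I)" if "y > 0" "P > 0" "D > 0" for y P D I :: real
   using that by (simp add: field_simps)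
  show ?thesis unfolding H inversion_const_def by (rule alg[OF G]) simp_all
 qed
 have lim: "((%N. complex_of_real (inversion_const ?d * fN N x)) \<longlongrightarrow> f x) at_top"
  using f0(2)[OF z] unfolding f0(1)
  by (rule Lim_transform_eventually) (use eventually_gt_at_top[of 0] in \<open>eventually_elim, simp only: eq\<close>)
 have "((%N. Re (complex_of_real (inversion_const ?d * fN N x))) \<longlongrightarrow> Re (f x)) at_top"
  by (rule tendsto_Re[OF lim])
 then have re: "((%N. inversion_const ?d * fN N x) \<longlongrightarrow> Re (f x)) at_top" by simp
 from tendsto_divide[OF re tendsto_const[of "inversion_const ?d"]] inversion_const_pos(1)[of ?d]
 show "((%N. fN N x) \<longlongrightarrow> g x) at_top" by (simp add: g_def)
 have "((%N. complex_of_real (inversion_const ?d * fN N x)) \<longlongrightarrow> complex_of_real (Re (f x))) at_top"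
  by (rule tendsto_of_real[OF re])
 from tendsto_unique[OF trivial_limit_at_top_linorder this lim]
 have "f x = complex_of_real (Re (f x))" by (rule sym)
 moreover have "inversion_const ?d * g x = Re (f x)" by (simp add: g_def)
 ultimately show "f x = complex_of_real (inversion_const ?d * g x)" by (simp only:)
qed

section \<open>From the complex function to its real profile, and the equivalence of norms\<close>

lemma iterated_diff_cong:
 "(!!i. i <= k ==> f (x + real i *\<^sub>R h) = f' (x + real i *\<^sub>R h)) ==> iterated_diff k h f x = iterated_diff k h f' x"
proof (induction k arbitrary: x)
 case 0
 then show ?case using 0[of 0] by simp
next
 case (Suc k)
 have "iterated_diff k h f (x + h) = iterated_diff k h f' (x + h)"
 proof (rule Suc.IH)
  fix i assume "i <= k"
  then show "f (x + h + real i *\<^sub>R h) = f' (x + h + real i *\<^sub>R h)"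
   using Suc.prems[of "Suc i"] by (simp add: algebra_simps)
 qed
 moreover have "iterated_diff k h f x = iterated_diff k h f' x"
  using Suc.prems by (intro Suc.IH) simp
 ultimately show ?case by simp
qed

lemma iterated_diff_measurable:
 "f \<in> borel_measurable borel ==> iterated_diff k h f \<in> borel_measurable borel"
proof (induction k)
 case (Suc k)
 then have [measurable]: "iterated_diff k h f \<in> borel_measurable borel" by simp
 show ?case by simp
qed simp

lemma rdiff_borel_measurable:
 fixes g :: "'a::euclidean_space => real"
 shows "g \<in> borel_measurable borel ==> rdiff k h g \<in> borel_measurable borel"
proof (induction k)
 case (Suc k)
 then have [measurable]: "rdiff k h g \<in> borel_measurable borel" by simp
 show ?case by simp
qed simp

text \<open>Since \<open>f\<close> and \<open>kp * g\<close> may differ at the origin, their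
  differences agree off the finite set of points \<open>- (real i *\<^sub>R h)\<close>, which is a
  null set.\<close>

lemma Lp_norm_iterated_diff:
 fixes f :: "real ^ 'n => complex"
 assumes p: "p > 0" and g [measurable]: "g \<in> borel_measurable borel" and kp: "kp > 0"
  and f: "!!x. x \<noteq> 0 ==> f x = complex_of_real (kp * g x)"
 shows "Lp_norm p (iterated_diff k h f) =
  ennreal kp * (NI x. ennreal \<bar>rdiff k h g x\<bar> epowr p) epowr (1 / p)"
proof -
 have "(%x. if x = 0 then f 0 else complex_of_real (kp * g x)) = f" using f by auto
 moreover have "(%x. if x = 0 then f 0 else complex_of_real (kp * g x)) \<in> borel_measurable borel" by measurable
 ultimately have fm: "f \<in> borel_measurable borel" by simp
 have m [measurable]: "iterated_diff k h f \<in> borel_measurable borel" by (rule iterated_diff_measurable[OF fm])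
 have rm [measurable]: "rdiff k h g \<in> borel_measurable borel" by (rule rdiff_borel_measurable[OF g])
 have ml: "iterated_diff k h f \<in> borel_measurable lebesgue"
  using measurable_completion[of "iterated_diff k h f" lborel borel] by simp
 let ?B = "(%i. - (real i *\<^sub>R h)) ` {..k}"
 have "AE x in lborel. x \<notin> ?B"
  by (intro AE_not_in finite_imp_null_set_lborel) simp
 then have ae: "AE x in lborel. ennreal (norm (iterated_diff k h f x) powr p) = ennreal (kp powr p) * ennreal \<bar>rdiff k h g x\<bar> epowr p"
 proof eventually_elim
  case (elim x)
  have "iterated_diff k h f x = iterated_diff k h (%x. complex_of_real (kp * g x)) x"
  proof (intro iterated_diff_cong f)
   fix i assume i: "i <= k"
   show "x + real i *\<^sub>R h \<noteq> 0"
   proof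
    assume "x + real i *\<^sub>R h = 0"
    then have "x = - (real i *\<^sub>R h)" by (simp add: eq_neg_iff_add_eq_0)
    then show False using elim i by auto
   qed
  qed
  also have "... = complex_of_real (kp * rdiff k h g x)"
   using rdiff_linear[of k h kp g 0 g x] by (simp only: iterated_diff_of_real) simp
  finally show ?case using p kp by (simp add: norm_mult abs_mult powr_mult epowr_ennreal ennreal_mult)
 qed
 have "(\<integral>\<^sup>+x. ennreal (norm (iterated_diff k h f x) powr p) \<partial>lebesgue) = (NI x. ennreal (norm (iterated_diff k h f x) powr p))"
  by (intro nn_integral_completion) measurable
 also have "... = (NI x. ennreal (kp powr p) * ennreal \<bar>rdiff k h g x\<bar> epowr p)"
  by (rule nn_integral_cong_AE[OF ae])
 also have "... = ennreal (kp powr p) * (NI x. ennreal \<bar>rdiff k h g x\<bar> epowr p)"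
  by (rule nn_integral_cmult) measurable
 finally show ?thesis
  using p kp ml by (simp add: Lp_norm_def epowr_mult epowr_ennreal powr_powr)
qed

text \<open>Monotone convergence. The lower estimates reach only frequencies above a threshold,
  which is then lowered without bound.\<close>

lemma zsum_le_of_tails:
 assumes "!!M::nat. zsum (%n. if - int M <= n then f n else 0) <= B"
 shows "zsum f <= B"
proof -
 let ?g = "%M n. if - int M <= n then f n else 0"
 have "(SUP M. ?g M n) = f n" for n
 proof (rule antisym)
  show "f n <= (SUP M. ?g M n)" by (rule SUP_upper2[of "nat \<bar>n\<bar>"]) auto
  show "(SUP M. ?g M n) <= f n" by (rule SUP_least) simp
 qed
 then have "zsum f = (\<integral>\<^sup>+n. (SUP M. ?g M n) \<partial>count_space UNIV)" by (simp add: zsum_def)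
 also have "... = (SUP M. \<integral>\<^sup>+n. ?g M n \<partial>count_space UNIV)"
  by (intro nn_integral_monotone_convergence_SUP) (auto simp: incseq_def le_fun_def)
 also have "... <= B" using assms by (intro SUP_least) (simp add: zsum_def)
 finally show ?thesis .
qed

lemma int_norm_cong: "(!!t. t \<in> A ==> f t = g t) ==> int_norm q A f = int_norm q A g"
 unfolding int_norm_def by (auto intro!: SUP_cong nn_integral_cong arg_cong[where f = "%x. x epowr _"] simp: indicator_def)

lemma modulus_mono: "mono (modulus k p f)"
 unfolding modulus_def by (intro monoI SUP_subset_mono) auto

text \<open>Every hypothesis of \<open>discrete_equivalence\<close> is supplied by an estimate whose
  constant was fixed before \<open>f\<close>, so the final constant depends only on the parameters
  and \<open>C\<close>.\<close>

theorem besov_norm_equivalence: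
 fixes p s b C :: real and q :: ennreal and k :: nat
 assumes pd: "2 * real CARD('n) / (real CARD('n) + 1) < p"
  and q: "0 < q" and s: "0 <= s" "s < real k" and C: "1 < C"
 defines "e \<equiv> real CARD('n) * (1 - 1 / p)"
 obtains K where "K > 0"
  "!!(f :: real ^ 'n => complex) F0 I0 R1. GM_hat C F0 f ==>
   I0 = int_norm (ennreal p) {0<..<1} (%t. ennreal (t powr e * F0 t)) ==>
   R1 = (if s > 0 then int_norm q {1<..} (%t. ennreal (t powr (s + e) * (1 + ln t) powr b * F0 t))
    else int_norm q {1<..} (%t. ennreal ((1 + ln t) powr b) * int_norm (ennreal p) {t<..} (%u. ennreal (u powr e * F0 u)))) ==>
   besov_norm k s b p q f <= ennreal K * (I0 + R1) \<and> I0 + R1 <= ennreal K * besov_norm k s b p q f"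
proof -
 let ?d = "CARD('n)"
 have dim: "DIM(real ^ 'n) = ?d" by simp
 have d1: "real ?d >= 1" by simp
 have p: "p > 1" and pd': "real ?d / p < (real ?d + 1) / 2"
 proof -
  have "1 <= 2 * real ?d / (real ?d + 1)" using d1 by (simp add: field_simps)
  then show "p > 1" using pd by linarith
  then show "real ?d / p < (real ?d + 1) / 2" using pd d1 by (simp add: field_simps)
 qed
 have p0: "p > 0" using p by simp
 have pd'': "real DIM(real ^ 'n) / p < (real DIM(real ^ 'n) + 1) / 2" using pd' by simp
 \<comment> \<open>The instance with no differences controls the norm of the function itself; the
   same device is used for the lower bound.\<close>
 obtain U0 where U0: "U0 > 0"
  "!!F V h m g. gm TYPE(real ^ 'n) F V C ==>
   (!!x. x \<noteq> 0 ==> ((%N. gm.fN F N x) \<longlongrightarrow> g x) at_top) ==> g \<in> borel_measurable borel ==>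
   0 = (0::nat) \<or> norm (h::real ^ 'n) * tw m <= 1 ==>
   (NI x. ennreal \<bar>rdiff 0 h g x\<bar> epowr p) <=
    ennreal U0 * zsum (%n. ennreal ((min 1 (tw (n - m))) ^ 0 * cseq DIM(real ^ 'n) F p n) epowr p)"
  apply (rule gm_upper[OF p0 pd'', where k = 0 and C = C])
  subgoal premises prems for K by (rule that[OF prems(2)], rule prems(3); assumption)
  done
 obtain U where U: "U > 0"
  "!!F V h m g. gm TYPE(real ^ 'n) F V C ==>
   (!!x. x \<noteq> 0 ==> ((%N. gm.fN F N x) \<longlongrightarrow> g x) at_top) ==> g \<in> borel_measurable borel ==>
   k = 0 \<or> norm (h::real ^ 'n) * tw m <= 1 ==>
   (NI x. ennreal \<bar>rdiff k h g x\<bar> epowr p) <=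
    ennreal U * zsum (%n. ennreal ((min 1 (tw (n - m))) ^ k * cseq DIM(real ^ 'n) F p n) epowr p)"
  apply (rule gm_upper[OF p0 pd'', where k = k and C = C])
  subgoal premises prems for K by (rule that[OF prems(2)], rule prems(3); assumption)
  done
 obtain L0 R0 where L0: "L0 > 0" "R0 > 0"
  "!!F V g t D. gm_Lp F V C (g :: real ^ 'n => real) p ==> t > 0 ==>
   (!!h::real ^ 'n. norm h <= t ==> (NI x. ennreal \<bar>rdiff 0 h g x\<bar> epowr p) <= D) ==>
   zsum (%n. if R0 <= tw (n - 1) * t then ennreal (cseq DIM(real ^ 'n) F p n) epowr p else 0) <= ennreal L0 * D"
  apply (rule gm_lower[OF p, where k = 0 and C = C and ?'a = "real ^ 'n"])
  subgoal premises prems for K R by (rule that[OF prems(2,3)], rule prems(4); assumption)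
  done
 obtain L R where L: "L > 0" "R > 0"
  "!!F V g t D. gm_Lp F V C (g :: real ^ 'n => real) p ==> t > 0 ==>
   (!!h::real ^ 'n. norm h <= t ==> (NI x. ennreal \<bar>rdiff k h g x\<bar> epowr p) <= D) ==>
   zsum (%n. if R <= tw (n - 1) * t then ennreal (cseq DIM(real ^ 'n) F p n) epowr p else 0) <= ennreal L * D"
  apply (rule gm_lower[OF p, where k = k and C = C and ?'a = "real ^ 'n"])
  subgoal premises prems for K R by (rule that[OF prems(2,3)], rule prems(4); assumption)
  done
 obtain M where M: "M > 0"
  "!!\<omega> :: real => ennreal. mono \<omega> ==> int_norm q {0<..<1} (%t. ennreal (t powr (- s) * (1 - ln t) powr b) * \<omega> t)
    <= ennreal M * seq_norm q (%m. ennreal (lam s b m) * \<omega> (tw (- int m)))"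
  "!!\<omega> :: real => ennreal. mono \<omega> ==> seq_norm q (%m. ennreal (lam s b m) * \<omega> (tw (- int (Suc m))))
    <= ennreal M * int_norm q {0<..<1} (%t. ennreal (t powr (- s) * (1 - ln t) powr b) * \<omega> t)"
  apply (rule modulus_integral_discrete[OF q s(1), where b = b])
  subgoal premises prems for K by (rule that[OF prems(2)]; erule prems(3-))
  done
 obtain J where J: "J > 0"
  "!!F V. gm TYPE(real ^ 'n) F V C ==> int_norm (ennreal p) {0<..<1} (%t. ennreal (t powr e * F t)) <= ennreal J * low_norm p (cseq ?d F p)"
  "!!F V. gm TYPE(real ^ 'n) F V C ==> low_norm p (cseq ?d F p) <= ennreal J * int_norm (ennreal p) {0<..<1} (%t. ennreal (t powr e * F t))"
  "!!F V. gm TYPE(real ^ 'n) F V C ==> int_norm q {1<..} (%t. ennreal (t powr (s + e) * (1 + ln t) powr b * F t))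
    <= ennreal J * seq_norm q (%m. ennreal (lam s b m) * ennreal (cseq ?d F p (int m)))"
  "!!F V. gm TYPE(real ^ 'n) F V C ==> seq_norm q (%m. ennreal (lam s b m) * ennreal (cseq ?d F p (int (m + 1))))
    <= ennreal J * int_norm q {1<..} (%t. ennreal (t powr (s + e) * (1 + ln t) powr b * F t))"
  "!!F V. gm TYPE(real ^ 'n) F V C ==> int_norm q {1<..} (%t. ennreal ((1 + ln t) powr b) * int_norm (ennreal p) {t<..} (%u. ennreal (u powr e * F u)))
    <= ennreal J * seq_norm q (%m. ennreal (lam 0 b m) * tail_norm p (cseq ?d F p) (int m))"
  "!!F V. gm TYPE(real ^ 'n) F V C ==> seq_norm q (%m. ennreal (lam 0 b m) * tail_norm p (cseq ?d F p) (int (m + 2)))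
    <= ennreal J * int_norm q {1<..} (%t. ennreal ((1 + ln t) powr b) * int_norm (ennreal p) {t<..} (%u. ennreal (u powr e * F u)))"
  apply (rule gm_integrals_discrete[OF p q s(1) C, where b = b and ?'a = "real ^ 'n", unfolded dim, folded e_def])
  subgoal premises prems for K by (rule that[OF prems(2)]; erule prems(3-))
  done
 define kp where "kp = inversion_const ?d"
 have kp: "kp > 0" by (simp add: kp_def)
 define k1 where "k1 = 2 powr e * (1 + C)"
 define k2 where "k2 = kp * U0 powr (1 / p)"
 define k3 where "k3 = kp * U powr (1 / p)"
 define k4 where "k4 = L0 powr (1 / p) / kp"
 define k5 where "k5 = L powr (1 / p) / kp"
 have k: "k1 >= 0" "k2 >= 0" "k3 >= 0" "k4 >= 0" "k5 >= 0"
  using C kp by (simp_all add: k1_def k2_def k3_def k4_def k5_def)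
 \<comment> \<open>A single constant dominating all the others, as the discrete argument takes only
   one.\<close>
 define K0 where "K0 = k1 + k2 + k3 + k4 + k5 + M + J"
 have le: "k1 <= K0" "k2 <= K0" "k3 <= K0" "k4 <= K0" "k5 <= K0" "M <= K0" "J <= K0"
  unfolding K0_def using k M(1) J(1) by linarith+
 note K0 = le[unfolded k1_def k2_def k3_def k4_def k5_def]
 have K0p: "K0 > 0" using K0(6) M(1) by linarith
 \<comment> \<open>Hence \<open>tw (n - 1) * tw (- m) >= R\<close> as soon as
   \<open>n >= m + m1 + 1\<close>, which is the number \<open>m0\<close> of octaves lost.\<close>
 obtain m1 :: nat where m1: "R < 2 ^ m1" using real_arch_pow[of 2 R] by auto
 define m0 where "m0 = Suc m1"
 define N where "N = (if s > 0 then 1 else 2 :: nat)"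
 obtain K where K: "K > 0"
  "!!(c :: int => real) A Lp om BI I0 R1. (!!n. c n >= 0) ==> c 1 <= K0 * c 0 ==>
   A = (%m::nat. if s > 0 then ennreal (c (int m)) else tail_norm p c (int m)) ==>
   Lp <= ennreal K0 * zsum (%n. ennreal (c n) epowr p) epowr (1 / p) ==>
   zsum (%n. ennreal (c n) epowr p) epowr (1 / p) <= ennreal K0 * Lp ==>
   (!!m. om m <= ennreal K0 * zsum (%n. ennreal ((min 1 (tw (n - int m))) ^ k * c n) epowr p) epowr (1 / p)) ==>
   (!!m. Lp < \<infinity> ==> tail_norm p c (int (m + m0)) <= ennreal K0 * om m) ==>
   BI <= ennreal K0 * seq_norm q (%m. ennreal (lam s b m) * om m) ==>
   seq_norm q (%m. ennreal (lam s b m) * om (Suc m)) <= ennreal K0 * BI ==>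
   I0 <= ennreal K0 * low_norm p c ==> low_norm p c <= ennreal K0 * I0 ==>
   R1 <= ennreal K0 * seq_norm q (%m. ennreal (lam s b m) * A m) ==>
   seq_norm q (%m. ennreal (lam s b m) * A (m + N)) <= ennreal K0 * R1 ==>
   Lp + BI <= ennreal K * (I0 + R1) \<and> I0 + R1 <= ennreal K * (Lp + BI)"
  apply (rule discrete_equivalence[OF q s p0 K0p N_def, where b = b and M = m0])
  subgoal premises prems for K by (rule that[OF prems(2)], rule prems(3); assumption)
  done
 show thesis
 proof (rule that[OF K(1)])
  fix f :: "real ^ 'n => complex" and F0 I0 R1
  assume f: "GM_hat C F0 f"
   and I0: "I0 = int_norm (ennreal p) {0<..<1} (%t. ennreal (t powr e * F0 t))"
   and R1: "R1 = (if s > 0 then int_norm q {1<..} (%t. ennreal (t powr (s + e) * (1 + ln t) powr b * F0 t))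
    else int_norm q {1<..} (%t. ennreal ((1 + ln t) powr b) * int_norm (ennreal p) {t<..} (%u. ennreal (u powr e * F0 u))))"
  define F where "F s = (if s > 0 then F0 s else (0::real))" for s
  define V where "V a b = enn2real (total_variation (%u. complex_of_real (F0 u)) a b)" for a b
  have gt: "gm_tail TYPE(real ^ 'n) F V C"
   using GM_hat_gm_tail[OF f] unfolding F_def[abs_def] V_def[abs_def] .
  interpret gm_tail F V C "TYPE(real ^ 'n)" by (rule gt)
  have gm: "gm TYPE(real ^ 'n) F V C" by (rule gm_axioms)
  \<comment> \<open>The unconstrained value at the origin is replaced by 0, which makes
    \<open>g\<close> an everywhere limit of measurable functions.\<close>
  define g where "g x = (if x = 0 then 0 else Re (f x) / kp)" for x
  have lim: "((%N. fN N x) \<longlongrightarrow> g x) at_top" and fg: "f x = complex_of_real (kp * g x)" if "x \<noteq> 0" for x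
   using GM_hat_inversion[OF f that] that by (simp_all add: g_def kp_def F_def[abs_def])
  have gmeas [measurable]: "g \<in> borel_measurable borel"
  proof (rule borel_measurable_LIMSEQ_real)
   show "(%j. if x = 0 then 0 else fN (real j) x) \<longlonglongrightarrow> g x" for x
    using filterlim_compose[OF lim filterlim_real_sequentially, of x] by (cases "x = 0") (auto simp: g_def)
   show "(%x. if x = 0 then 0 else fN (real j) x) \<in> borel_measurable borel" for j by measurable
  qed
  define c where "c = cseq ?d F p"
  have c0: "c n >= 0" for n using F_nonneg by (simp add: c_def cseq_def)
  define D where "D j h = (NI x. ennreal \<bar>rdiff j h g x\<bar> epowr p)" for j h
  have Lp_eq: "Lp_norm p (iterated_diff j h f) = ennreal kp * D j h epowr (1 / p)" for j h
   unfolding D_def by (rule Lp_norm_iterated_diff[OF p0 gmeas kp fg])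
  have D_eq: "D j h = (ennreal (1 / kp) * Lp_norm p (iterated_diff j h f)) epowr p" for j h
  proof -
   have "ennreal (1 / kp) * (ennreal kp * D j h epowr (1 / p)) = D j h epowr (1 / p)"
    using kp by (simp add: mult.assoc[symmetric] ennreal_mult[symmetric])
   then show ?thesis using p0 by (simp add: Lp_eq epowr_inverse)
  qed
  define om where "om m = modulus k p f (tw (- int m))" for m
  define BI where "BI = int_norm q {0<..<1} (%t. ennreal (t powr (- s) * (1 - ln t) powr b) * modulus k p f t)"
  have besov: "besov_norm k s b p q f = Lp_norm p f + BI"
   by (simp add: besov_norm_def BI_def int_norm_def)
  let ?Z = "zsum (%n. ennreal (c n) epowr p)"
  have root: "X epowr (1 / p) <= ennreal (a powr (1 / p)) * Y epowr (1 / p)" if "X <= ennreal a * Y" "a > 0" for X Y a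
  proof -
   have "X epowr (1 / p) <= (ennreal a * Y) epowr (1 / p)" using that p0 by (intro epowr_mono) auto
   then show ?thesis using that p0 by (simp add: epowr_mult epowr_ennreal)
  qed
  have Lp0: "Lp_norm p f = ennreal kp * D 0 0 epowr (1 / p)" using Lp_eq[of 0 0] by simp
  have F_eq: "F t = F0 t" if "t > 0" for t using that by (simp add: F_def)
  have I0': "I0 = int_norm (ennreal p) {0<..<1} (%t. ennreal (t powr e * F t))"
   unfolding I0 by (rule int_norm_cong) (simp add: F_eq)
  define A where "A = (%m::nat. if s > 0 then ennreal (c (int m)) else tail_norm p c (int m))"
  show "besov_norm k s b p q f <= ennreal K * (I0 + R1) \<and> I0 + R1 <= ennreal K * besov_norm k s b p q f"
   unfolding besov
  proof (rule K(2)[OF c0 _ A_def])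
   have "c (0 + 1) <= (2 powr e * (1 + C)) * (1 powr e * F 1)"
    using gm_dyadic(2)[OF gm p, of 0 1] by (simp add: c_def e_def tw_def)
   also have "1 powr e * F 1 = c 0" by (simp add: c_def cseq_def)
   also have "(2 powr e * (1 + C)) * c 0 <= K0 * c 0" by (intro mult_right_mono K0 c0)
   finally show "c 1 <= K0 * c 0" by simp
  next
   have "D 0 0 <= ennreal U0 * ?Z"
    using U0(2)[OF gm lim gmeas, of 0 0] unfolding D_def c_def dim by simp
   from mult_left_mono[OF root[OF this U0(1)], of "ennreal kp"]
   have "Lp_norm p f <= ennreal (kp * U0 powr (1 / p)) * ?Z epowr (1 / p)"
    using kp U0 unfolding Lp0 by (simp add: ennreal_mult mult.assoc)
   then show "Lp_norm p f <= ennreal K0 * ?Z epowr (1 / p)" using K0(2) by (rule dominated_weaken)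
  next
   show "?Z epowr (1 / p) <= ennreal K0 * Lp_norm p f"
   proof (cases "Lp_norm p f < \<infinity>")
    case False
    then have "Lp_norm p f = top" by (simp add: less_top[symmetric])
    then show ?thesis using K0p by (simp add: ennreal_mult_top)
   next
    case True
    have "D 0 0 < \<infinity>"
     using True D_eq[of 0 0] kp by (simp add: epowr_def ennreal_mult_less_top less_top)
    then interpret gm_Lp F V C "TYPE(real ^ 'n)" g p
     using p lim by unfold_locales (auto simp: D_def)
    have loc: "gm_Lp F V C g p" by unfold_locales
    have "?Z <= ennreal L0 * D 0 0"
    proof (rule zsum_le_of_tails)
     fix j :: nat
     \<comment> \<open>With no differences the bound \<open>D 0 0\<close> does not depend on the
       step, so \<open>t\<close> may be taken large enough to reach all
       \<open>n >= - j\<close>.\<close>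
     define t where "t = R0 / tw (- int j - 1)"
     have t: "t > 0" using L0(2) by (simp add: t_def)
     have R0t: "R0 <= tw (n - 1) * t" if "- int j <= n" for n
     proof -
      have "R0 = tw (- int j - 1) * t" by (simp add: t_def)
      also have "... <= tw (n - 1) * t" using that t by (intro mult_right_mono tw_mono) auto
      finally show ?thesis .
     qed
     have "zsum (%n. if - int j <= n then ennreal (c n) epowr p else 0) <=
       zsum (%n. if R0 <= tw (n - 1) * t then ennreal (c n) epowr p else 0)"
      using R0t by (intro zsum_mono) auto
     also have "... <= ennreal L0 * D 0 0"
      using L0(3)[OF loc t, of "D 0 0"] unfolding c_def D_def dim by simp
     finally show "zsum (%n. if - int j <= n then ennreal (c n) epowr p else 0) <= ennreal L0 * D 0 0" .
    qed
    from root[OF this L0(1)] have "?Z epowr (1 / p) <= ennreal (L0 powr (1 / p)) * D 0 0 epowr (1 / p)" .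
    moreover have "D 0 0 epowr (1 / p) = ennreal (1 / kp) * Lp_norm p f"
     using D_eq[of 0 0] p0 by (simp add: epowr_inverse)
    ultimately have "?Z epowr (1 / p) <= ennreal (L0 powr (1 / p) / kp) * Lp_norm p f"
     using kp dominated_trans[of _ "L0 powr (1 / p)" _ "1 / kp" "Lp_norm p f"] by simp
    then show ?thesis using K0(4) by (rule dominated_weaken)
   qed
  next
   fix m :: nat
   let ?W = "zsum (%n. ennreal ((min 1 (tw (n - int m))) ^ k * c n) epowr p)"
   have "Lp_norm p (iterated_diff k h f) <= ennreal (kp * U powr (1 / p)) * ?W epowr (1 / p)" if h: "norm h <= tw (- int m)" for h
   proof -
    have "norm h * tw (int m) <= tw (- int m) * tw (int m)" using h by (intro mult_right_mono) auto
    then have "norm h * tw (int m) <= 1" by (simp add: tw_add[symmetric])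
    then have "D k h <= ennreal U * ?W"
     using U(2)[OF gm lim gmeas, of h "int m"] unfolding D_def c_def dim by simp
    from mult_left_mono[OF root[OF this U(1)], of "ennreal kp"]
    show ?thesis using kp U unfolding Lp_eq by (simp add: ennreal_mult mult.assoc)
   qed
   then have "om m <= ennreal (kp * U powr (1 / p)) * ?W epowr (1 / p)"
    unfolding om_def modulus_def by (intro SUP_least) auto
   then show "om m <= ennreal K0 * ?W epowr (1 / p)" using K0(3) by (rule dominated_weaken)
  next
   fix m :: nat
   assume fin: "Lp_norm p f < \<infinity>"
   have "D 0 0 < \<infinity>"
    using fin D_eq[of 0 0] kp by (simp add: epowr_def ennreal_mult_less_top less_top)
   then interpret gm_Lp F V C "TYPE(real ^ 'n)" g p
    using p lim by unfold_locales (auto simp: D_def)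
   have loc: "gm_Lp F V C g p" by unfold_locales
   let ?B = "(ennreal (1 / kp) * om m) epowr p"
   have Dk: "D k h <= ?B" if "norm h <= tw (- int m)" for h
    unfolding D_eq om_def modulus_def using that p0 by (intro epowr_mono mult_left_mono SUP_upper) auto
   have R: "R <= tw (n - 1) * tw (- int m)" if "int (m + m0) <= n" for n
   proof -
    have "R <= tw (int m1)" using m1 by (simp add: tw_nat)
    also have "... <= tw ((n - 1) + - int m)" using that by (intro tw_mono) (simp add: m0_def)
    finally show ?thesis by (simp only: tw_add)
   qed
   have "(\<Sum>i. ennreal (c (int (m + m0) + int i)) epowr p) = zsum (%n. if int (m + m0) <= n then ennreal (c n) epowr p else 0)"
    by (rule zsum_tail[symmetric])
   also have "... <= zsum (%n. if R <= tw (n - 1) * tw (- int m) then ennreal (c n) epowr p else 0)"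
    using R by (intro zsum_mono) auto
   also have "... <= ennreal L * ?B"
    using L(3)[OF loc tw_pos(1), of "- int m" ?B] Dk unfolding D_def c_def dim by blast
   finally have "tail_norm p c (int (m + m0)) <= ennreal (L powr (1 / p)) * ?B epowr (1 / p)"
    unfolding tail_norm_def seq_norm_real[OF p0] by (rule root[OF _ L(1)])
   also have "?B epowr (1 / p) = ennreal (1 / kp) * om m" using p0 by (simp add: epowr_inverse)
   finally have "tail_norm p c (int (m + m0)) <= ennreal (L powr (1 / p) / kp) * om m"
    using kp dominated_trans[of _ "L powr (1 / p)" _ "1 / kp" "om m"] by simp
   then show "tail_norm p c (int (m + m0)) <= ennreal K0 * om m" using K0(5) by (rule dominated_weaken)
  next
   show "BI <= ennreal K0 * seq_norm q (%m. ennreal (lam s b m) * om m)"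
    using dominated_weaken[OF M(2)[OF modulus_mono] K0(6)] unfolding BI_def om_def .
   show "seq_norm q (%m. ennreal (lam s b m) * om (Suc m)) <= ennreal K0 * BI"
    using dominated_weaken[OF M(3)[OF modulus_mono] K0(6)] unfolding BI_def om_def .
   show "I0 <= ennreal K0 * low_norm p c" "low_norm p c <= ennreal K0 * I0"
    using dominated_weaken[OF J(2)[OF gm] K0(7)] dominated_weaken[OF J(3)[OF gm] K0(7)] unfolding I0' c_def .
   show "R1 <= ennreal K0 * seq_norm q (%m. ennreal (lam s b m) * A m)"
    "seq_norm q (%m. ennreal (lam s b m) * A (m + N)) <= ennreal K0 * R1"
   proof -
    have "R1 <= ennreal K0 * seq_norm q (%m. ennreal (lam s b m) * A m) \<and>
     seq_norm q (%m. ennreal (lam s b m) * A (m + N)) <= ennreal K0 * R1"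
    proof (cases "s > 0")
     case True
     have "R1 = int_norm q {1<..} (%t. ennreal (t powr (s + e) * (1 + ln t) powr b * F t))"
      unfolding R1 if_P[OF True] by (rule int_norm_cong) (simp add: F_eq)
     then show ?thesis
      using True dominated_weaken[OF J(4)[OF gm] K0(7)] dominated_weaken[OF J(5)[OF gm] K0(7)]
      by (simp add: A_def N_def c_def)
    next
     case False
     then have s0: "s = 0" using s by simp
     have in_eq: "int_norm (ennreal p) {t<..} (%u. ennreal (u powr e * F0 u)) = int_norm (ennreal p) {t<..} (%u. ennreal (u powr e * F u))"
      if "t \<in> {1<..}" for t
      using that by (intro int_norm_cong) (simp add: F_eq)
     have "R1 = int_norm q {1<..} (%t. ennreal ((1 + ln t) powr b) * int_norm (ennreal p) {t<..} (%u. ennreal (u powr e * F u)))"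
      unfolding R1 if_not_P[OF False] by (rule int_norm_cong) (simp only: in_eq)
     then show ?thesis
      using s0 dominated_weaken[OF J(6)[OF gm] K0(7)] dominated_weaken[OF J(7)[OF gm] K0(7)]
      by (simp add: A_def N_def c_def)
    qed
    then show "R1 <= ennreal K0 * seq_norm q (%m. ennreal (lam s b m) * A m)"
     "seq_norm q (%m. ennreal (lam s b m) * A (m + N)) <= ennreal K0 * R1" by auto
   qed
  qed
 qed
qed

section \<open>Rewriting the norms in the form of the statement\<close>

lemma comparableI:
 assumes K: "K > 0" and A: "A <= ennreal K * B" and B: "B <= ennreal K * A"
 shows "comparable K A B"
proof -
 have "ennreal (1 / K) * B <= ennreal (1 / K) * (ennreal K * A)" by (intro mult_left_mono B) simp
 also have "... = ennreal (1 / K * K) * A" using K by (subst ennreal_mult) (auto simp: mult.assoc)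
 also have "... = A" using K by simp
 finally show ?thesis using A by (simp add: comparable_def)
qed

text \<open>The identity \<open>d * (1 - 1 / p) * p - 1 = d * p - d - 1\<close> of exponents; the
  \<open>- 1\<close> is the density of \<open>dt / t\<close>.\<close>

lemma int_norm_low_eq:
 assumes p: "p > 1" and A: "A \<subseteq> {0<..}" and F0: "!!u. u > 0 ==> F0 u > 0"
 shows "(\<integral>\<^sup>+ t\<in>A. ennreal (t powr (d * p - d - 1) * F0 t powr p) \<partial>lborel) epowr (1 / p) =
  int_norm (ennreal p) A (%t. ennreal (t powr (d * (1 - 1 / p)) * F0 t))"
proof -
 have "(\<integral>\<^sup>+ t\<in>A. ennreal (t powr (d * p - d - 1) * F0 t powr p) \<partial>lborel) =
   (\<integral>\<^sup>+ t\<in>A. ennreal (t powr (d * (1 - 1 / p)) * F0 t) epowr p * ennreal (1 / t) \<partial>lborel)"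
 proof (rule nn_integral_cong)
  fix t
  show "ennreal (t powr (d * p - d - 1) * F0 t powr p) * indicator A t =
    ennreal (t powr (d * (1 - 1 / p)) * F0 t) epowr p * ennreal (1 / t) * indicator A t"
  proof (cases "t \<in> A")
   case True
   then have t: "t > 0" "F0 t > 0" using A F0 by auto
   have e: "d * (1 - 1 / p) * p - 1 = d * p - d - 1" using p by (simp add: field_simps)
   have nn: "0 <= t powr (d * (1 - 1 / p)) * F0 t" using t by simp
   have "ennreal (t powr (d * (1 - 1 / p)) * F0 t) epowr p * ennreal (1 / t) =
     ennreal ((t powr (d * (1 - 1 / p)) * F0 t) powr p * (1 / t))"
    unfolding epowr_ennreal[OF nn] by (rule ennreal_mult[symmetric]) (use t in simp_all)
   also have "(t powr (d * (1 - 1 / p)) * F0 t) powr p * (1 / t) = t powr (d * (1 - 1 / p) * p - 1) * F0 t powr p"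
    using t by (simp only: powr_diff powr_mult powr_powr powr_ge_zero less_imp_le) simp
   finally show ?thesis unfolding e by simp
  qed simp
 qed
 then show ?thesis using p by (simp add: int_norm_def)
qed

lemma int_norm_high_eq:
 assumes q: "0 < q" "q \<noteq> \<infinity>" and F0: "!!u. u > 0 ==> F0 u > 0"
 shows "(\<integral>\<^sup>+ t\<in>{1<..}. ennreal (t powr (s * enn2real q + d * enn2real q - d * enn2real q / p - 1)
   * (1 + ln t) powr (b * enn2real q) * F0 t powr enn2real q) \<partial>lborel) epowr (1 / enn2real q) =
  int_norm q {1<..} (%t. ennreal (t powr (s + d * (1 - 1 / p)) * (1 + ln t) powr b * F0 t))"
proof -
 define r where "r = enn2real q"
 have "(\<integral>\<^sup>+ t\<in>{1<..}. ennreal (t powr (s * r + d * r - d * r / p - 1) * (1 + ln t) powr (b * r) * F0 t powr r) \<partial>lborel) =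
   (\<integral>\<^sup>+ t\<in>{1<..}. ennreal (t powr (s + d * (1 - 1 / p)) * (1 + ln t) powr b * F0 t) epowr r * ennreal (1 / t) \<partial>lborel)"
 proof (rule nn_integral_cong)
  fix t :: real
  show "ennreal (t powr (s * r + d * r - d * r / p - 1) * (1 + ln t) powr (b * r) * F0 t powr r) * indicator {1<..} t =
    ennreal (t powr (s + d * (1 - 1 / p)) * (1 + ln t) powr b * F0 t) epowr r * ennreal (1 / t) * indicator {1<..} t"
  proof (cases "t > 1")
   case True
   then have t: "t > 0" "F0 t > 0" using F0 by auto
   have e: "(s + d * (1 - 1 / p)) * r - 1 = s * r + d * r - d * r / p - 1" by (simp add: algebra_simps)
   have nn: "0 <= t powr (s + d * (1 - 1 / p)) * (1 + ln t) powr b * F0 t" using t by simp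
   have "ennreal (t powr (s + d * (1 - 1 / p)) * (1 + ln t) powr b * F0 t) epowr r * ennreal (1 / t) =
     ennreal ((t powr (s + d * (1 - 1 / p)) * (1 + ln t) powr b * F0 t) powr r * (1 / t))"
    unfolding epowr_ennreal[OF nn] by (rule ennreal_mult[symmetric]) (use t in simp_all)
   also have "(t powr (s + d * (1 - 1 / p)) * (1 + ln t) powr b * F0 t) powr r * (1 / t) =
     t powr ((s + d * (1 - 1 / p)) * r - 1) * (1 + ln t) powr (b * r) * F0 t powr r"
    using t by (simp only: powr_diff powr_mult powr_powr powr_ge_zero less_imp_le mult_nonneg_nonneg) simp
   finally show ?thesis unfolding e by simp
  qed simp
 qed
 then show ?thesis unfolding int_norm_def if_not_P[OF q(2)] r_def by (simp only:)
qed

theorem theorem4p2: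
  fixes p s b C :: real and q :: ennreal and k :: nat
  assumes "2 * real CARD('n) / (real CARD('n) + 1) < p"
    and "0 < q" and "0 \<le> s" and "s < real k" and "1 < C"
  shows
    "let d = real CARD('n); r = enn2real q in
      (0 < s \<and> q < \<infinity> \<longrightarrow>
        (\<exists>c>0. \<forall>(f :: real ^ 'n \<Rightarrow> complex) F\<^sub>0. GM_hat C F\<^sub>0 f \<longrightarrow>
          comparable c (besov_norm k s b p q f)
            ((\<integral>\<^sup>+ t\<in>{0<..<1}. ennreal (t powr (d * p - d - 1) * F\<^sub>0 t powr p) \<partial>lborel) epowr (1 / p)
             + (\<integral>\<^sup>+ t\<in>{1<..}. ennreal (t powr (s * r + d * r - d * r / p - 1)
                    * (1 + ln t) powr (b * r) * F\<^sub>0 t powr r) \<partial>lborel) epowr (1 / r)))) \<and>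
      (0 < s \<and> q = \<infinity> \<longrightarrow>
        (\<exists>c>0. \<forall>(f :: real ^ 'n \<Rightarrow> complex) F\<^sub>0. GM_hat C F\<^sub>0 f \<longrightarrow>
          comparable c (besov_norm k s b p q f)
            ((\<integral>\<^sup>+ t\<in>{0<..<1}. ennreal (t powr (d * p - d - 1) * F\<^sub>0 t powr p) \<partial>lborel) epowr (1 / p)
             + (SUP t\<in>{1<..}. ennreal (t powr (s + d - d / p) * (1 + ln t) powr b * F\<^sub>0 t))))) \<and>
      (s = 0 \<and> q < \<infinity> \<longrightarrow>
        (\<exists>c>0. \<forall>(f :: real ^ 'n \<Rightarrow> complex) F\<^sub>0. GM_hat C F\<^sub>0 f \<longrightarrow>
          comparable c (besov_norm k s b p q f)
            ((\<integral>\<^sup>+ t\<in>{0<..<1}. ennreal (t powr (d * p - d - 1) * F\<^sub>0 t powr p) \<partial>lborel) epowr (1 / p)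
             + (\<integral>\<^sup>+ t\<in>{1<..}. (ennreal ((1 + ln t) powr b)
                    * (\<integral>\<^sup>+ u\<in>{t<..}. ennreal (u powr (d * p - d - 1) * F\<^sub>0 u powr p) \<partial>lborel)
                        epowr (1 / p)) epowr r * ennreal (1 / t) \<partial>lborel) epowr (1 / r)))) \<and>
      (s = 0 \<and> q = \<infinity> \<longrightarrow>
        (\<exists>c>0. \<forall>(f :: real ^ 'n \<Rightarrow> complex) F\<^sub>0. GM_hat C F\<^sub>0 f \<longrightarrow>
          comparable c (besov_norm k s b p q f)
            ((\<integral>\<^sup>+ t\<in>{0<..<1}. ennreal (t powr (d * p - d - 1) * F\<^sub>0 t powr p) \<partial>lborel) epowr (1 / p)
             + (SUP t\<in>{1<..}. ennreal ((1 + ln t) powr b)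
                    * (\<integral>\<^sup>+ u\<in>{t<..}. ennreal (u powr (d * p - d - 1) * F\<^sub>0 u powr p) \<partial>lborel)
                        epowr (1 / p)))))"
proof -
 let ?d = "real CARD('n)"
 define e where "e = ?d * (1 - 1 / p)"
 have d1: "?d >= 1" by simp
 have "1 <= 2 * ?d / (?d + 1)" using d1 by (simp add: field_simps)
 then have p: "p > 1" using assms(1) by linarith
 define J where "J F\<^sub>0 = int_norm (ennreal p) {0<..<1} (%t. ennreal (t powr e * F\<^sub>0 t))" for F\<^sub>0
 define H where "H F\<^sub>0 = int_norm q {1<..} (%t. ennreal (t powr (s + e) * (1 + ln t) powr b * F\<^sub>0 t))" for F\<^sub>0
 define H0 where "H0 F\<^sub>0 = int_norm q {1<..} (%t. ennreal ((1 + ln t) powr b) * int_norm (ennreal p) {t<..} (%u. ennreal (u powr e * F\<^sub>0 u)))" for F\<^sub>0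
 obtain c where c: "c > 0"
  "!!(f :: real ^ 'n => complex) F\<^sub>0 I0 R1. GM_hat C F\<^sub>0 f ==> I0 = J F\<^sub>0 ==> R1 = (if s > 0 then H F\<^sub>0 else H0 F\<^sub>0) ==>
   besov_norm k s b p q f <= ennreal c * (I0 + R1) \<and> I0 + R1 <= ennreal c * besov_norm k s b p q f"
  apply (rule besov_norm_equivalence[OF assms(1-5), where b = b, folded e_def, folded J_def H_def H0_def])
  subgoal premises prems for K by (rule that[OF prems(2)], rule prems(3); assumption)
  done
 have pos: "!!u. u > 0 ==> F\<^sub>0 u > 0" if "GM_hat C F\<^sub>0 f" for F\<^sub>0 and f :: "real ^ 'n => complex"
  using that unfolding GM_hat_def by blast
 have c1: "comparable c (besov_norm k s b p q f) (J F\<^sub>0 + H F\<^sub>0)" if "GM_hat C F\<^sub>0 f" "0 < s" for F\<^sub>0 and f :: "real ^ 'n => complex"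
  using c(2)[OF that(1) refl refl] unfolding if_P[OF that(2)] by (intro comparableI c(1)) blast+
 have c2: "comparable c (besov_norm k s b p q f) (J F\<^sub>0 + H0 F\<^sub>0)" if "GM_hat C F\<^sub>0 f" "\<not> 0 < s" for F\<^sub>0 and f :: "real ^ 'n => complex"
  using c(2)[OF that(1) refl refl] unfolding if_not_P[OF that(2)] by (intro comparableI c(1)) blast+
 have low: "(\<integral>\<^sup>+ t\<in>{0<..<1}. ennreal (t powr (?d * p - ?d - 1) * F\<^sub>0 t powr p) \<partial>lborel) epowr (1 / p) = J F\<^sub>0"
  if "GM_hat C F\<^sub>0 f" for F\<^sub>0 and f :: "real ^ 'n => complex"
  unfolding J_def e_def by (rule int_norm_low_eq[OF p _ pos[OF that]]) auto
 have H0: "int_norm q {1<..} (%t. ennreal ((1 + ln t) powr b)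
   * (\<integral>\<^sup>+ u\<in>{t<..}. ennreal (u powr (?d * p - ?d - 1) * F\<^sub>0 u powr p) \<partial>lborel) epowr (1 / p)) = H0 F\<^sub>0"
  if "GM_hat C F\<^sub>0 f" for F\<^sub>0 and f :: "real ^ 'n => complex"
  unfolding H0_def
 proof (rule int_norm_cong)
  fix t :: real assume t: "t \<in> {1<..}"
  have "(\<integral>\<^sup>+ u\<in>{t<..}. ennreal (u powr (?d * p - ?d - 1) * F\<^sub>0 u powr p) \<partial>lborel) epowr (1 / p) =
    int_norm (ennreal p) {t<..} (%u. ennreal (u powr e * F\<^sub>0 u))"
   unfolding e_def using t by (intro int_norm_low_eq[OF p _ pos[OF that]]) auto
  then show "ennreal ((1 + ln t) powr b) * (\<integral>\<^sup>+ u\<in>{t<..}. ennreal (u powr (?d * p - ?d - 1) * F\<^sub>0 u powr p) \<partial>lborel) epowr (1 / p) =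
    ennreal ((1 + ln t) powr b) * int_norm (ennreal p) {t<..} (%u. ennreal (u powr e * F\<^sub>0 u))" by (simp only:)
 qed
 show ?thesis
  unfolding Let_def
 proof (intro conjI impI)
  assume "0 < s \<and> q < \<infinity>"
  then have s: "0 < s" and q: "q \<noteq> \<infinity>" by auto
  show "\<exists>c>0. \<forall>(f :: real ^ 'n => complex) F\<^sub>0. GM_hat C F\<^sub>0 f \<longrightarrow> comparable c (besov_norm k s b p q f)
    ((\<integral>\<^sup>+ t\<in>{0<..<1}. ennreal (t powr (?d * p - ?d - 1) * F\<^sub>0 t powr p) \<partial>lborel) epowr (1 / p)
       + (\<integral>\<^sup>+ t\<in>{1<..}. ennreal (t powr (s * enn2real q + ?d * enn2real q - ?d * enn2real q / p - 1)
          * (1 + ln t) powr (b * enn2real q) * F\<^sub>0 t powr enn2real q) \<partial>lborel) epowr (1 / enn2real q))"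
  proof (intro exI[of _ c] conjI allI impI c(1))
   fix f :: "real ^ 'n => complex" and F\<^sub>0 assume g: "GM_hat C F\<^sub>0 f"
   have h: "(\<integral>\<^sup>+ t\<in>{1<..}. ennreal (t powr (s * enn2real q + ?d * enn2real q - ?d * enn2real q / p - 1)
          * (1 + ln t) powr (b * enn2real q) * F\<^sub>0 t powr enn2real q) \<partial>lborel) epowr (1 / enn2real q) = H F\<^sub>0"
    unfolding H_def e_def by (rule int_norm_high_eq[OF assms(2) q]) (rule pos[OF g])
   show "comparable c (besov_norm k s b p q f)
    ((\<integral>\<^sup>+ t\<in>{0<..<1}. ennreal (t powr (?d * p - ?d - 1) * F\<^sub>0 t powr p) \<partial>lborel) epowr (1 / p)
       + (\<integral>\<^sup>+ t\<in>{1<..}. ennreal (t powr (s * enn2real q + ?d * enn2real q - ?d * enn2real q / p - 1)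
          * (1 + ln t) powr (b * enn2real q) * F\<^sub>0 t powr enn2real q) \<partial>lborel) epowr (1 / enn2real q))"
    unfolding low[OF g] h by (rule c1[OF g s])
  qed
 next
  assume "0 < s \<and> q = \<infinity>"
  then have s: "0 < s" and q: "q = \<infinity>" by auto
  have h: "(SUP t\<in>{1<..}. ennreal (t powr (s + ?d - ?d / p) * (1 + ln t) powr b * F\<^sub>0 t)) = H F\<^sub>0" for F\<^sub>0
  proof -
   have "s + e = s + ?d - ?d / p" by (simp add: e_def algebra_simps)
   then show ?thesis unfolding H_def int_norm_def if_P[OF q] by (simp only:)
  qed
  show "\<exists>c>0. \<forall>(f :: real ^ 'n => complex) F\<^sub>0. GM_hat C F\<^sub>0 f \<longrightarrow> comparable c (besov_norm k s b p q f)
    ((\<integral>\<^sup>+ t\<in>{0<..<1}. ennreal (t powr (?d * p - ?d - 1) * F\<^sub>0 t powr p) \<partial>lborel) epowr (1 / p)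
       + (SUP t\<in>{1<..}. ennreal (t powr (s + ?d - ?d / p) * (1 + ln t) powr b * F\<^sub>0 t)))"
   unfolding h by (intro exI[of _ c] conjI allI impI c(1)) (simp only: low c1[OF _ s])
 next
  assume "s = 0 \<and> q < \<infinity>"
  then have s: "\<not> 0 < s" and q: "q \<noteq> \<infinity>" by auto
  show "\<exists>c>0. \<forall>(f :: real ^ 'n => complex) F\<^sub>0. GM_hat C F\<^sub>0 f \<longrightarrow> comparable c (besov_norm k s b p q f)
    ((\<integral>\<^sup>+ t\<in>{0<..<1}. ennreal (t powr (?d * p - ?d - 1) * F\<^sub>0 t powr p) \<partial>lborel) epowr (1 / p)
       + (\<integral>\<^sup>+ t\<in>{1<..}. (ennreal ((1 + ln t) powr b)
          * (\<integral>\<^sup>+ u\<in>{t<..}. ennreal (u powr (?d * p - ?d - 1) * F\<^sub>0 u powr p) \<partial>lborel)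
            epowr (1 / p)) epowr enn2real q * ennreal (1 / t) \<partial>lborel) epowr (1 / enn2real q))"
  proof (intro exI[of _ c] conjI allI impI c(1))
   fix f :: "real ^ 'n => complex" and F\<^sub>0 assume g: "GM_hat C F\<^sub>0 f"
   show "comparable c (besov_norm k s b p q f)
    ((\<integral>\<^sup>+ t\<in>{0<..<1}. ennreal (t powr (?d * p - ?d - 1) * F\<^sub>0 t powr p) \<partial>lborel) epowr (1 / p)
       + (\<integral>\<^sup>+ t\<in>{1<..}. (ennreal ((1 + ln t) powr b)
          * (\<integral>\<^sup>+ u\<in>{t<..}. ennreal (u powr (?d * p - ?d - 1) * F\<^sub>0 u powr p) \<partial>lborel)
            epowr (1 / p)) epowr enn2real q * ennreal (1 / t) \<partial>lborel) epowr (1 / enn2real q))"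
    using c2[OF g s] unfolding H0[OF g, symmetric] low[OF g] int_norm_def[of q] if_not_P[OF q] .
  qed
 next
  assume "s = 0 \<and> q = \<infinity>"
  then have s: "\<not> 0 < s" and q: "q = \<infinity>" by auto
  show "\<exists>c>0. \<forall>(f :: real ^ 'n => complex) F\<^sub>0. GM_hat C F\<^sub>0 f \<longrightarrow> comparable c (besov_norm k s b p q f)
    ((\<integral>\<^sup>+ t\<in>{0<..<1}. ennreal (t powr (?d * p - ?d - 1) * F\<^sub>0 t powr p) \<partial>lborel) epowr (1 / p)
       + (SUP t\<in>{1<..}. ennreal ((1 + ln t) powr b)
          * (\<integral>\<^sup>+ u\<in>{t<..}. ennreal (u powr (?d * p - ?d - 1) * F\<^sub>0 u powr p) \<partial>lborel)
            epowr (1 / p)))"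
  proof (intro exI[of _ c] conjI allI impI c(1))
   fix f :: "real ^ 'n => complex" and F\<^sub>0 assume g: "GM_hat C F\<^sub>0 f"
   show "comparable c (besov_norm k s b p q f)
    ((\<integral>\<^sup>+ t\<in>{0<..<1}. ennreal (t powr (?d * p - ?d - 1) * F\<^sub>0 t powr p) \<partial>lborel) epowr (1 / p)
       + (SUP t\<in>{1<..}. ennreal ((1 + ln t) powr b)
          * (\<integral>\<^sup>+ u\<in>{t<..}. ennreal (u powr (?d * p - ?d - 1) * F\<^sub>0 u powr p) \<partial>lborel)
            epowr (1 / p)))"
    using c2[OF g s] unfolding H0[OF g, symmetric] low[OF g] int_norm_def[of q] if_P[OF q] .
  qed
 qed
qed

end
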